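(* Let $m\in\mathbb{Z}_{\ge0}$ and let $p>1+(m+2)/n$. Let $u_0\in L^1_{m+1}(\mathbb{R}^n)\cap L^\infty(\mathbb{R}^n)$ and let $u\in X$ be a global solution to (P) satisfying $$\sup_{q\in[1,+\infty]}\ \sup_{t>0}\ t^{\frac n2\left(1-\frac1q\right)}\|u(t)\|_q<+\infty .$$ Put $\sigma:=\frac n2(p-1)-1>\frac m2$. Then, for any $q\in[1,+\infty]$, there exists $C>0$ such that $$t^{\frac n2\left(1-\frac1q\right)+\frac m2}\|u(t)-\mathcal{A}_m(t)\|_q\le\begin{cases}Ct^{-\left(\sigma-\frac m2\right)}&\text{if }1+\frac{m+2}n<p<1+\frac{m+3}n,\\ Ct^{-\frac12}\log(2+t)&\text{if }p=1+\frac{m+3}n,\\ Ct^{-\frac12}&\text{if }p>1+\frac{m+3}n\end{cases}$$ holds for all $t>0$, where the asymptotic profile $\mathcal{A}_m(t)$ is defined in the context.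
   Context: Let $n\in\mathbb{Z}_{>0}$, $\nu\in\mathbb{C}$ with $\operatorname{Re}\nu>0$, and $p\in(1,+\infty)$. Let $f:\mathbb{C}\to\mathbb{C}$ satisfy $f(0)=0$ and, for some $K>0$, $|f(\xi)-f(\eta)|\le K(|\xi|^{p-1}+|\eta|^{p-1})|\xi-\eta|$ for all $\xi,\eta\in\mathbb{C}$. (P) denotes the Cauchy problem $\partial_t u-\nu\Delta u=f(u)$ in $(0,+\infty)\times\mathbb{R}^n$, $u(0)=u_0$ in $\mathbb{R}^n$, for a complex-valued unknown $u$. $L^q(\mathbb{R}^n)$, $q\in[1,+\infty]$, is the complex-valued Lebesgue space with norm $\|\cdot\|_q$. Greek indices $\alpha,\beta,\gamma$ range over $\mathbb{Z}_{\ge0}^n$; $|\alpha|=\sum_j\alpha_j$, $\alpha!=\prod_j\alpha_j!$, $x^\alpha=\prod_jx_j^{\alpha_j}$, and $\alpha\le\beta$ means $\alpha_j\le\beta_j$ for all $j$. For $k\in\mathbb{Z}_{>0}$, $L^1_k(\mathbb{R}^n)$ is the set of $\varphi\in L^1(\mathbb{R}^n)$ with $x^\alpha\varphi\in L^1(\mathbb{R}^n)$ for all $|\alpha|\le k$. $G_{t\nu}(x)=(4\pi t\nu)^{-n/2}\exp\left(-\frac{|x|^2}{4t\nu}\right)$ (principal branch of the power), $G_\nu$ is the case $t=1$, and $e^{t\nu\Delta}\varphi=G_{t\nu}*\varphi$ for $t>0$, $e^{0\nu\Delta}\varphi=\varphi$. $X=(C\cap L^\infty)([0,+\infty);L^1(\mathbb{R}^n))\cap(C\cap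 L^\infty)((0,+\infty);L^\infty(\mathbb{R}^n))$. For $u_0\in L^1(\mathbb{R}^n)\cap L^\infty(\mathbb{R}^n)$, a function $u\in X$ is a global (mild) solution to (P) if $u(t)=e^{t\nu\Delta}u_0+\int_0^t e^{(t-s)\nu\Delta}f(u(s))\,ds$ holds in $L^1(\mathbb{R}^n)\cap L^\infty(\mathbb{R}^n)$ for all $t>0$. Asymptotic profile: $$\mathcal{A}_m(t):=\Lambda_{0,m}(t;u_0)+\sum_{|\gamma|\le m/2}\frac{(-\nu)^{|\gamma|}}{\gamma!}\Lambda_{2\gamma,\,m-2|\gamma|}(t;\psi_{|\gamma|}),\qquad \psi_k:=\int_0^{+\infty}s^kf(u(s))\,ds,$$ $$\Lambda_{\alpha,N}(t;\varphi):=(-2)^{-|\alpha|}t^{-\frac{|\alpha|}2}\sum_{k=0}^N2^{-k}t^{-\frac k2}\sum_{|\beta|=k}\mathcal{M}_\beta(\varphi)\,\delta_t(\boldsymbol{h}_{\nu,\alpha+\beta}G_\nu),$$ $$\mathcal{M}_\beta(\varphi):=\frac1{\beta!}\int_{\mathbb{R}^n}y^\beta\varphi(y)\,dy,\qquad \boldsymbol{h}_{\nu,\alpha}(x):=\sum_{2\beta\le\alpha}\frac{(-1)^{|\beta|}\alpha!}{\beta!(\alpha-2\beta)!}\nu^{-|\alpha-\beta|}x^{\alpha-2\beta},\qquad(\delta_t\varphi)(x)=t^{-\frac n2}\varphi(t^{-\frac12}x).$$ *)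

theory Defs
  imports "HOL-Analysis.Analysis" "HOL-Probability.Essential_Supremum"
begin

section \<open>Lebesgue spaces\<close>

text \<open>
  Elements of $L^q$ are represented by functions; equality in $L^q$ is equality almost
  everywhere.  The exponent ranges over \<^typ>\<open>ennreal\<close>, and norms take values
  in \<^typ>\<open>ennreal\<close>.  The function \<^const>\<open>esssup\<close> is infinite on
  non-measurable functions.
\<close>

definition Lq_norm :: "ennreal \<Rightarrow> ('a::euclidean_space \<Rightarrow> complex) \<Rightarrow> ennreal" where
  "Lq_norm q \<phi> =
     (if q = \<infinity> then esssup lebesgue (\<lambda>x. ennreal (norm (\<phi> x)))
      else let I = (\<integral>\<^sup>+ x. ennreal (norm (\<phi> x) powr enn2real q) \<partial>lebesgue)
           in if I = \<infinity> then \<infinity> else ennreal (enn2real I powr (1 / enn2real q)))"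

definition normed_part ::
  "(('a::euclidean_space \<Rightarrow> complex) \<Rightarrow> ennreal) \<Rightarrow> ('a \<Rightarrow> complex) set" where
  "normed_part N = {\<phi>. \<phi> \<in> borel_measurable lebesgue \<and> N \<phi> < \<infinity>}"

definition Lq :: "ennreal \<Rightarrow> ('a::euclidean_space \<Rightarrow> complex) set" where
  "Lq q = normed_part (Lq_norm q)"

definition L1_Linf_norm :: "('a::euclidean_space \<Rightarrow> complex) \<Rightarrow> ennreal" where
  "L1_Linf_norm \<phi> = Lq_norm 1 \<phi> + Lq_norm \<infinity> \<phi>"

text \<open>
  \<open>(C \<inter> L\<^sup>\<infinity>)(S; L\<^sup>q)\<close>: functions on \<open>S\<close> that are norm continuous
  and essentially bounded with values in \<open>L\<^sup>q\<close>.
\<close>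

definition C_Linf :: "real set \<Rightarrow> ennreal \<Rightarrow> (real \<Rightarrow> 'a::euclidean_space \<Rightarrow> complex) set" where
  "C_Linf S q = {u. (\<forall>t\<in>S. u t \<in> Lq q) \<and>
     (\<forall>t\<in>S. ((\<lambda>s. Lq_norm q (\<lambda>x. u s x - u t x)) \<longlongrightarrow> 0) (at t within S)) \<and>
     esssup (lebesgue_on S) (\<lambda>t. Lq_norm q (u t)) < \<infinity>}"

definition space_X :: "(real \<Rightarrow> 'a::euclidean_space \<Rightarrow> complex) set" where
  "space_X = C_Linf {0..} 1 \<inter> C_Linf {0<..} \<infinity>"

section \<open>Bochner integral with values in a space of functions modulo null functions\<close>

text \<open>
  The library's \<^const>\<open>has_bochner_integral\<close> needs the codomain to be a type of class
  \<open>real_normed_vector\<close>, which the spaces $L^q$ are not.  The definition below repeats it for the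
  space of measurable functions of finite norm \<open>N\<close>.  Measurability of
  \<open>\<lambda>s. N (F s - S i s)\<close> replaces measurability of \<open>F\<close>: together with
  \<open>\<integral> N (F s - S i s) ds \<rightarrow> 0\<close> it says that \<open>F\<close> is strongly
  measurable.
\<close>

definition simple_Bochner_integrable ::
  "(('a::euclidean_space \<Rightarrow> complex) \<Rightarrow> ennreal) \<Rightarrow> 'b measure \<Rightarrow> ('b \<Rightarrow> 'a \<Rightarrow> complex) \<Rightarrow> bool"
  where
  "simple_Bochner_integrable N M S \<longleftrightarrow>
     S ` space M \<subseteq> normed_part N \<and> simple_function M S \<and>
     emeasure M {s \<in> space M. S s \<noteq> (\<lambda>x. 0)} \<noteq> \<infinity>"

definition simple_Bochner_integral ::
  "'b measure \<Rightarrow> ('b \<Rightarrow> 'a \<Rightarrow> complex) \<Rightarrow> 'a \<Rightarrow> complex" where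
  "simple_Bochner_integral M S =
     (\<lambda>x. \<Sum>\<phi>\<in>S ` space M. measure M {s \<in> space M. S s = \<phi>} *\<^sub>R \<phi> x)"

definition has_Bochner_integral ::
  "(('a::euclidean_space \<Rightarrow> complex) \<Rightarrow> ennreal) \<Rightarrow> 'b measure \<Rightarrow> ('b \<Rightarrow> 'a \<Rightarrow> complex)
     \<Rightarrow> ('a \<Rightarrow> complex) \<Rightarrow> bool" where
  "has_Bochner_integral N M F I \<longleftrightarrow>
     F ` space M \<subseteq> normed_part N \<and> I \<in> normed_part N \<and>
     (\<exists>S :: nat \<Rightarrow> 'b \<Rightarrow> 'a \<Rightarrow> complex.
        (\<forall>i. simple_Bochner_integrable N M (S i)) \<and>
        (\<forall>i. (\<lambda>s. N (\<lambda>x. F s x - S i s x)) \<in> borel_measurable M) \<and>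
        (\<lambda>i. \<integral>\<^sup>+ s. N (\<lambda>x. F s x - S i s x) \<partial>M) \<longlonglongrightarrow> 0 \<and>
        (\<lambda>i. N (\<lambda>x. simple_Bochner_integral M (S i) x - I x)) \<longlonglongrightarrow> 0)"

text \<open>A representative of the integral; it is unique up to null functions.\<close>

definition Bochner_integral ::
  "(('a::euclidean_space \<Rightarrow> complex) \<Rightarrow> ennreal) \<Rightarrow> 'b measure \<Rightarrow> ('b \<Rightarrow> 'a \<Rightarrow> complex)
     \<Rightarrow> 'a \<Rightarrow> complex" where
  "Bochner_integral N M F = (SOME I. has_Bochner_integral N M F I)"

section \<open>Multi-indices\<close>

type_synonym 'n multiindex = "'n \<Rightarrow> nat"

definition mi_abs :: "'n::finite multiindex \<Rightarrow> nat" where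
  "mi_abs \<alpha> = (\<Sum>j\<in>UNIV. \<alpha> j)"

definition mi_fact :: "'n::finite multiindex \<Rightarrow> nat" where
  "mi_fact \<alpha> = (\<Prod>j\<in>UNIV. fact (\<alpha> j))"

definition mi_power :: "real ^ 'n::finite \<Rightarrow> 'n multiindex \<Rightarrow> real" where
  "mi_power x \<alpha> = (\<Prod>j\<in>UNIV. (x $ j) ^ \<alpha> j)"

definition mi_add :: "'n multiindex \<Rightarrow> 'n multiindex \<Rightarrow> 'n multiindex" where
  "mi_add \<alpha> \<beta> = (\<lambda>j. \<alpha> j + \<beta> j)"

definition mi_diff :: "'n multiindex \<Rightarrow> 'n multiindex \<Rightarrow> 'n multiindex" where
  "mi_diff \<alpha> \<beta> = (\<lambda>j. \<alpha> j - \<beta> j)"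

definition mi_double :: "'n multiindex \<Rightarrow> 'n multiindex" where
  "mi_double \<alpha> = (\<lambda>j. 2 * \<alpha> j)"

text \<open>\<open>L\<^sup>1\<^sub>k\<close>\<close>

definition L1_weighted :: "nat \<Rightarrow> (real ^ 'n::finite \<Rightarrow> complex) set" where
  "L1_weighted k = {\<phi> \<in> Lq 1. \<forall>\<alpha>. mi_abs \<alpha> \<le> k \<longrightarrow>
     (\<lambda>x. of_real (mi_power x \<alpha>) * \<phi> x) \<in> Lq 1}"

section \<open>The Cauchy problem\<close>

text \<open>\<open>heat_kernel (t * \<nu>)\<close> is \<open>G\<^bsub>t\<nu>\<^esub>\<close>.\<close>

definition heat_kernel :: "complex \<Rightarrow> real ^ 'n::finite \<Rightarrow> complex" where
  "heat_kernel \<mu> x = (4 * of_real pi * \<mu>) powr (- (of_nat CARD('n) / 2))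
     * exp (- (of_real ((norm x)\<^sup>2) / (4 * \<mu>)))"

definition heat_semigroup ::
  "complex \<Rightarrow> real \<Rightarrow> (real ^ 'n::finite \<Rightarrow> complex) \<Rightarrow> real ^ 'n \<Rightarrow> complex" where
  "heat_semigroup \<nu> t \<phi> =
     (if t = 0 then \<phi>
      else (\<lambda>x. LINT y|lebesgue. heat_kernel (of_real t * \<nu>) (x - y) * \<phi> y))"

definition global_mild_solution ::
  "complex \<Rightarrow> (complex \<Rightarrow> complex) \<Rightarrow> (real ^ 'n::finite \<Rightarrow> complex)
     \<Rightarrow> (real \<Rightarrow> real ^ 'n \<Rightarrow> complex) \<Rightarrow> bool" where
  "global_mild_solution \<nu> f u\<^sub>0 u \<longleftrightarrow>
     u \<in> space_X \<and>
     (\<forall>t>0. \<exists>I.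
        has_Bochner_integral L1_Linf_norm (lebesgue_on {0<..<t})
          (\<lambda>s. heat_semigroup \<nu> (t - s) (\<lambda>x. f (u s x))) I \<and>
        (AE x in lebesgue. u t x = heat_semigroup \<nu> t u\<^sub>0 x + I x))"

section \<open>The asymptotic profile\<close>

definition hermite :: "complex \<Rightarrow> 'n::finite multiindex \<Rightarrow> real ^ 'n \<Rightarrow> complex" where
  "hermite \<nu> \<alpha> x =
     (\<Sum>\<beta> | mi_double \<beta> \<le> \<alpha>.
        (-1) ^ mi_abs \<beta> * of_nat (mi_fact \<alpha>)
          / (of_nat (mi_fact \<beta>) * of_nat (mi_fact (mi_diff \<alpha> (mi_double \<beta>))))
        * \<nu> powi (- int (mi_abs (mi_diff \<alpha> \<beta>)))
        * of_real (mi_power x (mi_diff \<alpha> (mi_double \<beta>))))"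

definition dilation :: "real \<Rightarrow> (real ^ 'n::finite \<Rightarrow> complex) \<Rightarrow> real ^ 'n \<Rightarrow> complex" where
  "dilation t \<phi> x = of_real (t powr (- (real CARD('n) / 2))) * \<phi> ((t powr (- (1 / 2))) *\<^sub>R x)"

definition moment :: "'n::finite multiindex \<Rightarrow> (real ^ 'n \<Rightarrow> complex) \<Rightarrow> complex" where
  "moment \<beta> \<phi> =
     (LINT y|lebesgue. of_real (mi_power y \<beta>) * \<phi> y) / of_nat (mi_fact \<beta>)"

definition Lambda_profile ::
  "complex \<Rightarrow> 'n::finite multiindex \<Rightarrow> nat \<Rightarrow> real \<Rightarrow> (real ^ 'n \<Rightarrow> complex) \<Rightarrow> real ^ 'n \<Rightarrow> complex"
  where
  "Lambda_profile \<nu> \<alpha> N t \<phi> x =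
     (-2) powi (- int (mi_abs \<alpha>)) * of_real (t powr (- (real (mi_abs \<alpha>) / 2))) *
     (\<Sum>k=0..N. 2 powi (- int k) * of_real (t powr (- (real k / 2))) *
        (\<Sum>\<beta> | mi_abs \<beta> = k.
           moment \<beta> \<phi> *
           dilation t (\<lambda>y. hermite \<nu> (mi_add \<alpha> \<beta>) y * heat_kernel \<nu> y) x))"

definition psi ::
  "(complex \<Rightarrow> complex) \<Rightarrow> (real \<Rightarrow> real ^ 'n::finite \<Rightarrow> complex) \<Rightarrow> nat \<Rightarrow> real ^ 'n \<Rightarrow> complex"
  where
  "psi f u k =
     Bochner_integral (Lq_norm 1) (lebesgue_on {0<..}) (\<lambda>s x. of_real (s ^ k) * f (u s x))"

definition asymptotic_profile ::
  "complex \<Rightarrow> (complex \<Rightarrow> complex) \<Rightarrow> (real ^ 'n::finite \<Rightarrow> complex)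
     \<Rightarrow> (real \<Rightarrow> real ^ 'n \<Rightarrow> complex) \<Rightarrow> nat \<Rightarrow> real \<Rightarrow> real ^ 'n \<Rightarrow> complex" where
  "asymptotic_profile \<nu> f u\<^sub>0 u m t x =
     Lambda_profile \<nu> (\<lambda>_. 0) m t u\<^sub>0 x +
     (\<Sum>\<gamma> | 2 * mi_abs \<gamma> \<le> m.
        (- \<nu>) ^ mi_abs \<gamma> / of_nat (mi_fact \<gamma>) *
        Lambda_profile \<nu> (mi_double \<gamma>) (m - 2 * mi_abs \<gamma>) t (psi f u (mi_abs \<gamma>)) x)"

end

theory Submission
  imports Defs "HOL-Complex_Analysis.Complex_Analysis" "HOL-Probability.Distributions" "HOL-Probability.Giry_Monad"
begin

text \<open>
  For $t = 1$ consider the path $\theta \mapsto G_{(1-\theta^2 s)\nu}(x - \theta y)$ from $G_\nu(x)$ to the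
  Duhamel kernel $G_{(1-s)\nu}(x-y)$.  By Mehler's formula its Taylor coefficients at $\theta = 0$
  are sums of products of Hermite polynomials in $x$ and monomials $y^\beta s^k$, and integrating the Taylor
  polynomial of degree $m$ against $u_0$ (with $s = 0$) and $f(u(s))$ gives exactly the profile
  $\mathcal{A}_m$.  The path is holomorphic for $|\theta| < \varepsilon / \rho$, where
  $\rho = |y| + \sqrt s$, and bounded there by a Gaussian in $x$, so Cauchy's estimates bound the remainder by
  $\rho^j$ times Gaussians for $j = m$ and $j = m + 1$; for general $t$ one rescales.  Gronwall's lemma with the
  weight $(1 + |x| / \sqrt{1+t})^{m+1}$ gives
  $\| (|y| + \sqrt s)^j f(u(s)) \|_1 = O((1+s)^{j/2-\sigma-1})$ for $j \le m + 1$.  Using $j = m + 1$ for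
  $s < t/2$ and $j = m$ for $s > t/2$ yields the estimate in $L^1$ and $L^\infty$, and interpolation
  covers the remaining $q$.
\<close>

section \<open>Mehler's formula\<close>

text \<open>The path scales space by \<theta> and time by \<theta>^2, so that y^\<beta> s^k has
  degree |\<beta>| + 2k. Truncation at degree m thus produces exactly the pairs with |\<beta>| +
  2|\<gamma>| \<le> m of the profile: one Taylor formula expands space and time together.

  The obstacle is that only \<sigma> > m/2 is known. Moments of f(u) of degree m are integrable in
  time, those of degree m + 1 need not be. The integral of the latter over (0, t/2) grows like
  t^(1/2 - (\<sigma> - m/2)), like log t, or stays bounded; multiplied by t^(-1/2) this gives the
  three rates. For s > t/2 there is no cancellation to gain, and kernel and Taylor polynomial are
  bounded separately; times s > t count as well, since psi_k integrates over all times.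

  A second obstacle is that u is a curve of classes of functions, while the estimates are pointwise
  in (s, y) and use Tonelli. Hence the jointly measurable versions and the identification of both
  Bochner integrals, in psi_k and in the Duhamel formula, with pointwise ones.\<close>

text \<open>
  The Taylor coefficients of $e^{A\theta + B\theta^2}$: Hermite polynomials without the case distinction $B = 0$.
\<close>

definition hpoly :: "complex \<Rightarrow> complex \<Rightarrow> nat \<Rightarrow> complex" where
  "hpoly A B k = (\<Sum>c | 2 * c \<le> k. B ^ c / fact c * (A ^ (k - 2 * c) / fact (k - 2 * c)))"

text \<open>\<open>E\<close> is the power series of exp(B X^2): the claim is its Cauchy product with
  that of exp(A X), where the vanishing odd coefficients of \<open>E\<close> leave the indices
  2c.\<close>

lemma hpoly_fps:
  fixes A B :: complex
  defines "E \<equiv> Abs_fps (\<lambda>n. if even n then B ^ (n div 2) / fact (n div 2) else 0)"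
  shows "hpoly A B k = fps_nth (E * fps_exp A) k"
proof -
  have "fps_nth (E * fps_exp A) k = (\<Sum>i=0..k. fps_nth E i * (A ^ (k - i) / fact (k - i)))"
    by (simp add: fps_mult_nth)
  also have "\<dots> = (\<Sum>i\<in>(\<lambda>c. 2 * c) ` {c. 2 * c \<le> k}. fps_nth E i * (A ^ (k - i) / fact (k - i)))"
    by (rule sum.mono_neutral_right) (auto simp: E_def elim!: evenE)
  also have "\<dots> = hpoly A B k"
    by (subst sum.reindex) (auto simp: inj_on_def hpoly_def E_def)
  finally show ?thesis by simp
qed

lemma hpoly_0 [simp]: "hpoly A B 0 = 1"
  by (simp add: hpoly_def)

lemma hpoly_1 [simp]: "hpoly A B (Suc 0) = A"
proof -
  have "{c. 2 * c \<le> Suc 0} = {0}" by auto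
  then show ?thesis by (simp add: hpoly_def)
qed

text \<open>Coefficient form of H' = (A + 2 B X) H for H = exp(A X + B X^2).\<close>

lemma hpoly_Suc_Suc:
  "of_nat (k + 2) * hpoly A B (k + 2) = A * hpoly A B (k + 1) + 2 * B * hpoly A B k"
proof -
  define E where "E = Abs_fps (\<lambda>n. if even n then B ^ (n div 2) / fact (n div 2) else 0)"
  have dE: "fps_deriv E = fps_const (2 * B) * (fps_X * E)"
  proof (rule fps_ext)
    fix n show "fps_nth (fps_deriv E) n = fps_nth (fps_const (2 * B) * (fps_X * E)) n"
    proof (cases "odd n")
      case True
      then obtain l where "n = 2 * l + 1" by (auto elim!: oddE)
      then show ?thesis by (simp add: E_def divide_simps del: of_nat_Suc) (simp add: algebra_simps)
    qed (auto simp: E_def)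
  qed
  have "fps_deriv (E * fps_exp A) = fps_const A * (E * fps_exp A)
      + fps_const (2 * B) * (fps_X * (E * fps_exp A))"
    by (simp add: dE algebra_simps)
  then have "fps_nth (fps_deriv (E * fps_exp A)) (k + 1) = fps_nth (fps_const A * (E * fps_exp A)
      + fps_const (2 * B) * (fps_X * (E * fps_exp A))) (k + 1)" by (simp only:)
  then have "of_nat (k + 2) * fps_nth (E * fps_exp A) (k + 2)
      = A * fps_nth (E * fps_exp A) (k + 1) + 2 * B * fps_nth (E * fps_exp A) k"
    by (simp only: fps_deriv_nth fps_add_nth fps_mult_left_const_nth fps_X_mult_nth) simp
  then show ?thesis by (simp only: hpoly_fps E_def)
qed

text \<open>
  Mehler's formula is proved by showing that both sides satisfy the differential equation
  $(1 - D\theta^2)^2 M' = (P + (2E + D)\theta + DP\theta^2 - D^2\theta^3) M$; this is its coefficient form.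
\<close>

lemma mehler_recurrence:
  fixes A\<^sub>1 B\<^sub>1 A\<^sub>2 B\<^sub>2 :: complex
  defines "D \<equiv> 4 * B\<^sub>1 * B\<^sub>2" and "P \<equiv> A\<^sub>1 * A\<^sub>2" and "E \<equiv> B\<^sub>1 * A\<^sub>2\<^sup>2 + B\<^sub>2 * A\<^sub>1\<^sup>2"
  defines "M \<equiv> \<lambda>k. fact k * hpoly A\<^sub>1 B\<^sub>1 k * hpoly A\<^sub>2 B\<^sub>2 k"
  shows "of_nat (k + 4) * M (k + 4) - 2 * D * (of_nat (k + 2) * M (k + 2)) + D\<^sup>2 * (of_nat k * M k)
       = P * M (k + 3) + (2 * E + D) * M (k + 2) + D * P * M (k + 1) - D\<^sup>2 * M k"
    and "of_nat 3 * M 3 - 2 * D * M 1 = P * M 2 + (2 * E + D) * M 1 + D * P * M 0"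
    and "of_nat 2 * M 2 = P * M 1 + (2 * E + D) * M 0"
    and "M 1 = P * M 0"
proof -
  \<comment> \<open>The factor k! gives recurrences with polynomial coefficients, and M k = x k * y
    k / k!.\<close>
  define x where "x = (\<lambda>k. fact k * hpoly A\<^sub>1 B\<^sub>1 k)"
  define y where "y = (\<lambda>k. fact k * hpoly A\<^sub>2 B\<^sub>2 k)"
  have x: "x (k + 2) = A\<^sub>1 * x (k + 1) + 2 * B\<^sub>1 * of_nat (k + 1) * x k" for k
    using arg_cong[OF hpoly_Suc_Suc[of k A\<^sub>1 B\<^sub>1], of "\<lambda>z. fact (k + 1) * z"]
    by (simp add: x_def algebra_simps)
  have y: "y (k + 2) = A\<^sub>2 * y (k + 1) + 2 * B\<^sub>2 * of_nat (k + 1) * y k" for k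
    using arg_cong[OF hpoly_Suc_Suc[of k A\<^sub>2 B\<^sub>2], of "\<lambda>z. fact (k + 1) * z"]
    by (simp add: y_def algebra_simps)
  have M: "M k = x k * y k / fact k" for k by (simp add: M_def x_def y_def)
  have Mf: "M j * fact j = x j * y j" for j by (simp add: M)
  have x0: "x 0 = 1" "x 1 = A\<^sub>1" "y 0 = 1" "y 1 = A\<^sub>2" by (simp_all add: x_def y_def)
  define K where "K = (of_nat k :: complex)"
  have f: "fact (k + 4) = (K + 4) * (K + 3) * (K + 2) * (K + 1) * fact k"
    "fact (k + 3) = (K + 3) * (K + 2) * (K + 1) * fact k"
    "fact (k + 2) = (K + 2) * (K + 1) * fact k" "fact (k + 1) = (K + 1) * fact k"
    by (simp_all add: K_def eval_nat_numeral algebra_simps)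
  have nz: "K + 4 \<noteq> 0" "K + 3 \<noteq> 0" "K + 2 \<noteq> 0" "K + 1 \<noteq> 0" "fact k \<noteq> (0::complex)"
    by (simp_all add: K_def add_eq_0_iff complex_eq_iff)
  have X2: "x (k + 2) = A\<^sub>1 * x (k + 1) + 2 * B\<^sub>1 * (K + 1) * x k"
    using x[of k] by (simp add: K_def)
  have X3: "x (k + 3) = A\<^sub>1 * x (k + 2) + 2 * B\<^sub>1 * (K + 2) * x (k + 1)"
    using x[of "k + 1"] by (simp add: K_def eval_nat_numeral algebra_simps)
  have X4: "x (k + 4) = A\<^sub>1 * x (k + 3) + 2 * B\<^sub>1 * (K + 3) * x (k + 2)"
    using x[of "k + 2"] by (simp add: K_def eval_nat_numeral algebra_simps)
  have Y2: "y (k + 2) = A\<^sub>2 * y (k + 1) + 2 * B\<^sub>2 * (K + 1) * y k"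
    using y[of k] by (simp add: K_def)
  have Y3: "y (k + 3) = A\<^sub>2 * y (k + 2) + 2 * B\<^sub>2 * (K + 2) * y (k + 1)"
    using y[of "k + 1"] by (simp add: K_def eval_nat_numeral algebra_simps)
  have Y4: "y (k + 4) = A\<^sub>2 * y (k + 3) + 2 * B\<^sub>2 * (K + 3) * y (k + 2)"
    using y[of "k + 2"] by (simp add: K_def eval_nat_numeral algebra_simps)
  \<comment> \<open>Unfolding the recurrences expresses both sides by the values at k and k + 1,
    where the claim is a polynomial identity.\<close>
  have main: "x (k + 4) * y (k + 4) - 2 * D * (K + 3) * (K + 2) * (x (k + 2) * y (k + 2))
      + D\<^sup>2 * (K + 3) * (K + 2) * (K + 1) * K * (x k * y k)
    = P * (x (k + 3) * y (k + 3)) + (2 * E + D) * (K + 3) * (x (k + 2) * y (k + 2))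
      + D * P * (K + 3) * (K + 2) * (x (k + 1) * y (k + 1)) - D\<^sup>2 * (K + 3) * (K + 2) * (K + 1) * (x k * y k)"
    unfolding X4 Y4 X3 Y3 X2 Y2 D_def P_def E_def by algebra
  have s: "of_nat (k + 4) = K + 4" "of_nat (k + 2) = K + 2" "of_nat k = K"
    by (simp_all add: K_def)
  \<comment> \<open>\<open>F\<close> is (k + 3)!, the factor by which the claim must be multiplied
    to reach \<open>main\<close>.\<close>
  define F where "F = (K + 3) * (K + 2) * (K + 1) * (fact k :: complex)"
  have F: "F \<noteq> 0" using nz by (simp add: F_def)
  have m4: "of_nat (k + 4) * M (k + 4) * F = x (k + 4) * y (k + 4)"
    using Mf[of "k + 4"] unfolding f s F_def by algebra
  have m3: "M (k + 3) * F = x (k + 3) * y (k + 3)"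
    using Mf[of "k + 3"] unfolding f s F_def .
  have m2: "M (k + 2) * F = (K + 3) * (x (k + 2) * y (k + 2))"
    using Mf[of "k + 2"] unfolding f s F_def by algebra
  have m1: "M (k + 1) * F = (K + 3) * (K + 2) * (x (k + 1) * y (k + 1))"
    using Mf[of "k + 1"] unfolding f s F_def by algebra
  have m0: "M k * F = (K + 3) * (K + 2) * (K + 1) * (x k * y k)"
    using Mf[of k] unfolding F_def by algebra
  have "(of_nat (k + 4) * M (k + 4) - 2 * D * (of_nat (k + 2) * M (k + 2)) + D\<^sup>2 * (of_nat k * M k)) * F
       = (P * M (k + 3) + (2 * E + D) * M (k + 2) + D * P * M (k + 1) - D\<^sup>2 * M k) * F"
    using main m4 m3 m2 m1 m0 unfolding s by algebra
  then show "of_nat (k + 4) * M (k + 4) - 2 * D * (of_nat (k + 2) * M (k + 2)) + D\<^sup>2 * (of_nat k * M k)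
       = P * M (k + 3) + (2 * E + D) * M (k + 2) + D * P * M (k + 1) - D\<^sup>2 * M k"
    using F by simp
  have x2: "x 2 = A\<^sub>1\<^sup>2 + 2 * B\<^sub>1" "y 2 = A\<^sub>2\<^sup>2 + 2 * B\<^sub>2"
    using x[of 0] y[of 0] x0 by (simp_all add: power2_eq_square numeral_2_eq_2)
  have x3: "x 3 = A\<^sub>1 * x 2 + 4 * B\<^sub>1 * x 1" "y 3 = A\<^sub>2 * y 2 + 4 * B\<^sub>2 * y 1"
    using x[of 1] y[of 1] by (simp_all add: eval_nat_numeral)
  show "of_nat 3 * M 3 - 2 * D * M 1 = P * M 2 + (2 * E + D) * M 1 + D * P * M 0"
    unfolding M x3 x2 x0 D_def P_def E_def by (simp add: field_simps fact_numeral power2_eq_square)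
  show "of_nat 2 * M 2 = P * M 1 + (2 * E + D) * M 0"
    unfolding M x3 x2 x0 D_def P_def E_def by (simp add: field_simps fact_numeral power2_eq_square)
  show "M 1 = P * M 0" unfolding M x0 P_def by simp
qed

text \<open>The polynomial in front of the derivative has constant term 1, so the equation
  determines each coefficient from the earlier ones. By \<open>mehler_recurrence\<close> the
  products of \<open>hpoly\<close> obey the same recurrence with the same start.\<close>

lemma mehler_fps:
  fixes G :: "complex fps"
  assumes ode: "(1 - fps_const (2 * D) * fps_X ^ 2 + fps_const (D\<^sup>2) * fps_X ^ 4) * fps_deriv G
    = (fps_const P + fps_const (2 * E + D) * fps_X ^ 1 + fps_const (D * P) * fps_X ^ 2
        - fps_const (D\<^sup>2) * fps_X ^ 3) * G"
    and D: "D = 4 * B\<^sub>1 * B\<^sub>2" and P: "P = A\<^sub>1 * A\<^sub>2" and E: "E = B\<^sub>1 * A\<^sub>2\<^sup>2 + B\<^sub>2 * A\<^sub>1\<^sup>2"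
    and G0: "fps_nth G 0 = 1"
  shows "fps_nth G k = fact k * hpoly A\<^sub>1 B\<^sub>1 k * hpoly A\<^sub>2 B\<^sub>2 k"
proof -
  define M where "M = (\<lambda>k. fact k * hpoly A\<^sub>1 B\<^sub>1 k * hpoly A\<^sub>2 B\<^sub>2 k)"
  note rec = mehler_recurrence[where A\<^sub>1 = A\<^sub>1 and B\<^sub>1 = B\<^sub>1 and A\<^sub>2 = A\<^sub>2 and B\<^sub>2 = B\<^sub>2, folded M_def D P E]
  have c: "fps_nth ((1 - fps_const (2 * D) * fps_X ^ 2 + fps_const (D\<^sup>2) * fps_X ^ 4) * fps_deriv G) k
      = fps_nth (fps_deriv G) k - 2 * D * (if k < 2 then 0 else fps_nth (fps_deriv G) (k - 2))
        + D\<^sup>2 * (if k < 4 then 0 else fps_nth (fps_deriv G) (k - 4))" for k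
  proof -
    have "(1 - fps_const (2 * D) * fps_X ^ 2 + fps_const (D\<^sup>2) * fps_X ^ 4) * fps_deriv G
      = fps_deriv G - fps_const (2 * D) * (fps_X ^ 2 * fps_deriv G) + fps_const (D\<^sup>2) * (fps_X ^ 4 * fps_deriv G)"
      by (simp only: left_diff_distrib distrib_right mult.assoc mult_1_left)
    then show ?thesis by (simp only: fps_add_nth fps_sub_nth fps_mult_left_const_nth fps_X_power_mult_nth)
  qed
  have d: "fps_nth ((fps_const P + fps_const (2 * E + D) * fps_X ^ 1 + fps_const (D * P) * fps_X ^ 2
        - fps_const (D\<^sup>2) * fps_X ^ 3) * G) k = P * fps_nth G k
      + (2 * E + D) * (if k < 1 then 0 else fps_nth G (k - 1))
      + D * P * (if k < 2 then 0 else fps_nth G (k - 2))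
      - D\<^sup>2 * (if k < 3 then 0 else fps_nth G (k - 3))" for k
  proof -
    have "(fps_const P + fps_const (2 * E + D) * fps_X ^ 1 + fps_const (D * P) * fps_X ^ 2
        - fps_const (D\<^sup>2) * fps_X ^ 3) * G = fps_const P * G + fps_const (2 * E + D) * (fps_X ^ 1 * G)
       + fps_const (D * P) * (fps_X ^ 2 * G) - fps_const (D\<^sup>2) * (fps_X ^ 3 * G)"
      by (simp only: left_diff_distrib distrib_right mult.assoc)
    then show ?thesis by (simp only: fps_add_nth fps_sub_nth fps_mult_left_const_nth fps_X_power_mult_nth)
  qed
  have step: "fps_nth (fps_deriv G) k - 2 * D * (if k < 2 then 0 else fps_nth (fps_deriv G) (k - 2))
        + D\<^sup>2 * (if k < 4 then 0 else fps_nth (fps_deriv G) (k - 4)) = P * fps_nth G k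
      + (2 * E + D) * (if k < 1 then 0 else fps_nth G (k - 1))
      + D * P * (if k < 2 then 0 else fps_nth G (k - 2))
      - D\<^sup>2 * (if k < 3 then 0 else fps_nth G (k - 3))" for k
    unfolding c[symmetric] d[symmetric] ode ..
  have "fps_nth G k = M k"
  proof (induction k rule: less_induct)
    case (less k)
    \<comment> \<open>In its general form the recurrence reaches back four indices; below that some
      terms are cut off, so the small indices have recurrences of their own.\<close>
    consider "k = 0" | "k = 1" | "k = 2" | "k = 3" | j where "k = j + 4"
    proof -
      have "k = 0 \<or> k = 1 \<or> k = 2 \<or> k = 3 \<or> k = (k - 4) + 4" by linarith
      then show ?thesis using that by blast
    qed
    then show ?case
    proof cases
      case 1 then show ?thesis using G0 by (simp add: M_def)
    next
      case 2 then show ?thesis using step[of 0] rec(4) G0 by (simp add: M_def)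
    next
      case 3
      have "fps_nth G 0 = M 0" "fps_nth G 1 = M 1" using less 3 by auto
      then have "2 * fps_nth G 2 = P * M 1 + (2 * E + D) * M 0"
        using step[of 1] by (simp add: numeral_2_eq_2)
      moreover have "2 * M 2 = P * M 1 + (2 * E + D) * M 0"
        using rec(3) by (simp only: M_def of_nat_numeral)
      ultimately have "2 * fps_nth G 2 = 2 * M 2" by (simp only:)
      then show ?thesis using 3 by simp
    next
      case 4
      have "fps_nth G 0 = M 0" "fps_nth G 1 = M 1" "fps_nth G 2 = M 2" using less 4 by auto
      then have "3 * fps_nth G 3 - 2 * D * M 1 = P * M 2 + (2 * E + D) * M 1 + D * P * M 0"
        using step[of 2] by (simp add: eval_nat_numeral)
      moreover have "3 * M 3 - 2 * D * M 1 = P * M 2 + (2 * E + D) * M 1 + D * P * M 0"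
        using rec(2) by (simp only: M_def of_nat_numeral)
      ultimately have "3 * fps_nth G 3 = 3 * M 3" by algebra
      then show ?thesis using 4 by simp
    next
      case 5
      have G: "fps_nth G j = M j" "fps_nth G (j + 1) = M (j + 1)"
        "fps_nth G (j + 2) = M (j + 2)" "fps_nth G (j + 3) = M (j + 3)"
        using less 5 by auto
      \<comment> \<open>For j = 0 the term with D^2 is cut off in \<open>step\<close>, in agreement
        with its factor \<open>of_nat j\<close> = 0 here.\<close>
      have "of_nat (j + 4) * fps_nth G (j + 4) - 2 * D * (of_nat (j + 2) * fps_nth G (j + 2))
          + D\<^sup>2 * (of_nat j * fps_nth G j)
        = P * fps_nth G (j + 3) + (2 * E + D) * fps_nth G (j + 2) + D * P * fps_nth G (j + 1) - D\<^sup>2 * fps_nth G j"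
        using step[of "j + 3"] by (cases j) (simp_all add: eval_nat_numeral)
      moreover have "of_nat (j + 4) * M (j + 4) - 2 * D * (of_nat (j + 2) * M (j + 2))
          + D\<^sup>2 * (of_nat j * M j)
        = P * M (j + 3) + (2 * E + D) * M (j + 2) + D * P * M (j + 1) - D\<^sup>2 * M j"
        using rec(1)[of j] by (simp only: M_def)
      ultimately have "of_nat (j + 4) * fps_nth G (j + 4) = of_nat (j + 4) * M (j + 4)"
        unfolding G by algebra
      moreover have "of_nat (j + 4) \<noteq> (0::complex)" by (simp del: of_nat_add)
      ultimately show ?thesis using 5 by (simp only: mult_cancel_left simp_thms)
    qed
  qed
  then show ?thesis by (simp add: M_def)
qed

text \<open>The sum of Mehler's series, (1 - D z^2)^(-1/2) exp((P z + E z^2) / (1 - D z^2)), with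
  the root on the principal branch: holomorphic wherever |D z^2| < 1.\<close>

definition mehler :: "complex \<Rightarrow> complex \<Rightarrow> complex \<Rightarrow> complex \<Rightarrow> complex" where
  "mehler D P E z = exp (- (Ln (1 - D * z\<^sup>2) / 2)) * exp ((P * z + E * z\<^sup>2) / (1 - D * z\<^sup>2))"

lemma mehler_holomorphic:
  assumes "\<And>z. z \<in> A \<Longrightarrow> norm (D * z\<^sup>2) < 1"
  shows "mehler D P E holomorphic_on A"
proof -
  have "1 - D * z\<^sup>2 \<notin> \<real>\<^sub>\<le>\<^sub>0" if "z \<in> A" for z
  proof -
    have "Re (D * z\<^sup>2) < 1" using assms[OF that] complex_Re_le_cmod[of "D * z\<^sup>2"] by linarith
    then show ?thesis by (auto simp: complex_nonpos_Reals_iff)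
  qed
  then show ?thesis
    unfolding mehler_def by (intro holomorphic_intros) force+
qed

text \<open>Multiplied by (1 - D z^2)^2, the logarithmic derivative of the closed form becomes a
  polynomial. The resulting differential equation passes to power series, where
  \<open>mehler_fps\<close> determines the coefficients.\<close>

lemma mehler_fps_expansion:
  assumes D: "D = 4 * B\<^sub>1 * B\<^sub>2" and P: "P = A\<^sub>1 * A\<^sub>2" and E: "E = B\<^sub>1 * A\<^sub>2\<^sup>2 + B\<^sub>2 * A\<^sub>1\<^sup>2"
  shows "mehler D P E has_fps_expansion Abs_fps (\<lambda>k. fact k * hpoly A\<^sub>1 B\<^sub>1 k * hpoly A\<^sub>2 B\<^sub>2 k)"
proof -
  define U where "U = {z. norm (D * z\<^sup>2) < 1}"
  have U: "open U" "0 \<in> U"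
    unfolding U_def by (auto intro!: open_Collect_less continuous_intros)
  have nz: "1 - D * z\<^sup>2 \<notin> \<real>\<^sub>\<le>\<^sub>0" "1 - D * z\<^sup>2 \<noteq> 0" if "z \<in> U" for z
  proof -
    have "Re (D * z\<^sup>2) < 1" using that complex_Re_le_cmod[of "D * z\<^sup>2"] by (simp add: U_def)
    then show "1 - D * z\<^sup>2 \<notin> \<real>\<^sub>\<le>\<^sub>0" by (auto simp: complex_nonpos_Reals_iff)
    then show "1 - D * z\<^sup>2 \<noteq> 0" by auto
  qed
  let ?g = "mehler D P E"
  have hol: "?g holomorphic_on U" by (rule mehler_holomorphic) (simp add: U_def)
  define G where "G = fps_expansion ?g 0"
  have G: "?g has_fps_expansion G"
    unfolding G_def using U hol by (rule has_fps_expansion_fps_expansion)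
  have der: "deriv ?g z = (D * z / (1 - D * z\<^sup>2) + (P + 2 * E * z + D * P * z\<^sup>2) / (1 - D * z\<^sup>2)\<^sup>2) * ?g z"
    if z: "z \<in> U" for z
  proof (rule DERIV_imp_deriv)
    have n: "1 - D * z\<^sup>2 \<noteq> 0" "1 - D * z\<^sup>2 \<notin> \<real>\<^sub>\<le>\<^sub>0" using nz[OF z] by auto
    have d1: "((\<lambda>z. - (Ln (1 - D * z\<^sup>2) / 2)) has_field_derivative (D * z / (1 - D * z\<^sup>2))) (at z)"
      using n by (auto intro!: derivative_eq_intros simp: field_simps)
    have d2: "((\<lambda>z. (P * z + E * z\<^sup>2) / (1 - D * z\<^sup>2)) has_field_derivative
        ((P + 2 * E * z + D * P * z\<^sup>2) / (1 - D * z\<^sup>2)\<^sup>2)) (at z)"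
      using n by (auto intro!: derivative_eq_intros simp: divide_simps) algebra
    show "(?g has_field_derivative (D * z / (1 - D * z\<^sup>2) + (P + 2 * E * z + D * P * z\<^sup>2) / (1 - D * z\<^sup>2)\<^sup>2) * ?g z) (at z)"
      unfolding mehler_def
      by (rule derivative_eq_intros DERIV_chain2[OF DERIV_exp] d1 d2 | rule refl)+
         (simp add: algebra_simps)
  qed
  have ode: "(1 - 2 * D * z ^ 2 + D\<^sup>2 * z ^ 4) * deriv ?g z
      = (P + (2 * E + D) * z ^ 1 + (D * P) * z ^ 2 - D\<^sup>2 * z ^ 3) * ?g z" if "z \<in> U" for z
  proof -
    define q where "q = 1 - D * z\<^sup>2"
    have n: "q \<noteq> 0" using nz[OF that] by (simp add: q_def)
    have q2: "1 - 2 * D * z ^ 2 + D\<^sup>2 * z ^ 4 = q ^ 2" unfolding q_def by algebra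
    have "q\<^sup>2 * (D * z / q + (P + 2 * E * z + D * P * z\<^sup>2) / q\<^sup>2) = q * D * z + (P + 2 * E * z + D * P * z\<^sup>2)"
      using n by (simp add: field_simps power2_eq_square)
    also have "\<dots> = P + (2 * E + D) * z ^ 1 + (D * P) * z ^ 2 - D\<^sup>2 * z ^ 3" unfolding q_def by algebra
    finally show ?thesis unfolding der[OF that] q2 q_def[symmetric] mult.assoc[symmetric] by simp
  qed
  have e: "(\<lambda>z. (1 - 2 * D * z ^ 2 + D\<^sup>2 * z ^ 4) * deriv ?g z) has_fps_expansion
    (1 - fps_const (2 * D) * fps_X ^ 2 + fps_const (D\<^sup>2) * fps_X ^ 4) * fps_deriv G"
    by (intro fps_expansion_intros G)
  have f: "(\<lambda>z. (P + (2 * E + D) * z ^ 1 + (D * P) * z ^ 2 - D\<^sup>2 * z ^ 3) * ?g z) has_fps_expansion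
    (fps_const P + fps_const (2 * E + D) * fps_X ^ 1 + fps_const (D * P) * fps_X ^ 2
        - fps_const (D\<^sup>2) * fps_X ^ 3) * G"
    by (intro fps_expansion_intros G)
  have ev: "eventually (\<lambda>z. (1 - 2 * D * z ^ 2 + D\<^sup>2 * z ^ 4) * deriv ?g z
      = (P + (2 * E + D) * z ^ 1 + (D * P) * z ^ 2 - D\<^sup>2 * z ^ 3) * ?g z) (nhds 0)"
    using ode U eventually_nhds by blast
  have e': "(\<lambda>z. (P + (2 * E + D) * z ^ 1 + (D * P) * z ^ 2 - D\<^sup>2 * z ^ 3) * ?g z) has_fps_expansion
    (1 - fps_const (2 * D) * fps_X ^ 2 + fps_const (D\<^sup>2) * fps_X ^ 4) * fps_deriv G"
    using has_fps_expansion_cong[OF ev refl] e by blast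
  have "fps_nth G 0 = 1"
    using fps_nth_fps_expansion[OF G, of 0] by (simp add: mehler_def)
  then have "fps_nth G k = fact k * hpoly A\<^sub>1 B\<^sub>1 k * hpoly A\<^sub>2 B\<^sub>2 k" for k
    by (rule mehler_fps[OF fps_expansion_unique_complex[OF e' f] D P E])
  then have "G = Abs_fps (\<lambda>k. fact k * hpoly A\<^sub>1 B\<^sub>1 k * hpoly A\<^sub>2 B\<^sub>2 k)"
    by (simp add: fps_eq_iff)
  with G show ?thesis by simp
qed

section \<open>Taylor coefficients of the kernel path in several variables\<close>

text \<open>The library formula for a finite product sums over multisets of size k; over a finite
  index type, \<open>count\<close> and \<open>Abs_multiset\<close> identify these with multi-indices
  of order k.\<close>

lemma fps_nth_prod_mi:
  fixes F :: "'n::finite \<Rightarrow> 'a::comm_ring_1 fps"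
  shows "fps_nth (\<Prod>j\<in>UNIV. F j) k = (\<Sum>\<kappa> | mi_abs \<kappa> = k. \<Prod>j\<in>UNIV. fps_nth (F j) (\<kappa> j))"
proof -
  have cnt: "count (Abs_multiset \<kappa>) = \<kappa>" for \<kappa> :: "'n \<Rightarrow> nat"
    by (simp add: Abs_multiset_inverse)
  have sz: "size X = (\<Sum>j\<in>UNIV. count X j)" for X :: "'n multiset"
    unfolding size_multiset_overloaded_eq
    by (rule sum.mono_neutral_left) (auto simp: not_in_iff)
  show ?thesis
    unfolding fps_prod_nth'[OF finite]
    by (rule sum.reindex_bij_witness[where i = Abs_multiset and j = count])
       (auto simp: cnt multisets_of_size_def sz mi_abs_def count_inverse)
qed

lemma finite_mi_abs: "finite {\<kappa> :: 'n::finite \<Rightarrow> nat. mi_abs \<kappa> = k}"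
proof (rule finite_subset)
  show "{\<kappa> :: 'n \<Rightarrow> nat. mi_abs \<kappa> = k} \<subseteq> (UNIV :: 'n set) \<rightarrow>\<^sub>E {..k}"
    by (auto simp: mi_abs_def intro: member_le_sum)
qed (simp add: finite_PiE)

lemma has_fps_expansion_prod_finite:
  fixes F :: "'b \<Rightarrow> complex fps"
  assumes "\<And>j. j \<in> A \<Longrightarrow> f j has_fps_expansion F j"
  shows "(\<lambda>z. \<Prod>j\<in>A. f j z) has_fps_expansion (\<Prod>j\<in>A. F j)"
  using assms by (induction A rule: infinite_finite_induct) (auto intro!: fps_expansion_intros)

text \<open>The k-th Taylor coefficient at 0 of the path from the heat kernel to the Duhamel kernel,
  as Mehler's formula yields it coordinate by coordinate. The first \<open>hpoly\<close> is a
  rescaled Hermite polynomial in x, the second collects the monomials in y and s.\<close>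

definition kernel_coeff ::
  "complex \<Rightarrow> nat \<Rightarrow> real ^ 'n::finite \<Rightarrow> real ^ 'n \<Rightarrow> real \<Rightarrow> complex" where
  "kernel_coeff \<nu> k x y s = (4 * of_real pi * \<nu>) powr (- (of_nat CARD('n) / 2)) *
     (\<Sum>\<kappa> | mi_abs \<kappa> = k. \<Prod>j\<in>UNIV. exp (- (of_real ((x $ j)\<^sup>2) / (4 * \<nu>))) *
       (fact (\<kappa> j) * hpoly (of_real (x $ j) / (2 * \<nu>)) (- 1 / (4 * \<nu>)) (\<kappa> j)
         * hpoly (of_real (y $ j)) (- \<nu> * of_real s) (\<kappa> j)))"

text \<open>
  The path $z \mapsto G_{(1-z^2 s)\nu}(x - z y)$, factored over the coordinates so that the square root of
  $1 - sz^2$ is taken on the principal branch in each factor.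
\<close>

definition kernel_path ::
  "complex \<Rightarrow> real ^ 'n::finite \<Rightarrow> real ^ 'n \<Rightarrow> real \<Rightarrow> complex \<Rightarrow> complex" where
  "kernel_path \<nu> x y s z = (4 * of_real pi * \<nu>) powr (- (of_nat CARD('n) / 2)) *
     (\<Prod>j\<in>UNIV. exp (- (of_real ((x $ j)\<^sup>2) / (4 * \<nu>))) *
       mehler (of_real s) (of_real (x $ j) / (2 * \<nu>) * of_real (y $ j))
         (- 1 / (4 * \<nu>) * (of_real (y $ j))\<^sup>2 + (- \<nu> * of_real s) * (of_real (x $ j) / (2 * \<nu>))\<^sup>2) z)"

text \<open>With B_1 = -1/(4\<nu>) and B_2 = -\<nu> s the product 4 B_1 B_2 is s, independently of
  \<nu>. So every factor of the path is a Mehler function, and the coefficients of the product are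
  sums over multi-indices.\<close>

lemma kernel_path_coeff:
  assumes "\<nu> \<noteq> 0"
  shows "(deriv ^^ k) (kernel_path \<nu> x y s) 0 / fact k = kernel_coeff \<nu> k x y s"
proof -
  have "kernel_path \<nu> x y s has_fps_expansion
      fps_const ((4 * of_real pi * \<nu>) powr (- (of_nat CARD('a) / 2))) *
      (\<Prod>j\<in>UNIV. fps_const (exp (- (of_real ((x $ j)\<^sup>2) / (4 * \<nu>)))) *
        Abs_fps (\<lambda>k. fact k * hpoly (of_real (x $ j) / (2 * \<nu>)) (- 1 / (4 * \<nu>)) k
         * hpoly (of_real (y $ j)) (- \<nu> * of_real s) k))"
    unfolding kernel_path_def
    by (intro fps_expansion_intros has_fps_expansion_prod_finite mehler_fps_expansion)
       (use assms in auto)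
  from fps_nth_fps_expansion[OF this, of k] show ?thesis
    by (simp add: fps_nth_prod_mi kernel_coeff_def)
qed

lemma kernel_path_holomorphic:
  assumes "\<And>z. z \<in> A \<Longrightarrow> norm (of_real s * z\<^sup>2) < 1"
  shows "kernel_path \<nu> x y s holomorphic_on A"
  unfolding kernel_path_def by (intro holomorphic_intros mehler_holomorphic assms)

text \<open>Completing the square: together with the Gaussian at z = 0, Mehler's exponent becomes
  that of the heat kernel at time 1 - s z^2, centred at z y.\<close>

lemma mehler_exponent:
  fixes x y \<nu> z s :: complex
  assumes "\<nu> \<noteq> 0" "1 - s * z\<^sup>2 \<noteq> 0"
  shows "- (x\<^sup>2 / (4 * \<nu>)) + (x / (2 * \<nu>) * y * z
      + (- 1 / (4 * \<nu>) * y\<^sup>2 + (- \<nu> * s) * (x / (2 * \<nu>))\<^sup>2) * z\<^sup>2) / (1 - s * z\<^sup>2)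
    = - ((x - z * y)\<^sup>2 / (4 * \<nu> * (1 - s * z\<^sup>2)))"
  using assms by (simp add: divide_simps) algebra

section \<open>The complex heat kernel: scaling, modulus, and the end of the path\<close>

lemma norm_vec_eq_sum: "(norm (x :: real ^ 'n::finite))\<^sup>2 = (\<Sum>j\<in>UNIV. (x $ j)\<^sup>2)"
  by (simp add: norm_vec_def L2_set_def sum_nonneg)

text \<open>Parabolic scaling. The principal power splits since Ln(r w) = ln r + Ln w for positive
  r.\<close>

lemma heat_kernel_scale:
  fixes x :: "real ^ 'n::finite"
  assumes "\<mu> \<noteq> 0" "r > 0"
  shows "heat_kernel (of_real r * \<mu>) x
    = of_real (r powr (- (real CARD('n) / 2))) * heat_kernel \<mu> ((r powr (- (1 / 2))) *\<^sub>R x)"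
proof -
  have "(4 * of_real pi * (of_real r * \<mu>)) = of_real r * (4 * of_real pi * \<mu>)" by simp
  moreover have "(of_real r * (4 * of_real pi * \<mu>)) powr (- (of_nat CARD('n) / 2))
      = of_real (r powr (- (real CARD('n) / 2))) * (4 * of_real pi * \<mu>) powr (- (of_nat CARD('n) / 2))"
    using assms by (simp add: powr_def Ln_times_of_real exp_add[symmetric] ring_distribs)
      (simp add: exp_of_real[symmetric] exp_add[symmetric] ring_distribs Ln_of_real del: exp_of_real)
  moreover have "(norm ((r powr (- (1 / 2))) *\<^sub>R x))\<^sup>2 = (norm x)\<^sup>2 / r"
  proof -
    have "(r powr (- (1 / 2)))\<^sup>2 = 1 / r"
      using assms(2) by (simp add: powr_minus powr_half_sqrt power_divide inverse_eq_divide)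
    then show ?thesis by (simp add: power_mult_distrib)
  qed
  ultimately show ?thesis
    by (simp add: heat_kernel_def mult_ac)
qed

lemma Re_of_real_mult: "Re (of_real q * w) = q * Re w"
  by simp

text \<open>For a real exponent the modulus of the principal power is the power of the modulus. The
  Gaussian decays at the rate Re(1/(4\<nu>)), which is positive because Re \<nu> is.\<close>

lemma norm_heat_kernel:
  fixes x :: "real ^ 'n::finite"
  assumes "Re \<nu> > 0" "r > 0"
  shows "norm (heat_kernel (of_real r * \<nu>) x)
    = norm (4 * of_real pi * \<nu>) powr (- (real CARD('n) / 2)) * r powr (- (real CARD('n) / 2))
       * exp (- (Re (1 / (4 * \<nu>)) * (norm x)\<^sup>2 / r))"
proof -
  have 1: "norm ((4 * of_real pi * (of_real r * \<nu>)) powr (- (of_nat CARD('n) / 2)))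
      = norm (4 * of_real pi * (of_real r * \<nu>)) powr (- (real CARD('n) / 2))"
    by (subst norm_powr_real_powr') auto
  have 2: "norm (4 * of_real pi * (of_real r * \<nu>)) = norm (4 * of_real pi * \<nu>) * r"
    using assms by (simp add: norm_mult)
  have "of_real ((norm x)\<^sup>2) / (4 * (of_real r * \<nu>)) = of_real ((norm x)\<^sup>2 / r) * (1 / (4 * \<nu>))"
    by simp
  then have 3: "Re (- (of_real ((norm x)\<^sup>2) / (4 * (of_real r * \<nu>)))) = - (Re (1 / (4 * \<nu>)) * (norm x)\<^sup>2 / r)"
    using Re_of_real_mult by (simp only: uminus_complex.sel) simp
  show ?thesis
    unfolding heat_kernel_def norm_mult 1 2 norm_exp_eq_Re 3
    using assms by (simp add: powr_mult norm_mult)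
qed

text \<open>At z = 1 the factors (1 - s)^(-1/2), one per coordinate, combine with the constant in
  front to the principal power, because 1 - s is positive.\<close>

lemma kernel_path_1:
  fixes x y :: "real ^ 'n::finite"
  assumes "\<nu> \<noteq> 0" "0 \<le> s" "s < 1"
  shows "kernel_path \<nu> x y s 1 = heat_kernel (of_real (1 - s) * \<nu>) (x - y)"
proof -
  have nz: "1 - of_real s * 1\<^sup>2 \<noteq> (0::complex)"
    using assms by (simp add: complex_eq_iff)
  have ln: "Ln (1 - of_real s) = of_real (ln (1 - s))"
    using Ln_of_real[of "1 - s"] assms(3) unfolding of_real_diff of_real_1 by linarith
  have "kernel_path \<nu> x y s 1 = (4 * of_real pi * \<nu>) powr (- (of_nat CARD('n) / 2)) *
     (\<Prod>j\<in>UNIV. exp (- (Ln (1 - of_real s) / 2)) * exp (- ((of_real (x $ j) - 1 * of_real (y $ j))\<^sup>2 / (4 * \<nu> * (1 - of_real s * 1\<^sup>2)))))"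
    unfolding kernel_path_def mehler_def mehler_exponent[OF assms(1) nz, symmetric] exp_add
    by (simp add: mult_ac)
  also have "\<dots> = (4 * of_real pi * \<nu>) powr (- (of_nat CARD('n) / 2)) * exp (- (Ln (1 - of_real s) / 2)) ^ CARD('n)
     * exp (\<Sum>j\<in>UNIV. - ((of_real (x $ j) - of_real (y $ j))\<^sup>2 / (4 * \<nu> * (1 - of_real s))))"
    by (simp add: prod.distrib exp_sum)
  also have "(\<Sum>j\<in>UNIV. - ((of_real (x $ j) - of_real (y $ j))\<^sup>2 / (4 * \<nu> * (1 - of_real s))))
     = - (of_real ((norm (x - y))\<^sup>2) / (4 * (of_real (1 - s) * \<nu>)))"
    by (simp add: norm_vec_eq_sum sum_negf sum_divide_distrib mult_ac)
  also have "(4 * of_real pi * \<nu>) powr (- (of_nat CARD('n) / 2)) * exp (- (Ln (1 - of_real s) / 2)) ^ CARD('n)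
    = (4 * of_real pi * (of_real (1 - s) * \<nu>)) powr (- (of_nat CARD('n) / 2))"
  proof -
    have "(4 * of_real pi * (of_real (1 - s) * \<nu>)) = of_real (1 - s) * (4 * of_real pi * \<nu>)" by simp
    moreover have "Ln (of_real (1 - s) * (4 * of_real pi * \<nu>)) = of_real (ln (1 - s)) + Ln (4 * of_real pi * \<nu>)"
      using assms by (simp add: Ln_times_of_real Ln_of_real del: of_real_diff)
    moreover have "of_real (1 - s) * (4 * of_real pi * \<nu>) \<noteq> 0"
      using assms by (simp add: complex_eq_iff)
    ultimately show ?thesis
      using assms unfolding ln by (simp add: powr_def exp_of_nat_mult[symmetric] exp_add[symmetric] ring_distribs add_divide_distrib diff_divide_distrib mult_ac)
  qed
  finally show ?thesis by (simp add: heat_kernel_def)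
qed

section \<open>Cauchy estimates for the kernel path\<close>

text \<open>Cauchy's inequality on the circle of radius r bounds the coefficients. For r \<ge> 2 the
  tail at z = 1 is dominated by a geometric series of ratio 1/2, whence the factor 2.\<close>

lemma taylor_bounds:
  assumes hol: "f holomorphic_on ball 0 R" and "0 < r" "r < R"
    and M: "\<And>z. norm z \<le> r \<Longrightarrow> norm (f z) \<le> M"
  shows "norm ((deriv ^^ k) f 0 / fact k) \<le> M / r ^ k"
    and "r \<ge> 2 \<Longrightarrow> norm (f 1 - (\<Sum>k\<le>N. (deriv ^^ k) f 0 / fact k)) \<le> 2 * M / r ^ (N + 1)"
proof -
  have bound: "norm ((deriv ^^ k) f 0 / fact k) \<le> M / r ^ k" for k
  proof -
    have "norm ((deriv ^^ k) f 0) \<le> fact k * M / r ^ k"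
    proof (rule Cauchy_inequality)
      show "f holomorphic_on ball 0 r"
        using hol by (rule holomorphic_on_subset) (use assms in auto)
      show "continuous_on (cball 0 r) f"
        using hol by (intro holomorphic_on_imp_continuous_on) (rule holomorphic_on_subset, use assms in auto)
    qed (use assms in auto)
    then show ?thesis by (simp add: norm_divide field_simps)
  qed
  then show "norm ((deriv ^^ k) f 0 / fact k) \<le> M / r ^ k" .
  assume r2: "r \<ge> 2"
  define a where "a = (\<lambda>k. (deriv ^^ k) f 0 / fact k)"
  have "(\<lambda>n. (deriv ^^ n) f 0 / fact n * (1 - 0) ^ n) sums f 1"
    using hol by (rule holomorphic_power_series) (use assms r2 in auto)
  then have "a sums f 1" by (simp add: a_def)
  then have sums: "(\<lambda>k. a (k + (N + 1))) sums (f 1 - (\<Sum>k\<le>N. a k))"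
    using sums_iff_shift[of a "N + 1" "f 1 - (\<Sum>k\<le>N. a k)"] by (simp add: lessThan_Suc_atMost)
  have M0: "0 \<le> M" using M[of 0] assms(2) norm_ge_zero[of "f 0"] by (simp, linarith)
  have g: "(\<lambda>k. M / r ^ (N + 1) * (1 / 2) ^ k) sums (M / r ^ (N + 1) * 2)"
    using sums_mult[OF geometric_sums[of "1/2::real"], of "M / r ^ (N + 1)"] by simp
  have le: "norm (a (k + (N + 1))) \<le> M / r ^ (N + 1) * (1 / 2) ^ k" for k
  proof -
    have "(1 / r) ^ k \<le> (1 / 2) ^ k" using r2 by (intro power_mono) (auto simp: field_simps)
    then have "M / r ^ (N + 1) * (1 / r) ^ k \<le> M / r ^ (N + 1) * (1 / 2) ^ k"
      using M0 assms(2) by (intro mult_left_mono) auto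
    moreover have "M / r ^ (k + (N + 1)) = M / r ^ (N + 1) * (1 / r) ^ k"
      by (simp add: power_add power_divide)
    ultimately show ?thesis using bound[of "k + (N + 1)"] unfolding a_def by linarith
  qed
  have "norm (f 1 - (\<Sum>k\<le>N. a k)) \<le> M / r ^ (N + 1) * 2"
    using norm_suminf_le[OF le sums_summable[OF g]] sums_unique[OF sums] sums_unique[OF g] by simp
  then show "norm (f 1 - (\<Sum>k\<le>N. (deriv ^^ k) f 0 / fact k)) \<le> 2 * M / r ^ (N + 1)"
    by (simp add: a_def mult.commute)
qed


lemma Re_one_divide_pos:
  assumes "Re \<nu> > 0" shows "Re (1 / (4 * \<nu>)) > 0"
proof -
  have "(4 * Re \<nu>)\<^sup>2 + (4 * Im \<nu>)\<^sup>2 > 0" using assms by (intro add_pos_nonneg) auto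
  then show ?thesis using assms by (simp add: Re_divide)
qed

text \<open>Write the exponent as -b (x - \<zeta>)^2 with b = a / (1 - w) and a = 1/(4\<nu>). The
  smallness of w keeps |b - a| \<le> Re a / 2, hence Re b \<ge> c and |b| \<le> 2L. Young's
  inequality absorbs the cross term into half of c x^2 at the price 8 L^2 / c, and b \<zeta>^2 costs
  2L. The factor 2 bounds |1 - w|^(-1/2).\<close>

lemma mehler_factor_bound:
  fixes \<nu> \<zeta> w :: complex and x :: real
  assumes \<nu>: "Re \<nu> > 0" and w: "norm w \<le> 1 / 2" "norm w \<le> Re (1 / (4 * \<nu>)) / (4 * norm (1 / (4 * \<nu>)))"
    and \<zeta>: "norm \<zeta> \<le> 1"
  defines "c \<equiv> Re (1 / (4 * \<nu>)) / 2" and "L \<equiv> norm (1 / (4 * \<nu>))"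
  shows "norm (exp (- (Ln (1 - w) / 2)) * exp (- ((of_real x - \<zeta>)\<^sup>2 / (4 * \<nu> * (1 - w)))))
     \<le> 2 * exp (8 * L\<^sup>2 / c + 2 * L) * exp (- (c / 2) * x\<^sup>2)"
proof -
  define a where "a = 1 / (4 * \<nu>)"
  have Rea: "Re a > 0" using Re_one_divide_pos[OF \<nu>] by (simp add: a_def)
  then have a0: "norm a > 0" by auto
  have c: "c > 0" using Rea by (simp add: c_def a_def)
  have q: "norm (1 - w) \<ge> 1 / 2" using w norm_triangle_ineq2[of 1 w] by simp
  then have q0: "1 - w \<noteq> 0" by auto
  have "1 / (1 - w) - 1 = w / (1 - w)" using q0 by (simp add: field_simps)
  then have "norm (1 / (1 - w) - 1) = norm w / norm (1 - w)" by (simp add: norm_divide)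
  also have "\<dots> \<le> norm w / (1 / 2)" using q by (intro divide_left_mono) auto
  finally have d: "norm (1 / (1 - w) - 1) \<le> 2 * norm w" by simp
  define b where "b = a / (1 - w)"
  have ba: "b - a = a * (1 / (1 - w) - 1)" by (simp add: b_def algebra_simps)
  have "norm (b - a) \<le> norm a * (2 * norm w)"
    unfolding ba norm_mult using d by (intro mult_left_mono) auto
  also have "\<dots> \<le> norm a * (2 * (Re a / (4 * norm a)))"
    using w by (intro mult_left_mono) (auto simp: a_def)
  also have "\<dots> = Re a / 2" using a0 by simp
  finally have bd: "norm (b - a) \<le> Re a / 2" .
  have Reb: "Re b \<ge> c"
    using bd abs_Re_le_cmod[of "b - a"] by (simp add: c_def a_def[symmetric])
  have bL: "norm b \<le> 2 * L"
    using bd norm_triangle_ineq2[of b a] complex_Re_le_cmod[of a] a0 unfolding L_def a_def[symmetric] by linarith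
  have e1: "norm (exp (- (Ln (1 - w) / 2))) \<le> 2"
  proof -
    have "norm (exp (- (Ln (1 - w) / 2))) = exp (- (ln (norm (1 - w)) / 2))"
      using q0 by simp
    also have "\<dots> \<le> exp (ln 2)"
    proof -
      have "ln (norm (1 - w)) \<ge> ln (1 / 2)" using q by (intro ln_mono) auto
      then have "- ln 2 \<le> ln (norm (1 - w))" by (simp add: ln_div)
      moreover have "ln 2 \<ge> (0::real)" by simp
      ultimately have "- (ln (norm (1 - w)) / 2) \<le> ln 2" by linarith
      then show ?thesis by (simp only: exp_le_cancel_iff)
    qed
    finally show ?thesis by simp
  qed
  have e2: "Re (- ((of_real x - \<zeta>)\<^sup>2 / (4 * \<nu> * (1 - w)))) \<le> (8 * L\<^sup>2 / c + 2 * L) + (- (c / 2) * x\<^sup>2)"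
  proof -
    have "- ((of_real x - \<zeta>)\<^sup>2 / (4 * \<nu> * (1 - w))) = - (of_real (x\<^sup>2) * b) + of_real (2 * x) * (b * \<zeta>) - b * \<zeta>\<^sup>2"
    proof -
      have "(of_real x - \<zeta>)\<^sup>2 / (4 * \<nu> * (1 - w)) = b * (of_real x - \<zeta>)\<^sup>2"
        by (simp add: b_def a_def)
      then show ?thesis by (simp add: power2_eq_square algebra_simps)
    qed
    then have "Re (- ((of_real x - \<zeta>)\<^sup>2 / (4 * \<nu> * (1 - w)))) = - (x\<^sup>2 * Re b) + 2 * x * Re (b * \<zeta>) - Re (b * \<zeta>\<^sup>2)"
      by (simp only: plus_complex.sel minus_complex.sel uminus_complex.sel Re_of_real_mult)
    moreover have "x\<^sup>2 * Re b \<ge> x\<^sup>2 * c" using Reb by (intro mult_left_mono) auto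
    moreover have bz: "\<bar>Re (b * \<zeta>)\<bar> \<le> 2 * L"
    proof -
      have "norm (b * \<zeta>) \<le> (2 * L) * 1" unfolding norm_mult using bL \<zeta> by (intro mult_mono) (auto simp: L_def)
      then show ?thesis using abs_Re_le_cmod[of "b * \<zeta>"] by linarith
    qed
    moreover have "- Re (b * \<zeta>\<^sup>2) \<le> 2 * L"
    proof -
      have "norm (b * \<zeta>\<^sup>2) \<le> (2 * L) * 1" unfolding norm_mult norm_power using bL \<zeta>
        by (intro mult_mono power_le_one) (auto simp: L_def)
      then show ?thesis using abs_Re_le_cmod[of "b * \<zeta>\<^sup>2"] by linarith
    qed
    moreover have "2 * x * Re (b * \<zeta>) \<le> c / 2 * x\<^sup>2 + 8 * L\<^sup>2 / c"
    proof -
      have "2 * x * Re (b * \<zeta>) \<le> 2 * (\<bar>x\<bar> * (2 * L))"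
      proof -
        have "x * Re (b * \<zeta>) \<le> \<bar>x\<bar> * \<bar>Re (b * \<zeta>)\<bar>" by (simp add: abs_mult[symmetric])
        also have "\<dots> \<le> \<bar>x\<bar> * (2 * L)" using bz by (intro mult_left_mono) auto
        finally show ?thesis by linarith
      qed
      also have "\<dots> \<le> c / 2 * x\<^sup>2 + 8 * L\<^sup>2 / c"
      proof -
        have "0 \<le> (c * \<bar>x\<bar> - 4 * L)\<^sup>2 / (2 * c)" using c by simp
        also have "\<dots> = c / 2 * x\<^sup>2 + 8 * L\<^sup>2 / c - 2 * (\<bar>x\<bar> * (2 * L))"
          using c by (simp add: field_simps power2_eq_square)
        finally show ?thesis by simp
      qed
      finally show ?thesis .
    qed
    moreover have "- (c / 2) * x\<^sup>2 = c / 2 * x\<^sup>2 - x\<^sup>2 * c" by (simp add: field_simps)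
    ultimately show ?thesis by linarith
  qed
  have "norm (exp (- (Ln (1 - w) / 2)) * exp (- ((of_real x - \<zeta>)\<^sup>2 / (4 * \<nu> * (1 - w)))))
      \<le> 2 * exp ((8 * L\<^sup>2 / c + 2 * L) + (- (c / 2) * x\<^sup>2))"
    unfolding norm_mult using e1 e2 by (intro mult_mono) auto
  then show ?thesis by (simp only: exp_add mult.assoc)
qed

text \<open>For |z| \<le> \<epsilon>/\<rho> both perturbations are small uniformly in y and s: |z y|
  \<le> \<epsilon> and |s z^2| \<le> \<epsilon>^2. So the one-dimensional bound applies in each
  coordinate, and the bounds are multiplied.\<close>

lemma kernel_path_bound:
  assumes \<nu>: "Re \<nu> > 0"
  obtains \<epsilon> C c where "\<epsilon> > 0" "C > 0" "c > 0" "\<epsilon>\<^sup>2 \<le> 1 / 2"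
    "\<And>(x :: real ^ 'n::finite) y s \<rho> z. 0 < \<rho> \<Longrightarrow> norm y \<le> \<rho> \<Longrightarrow> 0 \<le> s \<Longrightarrow> s \<le> \<rho>\<^sup>2 \<Longrightarrow> norm z \<le> \<epsilon> / \<rho>
       \<Longrightarrow> norm (kernel_path \<nu> x y s z) \<le> C * exp (- c * (norm x)\<^sup>2)"
proof -
  define L where "L = norm (1 / (4 * \<nu>))"
  define c where "c = Re (1 / (4 * \<nu>)) / 2"
  have nu0: "\<nu> \<noteq> 0" using \<nu> by auto
  have Rea: "Re (1 / (4 * \<nu>)) > 0" by (rule Re_one_divide_pos[OF \<nu>])
  then have c: "c > 0" by (simp add: c_def)
  have L: "L > 0" using nu0 by (simp add: L_def)
  \<comment> \<open>The smallness that \<open>mehler_factor_bound\<close> asks of w = s z^2; hence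
    \<epsilon> is its square root.\<close>
  define \<delta> where "\<delta> = min (1 / 2) (Re (1 / (4 * \<nu>)) / (4 * L))"
  have \<delta>: "0 < \<delta>" "\<delta> \<le> 1 / 2" "\<delta> \<le> Re (1 / (4 * \<nu>)) / (4 * L)" using Rea L by (auto simp: \<delta>_def)
  define \<epsilon> where "\<epsilon> = sqrt \<delta>"
  have \<epsilon>: "\<epsilon> > 0" "\<epsilon>\<^sup>2 = \<delta>" "\<epsilon> \<le> 1" using \<delta> by (auto simp: \<epsilon>_def)
  define N where "N = norm ((4 * of_real pi * \<nu>) powr (- (of_nat CARD('n) / 2)))"
  define B where "B = 2 * exp (8 * L\<^sup>2 / c + 2 * L)"
  have B: "B > 0" by (simp add: B_def)
  define C where "C = (N + 1) * B ^ CARD('n)"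
  have "C > 0" using B by (simp add: C_def N_def add_nonneg_pos)
  moreover have "norm (kernel_path \<nu> x y s z) \<le> C * exp (- (c / 2) * (norm x)\<^sup>2)"
    if \<rho>: "0 < \<rho>" "norm y \<le> \<rho>" "0 \<le> s" "s \<le> \<rho>\<^sup>2" "norm z \<le> \<epsilon> / \<rho>" for x y :: "real ^ 'n" and s \<rho> z
  proof -
    have z\<rho>: "norm z * \<rho> \<le> \<epsilon>" using \<rho> by (simp add: field_simps)
    have "norm (of_real s * z\<^sup>2) = s * (norm z)\<^sup>2" using \<rho> by (simp add: norm_mult norm_power)
    also have "\<dots> \<le> \<rho>\<^sup>2 * (norm z)\<^sup>2" using \<rho> by (intro mult_right_mono) auto
    also have "\<dots> = (norm z * \<rho>)\<^sup>2" by (simp add: power_mult_distrib mult.commute)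
    also have "\<dots> \<le> \<epsilon>\<^sup>2" using z\<rho> \<rho> by (intro power_mono) auto
    finally have w: "norm (of_real s * z\<^sup>2) \<le> \<delta>" using \<epsilon> by simp
    then have nz: "1 - of_real s * z\<^sup>2 \<noteq> 0" using \<delta> by (metis eq_iff_diff_eq_0 linorder_not_less norm_one one_less_numeral_iff order_trans divide_less_eq_1_pos semiring_norm(76) zero_less_numeral)
    have fac: "norm (exp (- (of_real ((x $ j)\<^sup>2) / (4 * \<nu>))) *
       mehler (of_real s) (of_real (x $ j) / (2 * \<nu>) * of_real (y $ j))
         (- 1 / (4 * \<nu>) * (of_real (y $ j))\<^sup>2 + (- \<nu> * of_real s) * (of_real (x $ j) / (2 * \<nu>))\<^sup>2) z)
       \<le> B * exp (- (c / 2) * (x $ j)\<^sup>2)" for j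
    proof -
      have "norm (z * of_real (y $ j)) \<le> norm z * \<rho>"
        unfolding norm_mult using \<rho> component_le_norm_cart[of y j] by (intro mult_left_mono) auto
      then have \<zeta>: "norm (z * of_real (y $ j)) \<le> 1" using z\<rho> \<epsilon> by linarith
      have "exp (- (of_real ((x $ j)\<^sup>2) / (4 * \<nu>))) *
         mehler (of_real s) (of_real (x $ j) / (2 * \<nu>) * of_real (y $ j))
         (- 1 / (4 * \<nu>) * (of_real (y $ j))\<^sup>2 + (- \<nu> * of_real s) * (of_real (x $ j) / (2 * \<nu>))\<^sup>2) z
        = exp (- (Ln (1 - of_real s * z\<^sup>2) / 2)) *
          exp (- ((of_real (x $ j) - z * of_real (y $ j))\<^sup>2 / (4 * \<nu> * (1 - of_real s * z\<^sup>2))))"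
        unfolding mehler_def mehler_exponent[OF nu0 nz, symmetric] exp_add by (simp add: mult_ac)
      then show ?thesis
        using mehler_factor_bound[OF \<nu> _ _ \<zeta>, of "of_real s * z\<^sup>2" "x $ j"] w \<delta>
        unfolding B_def c_def L_def by simp
    qed
    have "norm (kernel_path \<nu> x y s z) \<le> N * (\<Prod>j\<in>(UNIV::'n set). B * exp (- (c / 2) * (x $ j)\<^sup>2))"
      unfolding kernel_path_def norm_mult[of "_ powr _"] N_def prod_norm[symmetric]
      by (intro mult_left_mono prod_mono conjI fac) auto
    also have "\<dots> = N * B ^ CARD('n) * exp (- (c / 2) * (norm x)\<^sup>2)"
      by (simp add: prod.distrib exp_sum[symmetric] norm_vec_eq_sum sum_distrib_left)
    also have "\<dots> \<le> C * exp (- (c / 2) * (norm x)\<^sup>2)"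
      using B by (intro mult_right_mono) (auto simp: C_def)
    finally show ?thesis .
  qed
  ultimately show ?thesis
    using that[of \<epsilon> C "c / 2"] \<epsilon> \<delta> c by auto
qed

text \<open>Cauchy's estimates with radius \<epsilon>/\<rho>, which produce the growth
  (\<rho>/\<epsilon>)^k. The remainder at z = 1 needs this radius to be at least 2, that is \<rho>
  \<le> \<epsilon>/2.\<close>

lemma kernel_coeff_bounds:
  assumes \<nu>: "Re \<nu> > 0"
  obtains \<epsilon> C c where "\<epsilon> > 0" "\<epsilon> \<le> 1" "C > 0" "c > 0"
    "\<And>k (x :: real ^ 'n::finite) y s \<rho>. 0 < \<rho> \<Longrightarrow> norm y \<le> \<rho> \<Longrightarrow> 0 \<le> s \<Longrightarrow> s \<le> \<rho>\<^sup>2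
       \<Longrightarrow> norm (kernel_coeff \<nu> k x y s) \<le> C * (\<rho> / \<epsilon>) ^ k * exp (- c * (norm x)\<^sup>2)"
    "\<And>N (x :: real ^ 'n::finite) y s \<rho>. 0 < \<rho> \<Longrightarrow> norm y \<le> \<rho> \<Longrightarrow> 0 \<le> s \<Longrightarrow> s \<le> \<rho>\<^sup>2 \<Longrightarrow> \<rho> \<le> \<epsilon> / 2 \<Longrightarrow> s < 1
       \<Longrightarrow> norm (heat_kernel (of_real (1 - s) * \<nu>) (x - y) - (\<Sum>k\<le>N. kernel_coeff \<nu> k x y s))
          \<le> 2 * C * (\<rho> / \<epsilon>) ^ (N + 1) * exp (- c * (norm x)\<^sup>2)"
proof -
  obtain \<epsilon> C c where E: "\<epsilon> > 0" "C > 0" "c > 0" "\<epsilon>\<^sup>2 \<le> 1 / 2"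
    "\<And>(x :: real ^ 'n::finite) y s \<rho> z. 0 < \<rho> \<Longrightarrow> norm y \<le> \<rho> \<Longrightarrow> 0 \<le> s \<Longrightarrow> s \<le> \<rho>\<^sup>2 \<Longrightarrow> norm z \<le> \<epsilon> / \<rho>
       \<Longrightarrow> norm (kernel_path \<nu> x y s z) \<le> C * exp (- c * (norm x)\<^sup>2)"
    using kernel_path_bound[OF \<nu>] by metis
  have nu0: "\<nu> \<noteq> 0" using \<nu> by auto
  \<comment> \<open>The estimates on the disc of radius \<epsilon>/\<rho> ask for holomorphy on a
    slightly larger one; since \<epsilon>^2 \<le> 1/2, a factor 11/10 still leaves |s z^2| <
    1.\<close>
  have hol: "kernel_path \<nu> x y s holomorphic_on ball 0 (11 / 10 * (\<epsilon> / \<rho>))"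
    if \<rho>: "0 < \<rho>" "0 \<le> s" "s \<le> \<rho>\<^sup>2" for x y :: "real ^ 'n" and s \<rho>
  proof (rule kernel_path_holomorphic)
    fix z :: complex assume "z \<in> ball 0 (11 / 10 * (\<epsilon> / \<rho>))"
    then have z: "norm z * \<rho> \<le> 11 / 10 * \<epsilon>" using \<rho> by (simp add: field_simps)
    have "norm (of_real s * z\<^sup>2) = s * (norm z)\<^sup>2" using \<rho> by (simp add: norm_mult norm_power)
    also have "\<dots> \<le> \<rho>\<^sup>2 * (norm z)\<^sup>2" using \<rho> by (intro mult_right_mono) auto
    also have "\<dots> = (norm z * \<rho>)\<^sup>2" by (simp add: power_mult_distrib mult.commute)
    also have "\<dots> \<le> (11 / 10 * \<epsilon>)\<^sup>2" using z \<rho> by (intro power_mono) auto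
    also have "\<dots> < 1" using E(4) by (simp add: power_mult_distrib power2_eq_square)
    finally show "norm (of_real s * z\<^sup>2) < 1" .
  qed
  have e1: "\<epsilon> \<le> 1"
  proof (rule ccontr)
    assume "\<not> \<epsilon> \<le> 1"
    then have "\<epsilon>\<^sup>2 > 1" by (simp add: one_less_power)
    then show False using E(4) by simp
  qed
  show ?thesis
  proof (rule that[OF E(1) e1 E(2,3)])
    fix k and x y :: "real ^ 'n" and s \<rho> :: real
    assume \<rho>: "0 < \<rho>" "norm y \<le> \<rho>" "0 \<le> s" "s \<le> \<rho>\<^sup>2"
    have r: "0 < \<epsilon> / \<rho>" "\<epsilon> / \<rho> < 11 / 10 * (\<epsilon> / \<rho>)"
      using divide_pos_pos[OF E(1) \<rho>(1)] by auto
    have "norm ((deriv ^^ k) (kernel_path \<nu> x y s) 0 / fact k) \<le> C * exp (- c * (norm x)\<^sup>2) / (\<epsilon> / \<rho>) ^ k"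
      by (rule taylor_bounds(1)[OF hol[OF \<rho>(1,3,4)] r]) (use E \<rho> in auto)
    then show "norm (kernel_coeff \<nu> k x y s) \<le> C * (\<rho> / \<epsilon>) ^ k * exp (- c * (norm x)\<^sup>2)"
      unfolding kernel_path_coeff[OF nu0] using E \<rho> by (simp add: field_simps)
  next
    fix N and x y :: "real ^ 'n" and s \<rho> :: real
    assume \<rho>: "0 < \<rho>" "norm y \<le> \<rho>" "0 \<le> s" "s \<le> \<rho>\<^sup>2" "\<rho> \<le> \<epsilon> / 2" "s < 1"
    have r: "0 < \<epsilon> / \<rho>" "\<epsilon> / \<rho> < 11 / 10 * (\<epsilon> / \<rho>)"
      using divide_pos_pos[OF E(1) \<rho>(1)] by auto
    have "norm (kernel_path \<nu> x y s 1 - (\<Sum>k\<le>N. (deriv ^^ k) (kernel_path \<nu> x y s) 0 / fact k))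
        \<le> 2 * (C * exp (- c * (norm x)\<^sup>2)) / (\<epsilon> / \<rho>) ^ (N + 1)"
      by (rule taylor_bounds(2)[OF hol[OF \<rho>(1,3,4)] r]) (use E \<rho> in \<open>auto simp: field_simps\<close>)
    then show "norm (heat_kernel (of_real (1 - s) * \<nu>) (x - y) - (\<Sum>k\<le>N. kernel_coeff \<nu> k x y s))
          \<le> 2 * C * (\<rho> / \<epsilon>) ^ (N + 1) * exp (- c * (norm x)\<^sup>2)"
      unfolding kernel_path_coeff[OF nu0] kernel_path_1[OF nu0 \<rho>(3,6)] using E \<rho> by (simp add: field_simps)
  qed
qed

section \<open>The Taylor polynomial as the kernel of the profile\<close>

text \<open>Expanding the product over the coordinates turns the sums \<open>hpoly\<close> into the
  sum over multi-indices in \<open>hermite\<close>; the powers of 2 compensate the denominators in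
  x/(2\<nu>) and -1/(4\<nu>).\<close>

lemma hermite_prod:
  fixes x :: "real ^ 'n::finite"
  assumes "\<nu> \<noteq> 0"
  shows "hermite \<nu> \<alpha> x = (\<Prod>j\<in>UNIV. 2 ^ \<alpha> j * (fact (\<alpha> j)
    * hpoly (of_real (x $ j) / (2 * \<nu>)) (- 1 / (4 * \<nu>)) (\<alpha> j)))"
proof -
  have fin: "finite {c. 2 * c \<le> k}" for k :: nat
    by (rule finite_subset[of _ "{..k}"]) auto
  have PiE: "PiE UNIV (\<lambda>j. {c. 2 * c \<le> \<alpha> j}) = {\<beta>. mi_double \<beta> \<le> \<alpha>}"
    by (auto simp: mi_double_def le_fun_def)
  have "(\<Prod>j\<in>UNIV. 2 ^ \<alpha> j * (fact (\<alpha> j)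
      * hpoly (of_real (x $ j) / (2 * \<nu>)) (- 1 / (4 * \<nu>)) (\<alpha> j)))
    = (\<Prod>j\<in>UNIV. \<Sum>c | 2 * c \<le> \<alpha> j. 2 ^ \<alpha> j * (fact (\<alpha> j) * ((- 1 / (4 * \<nu>)) ^ c / fact c *
        ((of_real (x $ j) / (2 * \<nu>)) ^ (\<alpha> j - 2 * c) / fact (\<alpha> j - 2 * c)))))"
    by (simp add: hpoly_def sum_distrib_left)
  also have "\<dots> = (\<Sum>\<beta> | mi_double \<beta> \<le> \<alpha>. \<Prod>j\<in>UNIV. 2 ^ \<alpha> j * (fact (\<alpha> j) * ((- 1 / (4 * \<nu>)) ^ \<beta> j / fact (\<beta> j) *
        ((of_real (x $ j) / (2 * \<nu>)) ^ (\<alpha> j - 2 * \<beta> j) / fact (\<alpha> j - 2 * \<beta> j)))))"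
    by (subst prod_sum_PiE) (auto simp: fin PiE)
  also have "\<dots> = hermite \<nu> \<alpha> x"
    unfolding hermite_def
  proof (rule sum.cong[OF refl])
    fix \<beta> assume "\<beta> \<in> {\<beta>. mi_double \<beta> \<le> \<alpha>}"
    then have le: "2 * \<beta> j \<le> \<alpha> j" for j by (auto simp: mi_double_def le_fun_def)
    have pw: "\<nu> powi (- int k) = (1 / \<nu>) ^ k" for k
      by (simp add: power_int_minus power_one_over inverse_eq_divide)
    have *: "2 ^ \<alpha> j * (fact (\<alpha> j) * ((- 1 / (4 * \<nu>)) ^ \<beta> j / fact (\<beta> j) *
        ((of_real (x $ j) / (2 * \<nu>)) ^ (\<alpha> j - 2 * \<beta> j) / fact (\<alpha> j - 2 * \<beta> j))))
      = (-1) ^ \<beta> j * (fact (\<alpha> j) / (fact (\<beta> j) * fact (\<alpha> j - 2 * \<beta> j))) * (1 / \<nu>) ^ (\<alpha> j - \<beta> j)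
         * of_real (x $ j) ^ (\<alpha> j - 2 * \<beta> j)" for j
    proof -
      obtain d where d: "\<alpha> j = 2 * \<beta> j + d" using le[of j] le_Suc_ex by blast
      have e: "\<alpha> j - 2 * \<beta> j = d" "\<alpha> j - \<beta> j = \<beta> j + d" using d by auto
      have "(2::complex) ^ \<alpha> j = 4 ^ \<beta> j * 2 ^ d" by (simp add: d power_add power_mult)
      moreover have "(- 1 / (4 * \<nu>)) ^ \<beta> j = (- 1) ^ \<beta> j / (4 ^ \<beta> j * \<nu> ^ \<beta> j)"
        by (simp only: power_divide power_mult_distrib)
      ultimately show ?thesis unfolding e
        by (simp add: power_divide power_mult_distrib power_add mult_ac)
    qed
    show "(\<Prod>j\<in>UNIV. 2 ^ \<alpha> j * (fact (\<alpha> j) * ((- 1 / (4 * \<nu>)) ^ \<beta> j / fact (\<beta> j) *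
        ((of_real (x $ j) / (2 * \<nu>)) ^ (\<alpha> j - 2 * \<beta> j) / fact (\<alpha> j - 2 * \<beta> j)))))
      = (-1) ^ mi_abs \<beta> * of_nat (mi_fact \<alpha>)
          / (of_nat (mi_fact \<beta>) * of_nat (mi_fact (mi_diff \<alpha> (mi_double \<beta>))))
        * \<nu> powi (- int (mi_abs (mi_diff \<alpha> \<beta>)))
        * of_real (mi_power x (mi_diff \<alpha> (mi_double \<beta>)))"
      unfolding * pw mi_abs_def mi_fact_def mi_diff_def mi_double_def mi_power_def
      by (simp add: prod.distrib power_sum prod_dividef)
  qed
  finally show ?thesis by simp
qed

text \<open>Applied with B = -\<nu> s: the index \<gamma> of the expansion counts the powers of s
  and becomes the index \<gamma> of the profile.\<close>

lemma prod_hpoly_mi: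
  fixes y :: "real ^ 'n::finite"
  shows "(\<Prod>j\<in>UNIV. hpoly (of_real (y $ j)) B (\<kappa> j)) = (\<Sum>\<gamma> | mi_double \<gamma> \<le> \<kappa>.
    B ^ mi_abs \<gamma> / of_nat (mi_fact \<gamma>) *
     (of_real (mi_power y (mi_diff \<kappa> (mi_double \<gamma>))) / of_nat (mi_fact (mi_diff \<kappa> (mi_double \<gamma>)))))"
proof -
  have fin: "finite {c. 2 * c \<le> k}" for k :: nat
    by (rule finite_subset[of _ "{..k}"]) auto
  have PiE: "PiE UNIV (\<lambda>j. {c. 2 * c \<le> \<kappa> j}) = {\<beta>. mi_double \<beta> \<le> \<kappa>}"
    by (auto simp: mi_double_def le_fun_def)
  show ?thesis
    unfolding hpoly_def
    by (subst prod_sum_PiE)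
       (auto simp: fin PiE prod.distrib prod_dividef power_sum mi_abs_def mi_fact_def mi_power_def mi_diff_def mi_double_def
         intro!: sum.cong)
qed

lemma mi_abs_add: "mi_abs (mi_add \<alpha> \<beta>) = mi_abs \<alpha> + mi_abs \<beta>"
  by (simp add: mi_abs_def mi_add_def sum.distrib)

lemma mi_abs_double: "mi_abs (mi_double \<gamma>) = 2 * mi_abs \<gamma>"
  by (simp add: mi_abs_def mi_double_def sum_distrib_left)

lemma finite_mi_double_le: "finite {\<gamma> :: 'n::finite \<Rightarrow> nat. mi_double \<gamma> \<le> \<kappa>}"
proof (rule finite_subset)
  show "{\<gamma> :: 'n \<Rightarrow> nat. mi_double \<gamma> \<le> \<kappa>} \<subseteq> (\<Pi>\<^sub>E j\<in>UNIV. {..\<kappa> j})"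
  proof
    fix \<gamma> :: "'n \<Rightarrow> nat" assume "\<gamma> \<in> {\<gamma>. mi_double \<gamma> \<le> \<kappa>}"
    then have k: "2 * \<gamma> j \<le> \<kappa> j" for j by (auto simp: mi_double_def le_fun_def)
    have "\<gamma> j \<le> \<kappa> j" for j using k[of j] by linarith
    then show "\<gamma> \<in> (\<Pi>\<^sub>E j\<in>UNIV. {..\<kappa> j})" by auto
  qed
qed (simp add: finite_PiE)

lemma finite_mi_abs_le: "finite {\<gamma> :: 'n::finite \<Rightarrow> nat. 2 * mi_abs \<gamma> \<le> m}"
proof (rule finite_subset)
  show "{\<gamma> :: 'n \<Rightarrow> nat. 2 * mi_abs \<gamma> \<le> m} \<subseteq> (\<Union>k\<in>{..m}. {\<gamma>. mi_abs \<gamma> = k})" by auto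
qed (simp add: finite_mi_abs)

text \<open>The substitution \<kappa> = 2\<gamma> + \<beta>: a total degree of at most m becomes
  |\<gamma>| \<le> m/2 and |\<beta>| \<le> m - 2|\<gamma>|, the two ranges of summation in the
  profile.\<close>

lemma sum_mi_reindex:
  fixes T :: "('n::finite \<Rightarrow> nat) \<Rightarrow> ('n \<Rightarrow> nat) \<Rightarrow> 'a::comm_monoid_add"
  shows "(\<Sum>k\<le>m. \<Sum>\<kappa> | mi_abs \<kappa> = k. \<Sum>\<gamma> | mi_double \<gamma> \<le> \<kappa>. T \<kappa> \<gamma>)
    = (\<Sum>\<gamma> | 2 * mi_abs \<gamma> \<le> m. \<Sum>k=0..m - 2 * mi_abs \<gamma>. \<Sum>\<beta> | mi_abs \<beta> = k. T (mi_add (mi_double \<gamma>) \<beta>) \<gamma>)"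
proof -
  have dif: "mi_add (mi_double \<gamma>) (mi_diff \<kappa> (mi_double \<gamma>)) = \<kappa>" if "mi_double \<gamma> \<le> \<kappa>" for \<gamma> \<kappa> :: "'n \<Rightarrow> nat"
    using that by (auto simp: mi_add_def mi_diff_def le_fun_def)
  have dif2: "mi_diff (mi_add (mi_double \<gamma>) \<beta>) (mi_double \<gamma>) = \<beta>" for \<gamma> \<beta> :: "'n \<Rightarrow> nat"
    by (auto simp: mi_add_def mi_diff_def)
  have abs: "mi_abs \<kappa> = 2 * mi_abs \<gamma> + mi_abs (mi_diff \<kappa> (mi_double \<gamma>))" if "mi_double \<gamma> \<le> \<kappa>" for \<gamma> \<kappa> :: "'n \<Rightarrow> nat"
    using dif[OF that] mi_abs_add mi_abs_double by metis
  have "(\<Sum>k\<le>m. \<Sum>\<kappa> | mi_abs \<kappa> = k. \<Sum>\<gamma> | mi_double \<gamma> \<le> \<kappa>. T \<kappa> \<gamma>)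
      = (\<Sum>(k, \<kappa>, \<gamma>)\<in>(SIGMA k:{..m}. SIGMA \<kappa>:{\<kappa>. mi_abs \<kappa> = k}. {\<gamma>. mi_double \<gamma> \<le> \<kappa>}). T \<kappa> \<gamma>)"
    by (simp add: sum.Sigma finite_mi_abs finite_mi_double_le)
  also have "\<dots> = (\<Sum>(\<gamma>, k, \<beta>)\<in>(SIGMA \<gamma>:{\<gamma>. 2 * mi_abs \<gamma> \<le> m}. SIGMA k:{0..m - 2 * mi_abs \<gamma>}. {\<beta>. mi_abs \<beta> = k}).
      T (mi_add (mi_double \<gamma>) \<beta>) \<gamma>)"
  proof (rule sum.reindex_bij_witness[where
          i = "\<lambda>(\<gamma>, k, \<beta>). (mi_abs (mi_add (mi_double \<gamma>) \<beta>), mi_add (mi_double \<gamma>) \<beta>, \<gamma>)" and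
          j = "\<lambda>(k, \<kappa>, \<gamma>). (\<gamma>, mi_abs (mi_diff \<kappa> (mi_double \<gamma>)), mi_diff \<kappa> (mi_double \<gamma>))"], goal_cases)
    case (2 a)
    then obtain \<kappa> \<gamma> where a: "a = (mi_abs \<kappa>, \<kappa>, \<gamma>)" "mi_abs \<kappa> \<le> m" "mi_double \<gamma> \<le> \<kappa>" by auto
    show ?case using abs[OF a(3)] a by simp
  next
    case (4 b)
    have "mi_double \<gamma> \<le> mi_add (mi_double \<gamma>) \<beta>" for \<gamma> \<beta> :: "'n \<Rightarrow> nat"
      by (simp add: mi_add_def le_fun_def)
    with 4 show ?case by (auto simp: mi_abs_add mi_abs_double)
  qed (auto simp: dif dif2)
  also have "\<dots> = (\<Sum>\<gamma> | 2 * mi_abs \<gamma> \<le> m. \<Sum>k=0..m - 2 * mi_abs \<gamma>. \<Sum>\<beta> | mi_abs \<beta> = k. T (mi_add (mi_double \<gamma>) \<beta>) \<gamma>)"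
    by (simp add: sum.Sigma finite_mi_abs finite_mi_abs_le)
  finally show ?thesis .
qed

text \<open>The Taylor polynomial of degree m carried from time 1 to time t by parabolic scaling: x
  and y are measured in units of sqrt t, s in units of t.\<close>

definition profile_kernel ::
  "complex \<Rightarrow> nat \<Rightarrow> real \<Rightarrow> real ^ 'n::finite \<Rightarrow> real ^ 'n \<Rightarrow> real \<Rightarrow> complex" where
  "profile_kernel \<nu> m t x y s = of_real (t powr (- (real CARD('n) / 2))) *
     (\<Sum>k\<le>m. kernel_coeff \<nu> k ((t powr (- (1 / 2))) *\<^sub>R x) ((t powr (- (1 / 2))) *\<^sub>R y) (s / t))"

text \<open>The x-dependent factor that goes with s^|\<gamma>| y^\<beta>, arranged like the summands
  of \<open>Lambda_profile\<close>. It contains the 1/\<beta>! which there comes from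
  \<open>moment\<close>.\<close>

definition profile_coeff ::
  "complex \<Rightarrow> real \<Rightarrow> real ^ 'n::finite \<Rightarrow> 'n multiindex \<Rightarrow> 'n multiindex \<Rightarrow> complex" where
  "profile_coeff \<nu> t x \<gamma> \<beta> = (- \<nu>) ^ mi_abs \<gamma> / of_nat (mi_fact \<gamma>) *
     ((-2) powi (- int (mi_abs (mi_double \<gamma>))) * of_real (t powr (- (real (mi_abs (mi_double \<gamma>)) / 2)))) *
     (2 powi (- int (mi_abs \<beta>)) * of_real (t powr (- (real (mi_abs \<beta>) / 2)))) *
     (dilation t (\<lambda>y. hermite \<nu> (mi_add (mi_double \<gamma>) \<beta>) y * heat_kernel \<nu> y) x / of_nat (mi_fact \<beta>))"

lemma mi_power_scaleR: "mi_power (r *\<^sub>R y) \<beta> = r ^ mi_abs \<beta> * mi_power y \<beta>"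
  by (simp add: mi_power_def mi_abs_def power_mult_distrib prod.distrib power_sum)

text \<open>Only the factor in y and s is expanded. The factors in x stay together: with the
  Gaussians they form the Hermite function of index \<kappa>, which occurs as such in the
  profile.\<close>

lemma kernel_coeff_sum:
  fixes x :: "real ^ 'n::finite"
  assumes "\<nu> \<noteq> 0"
  shows "kernel_coeff \<nu> k x y s = (\<Sum>\<kappa> | mi_abs \<kappa> = k. \<Sum>\<gamma> | mi_double \<gamma> \<le> \<kappa>.
     (1 / 2) ^ mi_abs \<kappa> * (hermite \<nu> \<kappa> x * heat_kernel \<nu> x) *
     ((- \<nu> * of_real s) ^ mi_abs \<gamma> / of_nat (mi_fact \<gamma>) *
     (of_real (mi_power y (mi_diff \<kappa> (mi_double \<gamma>))) / of_nat (mi_fact (mi_diff \<kappa> (mi_double \<gamma>))))))"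
proof -
  have G: "heat_kernel \<nu> x = (4 * of_real pi * \<nu>) powr (- (of_nat CARD('n) / 2)) *
      (\<Prod>j\<in>UNIV. exp (- (of_real ((x $ j)\<^sup>2) / (4 * \<nu>))))"
    unfolding heat_kernel_def norm_vec_eq_sum
    by (simp add: exp_sum[symmetric] sum_negf sum_divide_distrib)
  have *: "(\<Prod>j\<in>UNIV. fact (\<kappa> j) * hpoly (of_real (x $ j) / (2 * \<nu>)) (- 1 / (4 * \<nu>)) (\<kappa> j))
      = (1 / 2) ^ mi_abs \<kappa> * hermite \<nu> \<kappa> x" for \<kappa>
  proof -
    have h: "(1 / 2) ^ k * (2 ^ k * X) = X" for k and X :: complex
      by (simp add: mult.assoc[symmetric] power_mult_distrib[symmetric])
    show ?thesis
      unfolding hermite_prod[OF assms] mi_abs_def power_sum prod.distrib[symmetric] h ..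
  qed
  show ?thesis
    unfolding kernel_coeff_def sum_distrib_left
  proof (rule sum.cong[OF refl])
    fix \<kappa> :: "'n multiindex"
    have "(4 * of_real pi * \<nu>) powr (- (of_nat CARD('n) / 2)) *
       (\<Prod>j\<in>UNIV. exp (- (of_real ((x $ j)\<^sup>2) / (4 * \<nu>))) *
       (fact (\<kappa> j) * hpoly (of_real (x $ j) / (2 * \<nu>)) (- 1 / (4 * \<nu>)) (\<kappa> j)
         * hpoly (of_real (y $ j)) (- \<nu> * of_real s) (\<kappa> j)))
      = heat_kernel \<nu> x * (\<Prod>j\<in>UNIV. fact (\<kappa> j) * hpoly (of_real (x $ j) / (2 * \<nu>)) (- 1 / (4 * \<nu>)) (\<kappa> j))
         * (\<Prod>j\<in>UNIV. hpoly (of_real (y $ j)) (- \<nu> * of_real s) (\<kappa> j))"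
      unfolding G by (simp add: prod.distrib mult_ac)
    also have "\<dots> = (1 / 2) ^ mi_abs \<kappa> * (hermite \<nu> \<kappa> x * heat_kernel \<nu> x) *
        (\<Prod>j\<in>UNIV. hpoly (of_real (y $ j)) (- \<nu> * of_real s) (\<kappa> j))"
      unfolding * by (simp add: mult_ac)
    finally show "(4 * of_real pi * \<nu>) powr (- (of_nat CARD('n) / 2)) *
       (\<Prod>j\<in>UNIV. exp (- (of_real ((x $ j)\<^sup>2) / (4 * \<nu>))) *
       (fact (\<kappa> j) * hpoly (of_real (x $ j) / (2 * \<nu>)) (- 1 / (4 * \<nu>)) (\<kappa> j)
         * hpoly (of_real (y $ j)) (- \<nu> * of_real s) (\<kappa> j)))
      = (\<Sum>\<gamma> | mi_double \<gamma> \<le> \<kappa>. (1 / 2) ^ mi_abs \<kappa> * (hermite \<nu> \<kappa> x * heat_kernel \<nu> x) *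
     ((- \<nu> * of_real s) ^ mi_abs \<gamma> / of_nat (mi_fact \<gamma>) *
     (of_real (mi_power y (mi_diff \<kappa> (mi_double \<gamma>))) / of_nat (mi_fact (mi_diff \<kappa> (mi_double \<gamma>))))))"
      unfolding prod_hpoly_mi sum_distrib_left .
  qed
qed

text \<open>After the reindexing the summands agree one by one: s/t contributes t^(-|\<gamma>|), y
  contributes t^(-|\<beta>|/2), and the sign in (-2)^(-2|\<gamma>|) disappears because the exponent
  is even.\<close>

lemma profile_kernel_eq:
  fixes x :: "real ^ 'n::finite"
  assumes "\<nu> \<noteq> 0" "t > 0"
  shows "profile_kernel \<nu> m t x y s = (\<Sum>\<gamma> | 2 * mi_abs \<gamma> \<le> m. \<Sum>k=0..m - 2 * mi_abs \<gamma>. \<Sum>\<beta> | mi_abs \<beta> = k.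
    profile_coeff \<nu> t x \<gamma> \<beta> * (of_real (s ^ mi_abs \<gamma>) * of_real (mi_power y \<beta>)))"
  unfolding profile_kernel_def kernel_coeff_sum[OF assms(1)] sum_mi_reindex unfolding sum_distrib_left
proof (intro sum.cong refl)
  fix \<gamma> \<beta> :: "'n multiindex"
  have 1: "mi_diff (mi_add (mi_double \<gamma>) \<beta>) (mi_double \<gamma>) = \<beta>"
    by (auto simp: mi_add_def mi_diff_def)
  have "(t powr (- (1 / 2)))\<^sup>2 = 1 / t"
    using assms(2) by (simp add: powr_minus powr_half_sqrt power_divide inverse_eq_divide)
  then have p1: "(t powr (- (1 / 2))) ^ (2 * k) = 1 / t ^ k" for k
    by (simp add: power_mult power_divide)
  have p2: "t powr (- (real k / 2)) = (t powr (- (1 / 2))) ^ k" for k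
    using assms powr_powr[of t "- (1 / 2)" "real k"] powr_realpow[of "t powr (- (1 / 2))" k]
    by simp
  have p3: "(-2::complex) powi (- int (2 * k)) = (1 / 2) ^ (2 * k)" for k
    by (simp only: power_int_minus power_int_of_nat) (simp add: power_mult power_one_over inverse_eq_divide)
  have p4: "(2::complex) powi (- int k) = (1 / 2) ^ k" for k
    by (simp only: power_int_minus power_int_of_nat) (simp add: power_one_over inverse_eq_divide)
  have p5: "(- \<nu> * of_real (s / t)) ^ k = (- \<nu>) ^ k * (of_real s ^ k / of_real t ^ k)" for k
    by (simp only: power_mult_distrib of_real_divide power_divide)
  show "of_real (t powr (- (real CARD('n) / 2))) *
     ((1 / 2) ^ mi_abs (mi_add (mi_double \<gamma>) \<beta>) * (hermite \<nu> (mi_add (mi_double \<gamma>) \<beta>) (t powr - (1 / 2) *\<^sub>R x) * heat_kernel \<nu> (t powr - (1 / 2) *\<^sub>R x)) *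
     ((- \<nu> * of_real (s / t)) ^ mi_abs \<gamma> / of_nat (mi_fact \<gamma>) *
     (of_real (mi_power (t powr - (1 / 2) *\<^sub>R y) (mi_diff (mi_add (mi_double \<gamma>) \<beta>) (mi_double \<gamma>))) / of_nat (mi_fact (mi_diff (mi_add (mi_double \<gamma>) \<beta>) (mi_double \<gamma>))))))
    = profile_coeff \<nu> t x \<gamma> \<beta> * (of_real (s ^ mi_abs \<gamma>) * of_real (mi_power y \<beta>))"
    unfolding 1 profile_coeff_def dilation_def mi_power_scaleR mi_abs_add mi_abs_double p3 p4 p2 p5
    using p1 by (simp add: power_add power_mult_distrib power_divide mult_ac)
qed

section \<open>Gaussian bounds for the kernel expansion\<close>

text \<open>Scaled so that its integral does not depend on \<tau>, but without the normalising
  constant.\<close>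

definition gauss :: "real \<Rightarrow> real \<Rightarrow> real ^ 'n::finite \<Rightarrow> real" where
  "gauss c \<tau> z = \<tau> powr (- (real CARD('n) / 2)) * exp (- (c * (norm z)\<^sup>2 / \<tau>))"

lemma gauss_nonneg [simp]: "gauss c \<tau> z \<ge> 0"
  by (simp add: gauss_def)

lemma gauss_mono: "c \<le> c' \<Longrightarrow> \<tau> > 0 \<Longrightarrow> gauss c' \<tau> z \<le> gauss c \<tau> z"
  by (auto simp: gauss_def intro!: mult_left_mono divide_right_mono mult_right_mono)

lemma heat_kernel_gauss:
  assumes "Re \<nu> > 0" "\<tau> > 0" "c \<le> Re (1 / (4 * \<nu>))"
  shows "norm (heat_kernel (of_real \<tau> * \<nu>) (z :: real ^ 'n::finite))
    \<le> norm (4 * of_real pi * \<nu>) powr (- (real CARD('n) / 2)) * gauss c \<tau> z"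
  using mult_left_mono[OF gauss_mono[OF assms(3,2)], of "norm (4 * of_real pi * \<nu>) powr (- (real CARD('n) / 2))" z]
  unfolding norm_heat_kernel[OF assms(1,2)] gauss_def by (simp add: mult_ac)

text \<open>Let \<rho> = |y| + sqrt s. If \<rho> is small, the Taylor remainder applies, and its
  power m + 1 may be lowered to m because \<rho>/\<epsilon> < 1. Otherwise 2\<rho>/\<epsilon> is at
  least 1, and kernel and polynomial are bounded separately; hence the two Gaussians, centred at y
  and at 0.\<close>

lemma unit_kernel_bounds:
  assumes \<nu>: "Re \<nu> > 0"
  obtains C c where "C > 0" "c > 0" "c \<le> Re (1 / (4 * \<nu>))"
    "\<And>(x :: real ^ 'n::finite) y s. 0 \<le> s \<Longrightarrow>
      norm (\<Sum>k\<le>m. kernel_coeff \<nu> k x y s) \<le> C * (1 + (norm y + sqrt s)) ^ m * exp (- c * (norm x)\<^sup>2)"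
    "\<And>(x :: real ^ 'n::finite) y s j. 0 \<le> s \<Longrightarrow> s \<le> 1 / 2 \<Longrightarrow> j \<in> {m, m + 1} \<Longrightarrow>
      norm (heat_kernel (of_real (1 - s) * \<nu>) (x - y) - (\<Sum>k\<le>m. kernel_coeff \<nu> k x y s))
        \<le> C * (norm y + sqrt s) ^ j * (exp (- c * (norm x)\<^sup>2) + exp (- c * (norm (x - y))\<^sup>2))"
proof -
  obtain \<epsilon> B b where E: "\<epsilon> > 0" "\<epsilon> \<le> 1" "B > 0" "b > 0"
    and coeff: "\<And>k (x :: real ^ 'n::finite) y s \<rho>. 0 < \<rho> \<Longrightarrow> norm y \<le> \<rho> \<Longrightarrow> 0 \<le> s \<Longrightarrow> s \<le> \<rho>\<^sup>2
       \<Longrightarrow> norm (kernel_coeff \<nu> k x y s) \<le> B * (\<rho> / \<epsilon>) ^ k * exp (- b * (norm x)\<^sup>2)"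
    and rem: "\<And>N (x :: real ^ 'n::finite) y s \<rho>. 0 < \<rho> \<Longrightarrow> norm y \<le> \<rho> \<Longrightarrow> 0 \<le> s \<Longrightarrow> s \<le> \<rho>\<^sup>2 \<Longrightarrow> \<rho> \<le> \<epsilon> / 2 \<Longrightarrow> s < 1
       \<Longrightarrow> norm (heat_kernel (of_real (1 - s) * \<nu>) (x - y) - (\<Sum>k\<le>N. kernel_coeff \<nu> k x y s))
          \<le> 2 * B * (\<rho> / \<epsilon>) ^ (N + 1) * exp (- b * (norm x)\<^sup>2)"
    using kernel_coeff_bounds[OF \<nu>] by metis
  define c where "c = min b (Re (1 / (4 * \<nu>)))"
  have c: "c > 0" "c \<le> b" "c \<le> Re (1 / (4 * \<nu>))"
    using E Re_one_divide_pos[OF \<nu>] by (auto simp: c_def)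
  have eb: "exp (- b * (norm x)\<^sup>2) \<le> exp (- c * (norm x)\<^sup>2)" for x :: "real ^ 'n"
    using c by (simp add: mult_right_mono)
  \<comment> \<open>The factor 2^(n/2) bounds (1 - s)^(-n/2) for s \<le> 1/2.\<close>
  define N where "N = norm (4 * of_real pi * \<nu>) powr (- (real CARD('n) / 2)) * 2 powr (real CARD('n) / 2)"
  define C where "C = (real (m + 1) * B + 2 * B + N) * (2 / \<epsilon>) ^ (m + 1)"
  have N: "N \<ge> 0" by (simp add: N_def)
  have e2: "2 / \<epsilon> \<ge> 1" "1 / \<epsilon> \<ge> 1" "1 / \<epsilon> \<le> 2 / \<epsilon>" using E by (auto simp: field_simps)
  have C: "C > 0" unfolding C_def using E N by (intro mult_pos_pos add_pos_nonneg) auto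
  have sumc: "norm (\<Sum>k\<le>m. kernel_coeff \<nu> k x y s) \<le> real (m + 1) * (B * q ^ j * exp (- c * (norm x)\<^sup>2))"
    if "0 < \<rho>" "norm y \<le> \<rho>" "0 \<le> s" "s \<le> \<rho>\<^sup>2" "\<rho> / \<epsilon> \<le> q" "1 \<le> q" "m \<le> j" for x y :: "real ^ 'n" and s \<rho> q j
  proof -
    have "norm (\<Sum>k\<le>m. kernel_coeff \<nu> k x y s) \<le> (\<Sum>k\<le>m. B * q ^ j * exp (- c * (norm x)\<^sup>2))"
    proof (rule order.trans[OF norm_sum sum_mono])
      fix k assume "k \<in> {..m}"
      have "(\<rho> / \<epsilon>) ^ k \<le> q ^ k" using that E by (intro power_mono) auto
      also have "\<dots> \<le> q ^ j" using \<open>k \<in> {..m}\<close> that by (intro power_increasing) auto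
      finally have "B * (\<rho> / \<epsilon>) ^ k * exp (- b * (norm x)\<^sup>2) \<le> B * q ^ j * exp (- c * (norm x)\<^sup>2)"
        using E eb that by (intro mult_mono) auto
      with coeff[OF that(1-4), of k x] show "norm (kernel_coeff \<nu> k x y s) \<le> B * q ^ j * exp (- c * (norm x)\<^sup>2)"
        by linarith
    qed
    then show ?thesis by simp
  qed
  show ?thesis
  proof (rule that[OF C c(1,3)])
    fix x y :: "real ^ 'n" and s :: real assume s: "0 \<le> s"
    define \<rho> where "\<rho> = 1 + (norm y + sqrt s)"
    have \<rho>: "\<rho> \<ge> 1" "norm y \<le> \<rho>" using s by (auto simp: \<rho>_def)
    have "sqrt s \<le> \<rho>" by (simp add: \<rho>_def add_increasing)
    then have s2: "s \<le> \<rho>\<^sup>2" using s by (simp add: sqrt_le_D)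
    have q1: "1 \<le> \<rho> / \<epsilon>" using \<rho> E by (simp add: field_simps)
    have "norm (\<Sum>k\<le>m. kernel_coeff \<nu> k x y s) \<le> real (m + 1) * (B * (\<rho> / \<epsilon>) ^ m * exp (- c * (norm x)\<^sup>2))"
      by (rule sumc[OF _ \<rho>(2) s s2 order.refl q1 order.refl]) (use \<rho> in simp)
    also have "\<dots> = (real (m + 1) * B) * (1 / \<epsilon>) ^ m * (\<rho> ^ m * exp (- c * (norm x)\<^sup>2))"
      by (simp add: power_divide)
    also have "\<dots> \<le> C * (\<rho> ^ m * exp (- c * (norm x)\<^sup>2))"
    proof (rule mult_right_mono)
      have "(1 / \<epsilon>) ^ m \<le> (2 / \<epsilon>) ^ m" using e2 E by (intro power_mono) auto
      also have "\<dots> \<le> (2 / \<epsilon>) ^ (m + 1)" using e2 E by (intro power_increasing) auto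
      finally show "(real (m + 1) * B) * (1 / \<epsilon>) ^ m \<le> C"
        unfolding C_def using E N by (intro mult_mono) auto
    qed (use \<rho> in auto)
    finally show "norm (\<Sum>k\<le>m. kernel_coeff \<nu> k x y s) \<le> C * (1 + (norm y + sqrt s)) ^ m * exp (- c * (norm x)\<^sup>2)"
      by (simp add: \<rho>_def mult_ac)
  next
    fix x y :: "real ^ 'n" and s :: real and j assume s: "0 \<le> s" "s \<le> 1 / 2" and j: "j \<in> {m, m + 1}"
    define \<rho> where "\<rho> = norm y + sqrt s"
    let ?R = "norm (heat_kernel (of_real (1 - s) * \<nu>) (x - y) - (\<Sum>k\<le>m. kernel_coeff \<nu> k x y s))"
    let ?G = "exp (- c * (norm x)\<^sup>2) + exp (- c * (norm (x - y))\<^sup>2)"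
    \<comment> \<open>A length r slightly above \<rho> avoids \<rho> = 0, where there is no radius
      \<epsilon>/\<rho>; the claim follows by letting r decrease to \<rho>.\<close>
    have bound: "?R \<le> C * r ^ j * ?G" if r: "r > \<rho>" for r
    proof -
      have \<rho>0: "\<rho> \<ge> 0" using s by (simp add: \<rho>_def)
      then have r0: "r > 0" using r by simp
      have yr: "norm y \<le> r" using r s by (simp add: \<rho>_def) (smt (verit) real_sqrt_ge_zero)
      have "sqrt s \<le> r" using r by (simp add: \<rho>_def) (smt (verit) norm_ge_zero)
      then have sr: "s \<le> r\<^sup>2" using s by (simp add: sqrt_le_D)
      have ej: "(2 / \<epsilon>) ^ j \<le> (2 / \<epsilon>) ^ (m + 1)" using e2 j by (intro power_increasing) auto
      show ?thesis
      proof (cases "r \<le> \<epsilon> / 2")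
        case True
        have "?R \<le> 2 * B * (r / \<epsilon>) ^ (m + 1) * exp (- b * (norm x)\<^sup>2)"
          using rem[OF r0 yr s(1) sr True] s by simp
        also have "\<dots> \<le> 2 * B * (r / \<epsilon>) ^ j * ?G"
        proof (rule mult_mono)
          have "(r / \<epsilon>) ^ (m + 1) \<le> (r / \<epsilon>) ^ j"
            using True r0 E j by (intro power_decreasing) (auto simp: field_simps)
          then show "2 * B * (r / \<epsilon>) ^ (m + 1) \<le> 2 * B * (r / \<epsilon>) ^ j" using E by (intro mult_left_mono) auto
          show "exp (- b * (norm x)\<^sup>2) \<le> ?G" using eb[of x] by (simp add: add_increasing2)
        qed (use E r0 in auto)
        also have "\<dots> = 2 * B * (1 / \<epsilon>) ^ j * (r ^ j * ?G)" by (simp add: power_divide)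
        also have "\<dots> \<le> C * (r ^ j * ?G)"
        proof (rule mult_right_mono)
          have "(1 / \<epsilon>) ^ j \<le> (2 / \<epsilon>) ^ j" using e2 E by (intro power_mono) auto
          then show "2 * B * (1 / \<epsilon>) ^ j \<le> C"
            unfolding C_def using E N ej by (intro mult_mono) auto
        qed (use r0 in auto)
        finally show ?thesis by (simp add: mult_ac)
      next
        case False
        then have q: "2 * r / \<epsilon> \<ge> 1" "r / \<epsilon> \<le> 2 * r / \<epsilon>" using E r0 by (auto simp: field_simps)
        have mj: "m \<le> j" using j by auto
        have S: "norm (\<Sum>k\<le>m. kernel_coeff \<nu> k x y s) \<le> real (m + 1) * (B * (2 * r / \<epsilon>) ^ j * exp (- c * (norm x)\<^sup>2))"
          by (rule sumc[OF r0 yr s(1) sr q(2,1) mj])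
        have "norm (heat_kernel (of_real (1 - s) * \<nu>) (x - y)) \<le> N * exp (- c * (norm (x - y))\<^sup>2)"
        proof -
          have h: "norm (heat_kernel (of_real (1 - s) * \<nu>) (x - y)) \<le>
              norm (4 * of_real pi * \<nu>) powr (- (real CARD('n) / 2)) * gauss c (1 - s) (x - y)"
            using s c by (intro heat_kernel_gauss[OF \<nu>]) auto
          have "gauss c (1 - s) (x - y) \<le> 2 powr (real CARD('n) / 2) * exp (- c * (norm (x - y))\<^sup>2)"
            unfolding gauss_def
          proof (rule mult_mono)
            have "(1 - s) powr (- (real CARD('n) / 2)) \<le> (1 / 2) powr (- (real CARD('n) / 2))"
              using s by (intro powr_mono2') auto
            also have "\<dots> = 2 powr (real CARD('n) / 2)"
              by (simp add: powr_divide powr_minus)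
            finally show "(1 - s) powr (- (real CARD('n) / 2)) \<le> 2 powr (real CARD('n) / 2)" .
            have "c * (norm (x - y))\<^sup>2 * (1 - s) \<le> c * (norm (x - y))\<^sup>2 * 1"
              using s c by (intro mult_left_mono) auto
            then have "c * (norm (x - y))\<^sup>2 \<le> c * (norm (x - y))\<^sup>2 / (1 - s)"
              using s by (simp add: le_divide_eq)
            then show "exp (- (c * (norm (x - y))\<^sup>2 / (1 - s))) \<le> exp (- c * (norm (x - y))\<^sup>2)" by simp
          qed auto
          from mult_left_mono[OF this, of "norm (4 * of_real pi * \<nu>) powr (- (real CARD('n) / 2))"] h
          show ?thesis unfolding N_def mult.assoc by (rule order.trans[rotated]) simp
        qed
        also have "\<dots> \<le> N * (2 * r / \<epsilon>) ^ j * exp (- c * (norm (x - y))\<^sup>2)"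
          using N q by (intro mult_right_mono) (auto simp: mult_le_cancel_left1 one_le_power)
        finally have H: "norm (heat_kernel (of_real (1 - s) * \<nu>) (x - y)) \<le> N * (2 * r / \<epsilon>) ^ j * exp (- c * (norm (x - y))\<^sup>2)" .
        have "?R \<le> real (m + 1) * (B * (2 * r / \<epsilon>) ^ j * exp (- c * (norm x)\<^sup>2)) + N * (2 * r / \<epsilon>) ^ j * exp (- c * (norm (x - y))\<^sup>2)"
          using norm_triangle_ineq4[of "heat_kernel (of_real (1 - s) * \<nu>) (x - y)" "\<Sum>k\<le>m. kernel_coeff \<nu> k x y s"] S H by linarith
        also have "\<dots> \<le> (real (m + 1) * B + N) * (2 * r / \<epsilon>) ^ j * ?G"
          using E N r0 by (simp add: algebra_simps add_increasing)
        also have "\<dots> = (real (m + 1) * B + N) * (2 / \<epsilon>) ^ j * (r ^ j * ?G)"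
          by (simp add: power_divide power_mult_distrib mult_ac)
        also have "\<dots> \<le> C * (r ^ j * ?G)"
        proof (rule mult_right_mono)
          show "(real (m + 1) * B + N) * (2 / \<epsilon>) ^ j \<le> C"
            unfolding C_def using E N ej by (intro mult_mono) auto
        qed (use r0 in auto)
        finally show ?thesis by (simp add: mult_ac)
      qed
    qed
    have "((\<lambda>r. C * r ^ j * ?G) \<longlongrightarrow> C * \<rho> ^ j * ?G) (at_right \<rho>)"
      by (intro tendsto_intros)
    moreover have "eventually (\<lambda>r. ?R \<le> C * r ^ j * ?G) (at_right \<rho>)"
      using bound by (auto simp: eventually_at_right_less intro: eventually_mono[OF eventually_at_right_less])
    ultimately have "?R \<le> C * \<rho> ^ j * ?G"
      by (rule tendsto_lowerbound) simp
    then show "?R \<le> C * (norm y + sqrt s) ^ j * ?G" by (simp add: \<rho>_def)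
  qed
qed

text \<open>\<open>unit_kernel_bounds\<close> under parabolic scaling, which divides the length |y|
  + sqrt s by sqrt t.\<close>

lemma heat_kernel_expansion:
  assumes \<nu>: "Re \<nu> > 0"
  obtains C c where "C > 0" "c > 0"
    "\<And>\<tau> (z :: real ^ 'n::finite). \<tau> > 0 \<Longrightarrow> norm (heat_kernel (of_real \<tau> * \<nu>) z) \<le> C * gauss c \<tau> z"
    "\<And>t (x :: real ^ 'n::finite) y s. t > 0 \<Longrightarrow> 0 \<le> s \<Longrightarrow>
      norm (profile_kernel \<nu> m t x y s) \<le> C * (1 + (norm y + sqrt s) / sqrt t) ^ m * gauss c t x"
    "\<And>t (x :: real ^ 'n::finite) y s j. t > 0 \<Longrightarrow> 0 \<le> s \<Longrightarrow> s \<le> t / 2 \<Longrightarrow> j \<in> {m, m + 1} \<Longrightarrow>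
      norm (heat_kernel (of_real (t - s) * \<nu>) (x - y) - profile_kernel \<nu> m t x y s)
        \<le> C * ((norm y + sqrt s) / sqrt t) ^ j * (gauss c t x + gauss c t (x - y))"
proof -
  obtain B c where B: "B > 0" "c > 0" "c \<le> Re (1 / (4 * \<nu>))"
    and P: "\<And>(x :: real ^ 'n::finite) y s. 0 \<le> s \<Longrightarrow>
      norm (\<Sum>k\<le>m. kernel_coeff \<nu> k x y s) \<le> B * (1 + (norm y + sqrt s)) ^ m * exp (- c * (norm x)\<^sup>2)"
    and R: "\<And>(x :: real ^ 'n::finite) y s j. 0 \<le> s \<Longrightarrow> s \<le> 1 / 2 \<Longrightarrow> j \<in> {m, m + 1} \<Longrightarrow>
      norm (heat_kernel (of_real (1 - s) * \<nu>) (x - y) - (\<Sum>k\<le>m. kernel_coeff \<nu> k x y s))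
        \<le> B * (norm y + sqrt s) ^ j * (exp (- c * (norm x)\<^sup>2) + exp (- c * (norm (x - y))\<^sup>2))"
    using unit_kernel_bounds[OF \<nu>, where m = m] by metis
  define N where "N = norm (4 * of_real pi * \<nu>) powr (- (real CARD('n) / 2))"
  define C where "C = B + N"
  have N: "N \<ge> 0" by (simp add: N_def)
  have C: "C > 0" "B \<le> C" "N \<le> C" using B N by (auto simp: C_def)
  have sc: "t powr (- (1 / 2)) = 1 / sqrt t" if "t > 0" for t
    using that by (simp add: powr_minus powr_half_sqrt inverse_eq_divide)
  have ex: "t powr (- (real CARD('n) / 2)) * exp (- c * (norm ((t powr (- (1 / 2))) *\<^sub>R x))\<^sup>2) = gauss c t x"
    if "t > 0" for t and x :: "real ^ 'n"
    unfolding gauss_def sc[OF that] using that by (simp add: power_divide)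
  have \<rho>: "norm ((t powr (- (1 / 2))) *\<^sub>R y) + sqrt (s / t) = (norm y + sqrt s) / sqrt t"
    if "t > 0" for t s and y :: "real ^ 'n"
    unfolding sc[OF that] using that by (simp add: real_sqrt_divide add_divide_distrib)
  show ?thesis
  proof (rule that[OF C(1) B(2)])
    fix \<tau> and z :: "real ^ 'n" assume "\<tau> > (0::real)"
    from heat_kernel_gauss[OF \<nu> this B(3), of z, folded N_def]
    show "norm (heat_kernel (of_real \<tau> * \<nu>) z) \<le> C * gauss c \<tau> z"
      using mult_right_mono[OF C(3) gauss_nonneg[of c \<tau> z]] by linarith
  next
    fix t s and x y :: "real ^ 'n" assume t: "t > (0::real)" "0 \<le> (s::real)"
    let ?r = "t powr (- (1 / 2))"
    have "norm (profile_kernel \<nu> m t x y s) = t powr (- (real CARD('n) / 2)) *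
        norm (\<Sum>k\<le>m. kernel_coeff \<nu> k (?r *\<^sub>R x) (?r *\<^sub>R y) (s / t))"
      by (simp add: profile_kernel_def norm_mult)
    also have "\<dots> \<le> t powr (- (real CARD('n) / 2)) * (B * (1 + (norm (?r *\<^sub>R y) + sqrt (s / t))) ^ m * exp (- c * (norm (?r *\<^sub>R x))\<^sup>2))"
      using t by (intro mult_left_mono P) auto
    also have "\<dots> = B * ((1 + (norm y + sqrt s) / sqrt t) ^ m * gauss c t x)"
      unfolding \<rho>[OF t(1)] ex[OF t(1), symmetric] by (simp add: mult_ac)
    also have "\<dots> \<le> C * ((1 + (norm y + sqrt s) / sqrt t) ^ m * gauss c t x)"
      using C t by (intro mult_right_mono) auto
    finally show "norm (profile_kernel \<nu> m t x y s) \<le> C * (1 + (norm y + sqrt s) / sqrt t) ^ m * gauss c t x"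
      by (simp add: mult_ac)
  next
    fix t s j and x y :: "real ^ 'n" assume t: "t > (0::real)" "0 \<le> s" "s \<le> t / 2" and j: "j \<in> {m, m + 1}"
    let ?r = "t powr (- (1 / 2))"
    have st: "0 \<le> s / t" "s / t \<le> 1 / 2" using t by (auto simp: field_simps)
    have nz: "of_real (1 - s / t) * \<nu> \<noteq> 0"
      using \<nu> st by (auto simp: complex_eq_iff)
    have "of_real (t - s) * \<nu> = of_real t * (of_real (1 - s / t) * \<nu>)"
      using t by (simp add: field_simps)
    then have h: "heat_kernel (of_real (t - s) * \<nu>) (x - y) = of_real (t powr (- (real CARD('n) / 2))) *
        heat_kernel (of_real (1 - s / t) * \<nu>) (?r *\<^sub>R x - ?r *\<^sub>R y)"
      using heat_kernel_scale[OF nz t(1), of "x - y"] by (simp only: scaleR_diff_right)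
    have "norm (heat_kernel (of_real (t - s) * \<nu>) (x - y) - profile_kernel \<nu> m t x y s)
      = t powr (- (real CARD('n) / 2)) * norm (heat_kernel (of_real (1 - s / t) * \<nu>) (?r *\<^sub>R x - ?r *\<^sub>R y)
          - (\<Sum>k\<le>m. kernel_coeff \<nu> k (?r *\<^sub>R x) (?r *\<^sub>R y) (s / t)))"
      unfolding h profile_kernel_def right_diff_distrib[symmetric] by (simp add: norm_mult)
    also have "\<dots> \<le> t powr (- (real CARD('n) / 2)) * (B * (norm (?r *\<^sub>R y) + sqrt (s / t)) ^ j *
        (exp (- c * (norm (?r *\<^sub>R x))\<^sup>2) + exp (- c * (norm (?r *\<^sub>R x - ?r *\<^sub>R y))\<^sup>2)))"
      using st j by (intro mult_left_mono R) auto
    also have "\<dots> = B * (((norm y + sqrt s) / sqrt t) ^ j * (gauss c t x + gauss c t (x - y)))"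
      unfolding \<rho>[OF t(1)] scaleR_diff_right[symmetric] ex[OF t(1), symmetric] by (simp add: algebra_simps)
    also have "\<dots> \<le> C * (((norm y + sqrt s) / sqrt t) ^ j * (gauss c t x + gauss c t (x - y)))"
      using C t by (intro mult_right_mono mult_nonneg_nonneg add_nonneg_nonneg) auto
    finally show "norm (heat_kernel (of_real (t - s) * \<nu>) (x - y) - profile_kernel \<nu> m t x y s)
        \<le> C * ((norm y + sqrt s) / sqrt t) ^ j * (gauss c t x + gauss c t (x - y))"
      by (simp add: mult_ac)
  qed
qed

section \<open>Lebesgue norms and Bochner integrals\<close>

text \<open>Norms are moved from \<open>lebesgue\<close> to \<open>lborel\<close>, whose products
  are again of this kind, so that Tonelli's theorem applies to Borel versions.\<close>

lemma Lq_norm_1: "Lq_norm 1 \<phi> = (\<integral>\<^sup>+x. ennreal (norm (\<phi> x)) \<partial>lborel)"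
proof -
  define I where "I = (\<integral>\<^sup>+x. ennreal (norm (\<phi> x)) \<partial>lborel)"
  have "(\<integral>\<^sup>+ x. ennreal (norm (\<phi> x) powr enn2real 1) \<partial>lebesgue) = I"
    unfolding nn_integral_completion I_def by (simp add: powr_one)
  moreover have "ennreal (enn2real I powr (1 / enn2real 1)) = I" if "I \<noteq> \<infinity>"
    using that by (simp add: powr_one less_top)
  ultimately show ?thesis
    unfolding Lq_norm_def Let_def I_def[symmetric] by (auto simp del: enn2real_1)
qed

lemma Lq_norm_inf_AE: "AE x in lborel. ennreal (norm (\<phi> x)) \<le> Lq_norm \<infinity> \<phi>"
  unfolding Lq_norm_def using esssup_AE[of "\<lambda>x. ennreal (norm (\<phi> x))" lebesgue]
  by (simp add: AE_completion_iff)

lemma Lq_norm_inf_le: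
  assumes "\<phi> \<in> borel_measurable lebesgue" "AE x in lborel. ennreal (norm (\<phi> x)) \<le> b"
  shows "Lq_norm \<infinity> \<phi> \<le> b"
  unfolding Lq_norm_def using assms by (auto intro!: esssup_I AE_completion)

text \<open>From |\<phi>|^q \<le> b^(q-1) |\<phi>|. Since 1/q is 0 at q = \<infinity>, the same
  formula covers that case.\<close>

lemma Lq_norm_interpolation:
  assumes meas: "\<phi> \<in> borel_measurable lebesgue"
    and a: "(\<integral>\<^sup>+x. ennreal (norm (\<phi> x)) \<partial>lborel) \<le> ennreal a" "a > 0"
    and b: "AE x in lborel. norm (\<phi> x) \<le> b" "b > 0" and q: "1 \<le> q"
  shows "Lq_norm q \<phi> \<le> ennreal (a powr (enn2real (1 / q)) * b powr (1 - enn2real (1 / q)))"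
proof (cases "q = \<infinity>")
  case True
  have "Lq_norm \<infinity> \<phi> \<le> ennreal b"
    using b by (intro Lq_norm_inf_le[OF meas]) (auto elim!: eventually_mono intro: ennreal_leI)
  with True show ?thesis using a b by simp
next
  case False
  define r where "r = enn2real q"
  have qr: "q = ennreal r" using False by (simp add: r_def less_top)
  have r: "r \<ge> 1" using q unfolding qr by (simp flip: ennreal_1 add: ennreal_le_iff2)
  have inv: "enn2real (1 / q) = 1 / r"
    unfolding qr using r by (simp add: divide_ennreal flip: ennreal_1)
  define I where "I = (\<integral>\<^sup>+ x. ennreal (norm (\<phi> x) powr r) \<partial>lborel)"
  have I: "I \<le> ennreal (b powr (r - 1) * a)"
  proof -
    have "I \<le> (\<integral>\<^sup>+ x. ennreal (b powr (r - 1)) * ennreal (norm (\<phi> x)) \<partial>lborel)"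
      unfolding I_def
    proof (rule nn_integral_mono_AE)
      show "AE x in lborel. ennreal (norm (\<phi> x) powr r) \<le> ennreal (b powr (r - 1)) * ennreal (norm (\<phi> x))"
        using b(1)
      proof eventually_elim
        case (elim x)
        have "norm (\<phi> x) powr r = norm (\<phi> x) powr (r - 1) * norm (\<phi> x)"
          using r by (cases "\<phi> x = 0") (auto simp: powr_diff)
        also have "\<dots> \<le> b powr (r - 1) * norm (\<phi> x)"
          using elim r by (intro mult_right_mono powr_mono2) auto
        finally show ?case by (simp add: ennreal_mult[symmetric] ennreal_leI)
      qed
    qed
    also have "\<dots> = ennreal (b powr (r - 1)) * (\<integral>\<^sup>+ x. ennreal (norm (\<phi> x)) \<partial>lborel)"
    proof -
      have "(\<integral>\<^sup>+ x. ennreal (b powr (r - 1)) * ennreal (norm (\<phi> x)) \<partial>lebesgue) = ennreal (b powr (r - 1)) * (\<integral>\<^sup>+ x. ennreal (norm (\<phi> x)) \<partial>lebesgue)"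
        using meas by (intro nn_integral_cmult) auto
      then show ?thesis by (simp add: nn_integral_completion)
    qed
    also have "\<dots> \<le> ennreal (b powr (r - 1)) * ennreal a" using a by (intro mult_left_mono) auto
    finally show ?thesis using a by (simp add: ennreal_mult)
  qed
  then have fin: "I \<noteq> \<infinity>" by (metis ennreal_neq_top infinity_ennreal_def neq_top_trans)
  have "enn2real I \<le> b powr (r - 1) * a"
    using I a by (metis enn2real_ennreal enn2real_mono ennreal_less_top less_imp_le mult_nonneg_nonneg powr_ge_zero)
  then have "enn2real I powr (1 / r) \<le> (b powr (r - 1) * a) powr (1 / r)"
    using r by (intro powr_mono2) auto
  also have "\<dots> = a powr (1 / r) * b powr (1 - 1 / r)"
    using a b r by (simp add: powr_mult powr_powr diff_divide_distrib mult.commute)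
  finally show ?thesis
    using fin False unfolding Lq_norm_def inv r_def[symmetric] Let_def nn_integral_completion I_def[symmetric]
    by (simp add: ennreal_leI)
qed

section \<open>Borel representatives and joint measurability\<close>

lemma complex_ex_borel_measurable:
  fixes g :: "'a::euclidean_space \<Rightarrow> complex"
  assumes "g \<in> borel_measurable lebesgue"
  obtains g' where "g' \<in> borel_measurable borel" "AE x in lborel. g x = g' x"
proof -
  have "(\<lambda>x. Re (g x)) \<in> borel_measurable lebesgue" "(\<lambda>x. Im (g x)) \<in> borel_measurable lebesgue"
    using assms by auto
  from completion_ex_borel_measurable_real[OF this(1)] completion_ex_borel_measurable_real[OF this(2)]
  obtain a b where ab: "a \<in> borel_measurable lborel" "AE x in lborel. Re (g x) = a x"
    "b \<in> borel_measurable lborel" "AE x in lborel. Im (g x) = b x" by blast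
  show ?thesis
  proof (rule that[of "\<lambda>x. Complex (a x) (b x)"])
    have "(\<lambda>x. complex_of_real (a x) + \<i> * complex_of_real (b x)) \<in> borel_measurable borel"
      using ab by measurable
    then show "(\<lambda>x. Complex (a x) (b x)) \<in> borel_measurable borel" by (simp add: Complex_eq)
    show "AE x in lborel. g x = Complex (a x) (b x)"
      using ab(2,4) by eventually_elim (simp add: complex_eq_iff)
  qed
qed

text \<open>
  A curve in $L^\infty$ only consists of classes of functions.  Approximating $s$ by dyadic numbers from above gives
  a jointly measurable representative; right continuity of the norm ensures convergence.
\<close>

definition dyadic_above :: "nat \<Rightarrow> real \<Rightarrow> real" where
  "dyadic_above i s = (real_of_int (\<lfloor>s * 2 ^ i\<rfloor>) + 1) / 2 ^ i"

lemma dyadic_above: "s < dyadic_above i s" "dyadic_above i s \<le> s + 1 / 2 ^ i"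
proof -
  have "s * 2 ^ i < real_of_int \<lfloor>s * 2 ^ i\<rfloor> + 1" by linarith
  then show "s < dyadic_above i s" by (simp add: dyadic_above_def field_simps)
  have "real_of_int \<lfloor>s * 2 ^ i\<rfloor> + 1 \<le> s * 2 ^ i + 1" by linarith
  then show "dyadic_above i s \<le> s + 1 / 2 ^ i" by (simp add: dyadic_above_def field_simps)
qed

text \<open>The strict inequality keeps the points away from s itself, which the filter
  excludes.\<close>

lemma dyadic_above_tendsto: "filterlim (\<lambda>i. dyadic_above i s) (at s within {s..}) sequentially"
proof -
  have u: "(\<lambda>i. s + 1 / 2 ^ i) \<longlonglongrightarrow> s"
    using tendsto_add[OF tendsto_const[of s] LIMSEQ_divide_realpow_zero[of 2 1]] by simp
  have l: "(\<lambda>i. dyadic_above i s) \<longlonglongrightarrow> s"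
    by (rule tendsto_sandwich[OF _ _ tendsto_const u])
       (use dyadic_above in \<open>auto intro!: always_eventually less_imp_le[OF dyadic_above(1)]\<close>)
  show ?thesis
    using l dyadic_above(1)[of s] less_imp_le[OF dyadic_above(1)[of s]]
    by (auto simp: filterlim_at intro!: always_eventually less_imp_neq[symmetric])
qed

text \<open>On each dyadic cell in time the function depends on x only, and there are countably many
  cells; so measurability of the slices suffices.\<close>

lemma dyadic_above_measurable_compose:
  fixes b :: "real \<Rightarrow> 'a::topological_space \<Rightarrow> 'b::topological_space"
  assumes "\<And>r. r > 0 \<Longrightarrow> b r \<in> borel_measurable borel"
  shows "(\<lambda>(s, x). if s > 0 then b (dyadic_above i s) x else c) \<in> borel_measurable (borel \<Otimes>\<^sub>M borel)"
proof -
  define g where "g = (\<lambda>k::int. \<lambda>z :: real \<times> 'a. if k \<ge> 0 then b ((real_of_int k + 1) / 2 ^ i) (snd z) else c)"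
  have "(\<lambda>z. g k z) \<in> borel_measurable (borel \<Otimes>\<^sub>M borel)" for k
  proof (cases "k \<ge> 0")
    case True
    then have "b ((real_of_int k + 1) / 2 ^ i) \<in> borel_measurable borel" by (intro assms) auto
    then show ?thesis unfolding g_def using True by simp
  qed (simp add: g_def)
  moreover have "(\<lambda>z :: real \<times> 'a. \<lfloor>fst z * 2 ^ i\<rfloor>) \<in> (borel \<Otimes>\<^sub>M borel) \<rightarrow>\<^sub>M count_space UNIV"
    by measurable
  ultimately have m: "(\<lambda>z. g \<lfloor>fst z * 2 ^ i\<rfloor> z) \<in> borel_measurable (borel \<Otimes>\<^sub>M borel)"
    by (rule measurable_compose_countable)
  have "(\<lambda>z :: real \<times> 'a. if fst z > 0 then g \<lfloor>fst z * 2 ^ i\<rfloor> z else c) \<in> borel_measurable (borel \<Otimes>\<^sub>M borel)"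
    using m by measurable
  also have "(\<lambda>z :: real \<times> 'a. if fst z > 0 then g \<lfloor>fst z * 2 ^ i\<rfloor> z else c)
      = (\<lambda>(s, x). if s > 0 then b (dyadic_above i s) x else c)"
    by (auto simp: g_def dyadic_above_def fun_eq_iff)
  finally show ?thesis .
qed

lemma tendsto_dyadic_above:
  fixes N :: "real \<Rightarrow> ennreal"
  assumes "(N \<longlongrightarrow> l) (at s within S)" "{s..} \<subseteq> S"
  shows "(\<lambda>i. N (dyadic_above i s)) \<longlonglongrightarrow> l"
  using filterlim_compose[OF assms(1)[THEN tendsto_within_subset, OF assms(2)] dyadic_above_tendsto] .

text \<open>Convergence in L^infinity yields convergence at almost every x along the whole sequence
  of samples, so that no subsequence depending on s has to be chosen.\<close>

lemma joint_representative:
  fixes u :: "real \<Rightarrow> 'a::euclidean_space \<Rightarrow> complex"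
  assumes u: "u \<in> C_Linf {0<..} \<infinity>"
  obtains v where "(\<lambda>(s, x). v s x) \<in> borel_measurable (borel \<Otimes>\<^sub>M borel)"
    "\<And>s. s > 0 \<Longrightarrow> AE x in lborel. u s x = v s x" "\<And>s x. s \<le> 0 \<Longrightarrow> v s x = 0"
proof -
  have meas: "u s \<in> borel_measurable lebesgue" if "s > 0" for s
    using u that by (auto simp: C_Linf_def Lq_def normed_part_def)
  have "\<forall>s. \<exists>b. s > 0 \<longrightarrow> b \<in> borel_measurable borel \<and> (AE x in lborel. u s x = b x)"
    using complex_ex_borel_measurable[OF meas] by metis
  then obtain b where b: "\<And>s. s > 0 \<Longrightarrow> b s \<in> borel_measurable borel"
    "\<And>s. s > 0 \<Longrightarrow> AE x in lborel. u s x = b s x" by metis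
  define U where "U = (\<lambda>i s x. if s > 0 then b (dyadic_above i s) x else 0)"
  \<comment> \<open>\<open>lim\<close> gives a total and jointly measurable function; for each s > 0
    the sequence converges at almost every x.\<close>
  define v where "v = (\<lambda>s x. lim (\<lambda>i. U i s x))"
  have [measurable]: "(\<lambda>z. U i (fst z) (snd z)) \<in> borel_measurable (borel \<Otimes>\<^sub>M borel)" for i
    using dyadic_above_measurable_compose[of b i 0] b(1) by (simp add: U_def case_prod_beta)
  show ?thesis
  proof (rule that[of v])
    show "(\<lambda>(s, x). v s x) \<in> borel_measurable (borel \<Otimes>\<^sub>M borel)"
      unfolding v_def case_prod_beta by measurable
    show "v s x = 0" if "s \<le> 0" for s x using that by (simp add: v_def U_def lim_const)
    fix s :: real assume s: "s > 0"
    have "((\<lambda>r. Lq_norm \<infinity> (\<lambda>x. u r x - u s x)) \<longlongrightarrow> 0) (at s within {0<..})"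
      using u s by (auto simp: C_Linf_def)
    then have l: "(\<lambda>i. Lq_norm \<infinity> (\<lambda>x. u (dyadic_above i s) x - u s x)) \<longlonglongrightarrow> 0"
      by (rule tendsto_dyadic_above) (use s in auto)
    have ds: "dyadic_above i s > 0" for i using s dyadic_above(1)[of s i] by linarith
    have "AE x in lborel. \<forall>i. ennreal (norm (u (dyadic_above i s) x - u s x)) \<le> Lq_norm \<infinity> (\<lambda>x. u (dyadic_above i s) x - u s x)"
      unfolding AE_all_countable by (intro allI Lq_norm_inf_AE)
    moreover have "AE x in lborel. \<forall>i. u (dyadic_above i s) x = b (dyadic_above i s) x"
      unfolding AE_all_countable using b(2)[OF ds] by blast
    ultimately show "AE x in lborel. u s x = v s x"
    proof eventually_elim
      case (elim x)
      have "(\<lambda>i. ennreal (norm (u (dyadic_above i s) x - u s x))) \<longlonglongrightarrow> 0"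
        by (rule tendsto_sandwich[OF _ _ tendsto_const l]) (use elim in auto)
      then have "(\<lambda>i. norm (u (dyadic_above i s) x - u s x)) \<longlonglongrightarrow> 0"
        by (subst (asm) tendsto_ennreal_iff[where x = 0, simplified]) auto
      then have "(\<lambda>i. u (dyadic_above i s) x) \<longlonglongrightarrow> u s x"
        by (simp add: tendsto_norm_zero_iff LIM_zero_iff)
      then have "(\<lambda>i. U i s x) \<longlonglongrightarrow> u s x" using elim s by (simp add: U_def)
      then show ?case by (simp add: v_def limI)
    qed
  qed
qed

section \<open>Bochner integrals identified with pointwise integrals\<close>

lemma sigma_finite_completion:
  assumes "sigma_finite_measure M" shows "sigma_finite_measure (completion M)"
proof -
  obtain A where A: "countable A" "A \<subseteq> sets M" "\<Union>A = space M" "\<forall>a\<in>A. emeasure M a \<noteq> \<infinity>"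
    using sigma_finite_measure.sigma_finite_countable[OF assms] by blast
  show ?thesis
  proof
    show "\<exists>A. countable A \<and> A \<subseteq> sets (completion M) \<and> \<Union> A = space (completion M) \<and> (\<forall>a\<in>A. emeasure (completion M) a \<noteq> \<infinity>)"
      using A by (intro exI[of _ A]) (auto simp: emeasure_completion)
  qed
qed

lemma sigma_finite_lebesgue_on:
  assumes "S \<in> sets lebesgue" shows "sigma_finite_measure (lebesgue_on S)"
  by (intro sigma_finite_measure_restrict_space sigma_finite_completion sigma_finite_lborel assms)

lemma Lq_norm_1_triangle:
  assumes "(\<lambda>x. \<phi> x - \<theta> x) \<in> borel_measurable lebesgue" "(\<lambda>x. \<theta> x - \<psi> x) \<in> borel_measurable lebesgue"
  shows "Lq_norm 1 (\<lambda>x. \<phi> x - \<psi> x) \<le> Lq_norm 1 (\<lambda>x. \<phi> x - \<theta> x) + Lq_norm 1 (\<lambda>x. \<theta> x - \<psi> x)"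
proof -
  have "(\<integral>\<^sup>+x. ennreal (norm (\<phi> x - \<psi> x)) \<partial>lebesgue)
      \<le> (\<integral>\<^sup>+x. ennreal (norm (\<phi> x - \<theta> x)) + ennreal (norm (\<theta> x - \<psi> x)) \<partial>lebesgue)"
  proof (rule nn_integral_mono)
    fix x
    have "norm (\<phi> x - \<psi> x) \<le> norm (\<phi> x - \<theta> x) + norm (\<theta> x - \<psi> x)"
      by (metis dist_norm dist_triangle)
    then show "ennreal (norm (\<phi> x - \<psi> x)) \<le> ennreal (norm (\<phi> x - \<theta> x)) + ennreal (norm (\<theta> x - \<psi> x))"
      by (simp flip: ennreal_plus add: ennreal_leI)
  qed
  also have "\<dots> = (\<integral>\<^sup>+x. ennreal (norm (\<phi> x - \<theta> x)) \<partial>lebesgue) + (\<integral>\<^sup>+x. ennreal (norm (\<theta> x - \<psi> x)) \<partial>lebesgue)"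
    using assms by (intro nn_integral_add) auto
  finally show ?thesis by (simp add: Lq_norm_1 nn_integral_completion)
qed

lemma Lq_norm_1_cong:
  assumes "AE x in lborel. \<phi> x = \<psi> x" shows "Lq_norm 1 \<phi> = Lq_norm 1 \<psi>"
  unfolding Lq_norm_1 by (rule nn_integral_cong_AE) (use assms in \<open>auto elim!: eventually_mono\<close>)

lemma Lq_norm_1_minus_commute: "Lq_norm 1 (\<lambda>x. \<phi> x - \<psi> x) = Lq_norm 1 (\<lambda>x. \<psi> x - \<phi> x)"
  by (simp add: Lq_norm_1 norm_minus_commute)

lemma AE_integrable_section:
  fixes H :: "'b \<Rightarrow> 'a::euclidean_space \<Rightarrow> complex"
  assumes sf: "sigma_finite_measure M"
    and H: "(\<lambda>(s, x). H s x) \<in> borel_measurable (M \<Otimes>\<^sub>M lborel)"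
    and fin: "(\<integral>\<^sup>+s. \<integral>\<^sup>+x. ennreal (norm (H s x)) \<partial>lborel \<partial>M) < \<infinity>"
  shows "AE x in lborel. integrable M (\<lambda>s. H s x)"
proof -
  interpret M: sigma_finite_measure M by fact
  interpret pair_sigma_finite M lborel ..
  have Hm [measurable]: "(\<lambda>z. H (fst z) (snd z)) \<in> borel_measurable (M \<Otimes>\<^sub>M lborel)"
    using H by (simp add: case_prod_beta)
  have Hs [measurable]: "(\<lambda>z. H (snd z) (fst z)) \<in> borel_measurable (lborel \<Otimes>\<^sub>M M)"
    using measurable_pair_swap[OF Hm] by (simp add: case_prod_beta)
  have "(\<integral>\<^sup>+x. \<integral>\<^sup>+s. ennreal (norm (H s x)) \<partial>M \<partial>lborel) = (\<integral>\<^sup>+s. \<integral>\<^sup>+x. ennreal (norm (H s x)) \<partial>lborel \<partial>M)"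
    using Fubini'[of "\<lambda>s x. ennreal (norm (H s x))"] by simp
  then have "AE x in lborel. (\<integral>\<^sup>+s. ennreal (norm (H s x)) \<partial>M) \<noteq> \<infinity>"
  proof (intro nn_integral_noteq_infinite M.borel_measurable_nn_integral)
    have "(\<lambda>z. ennreal (norm (H (snd z) (fst z)))) \<in> borel_measurable (lborel \<Otimes>\<^sub>M M)"
      using Hs by measurable
    then show "(\<lambda>(x, s). ennreal (norm (H s x))) \<in> borel_measurable (lborel \<Otimes>\<^sub>M M)"
      by (simp add: case_prod_beta)
  qed (use fin in auto)
  with AE_space show ?thesis
  proof eventually_elim
    case (elim x)
    have "(\<lambda>s. H s x) \<in> borel_measurable M"
      using measurable_compose[OF measurable_Pair2'[of x lborel M] Hm] by simp
    with elim show ?case by (intro integrableI_bounded) (auto simp: less_top)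
  qed
qed

text \<open>Minkowski's inequality for H - S. The values of S are only Lebesgue measurable, so they
  are replaced by Borel versions; being finitely many, they agree with them off one null set, and
  the new function S' is jointly measurable as Tonelli requires.\<close>

lemma simple_Bochner_integral_approx:
  fixes H :: "'b \<Rightarrow> 'a::euclidean_space \<Rightarrow> complex"
  assumes sf: "sigma_finite_measure M"
    and H: "(\<lambda>(s, x). H s x) \<in> borel_measurable (M \<Otimes>\<^sub>M lborel)"
    and fin: "(\<integral>\<^sup>+s. \<integral>\<^sup>+x. ennreal (norm (H s x)) \<partial>lborel \<partial>M) < \<infinity>"
    and S: "simple_Bochner_integrable N M S"
  shows "Lq_norm 1 (\<lambda>x. simple_Bochner_integral M S x - (LINT s|M. H s x))
     \<le> (\<integral>\<^sup>+s. Lq_norm 1 (\<lambda>x. H s x - S s x) \<partial>M)"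
proof -
  interpret M: sigma_finite_measure M by fact
  interpret pair_sigma_finite M lborel ..
  have Hm [measurable]: "(\<lambda>z. H (fst z) (snd z)) \<in> borel_measurable (M \<Otimes>\<^sub>M lborel)"
    using H by (simp add: case_prod_beta)
  have Hs [measurable]: "(\<lambda>z. H (snd z) (fst z)) \<in> borel_measurable (lborel \<Otimes>\<^sub>M M)"
    using measurable_pair_swap[OF Hm] by (simp add: case_prod_beta)
  define T where "T = S ` space M"
  have simp: "simple_function M S" and nz: "emeasure M {s \<in> space M. S s \<noteq> (\<lambda>x. 0)} \<noteq> \<infinity>"
    and T: "T \<subseteq> normed_part N"
    using S by (auto simp: simple_Bochner_integrable_def T_def)
  have finT: "finite T" using simp by (simp add: simple_function_def T_def)
  have "\<forall>\<phi>\<in>T. \<exists>\<phi>'. \<phi>' \<in> borel_measurable borel \<and> (AE x in lborel. \<phi> x = \<phi>' x)"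
  proof
    fix \<phi> assume "\<phi> \<in> T"
    then have "\<phi> \<in> borel_measurable lebesgue" using T by (auto simp: normed_part_def)
    then show "\<exists>\<phi>'. \<phi>' \<in> borel_measurable borel \<and> (AE x in lborel. \<phi> x = \<phi>' x)"
      by (rule complex_ex_borel_measurable) blast
  qed
  then obtain r where r0: "\<And>\<phi>. \<phi> \<in> T \<Longrightarrow> r \<phi> \<in> borel_measurable borel"
    "\<And>\<phi>. \<phi> \<in> T \<Longrightarrow> AE x in lborel. \<phi> x = r \<phi> x" by metis
  define B where "B = (\<lambda>\<phi>. {s \<in> space M. S s = \<phi>})"
  have BM [measurable]: "B \<phi> \<in> sets M" if "\<phi> \<in> T" for \<phi>
  proof -
    have "S -` {\<phi>} \<inter> space M \<in> sets M" using simp that by (auto simp: simple_function_def T_def)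
    moreover have "S -` {\<phi>} \<inter> space M = B \<phi>" by (auto simp: B_def)
    ultimately show ?thesis by simp
  qed
  have Bs: "{s \<in> space M. S s = \<phi>} = B \<phi>" for \<phi> by (simp add: B_def)
  define S' where "S' = (\<lambda>s x. \<Sum>\<phi>\<in>T. indicator (B \<phi>) s *\<^sub>R r \<phi> x)"
  have Sx: "(\<Sum>\<phi>\<in>T. indicator (B \<phi>) s *\<^sub>R \<phi> x) = S s x" if "s \<in> space M" for s x
  proof -
    have "(\<Sum>\<phi>\<in>T. indicator (B \<phi>) s *\<^sub>R \<phi> x) = (\<Sum>\<phi>\<in>{S s}. indicator (B \<phi>) s *\<^sub>R \<phi> x)"
      using finT that by (intro sum.mono_neutral_right) (auto simp: T_def B_def)
    then show ?thesis using that by (simp add: B_def)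
  qed
  have aeT: "AE x in lborel. \<forall>\<phi>\<in>T. \<phi> x = r \<phi> x"
    using r0(2) finT by (simp add: AE_finite_all)
  have [measurable]: "(\<lambda>z. S' (fst z) (snd z)) \<in> borel_measurable (M \<Otimes>\<^sub>M lborel)"
    unfolding S'_def
  proof (rule borel_measurable_sum)
    fix \<phi> assume \<phi>: "\<phi> \<in> T"
    note BM[OF \<phi>, measurable]
    have [measurable]: "r \<phi> \<in> borel_measurable borel" using r0 \<phi> by blast
    show "(\<lambda>z. indicator (B \<phi>) (fst z) *\<^sub>R r \<phi> (snd z)) \<in> borel_measurable (M \<Otimes>\<^sub>M lborel)"
      by measurable
  qed
  \<comment> \<open>Level sets of nonzero values lie in the support of S, which has finite measure.
    The level set of the value 0 may have infinite measure, but for this value both sides are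
    0.\<close>
  have trm: "integrable M (\<lambda>s. indicator (B \<phi>) s *\<^sub>R \<phi> x) \<and>
      (LINT s|M. indicator (B \<phi>) s *\<^sub>R \<phi> x) = measure M (B \<phi>) *\<^sub>R \<phi> x" if \<phi>: "\<phi> \<in> T" for \<phi> x
  proof (cases "\<phi> = (\<lambda>x. 0)")
    case False
    have "B \<phi> \<subseteq> {s \<in> space M. S s \<noteq> (\<lambda>x. 0)}" using False by (auto simp: B_def)
    moreover have "{s \<in> space M. S s \<noteq> (\<lambda>x. 0)} \<in> sets M"
    proof -
      have "S -` {\<phi>. \<phi> \<noteq> (\<lambda>x. 0)} \<inter> space M \<in> sets M"
        by (rule simple_functionD(2)[OF simp])
      moreover have "S -` {\<phi>. \<phi> \<noteq> (\<lambda>x. 0)} \<inter> space M = {s \<in> space M. S s \<noteq> (\<lambda>x. 0)}" by auto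
      ultimately show ?thesis by simp
    qed
    ultimately have "emeasure M (B \<phi>) \<le> emeasure M {s \<in> space M. S s \<noteq> (\<lambda>x. 0)}" by (rule emeasure_mono)
    then have "emeasure M (B \<phi>) < \<infinity>" using nz by (simp add: less_top top.not_eq_extremum)
    moreover have "B \<phi> \<inter> space M = B \<phi>" by (auto simp: B_def)
    ultimately show ?thesis using BM[OF \<phi>] by simp
  qed simp
  have "Lq_norm 1 (\<lambda>x. simple_Bochner_integral M S x - (LINT s|M. H s x))
      \<le> (\<integral>\<^sup>+x. \<integral>\<^sup>+s. ennreal (norm (H s x - S' s x)) \<partial>M \<partial>lborel)"
    unfolding Lq_norm_1
  proof (rule nn_integral_mono_AE)
    show "AE x in lborel. ennreal (norm (simple_Bochner_integral M S x - (LINT s|M. H s x)))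
       \<le> (\<integral>\<^sup>+s. ennreal (norm (H s x - S' s x)) \<partial>M)"
      using aeT AE_integrable_section[OF sf H fin]
    proof eventually_elim
      case (elim x)
      have i: "integrable M (\<lambda>s. S' s x)" and e: "(LINT s|M. S' s x) = simple_Bochner_integral M S x"
        using elim trm by (auto simp: S'_def simple_Bochner_integral_def T_def[symmetric] Bs)
      have df: "simple_Bochner_integral M S x - (LINT s|M. H s x) = (LINT s|M. S' s x - H s x)"
        unfolding e[symmetric] using i elim by (intro Bochner_Integration.integral_diff[symmetric])
      then have "ennreal (norm (simple_Bochner_integral M S x - (LINT s|M. H s x)))
          \<le> (\<integral>\<^sup>+s. ennreal (norm (S' s x - H s x)) \<partial>M)"
        unfolding df by (intro integral_norm_bound_ennreal Bochner_Integration.integrable_diff i elim)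
      then show ?case by (simp add: norm_minus_commute)
    qed
  qed
  also have "\<dots> = (\<integral>\<^sup>+s. \<integral>\<^sup>+x. ennreal (norm (H s x - S' s x)) \<partial>lborel \<partial>M)"
    using Fubini'[of "\<lambda>s x. ennreal (norm (H s x - S' s x))"] by simp
  also have "\<dots> = (\<integral>\<^sup>+s. Lq_norm 1 (\<lambda>x. H s x - S s x) \<partial>M)"
  proof (rule nn_integral_cong)
    fix s assume s: "s \<in> space M"
    show "(\<integral>\<^sup>+x. ennreal (norm (H s x - S' s x)) \<partial>lborel) = Lq_norm 1 (\<lambda>x. H s x - S s x)"
      unfolding Lq_norm_1
    proof (rule nn_integral_cong_AE)
      show "AE x in lborel. ennreal (norm (H s x - S' s x)) = ennreal (norm (H s x - S s x))"
        using aeT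
      proof eventually_elim
        case (elim x)
        then have "S' s x = (\<Sum>\<phi>\<in>T. indicator (B \<phi>) s *\<^sub>R \<phi> x)" by (simp add: S'_def)
        with Sx[OF s] show ?case by simp
      qed
    qed
  qed
  finally show ?thesis .
qed

lemma simple_Bochner_integral_measurable:
  assumes "simple_Bochner_integrable N M S"
  shows "simple_Bochner_integral M S \<in> borel_measurable lebesgue"
proof -
  have "\<phi> \<in> borel_measurable lebesgue" if "\<phi> \<in> S ` space M" for \<phi>
    using assms that by (auto simp: simple_Bochner_integrable_def normed_part_def)
  then show ?thesis
    unfolding simple_Bochner_integral_def by (intro borel_measurable_sum borel_measurable_scaleR) auto
qed

text \<open>Since N dominates the L^1 norm, both I and the pointwise integral are limits in L^1 of
  the integrals of the simple functions. This serves the L^1 norm (for psi_k) as well as the norm of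
  L^1 \<inter> L^infinity (for the Duhamel formula).\<close>

lemma has_Bochner_integral_AE_eq:
  fixes H :: "'b \<Rightarrow> 'a::euclidean_space \<Rightarrow> complex"
  assumes sf: "sigma_finite_measure M"
    and H: "(\<lambda>(s, x). H s x) \<in> borel_measurable (M \<Otimes>\<^sub>M lborel)"
    and fin: "(\<integral>\<^sup>+s. \<integral>\<^sup>+x. ennreal (norm (H s x)) \<partial>lborel \<partial>M) < \<infinity>"
    and N: "\<And>\<phi>. Lq_norm 1 \<phi> \<le> N \<phi>"
    and eq: "AE s in M. AE x in lborel. F s x = H s x"
    and I: "has_Bochner_integral N M F I"
  shows "AE x in lborel. I x = (LINT s|M. H s x)"
proof -
  interpret M: sigma_finite_measure M by fact
  interpret pair_sigma_finite M lborel ..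
  have Hm [measurable]: "(\<lambda>z. H (fst z) (snd z)) \<in> borel_measurable (M \<Otimes>\<^sub>M lborel)"
    using H by (simp add: case_prod_beta)
  have Hs [measurable]: "(\<lambda>z. H (snd z) (fst z)) \<in> borel_measurable (lborel \<Otimes>\<^sub>M M)"
    using measurable_pair_swap[OF Hm] by (simp add: case_prod_beta)
  obtain S where S: "\<And>i. simple_Bochner_integrable N M (S i)"
    and l1: "(\<lambda>i. \<integral>\<^sup>+ s. N (\<lambda>x. F s x - S i s x) \<partial>M) \<longlonglongrightarrow> 0"
    and l2: "(\<lambda>i. N (\<lambda>x. simple_Bochner_integral M (S i) x - I x)) \<longlonglongrightarrow> 0"
    using I unfolding has_Bochner_integral_def by blast
  have Im: "I \<in> borel_measurable lebesgue" using I by (auto simp: has_Bochner_integral_def normed_part_def)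
  define J where "J = (\<lambda>x. LINT s|M. H s x)"
  have "J \<in> borel_measurable lborel" unfolding J_def
    by (rule M.borel_measurable_lebesgue_integral) (use Hs in \<open>simp add: case_prod_beta\<close>)
  then have Jm: "J \<in> borel_measurable lebesgue" by (rule measurable_completion)
  have "Lq_norm 1 (\<lambda>x. I x - J x) \<le> N (\<lambda>x. simple_Bochner_integral M (S i) x - I x) + (\<integral>\<^sup>+ s. N (\<lambda>x. F s x - S i s x) \<partial>M)" for i
  proof -
    have "Lq_norm 1 (\<lambda>x. I x - J x) \<le> Lq_norm 1 (\<lambda>x. I x - simple_Bochner_integral M (S i) x)
        + Lq_norm 1 (\<lambda>x. simple_Bochner_integral M (S i) x - J x)"
      using Im Jm simple_Bochner_integral_measurable[OF S[of i]] by (intro Lq_norm_1_triangle) auto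
    also have "Lq_norm 1 (\<lambda>x. I x - simple_Bochner_integral M (S i) x) \<le> N (\<lambda>x. simple_Bochner_integral M (S i) x - I x)"
      unfolding Lq_norm_1_minus_commute[of I] by (rule N)
    also have "Lq_norm 1 (\<lambda>x. simple_Bochner_integral M (S i) x - J x) \<le> (\<integral>\<^sup>+s. Lq_norm 1 (\<lambda>x. H s x - S i s x) \<partial>M)"
      unfolding J_def by (rule simple_Bochner_integral_approx[OF sf H fin S])
    also have "\<dots> \<le> (\<integral>\<^sup>+ s. N (\<lambda>x. F s x - S i s x) \<partial>M)"
    proof (rule nn_integral_mono_AE)
      show "AE s in M. Lq_norm 1 (\<lambda>x. H s x - S i s x) \<le> N (\<lambda>x. F s x - S i s x)"
        using eq
      proof eventually_elim
        case (elim s)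
        then have "Lq_norm 1 (\<lambda>x. H s x - S i s x) = Lq_norm 1 (\<lambda>x. F s x - S i s x)"
          by (intro Lq_norm_1_cong) (auto elim!: eventually_mono)
        also have "\<dots> \<le> N (\<lambda>x. F s x - S i s x)" by (rule N)
        finally show ?case .
      qed
    qed
    finally show ?thesis by (simp add: add_mono)
  qed
  moreover have "(\<lambda>i. N (\<lambda>x. simple_Bochner_integral M (S i) x - I x) + (\<integral>\<^sup>+ s. N (\<lambda>x. F s x - S i s x) \<partial>M)) \<longlonglongrightarrow> 0 + 0"
    by (intro tendsto_add l1 l2)
  ultimately have "Lq_norm 1 (\<lambda>x. I x - J x) \<le> 0"
    by (intro LIMSEQ_le_const[where x = "0::ennreal"]) auto
  then have "(\<integral>\<^sup>+x. ennreal (norm (I x - J x)) \<partial>lebesgue) = 0"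
    by (simp add: Lq_norm_1 nn_integral_completion)
  then have "AE x in lebesgue. ennreal (norm (I x - J x)) = 0"
    using Im Jm by (subst (asm) nn_integral_0_iff_AE) auto
  then show ?thesis unfolding AE_completion_iff by eventually_elim (simp add: J_def)
qed

lemma measurable_lebesgue_on_pair:
  assumes "f \<in> borel_measurable (borel \<Otimes>\<^sub>M borel)"
  shows "f \<in> borel_measurable (lebesgue_on S \<Otimes>\<^sub>M lborel)"
proof -
  have "(\<lambda>x :: 'a. x) \<in> lebesgue_on S \<rightarrow>\<^sub>M borel"
    by (rule measurable_restrict_space1) (simp add: measurable_completion)
  then have "(\<lambda>z. (fst z, snd z)) \<in> lebesgue_on S \<Otimes>\<^sub>M lborel \<rightarrow>\<^sub>M (borel :: 'a measure) \<Otimes>\<^sub>M (borel :: 'b measure)"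
    by (intro measurable_Pair) (auto intro: measurable_compose[OF measurable_fst])
  from measurable_compose[OF this assms] show ?thesis by simp
qed

text \<open>The simple functions are dyadic samples from above, cut off at s = i. Continuity gives
  convergence at each s. As g decreases, the sample at a later time is also bounded by g s, so 2 g s
  dominates the error and dominated convergence applies.\<close>

lemma has_Bochner_integral_L1:
  fixes F H :: "real \<Rightarrow> 'a::euclidean_space \<Rightarrow> complex"
  defines "M \<equiv> lebesgue_on {0<..}"
  assumes F: "\<And>s. s > 0 \<Longrightarrow> F s \<in> Lq 1"
    and H: "(\<lambda>(s, x). H s x) \<in> borel_measurable (borel \<Otimes>\<^sub>M borel)"
    and FH: "\<And>s. s > 0 \<Longrightarrow> AE x in lborel. F s x = H s x"
    and cont: "\<And>s. s > 0 \<Longrightarrow> ((\<lambda>r. Lq_norm 1 (\<lambda>x. F r x - F s x)) \<longlongrightarrow> 0) (at s within {0<..})"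
    and g: "\<And>s. s > 0 \<Longrightarrow> Lq_norm 1 (F s) \<le> g s" "\<And>r s. 0 < r \<Longrightarrow> r \<le> s \<Longrightarrow> g s \<le> g r"
      "g \<in> borel_measurable M" "(\<integral>\<^sup>+s. g s \<partial>M) < \<infinity>"
  shows "has_Bochner_integral (Lq_norm 1) M F (\<lambda>x. LINT s|M. H s x)"
    and "(\<integral>\<^sup>+s. \<integral>\<^sup>+x. ennreal (norm (H s x)) \<partial>lborel \<partial>M) < \<infinity>"
proof -
  have sf: "sigma_finite_measure M" unfolding M_def by (rule sigma_finite_lebesgue_on) simp
  interpret M: sigma_finite_measure M by fact
  interpret pair_sigma_finite M lborel ..
  have spM: "space M = {0<..}" by (simp add: M_def)
  have HM: "(\<lambda>(s, x). H s x) \<in> borel_measurable (M \<Otimes>\<^sub>M lborel)"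
    unfolding M_def by (rule measurable_lebesgue_on_pair[OF H])
  have [measurable]: "(\<lambda>z. H (fst z) (snd z)) \<in> borel_measurable (M \<Otimes>\<^sub>M lborel)"
    using HM by (simp add: case_prod_beta)
  have idM [measurable]: "(\<lambda>s. s) \<in> M \<rightarrow>\<^sub>M borel"
    unfolding M_def by (rule measurable_restrict_space1) (simp add: measurable_completion)
  have Fm: "F s \<in> borel_measurable lebesgue" if "s > 0" for s
    using F[OF that] by (simp add: Lq_def normed_part_def)
  have "(\<integral>\<^sup>+s. \<integral>\<^sup>+x. ennreal (norm (H s x)) \<partial>lborel \<partial>M) \<le> (\<integral>\<^sup>+s. g s \<partial>M)"
  proof (rule nn_integral_mono)
    fix s assume "s \<in> space M"
    then have s: "s > 0" by (simp add: spM)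
    show "(\<integral>\<^sup>+x. ennreal (norm (H s x)) \<partial>lborel) \<le> g s"
      using g(1)[OF s] Lq_norm_1_cong[OF FH[OF s]] by (simp add: Lq_norm_1)
  qed
  with g(4) show fin: "(\<integral>\<^sup>+s. \<integral>\<^sup>+x. ennreal (norm (H s x)) \<partial>lborel \<partial>M) < \<infinity>" by (rule le_less_trans[rotated])
  define S where "S = (\<lambda>i s. if s < real i then F (dyadic_above i s) else (\<lambda>x. 0))"
  have d0: "dyadic_above i s > 0" if "s > 0" for i s
    using dyadic_above(1)[of s i] that by linarith
  have S: "simple_Bochner_integrable (Lq_norm 1) M (S i)" for i
    unfolding simple_Bochner_integrable_def
  proof (intro conjI)
    have z: "(\<lambda>x. 0) \<in> Lq 1" by (simp add: Lq_def normed_part_def Lq_norm_1)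
    show "S i ` space M \<subseteq> normed_part (Lq_norm 1)"
      using F d0 z by (auto simp: S_def spM Lq_def)
    \<comment> \<open>An integer code for S i: the number of the dyadic cell, or -1 where S i is cut
      off to 0. It takes finitely many values, and S i is a function of it.\<close>
    define h where "h = (\<lambda>s::real. if s < real i then \<lfloor>s * 2 ^ i\<rfloor> else (-1))"
    have "simple_function M h"
      unfolding simple_function_eq_measurable
    proof
      have "h ` space M \<subseteq> {-1..\<lfloor>real i * 2 ^ i\<rfloor>}"
      proof
        fix k assume "k \<in> h ` space M"
        then obtain s where s: "s > 0" "k = h s" by (auto simp: spM)
        have "\<lfloor>s * 2 ^ i\<rfloor> \<le> \<lfloor>real i * 2 ^ i\<rfloor>" if "s < real i"
          using that by (intro floor_mono mult_right_mono) auto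
        moreover have "0 \<le> \<lfloor>s * 2 ^ i\<rfloor>" "0 \<le> \<lfloor>real i * 2 ^ i\<rfloor>" using s by auto
        then have "-1 \<le> \<lfloor>s * 2 ^ i\<rfloor>" "-1 \<le> \<lfloor>real i * 2 ^ i\<rfloor>" by linarith+
        ultimately show "k \<in> {-1..\<lfloor>real i * 2 ^ i\<rfloor>}" using s by (auto simp: h_def)
      qed
      then show "finite (h ` space M)" by (rule finite_subset) simp
      show "h \<in> M \<rightarrow>\<^sub>M count_space UNIV" unfolding h_def by measurable
    qed
    then have "simple_function M (\<lambda>s. (\<lambda>k. if k = -1 then (\<lambda>x. 0) else F ((real_of_int k + 1) / 2 ^ i)) (h s))"
      by (rule simple_function_compose1)
    moreover have "(\<lambda>k. if k = -1 then (\<lambda>x. 0) else F ((real_of_int k + 1) / 2 ^ i)) (h s) = S i s" if "s \<in> space M" for s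
    proof -
      have "0 \<le> \<lfloor>s * 2 ^ i\<rfloor>" using that by (simp add: spM)
      then have "\<lfloor>s * 2 ^ i\<rfloor> \<noteq> - 1" by linarith
      then show ?thesis by (auto simp: h_def S_def dyadic_above_def)
    qed
    ultimately show sm: "simple_function M (S i)" by (subst (asm) simple_function_cong) auto
    have "{s \<in> space M. S i s \<noteq> (\<lambda>x. 0)} \<subseteq> {0<..<real i}" by (auto simp: S_def spM split: if_splits)
    then have "emeasure M {s \<in> space M. S i s \<noteq> (\<lambda>x. 0)} \<le> emeasure M {0<..<real i}"
      by (rule emeasure_mono) (auto simp: M_def sets_restrict_space)
    also have "emeasure M {0<..<real i} = emeasure lebesgue {0<..<real i}"
      unfolding M_def by (rule emeasure_restrict_space) auto
    also have "\<dots> < \<infinity>" by simp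
    finally show "emeasure M {s \<in> space M. S i s \<noteq> (\<lambda>x. 0)} \<noteq> \<infinity>" by simp
  qed
  have Hd [measurable]: "(\<lambda>z. if fst z > 0 then H (dyadic_above i (fst z)) (snd z) else 0) \<in> borel_measurable (M \<Otimes>\<^sub>M lborel)" for i
  proof -
    have "H r \<in> borel_measurable borel" for r
      using measurable_compose[OF measurable_Pair1'[of r borel borel] H] by simp
    then have "(\<lambda>(s, x). if s > 0 then H (dyadic_above i s) x else 0) \<in> borel_measurable (borel \<Otimes>\<^sub>M borel)"
      by (intro dyadic_above_measurable_compose) auto
    from measurable_lebesgue_on_pair[OF this] show ?thesis by (simp add: M_def case_prod_beta)
  qed
  \<comment> \<open>A jointly measurable version of F - S i, which supplies the measurability in s
    of its norm.\<close>
  define D where "D = (\<lambda>i s x. H s x - (if s < real i then (if s > 0 then H (dyadic_above i s) x else 0) else 0))"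
  have DN: "Lq_norm 1 (\<lambda>x. F s x - S i s x) = (\<integral>\<^sup>+x. ennreal (norm (D i s x)) \<partial>lborel)" if s: "s > 0" for i s
    unfolding Lq_norm_1
  proof (rule nn_integral_cong_AE)
    show "AE x in lborel. ennreal (norm (F s x - S i s x)) = ennreal (norm (D i s x))"
      using FH[OF s] FH[OF d0[OF s, of i]] by eventually_elim (use s in \<open>auto simp: S_def D_def\<close>)
  qed
  have "(\<lambda>z. D i (fst z) (snd z)) \<in> borel_measurable (M \<Otimes>\<^sub>M lborel)" for i
    unfolding D_def by measurable
  then have "(\<lambda>s. \<integral>\<^sup>+x. ennreal (norm (D i s x)) \<partial>lborel) \<in> borel_measurable M" for i
    by (intro lborel.borel_measurable_nn_integral) (simp add: case_prod_beta)
  then have meas: "(\<lambda>s. Lq_norm 1 (\<lambda>x. F s x - S i s x)) \<in> borel_measurable M" for i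
    by (subst measurable_cong[OF DN]) (auto simp: spM)
  have bound: "Lq_norm 1 (\<lambda>x. F s x - S i s x) \<le> 2 * g s" if s: "s > 0" for i s
  proof (cases "s < real i")
    case True
    have "Lq_norm 1 (\<lambda>x. F s x - S i s x) \<le> Lq_norm 1 (\<lambda>x. F s x - 0) + Lq_norm 1 (\<lambda>x. 0 - F (dyadic_above i s) x)"
    proof -
      have "Lq_norm 1 (\<lambda>x. F s x - F (dyadic_above i s) x) \<le> Lq_norm 1 (\<lambda>x. F s x - 0) + Lq_norm 1 (\<lambda>x. 0 - F (dyadic_above i s) x)"
        by (rule Lq_norm_1_triangle) (use Fm[OF s] Fm[OF d0[OF s, of i]] in auto)
      then show ?thesis using True by (simp only: S_def if_True)
    qed
    also have "\<dots> = Lq_norm 1 (F s) + Lq_norm 1 (F (dyadic_above i s))"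
      by (simp add: Lq_norm_1)
    also have "\<dots> \<le> g s + g s"
      using g(1)[OF s] g(1)[OF d0[OF s, of i]] g(2)[OF s less_imp_le[OF dyadic_above(1)[of s i]]]
      by (intro add_mono) auto
    finally show ?thesis by (simp add: mult_2)
  next
    case False
    then show ?thesis using g(1)[OF s] by (simp add: S_def mult_2 add_increasing2)
  qed
  have lim0: "(\<lambda>i. Lq_norm 1 (\<lambda>x. F s x - S i s x)) \<longlonglongrightarrow> 0" if s: "s > 0" for s
  proof (rule Lim_transform_eventually)
    show "(\<lambda>i. Lq_norm 1 (\<lambda>x. F (dyadic_above i s) x - F s x)) \<longlonglongrightarrow> 0"
      by (rule tendsto_dyadic_above[OF cont[OF s]]) (use s in auto)
    obtain k :: nat where "s < real k" using reals_Archimedean2 by blast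
    then have "s < real i" if "i \<ge> k" for i using that by (meson less_le_trans of_nat_le_iff)
    then show "eventually (\<lambda>i. Lq_norm 1 (\<lambda>x. F (dyadic_above i s) x - F s x) = Lq_norm 1 (\<lambda>x. F s x - S i s x)) sequentially"
      unfolding eventually_sequentially
      by (intro exI[of _ k] allI impI, subst Lq_norm_1_minus_commute) (simp add: S_def)
  qed
  have l1: "(\<lambda>i. \<integral>\<^sup>+ s. Lq_norm 1 (\<lambda>x. F s x - S i s x) \<partial>M) \<longlonglongrightarrow> (\<integral>\<^sup>+ s. 0 \<partial>M)"
  proof (rule nn_integral_dominated_convergence[where w = "\<lambda>s. 2 * g s"])
    show "(\<integral>\<^sup>+s. 2 * g s \<partial>M) < \<infinity>"
      using g(3,4) by (subst nn_integral_cmult) (auto simp: ennreal_mult_less_top)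
  qed (use meas g(3) bound lim0 in \<open>auto simp: spM intro!: AE_I2\<close>)
  define J where "J = (\<lambda>x. LINT s|M. H s x)"
  have "(\<lambda>z. H (snd z) (fst z)) \<in> borel_measurable (lborel \<Otimes>\<^sub>M M)"
    using measurable_pair_swap[OF HM] by (simp add: case_prod_beta)
  then have "J \<in> borel_measurable lborel"
    unfolding J_def by (intro M.borel_measurable_lebesgue_integral) (simp add: case_prod_beta)
  then have Jm: "J \<in> borel_measurable lebesgue" by (rule measurable_completion)
  have le: "Lq_norm 1 (\<lambda>x. simple_Bochner_integral M (S i) x - J x) \<le> (\<integral>\<^sup>+ s. Lq_norm 1 (\<lambda>x. F s x - S i s x) \<partial>M)" for i
  proof -
    have "Lq_norm 1 (\<lambda>x. simple_Bochner_integral M (S i) x - J x) \<le> (\<integral>\<^sup>+ s. Lq_norm 1 (\<lambda>x. H s x - S i s x) \<partial>M)"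
      unfolding J_def by (rule simple_Bochner_integral_approx[OF sf HM fin S])
    also have "\<dots> = (\<integral>\<^sup>+ s. Lq_norm 1 (\<lambda>x. F s x - S i s x) \<partial>M)"
    proof (rule nn_integral_cong)
      fix s assume "s \<in> space M"
      then have "s > 0" by (simp add: spM)
      from FH[OF this] show "Lq_norm 1 (\<lambda>x. H s x - S i s x) = Lq_norm 1 (\<lambda>x. F s x - S i s x)"
        by (intro Lq_norm_1_cong) (auto elim!: eventually_mono)
    qed
    finally show ?thesis .
  qed
  have l2: "(\<lambda>i. Lq_norm 1 (\<lambda>x. simple_Bochner_integral M (S i) x - J x)) \<longlonglongrightarrow> 0"
    by (rule tendsto_sandwich[OF _ _ tendsto_const]) (use l1 le in auto)
  have Jfin: "Lq_norm 1 J < \<infinity>"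
  proof -
    have "Lq_norm 1 J \<le> (\<integral>\<^sup>+x. \<integral>\<^sup>+s. ennreal (norm (H s x)) \<partial>M \<partial>lborel)"
      unfolding Lq_norm_1
    proof (rule nn_integral_mono_AE)
      show "AE x in lborel. ennreal (norm (J x)) \<le> (\<integral>\<^sup>+s. ennreal (norm (H s x)) \<partial>M)"
        using AE_integrable_section[OF sf HM fin]
        by eventually_elim (simp add: J_def integral_norm_bound_ennreal)
    qed
    also have "\<dots> = (\<integral>\<^sup>+s. \<integral>\<^sup>+x. ennreal (norm (H s x)) \<partial>lborel \<partial>M)"
      using Fubini'[of "\<lambda>s x. ennreal (norm (H s x))"] by simp
    finally show ?thesis using fin by simp
  qed
  have "F ` space M \<subseteq> normed_part (Lq_norm 1)" using F by (auto simp: spM Lq_def)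
  moreover have "J \<in> normed_part (Lq_norm 1)" using Jm Jfin by (simp add: normed_part_def)
  ultimately show "has_Bochner_integral (Lq_norm 1) M F (\<lambda>x. LINT s|M. H s x)"
    unfolding has_Bochner_integral_def J_def[symmetric] using S meas l1 l2
    by (intro conjI exI[of _ S]) auto
qed

text \<open>Existence turns the choice in \<open>Bochner_integral\<close> into a genuine integral,
  and uniqueness up to null sets identifies it with the pointwise integral of the jointly measurable
  version H.\<close>

lemma Bochner_integral_AE_eq:
  fixes F H :: "real \<Rightarrow> 'a::euclidean_space \<Rightarrow> complex"
  defines "M \<equiv> lebesgue_on {0<..}"
  assumes F: "\<And>s. s > 0 \<Longrightarrow> F s \<in> Lq 1"
    and H: "(\<lambda>(s, x). H s x) \<in> borel_measurable (borel \<Otimes>\<^sub>M borel)"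
    and FH: "\<And>s. s > 0 \<Longrightarrow> AE x in lborel. F s x = H s x"
    and cont: "\<And>s. s > 0 \<Longrightarrow> ((\<lambda>r. Lq_norm 1 (\<lambda>x. F r x - F s x)) \<longlongrightarrow> 0) (at s within {0<..})"
    and g: "\<And>s. s > 0 \<Longrightarrow> Lq_norm 1 (F s) \<le> g s" "\<And>r s. 0 < r \<Longrightarrow> r \<le> s \<Longrightarrow> g s \<le> g r"
      "g \<in> borel_measurable M" "(\<integral>\<^sup>+s. g s \<partial>M) < \<infinity>"
  shows "AE x in lborel. Bochner_integral (Lq_norm 1) M F x = (LINT s|M. H s x)"
    and "Bochner_integral (Lq_norm 1) M F \<in> borel_measurable lebesgue"
proof -
  have ex: "has_Bochner_integral (Lq_norm 1) M F (\<lambda>x. LINT s|M. H s x)"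
      "(\<integral>\<^sup>+s. \<integral>\<^sup>+x. ennreal (norm (H s x)) \<partial>lborel \<partial>M) < \<infinity>"
    unfolding M_def
    by (rule has_Bochner_integral_L1[where F = F and H = H and g = g],
        (rule F H FH cont g(1,2) g(3,4)[unfolded M_def] | assumption)+)+
  have B: "has_Bochner_integral (Lq_norm 1) M F (Bochner_integral (Lq_norm 1) M F)"
    unfolding Bochner_integral_def
    by (rule someI[where P = "has_Bochner_integral (Lq_norm 1) M F", OF ex(1)])
  show "AE x in lborel. Bochner_integral (Lq_norm 1) M F x = (LINT s|M. H s x)"
  proof (rule has_Bochner_integral_AE_eq[OF _ _ ex(2) order.refl _ B])
    show "sigma_finite_measure M" unfolding M_def by (rule sigma_finite_lebesgue_on) simp
    show "(\<lambda>(s, x). H s x) \<in> borel_measurable (M \<Otimes>\<^sub>M lborel)"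
      unfolding M_def by (rule measurable_lebesgue_on_pair[OF H])
    show "AE s in M. AE x in lborel. F s x = H s x"
      by (intro AE_I2 FH) (simp add: M_def)
  qed
  show "Bochner_integral (Lq_norm 1) M F \<in> borel_measurable lebesgue"
    using B by (simp add: has_Bochner_integral_def normed_part_def)
qed

section \<open>Gaussian integrals\<close>

text \<open>The Gaussian factors into one-dimensional normal densities of variance \<tau>/(2c), each
  with a constant sqrt(pi/c).\<close>

lemma gauss_eq_normal_density:
  fixes x y :: "real ^ 'n::finite"
  assumes "c > 0" "\<tau> > 0"
  shows "gauss c \<tau> (x - y) = (\<Prod>b\<in>Basis. sqrt (pi / c) * normal_density (y \<bullet> b) (sqrt (\<tau> / (2 * c))) (x \<bullet> b))"
proof -
  have 1: "sqrt (pi / c) * normal_density a (sqrt (\<tau> / (2 * c))) z = \<tau> powr (- (1 / 2)) * exp (- (c * (z - a)\<^sup>2 / \<tau>))" for a z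
  proof -
    have q: "sqrt (pi / c) * (1 / sqrt (2 * pi * (sqrt (\<tau> / (2 * c)))\<^sup>2)) = 1 / sqrt \<tau>"
      using assms by (simp add: real_sqrt_divide[symmetric] real_sqrt_mult[symmetric] field_simps)
    have x: "- ((z - a)\<^sup>2 / (2 * (sqrt (\<tau> / (2 * c)))\<^sup>2)) = - (c * (z - a)\<^sup>2 / \<tau>)"
      using assms by (simp add: field_simps)
    have "sqrt (pi / c) * normal_density a (sqrt (\<tau> / (2 * c))) z
        = (sqrt (pi / c) * (1 / sqrt (2 * pi * (sqrt (\<tau> / (2 * c)))\<^sup>2)))
          * exp (- ((z - a)\<^sup>2 / (2 * (sqrt (\<tau> / (2 * c)))\<^sup>2)))"
      unfolding normal_density_def minus_divide_left mult.assoc ..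
    then show ?thesis
      unfolding q x using assms by (simp add: powr_minus powr_half_sqrt inverse_eq_divide)
  qed
  have "(norm (x - y))\<^sup>2 = (\<Sum>b\<in>Basis. (x \<bullet> b - y \<bullet> b)\<^sup>2)"
    unfolding power2_norm_eq_inner
    by (subst euclidean_inner) (simp add: inner_diff_left power2_eq_square)
  then have e: "exp (- (c * (norm (x - y))\<^sup>2 / \<tau>)) = (\<Prod>b\<in>Basis. exp (- (c * (x \<bullet> b - y \<bullet> b)\<^sup>2 / \<tau>)))"
    by (simp add: exp_sum[symmetric] sum_negf sum_distrib_left sum_divide_distrib)
  have "\<tau> powr (- (real CARD('n) / 2)) = (\<tau> powr (- (1 / 2))) ^ CARD('n)"
    using assms powr_powr[of \<tau> "- (1 / 2)" "real CARD('n)"] powr_realpow[of "\<tau> powr (- (1 / 2))" "CARD('n)"]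
    by simp
  then show ?thesis unfolding 1 gauss_def e by (simp add: prod.distrib)
qed

lemma nn_integral_gauss:
  assumes "c > 0" "\<tau> > 0"
  shows "(\<integral>\<^sup>+x. ennreal (gauss c \<tau> (x - y :: real ^ 'n::finite)) \<partial>lborel) = ennreal (sqrt (pi / c) ^ CARD('n))"
proof -
  have s: "sqrt (\<tau> / (2 * c)) > 0" using assms by simp
  have "(\<integral>\<^sup>+x. ennreal (gauss c \<tau> (x - y)) \<partial>lborel) =
    (\<integral>\<^sup>+x. (\<Prod>b\<in>Basis. ennreal (sqrt (pi / c) * normal_density (y \<bullet> b) (sqrt (\<tau> / (2 * c))) (x \<bullet> b))) \<partial>lborel)"
    unfolding gauss_eq_normal_density[OF assms]
    using assms by (subst prod_ennreal) (auto intro!: mult_nonneg_nonneg)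
  also have "\<dots> = (\<Prod>b\<in>(Basis :: (real ^ 'n) set). \<integral>\<^sup>+z. ennreal (sqrt (pi / c) * normal_density (y \<bullet> b) (sqrt (\<tau> / (2 * c))) z) \<partial>lborel)"
    by (rule nn_integral_lborel_prod) auto
  finally have e: "(\<integral>\<^sup>+x. ennreal (gauss c \<tau> (x - y)) \<partial>lborel) =
    (\<Prod>b\<in>(Basis :: (real ^ 'n) set). \<integral>\<^sup>+z. ennreal (sqrt (pi / c) * normal_density (y \<bullet> b) (sqrt (\<tau> / (2 * c))) z) \<partial>lborel)" .
  have one: "(\<integral>\<^sup>+z. ennreal (sqrt (pi / c) * normal_density a (sqrt (\<tau> / (2 * c))) z) \<partial>lborel) = ennreal (sqrt (pi / c))" for a
  proof -
    have "(\<integral>\<^sup>+z. ennreal (sqrt (pi / c) * normal_density a (sqrt (\<tau> / (2 * c))) z) \<partial>lborel)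
      = ennreal (LINT z|lborel. sqrt (pi / c) * normal_density a (sqrt (\<tau> / (2 * c))) z)"
      using s assms by (intro nn_integral_eq_integral) (auto intro!: mult_nonneg_nonneg)
    then show ?thesis using s by simp
  qed
  show ?thesis unfolding e one using assms by (simp add: ennreal_power)
qed

text \<open>1 + r \<le> exp(1 + r), and the linear exponent k r is absorbed by k^2/c + c
  r^2.\<close>

lemma power_le_exp_square:
  fixes c :: real
  assumes "c > 0"
  obtains B where "B > 0" "\<And>r. r \<ge> 0 \<Longrightarrow> (1 + r) ^ k \<le> B * exp (c * r\<^sup>2)"
proof -
  define B where "B = exp (real k * (1 + real k / c))"
  show ?thesis
  proof (rule that[of B])
    fix r :: real assume r: "r \<ge> 0"
    have "real k * r \<le> (real k)\<^sup>2 / c + c * r\<^sup>2"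
    proof -
      have "0 \<le> (real k / 2 - c * r)\<^sup>2 / c + 3 / 4 * (real k)\<^sup>2 / c" using assms by simp
      also have "\<dots> = (real k)\<^sup>2 / c + c * r\<^sup>2 - real k * r"
        using assms by (simp add: field_simps power2_eq_square)
      finally show ?thesis by simp
    qed
    then have "real k * (1 + r) \<le> real k * (1 + real k / c) + c * r\<^sup>2"
      by (simp add: algebra_simps power2_eq_square)
    moreover have "(1 + r) ^ k \<le> exp (1 + r) ^ k"
      using r exp_ge_add_one_self[of "1 + r"] by (intro power_mono) auto
    moreover have "exp (1 + r) ^ k = exp (real k * (1 + r))" by (simp add: exp_of_nat_mult)
    ultimately show "(1 + r) ^ k \<le> B * exp (c * r\<^sup>2)"
      unfolding B_def exp_add[symmetric] by (smt (verit) exp_le_cancel_iff)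
  qed (simp add: B_def)
qed

text \<open>Half of the Gaussian exponent pays for the weight. As sqrt \<tau> \<le> L, lengths
  measured in L are at most lengths measured in sqrt \<tau>, which makes \<kappa> independent of
  \<tau>, L and y.\<close>

lemma nn_integral_gauss_weighted:
  assumes "c > 0"
  obtains \<kappa> where "\<kappa> > 0"
    "\<And>\<tau> L (y :: real ^ 'n::finite). 0 < \<tau> \<Longrightarrow> 0 < L \<Longrightarrow> \<tau> \<le> L\<^sup>2 \<Longrightarrow>
      (\<integral>\<^sup>+x. ennreal (gauss c \<tau> (x - y) * (1 + norm (x - y) / L) ^ k) \<partial>lborel) \<le> ennreal \<kappa>"
proof -
  obtain B where B: "B > 0" "\<And>r. r \<ge> 0 \<Longrightarrow> (1 + r) ^ k \<le> B * exp (c / 2 * r\<^sup>2)"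
    using power_le_exp_square[of "c / 2" k] assms by auto
  show ?thesis
  proof (rule that[of "B * sqrt (pi / (c / 2)) ^ CARD('n)"])
    show "0 < B * sqrt (pi / (c / 2)) ^ CARD('n)" using B assms by simp
    fix \<tau> L :: real and y :: "real ^ 'n" assume \<tau>: "0 < \<tau>" "0 < L" "\<tau> \<le> L\<^sup>2"
    have "gauss c \<tau> z * (1 + norm z / L) ^ k \<le> B * gauss (c / 2) \<tau> z" for z :: "real ^ 'n"
    proof -
      have "sqrt \<tau> \<le> L" using \<tau> by (simp add: real_le_lsqrt)
      then have "norm z / L \<le> norm z / sqrt \<tau>" using \<tau> by (intro divide_left_mono) auto
      then have "(1 + norm z / L) ^ k \<le> (1 + norm z / sqrt \<tau>) ^ k" using \<tau> by (intro power_mono) auto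
      also have "\<dots> \<le> B * exp (c / 2 * (norm z / sqrt \<tau>)\<^sup>2)" using \<tau> by (intro B) auto
      also have "c / 2 * (norm z / sqrt \<tau>)\<^sup>2 = c / 2 * (norm z)\<^sup>2 / \<tau>" using \<tau> by (simp add: power_divide)
      finally have "gauss c \<tau> z * (1 + norm z / L) ^ k \<le> gauss c \<tau> z * (B * exp (c / 2 * (norm z)\<^sup>2 / \<tau>))"
        by (rule mult_left_mono) simp
      also have "\<dots> = B * (\<tau> powr (- (real CARD('n) / 2)) * (exp (- (c * (norm z)\<^sup>2 / \<tau>)) * exp (c / 2 * (norm z)\<^sup>2 / \<tau>)))"
        by (simp add: gauss_def)
      also have "exp (- (c * (norm z)\<^sup>2 / \<tau>)) * exp (c / 2 * (norm z)\<^sup>2 / \<tau>) = exp (- (c / 2 * (norm z)\<^sup>2 / \<tau>))"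
        using \<tau> by (subst exp_add[symmetric]) (simp add: field_simps)
      finally show ?thesis by (simp add: gauss_def)
    qed
    then have "(\<integral>\<^sup>+x. ennreal (gauss c \<tau> (x - y) * (1 + norm (x - y) / L) ^ k) \<partial>lborel)
      \<le> (\<integral>\<^sup>+x. ennreal B * ennreal (gauss (c / 2) \<tau> (x - y)) \<partial>lborel)"
      using B(1) by (intro nn_integral_mono) (simp add: ennreal_mult[symmetric] ennreal_leI)
    also have "\<dots> = ennreal B * (\<integral>\<^sup>+x. ennreal (gauss (c / 2) \<tau> (x - y)) \<partial>lborel)"
      by (rule nn_integral_cmult) (simp add: gauss_def)
    also have "\<dots> = ennreal (B * sqrt (pi / (c / 2)) ^ CARD('n))"
      using B(1) assms \<tau> by (subst nn_integral_gauss) (auto simp: ennreal_mult)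
    finally show "(\<integral>\<^sup>+x. ennreal (gauss c \<tau> (x - y) * (1 + norm (x - y) / L) ^ k) \<partial>lborel)
      \<le> ennreal (B * sqrt (pi / (c / 2)) ^ CARD('n))" .
  qed
qed

text \<open>
  The cutoff at $\tau \le 0$ turns $\int_0^t$ in the Duhamel formula into an integral over all of space-time.
\<close>

definition heat_kernel0 :: "complex \<Rightarrow> real \<Rightarrow> real ^ 'n::finite \<Rightarrow> complex" where
  "heat_kernel0 \<nu> \<tau> z = (if \<tau> > 0 then heat_kernel (of_real \<tau> * \<nu>) z else 0)"

text \<open>Scaling expresses the kernel at all positive times through the single continuous
  function at time 1, which reduces joint measurability to that of the scaling.\<close>

lemma heat_kernel0_measurable:
  assumes "\<nu> \<noteq> 0"
  shows "(\<lambda>z. heat_kernel0 \<nu> (fst z) (snd z :: real ^ 'n::finite)) \<in> borel_measurable (borel \<Otimes>\<^sub>M borel)"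
proof -
  have "continuous_on UNIV (heat_kernel \<nu> :: real ^ 'n \<Rightarrow> complex)"
    unfolding heat_kernel_def using assms by (intro continuous_intros) auto
  then have [measurable]: "(heat_kernel \<nu> :: real ^ 'n \<Rightarrow> complex) \<in> borel_measurable borel"
    by (rule borel_measurable_continuous_onI)
  have "(\<lambda>z. if fst z > 0 then of_real (fst z powr (- (real CARD('n) / 2))) *
      heat_kernel \<nu> ((fst z powr (- (1 / 2))) *\<^sub>R (snd z :: real ^ 'n)) else 0) \<in> borel_measurable (borel \<Otimes>\<^sub>M borel)"
    by measurable
  also have "(\<lambda>z. if fst z > 0 then of_real (fst z powr (- (real CARD('n) / 2))) *
      heat_kernel \<nu> ((fst z powr (- (1 / 2))) *\<^sub>R (snd z :: real ^ 'n)) else 0) = (\<lambda>z. heat_kernel0 \<nu> (fst z) (snd z))"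
    by (auto simp: fun_eq_iff heat_kernel0_def heat_kernel_scale[OF assms])
  finally show ?thesis .
qed

lemma heat_kernel0_compose:
  fixes g :: "'a \<Rightarrow> real ^ 'n::finite"
  assumes "\<nu> \<noteq> 0" "f \<in> borel_measurable M" "g \<in> borel_measurable M"
  shows "(\<lambda>z. heat_kernel0 \<nu> (f z) (g z)) \<in> borel_measurable M"
  using measurable_compose[OF measurable_Pair[OF assms(2,3)] heat_kernel0_measurable[OF assms(1)]] by simp

lemma AE_lborel_interval_witness:
  assumes "AE x in lborel. P x" "a < (b::real)"
  obtains x where "a < x" "x < b" "P x"
proof -
  have "\<exists>x. a < x \<and> x < b \<and> P x"
  proof (rule ccontr)
    assume "\<not> (\<exists>x. a < x \<and> x < b \<and> P x)"
    then have "AE x in lborel. \<not> (a < x \<and> x < b)" using assms(1) by (auto elim!: eventually_mono)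
    then have "emeasure lborel {x \<in> space lborel. a < x \<and> x < b} = 0" by (rule emeasure_eq_0_AE)
    moreover have "{x \<in> space lborel. a < x \<and> x < b} = {a<..<b}" by auto
    ultimately show False using assms(2) by simp
  qed
  then show ?thesis using that by blast
qed

lemma nn_integral_one_plus_powr:
  assumes "a > 1"
  shows "(\<integral>\<^sup>+s. ennreal ((1 + s) powr (- a)) * indicator {0..} s \<partial>lborel) = ennreal (1 / (a - 1))"
proof -
  have "(\<integral>\<^sup>+s. ennreal ((1 + s) powr (- a)) * indicator {0..} s \<partial>lborel)
      = ennreal (0 - (- ((1 + 0) powr (1 - a) / (a - 1))))"
  proof (rule nn_integral_FTC_atLeast)
    fix s :: real assume "0 \<le> s"
    then have "((\<lambda>s. (1 + s) powr (1 - a)) has_real_derivative (1 - a) * (1 + s) powr (- a)) (at s)"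
      by (auto intro!: derivative_eq_intros)
    then have "((\<lambda>s. - ((1 + s) powr (1 - a) / (a - 1))) has_real_derivative - ((1 - a) * (1 + s) powr (- a) / (a - 1))) (at s)"
      by (intro DERIV_minus DERIV_cdivide)
    moreover have "- ((1 - a) * (1 + s) powr (- a) / (a - 1)) = (1 + s) powr (- a)"
      using assms by (simp add: minus_divide_left minus_mult_left)
    ultimately show "((\<lambda>s. - ((1 + s) powr (1 - a) / (a - 1))) has_real_derivative (1 + s) powr (- a)) (at s)"
      by simp
  next
    have l: "((\<lambda>s. (1 + s) powr (1 - a)) \<longlongrightarrow> 0) at_top"
      using assms by (intro tendsto_neg_powr filterlim_tendsto_add_at_top[OF tendsto_const filterlim_ident]) auto
    show "((\<lambda>s. - ((1 + s) powr (1 - a) / (a - 1))) \<longlongrightarrow> 0) at_top"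
      using tendsto_minus[OF tendsto_divide[OF l tendsto_const[of "a - 1"]]] assms by simp
  qed auto
  then show ?thesis by simp
qed

section \<open>Decay of the solution\<close>

locale mild_solution =
  fixes \<nu> :: complex and p K :: real and f :: "complex \<Rightarrow> complex" and m :: nat
    and u\<^sub>0 :: "real ^ 'n::finite \<Rightarrow> complex"
    and u :: "real \<Rightarrow> real ^ 'n \<Rightarrow> complex"
  assumes Re_nu: "Re \<nu> > 0"
    and p1: "p > 1"
    and f0: "f 0 = 0"
    and K0: "K > 0"
    and f_diff: "\<And>\<xi> \<eta>. norm (f \<xi> - f \<eta>) \<le> K * (norm \<xi> powr (p - 1) + norm \<eta> powr (p - 1)) * norm (\<xi> - \<eta>)"
    and p_large: "p > 1 + (real m + 2) / real CARD('n)"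
    and initial: "u\<^sub>0 \<in> L1_weighted (m + 1) \<inter> Lq \<infinity>"
    and solution: "global_mild_solution \<nu> f u\<^sub>0 u"
    and decay: "(SUP q\<in>{1::ennreal..}. SUP t\<in>{0<..}.
           ennreal (t powr (real CARD('n) / 2 * (1 - enn2real (1 / q)))) * Lq_norm q (u t)) < \<infinity>"
begin

definition \<sigma> :: real where "\<sigma> = real CARD('n) / 2 * (p - 1) - 1"

lemma sigma_gt: "\<sigma> > real m / 2"
proof -
  have "real CARD('n) * ((real m + 2) / real CARD('n)) < real CARD('n) * (p - 1)"
    using p_large by (intro mult_strict_left_mono) auto
  then show ?thesis by (simp add: \<sigma>_def)
qed

lemma sigma_pos: "\<sigma> > 0"
  using sigma_gt by (rule le_less_trans[rotated]) simp

lemma nu_nz: "\<nu> \<noteq> 0"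
  using Re_nu by auto

lemma f_norm: "norm (f \<xi>) \<le> K * norm \<xi> powr (p - 1) * norm \<xi>"
  using f_diff[of \<xi> 0] f0 by simp

lemma f_measurable [measurable]: "f \<in> borel_measurable borel"
proof (rule borel_measurable_continuous_onI)
  show "continuous_on UNIV f"
    unfolding continuous_on_def
  proof
    fix \<xi> :: complex
    have "((\<lambda>\<eta>. K * (norm \<eta> powr (p - 1) + norm \<xi> powr (p - 1)) * norm (\<eta> - \<xi>))
        \<longlongrightarrow> K * (norm \<xi> powr (p - 1) + norm \<xi> powr (p - 1)) * norm (\<xi> - \<xi>)) (at \<xi> within UNIV)"
      by (intro tendsto_intros tendsto_powr') (use p1 in auto)
    then have l: "((\<lambda>\<eta>. K * (norm \<eta> powr (p - 1) + norm \<xi> powr (p - 1)) * norm (\<eta> - \<xi>)) \<longlongrightarrow> 0) (at \<xi> within UNIV)"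
      by simp
    have "((\<lambda>\<eta>. f \<eta> - f \<xi>) \<longlongrightarrow> 0) (at \<xi> within UNIV)"
      by (rule Lim_null_comparison[OF _ l]) (intro always_eventually allI f_diff)
    then show "(f \<longlongrightarrow> f \<xi>) (at \<xi> within UNIV)" by (simp add: LIM_zero_iff)
  qed
qed

lemma u_C_inf: "u \<in> C_Linf {0<..} \<infinity>" and u_C_1: "u \<in> C_Linf {0..} 1"
  using solution by (auto simp: global_mild_solution_def space_X_def)

lemma u_measurable: "s > 0 \<Longrightarrow> u s \<in> borel_measurable lebesgue"
  using u_C_inf by (auto simp: C_Linf_def Lq_def normed_part_def)

text \<open>The norm is bounded by E at almost every time. Near any s there is such a time r at
  which, by continuity, u r is within 1 of u s; hence the bound E + 1 at every time.\<close>

lemma u_bounded: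
  obtains A where "A > 0" "\<And>s. s > 0 \<Longrightarrow> Lq_norm \<infinity> (u s) \<le> ennreal A"
proof -
  define E where "E = esssup (lebesgue_on {0<..}) (\<lambda>t. Lq_norm \<infinity> (u t))"
  have E: "E < \<infinity>" using u_C_inf by (simp add: C_Linf_def E_def)
  have "AE s in lebesgue_on {0<..}. Lq_norm \<infinity> (u s) \<le> E"
    unfolding E_def by (rule esssup_AE)
  then have ae: "AE s in lborel. s > 0 \<longrightarrow> Lq_norm \<infinity> (u s) \<le> E"
    by (simp add: AE_restrict_space_iff AE_completion_iff)
  have *: "Lq_norm \<infinity> (u s) \<le> E + 1" if s: "s > 0" for s
  proof -
    have "((\<lambda>r. Lq_norm \<infinity> (\<lambda>x. u r x - u s x)) \<longlongrightarrow> 0) (at s within {0<..})"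
      using u_C_inf s by (auto simp: C_Linf_def)
    then have "eventually (\<lambda>r. Lq_norm \<infinity> (\<lambda>x. u r x - u s x) < 1) (at s within {0<..})"
      by (rule order_tendstoD) simp
    then obtain d where d: "d > 0" "\<And>r. r > 0 \<Longrightarrow> r \<noteq> s \<Longrightarrow> dist r s < d \<Longrightarrow> Lq_norm \<infinity> (\<lambda>x. u r x - u s x) < 1"
      by (auto simp: eventually_at)
    obtain r where r: "s < r" "r < s + d" "r > 0 \<longrightarrow> Lq_norm \<infinity> (u r) \<le> E"
      using AE_lborel_interval_witness[OF ae, of s "s + d"] d by auto
    have r1: "Lq_norm \<infinity> (u r) \<le> E" using r s by auto
    have r2: "Lq_norm \<infinity> (\<lambda>x. u r x - u s x) \<le> 1"
      using d(2)[of r] r s by (auto simp: dist_real_def)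
    show ?thesis
    proof (rule Lq_norm_inf_le[OF u_measurable[OF s]])
      show "AE x in lborel. ennreal (norm (u s x)) \<le> E + 1"
        using Lq_norm_inf_AE[of "u r"] Lq_norm_inf_AE[of "\<lambda>x. u r x - u s x"]
      proof eventually_elim
        case (elim x)
        have "norm (u s x) \<le> norm (u r x) + norm (u r x - u s x)"
          by (metis norm_minus_commute norm_triangle_sub add.commute)
        then have "ennreal (norm (u s x)) \<le> ennreal (norm (u r x)) + ennreal (norm (u r x - u s x))"
          by (simp flip: ennreal_plus add: ennreal_leI)
        also have "\<dots> \<le> E + 1" by (rule add_mono[OF order_trans[OF elim(1) r1] order_trans[OF elim(2) r2]])
        finally show ?case .
      qed
    qed
  qed
  obtain e where e: "E = ennreal e" "e \<ge> 0" using E by (cases E) auto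
  show ?thesis
    by (rule that[of "e + 1"]) (use * e in \<open>auto simp flip: ennreal_plus ennreal_1\<close>)
qed

text \<open>The assumed decay at q = \<infinity> degenerates as s tends to 0 and is replaced there
  by \<open>u_bounded\<close>; together they put 1 + s in place of s.\<close>

lemma u_bounds:
  obtains V where "V > 0" "\<And>s. s > 0 \<Longrightarrow> Lq_norm 1 (u s) \<le> ennreal V"
    "\<And>s. s > 0 \<Longrightarrow> Lq_norm \<infinity> (u s) \<le> ennreal (V * (1 + s) powr (- (real CARD('n) / 2)))"
proof -
  let ?h = "real CARD('n) / 2"
  obtain A where A: "A > 0" "\<And>s. s > 0 \<Longrightarrow> Lq_norm \<infinity> (u s) \<le> ennreal A"
    using u_bounded by blast
  define M where "M = (SUP q\<in>{1::ennreal..}. SUP t\<in>{0<..}.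
           ennreal (t powr (real CARD('n) / 2 * (1 - enn2real (1 / q)))) * Lq_norm q (u t))"
  obtain M' where M': "M = ennreal M'" "M' \<ge> 0" using decay unfolding M_def[symmetric] by (cases M) auto
  have dec: "ennreal (s powr (real CARD('n) / 2 * (1 - enn2real (1 / q)))) * Lq_norm q (u s) \<le> ennreal M'"
    if "s > 0" "1 \<le> q" for s q
    unfolding M'(1)[symmetric] M_def by (rule SUP_upper2[where i = q]) (use that in \<open>auto intro: SUP_upper2[where i = s]\<close>)
  \<comment> \<open>The factor 2^(n/2) comes from 1 + s \<le> 2 for s \<le> 1 and from 1 + s \<le> 2
    s for s > 1.\<close>
  define V where "V = max (M' + 1) (A + M') * 2 powr ?h"
  have p2: "1 \<le> 2 powr ?h" by (intro ge_one_powr_ge_zero) auto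
  show ?thesis
  proof (rule that[of V])
    show "V > 0" unfolding V_def using M' p2 by (intro mult_pos_pos) auto
    fix s :: real assume s: "s > 0"
    have "Lq_norm 1 (u s) \<le> ennreal M'" using dec[OF s, of 1] s by simp
    also have "M' \<le> V"
    proof -
      have "M' * 1 \<le> max (M' + 1) (A + M') * 2 powr ?h" using M' p2 by (intro mult_mono) auto
      then show ?thesis by (simp add: V_def)
    qed
    finally show "Lq_norm 1 (u s) \<le> ennreal V" by (simp add: ennreal_leI order_trans)
    show "Lq_norm \<infinity> (u s) \<le> ennreal (V * (1 + s) powr (- ?h))"
    proof (cases "s \<le> 1")
      case True
      have "A \<le> V * (1 + s) powr (- ?h)"
      proof -
        have "2 powr (- ?h) \<le> (1 + s) powr (- ?h)" using True s by (intro powr_mono2') auto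
        then have "2 powr ?h * 2 powr (- ?h) \<le> 2 powr ?h * (1 + s) powr (- ?h)" by (intro mult_left_mono) auto
        then have "1 \<le> 2 powr ?h * (1 + s) powr (- ?h)" by (simp flip: powr_add)
        moreover have "A \<le> max (M' + 1) (A + M')" using M' by auto
        ultimately have "A * 1 \<le> max (M' + 1) (A + M') * (2 powr ?h * (1 + s) powr (- ?h))"
          using A by (intro mult_mono) auto
        then show ?thesis by (simp add: V_def mult.assoc)
      qed
      with A(2)[OF s] show ?thesis by (meson ennreal_leI order_trans)
    next
      case False
      have inv: "ennreal (s powr (- ?h)) * ennreal (s powr ?h) = 1"
        using s by (simp flip: ennreal_mult powr_add)
      have "ennreal (s powr ?h) * Lq_norm \<infinity> (u s) \<le> ennreal M'"
        using dec[OF s, of \<infinity>] by (simp add: ennreal_divide_top)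
      then have "ennreal (s powr (- ?h)) * (ennreal (s powr ?h) * Lq_norm \<infinity> (u s)) \<le> ennreal (s powr (- ?h)) * ennreal M'"
        by (rule mult_left_mono) simp
      then have "Lq_norm \<infinity> (u s) \<le> ennreal (s powr (- ?h) * M')"
        unfolding mult.assoc[symmetric] inv using M' by (simp add: ennreal_mult)
      also have "s powr (- ?h) * M' \<le> V * (1 + s) powr (- ?h)"
      proof -
        have "((1 + s) / 2) powr ?h \<le> s powr ?h" using False by (intro powr_mono2) auto
        then have "s powr (- ?h) \<le> ((1 + s) / 2) powr (- ?h)" using s False by (intro powr_mono2') auto
        also have "\<dots> = 2 powr ?h * (1 + s) powr (- ?h)"
          using s by (simp add: powr_divide powr_minus field_simps)
        finally have "M' * s powr (- ?h) \<le> max (M' + 1) (A + M') * (2 powr ?h * (1 + s) powr (- ?h))"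
          using M' by (intro mult_mono) auto
        then show ?thesis by (simp add: V_def mult_ac)
      qed
      finally show ?thesis by (simp add: ennreal_leI order_trans)
    qed
  qed
qed

text \<open>
  \<open>v\<close> is a jointly measurable version of the solution, \<open>w\<close> of $f(u)$, and
  \<open>u\<^sub>b\<close> below is a Borel version of the initial value.
\<close>

definition v :: "real \<Rightarrow> real ^ 'n \<Rightarrow> complex" where
  "v = (SOME v. (\<lambda>(s, x). v s x) \<in> borel_measurable (borel \<Otimes>\<^sub>M borel) \<and>
     (\<forall>s>0. AE x in lborel. u s x = v s x) \<and> (\<forall>s x. s \<le> 0 \<longrightarrow> v s x = 0))"

lemma v_joint: "(\<lambda>(s, x). v s x) \<in> borel_measurable (borel \<Otimes>\<^sub>M borel)"
  and v_AE: "s > 0 \<Longrightarrow> AE x in lborel. u s x = v s x"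
  and v_neg: "s \<le> 0 \<Longrightarrow> v s x = 0"
proof -
  have "\<exists>v. (\<lambda>(s, x). v s x) \<in> borel_measurable (borel \<Otimes>\<^sub>M borel) \<and>
     (\<forall>s>0. AE x in lborel. u s x = v s x) \<and> (\<forall>s x. s \<le> 0 \<longrightarrow> v s x = 0)"
    by (rule joint_representative[OF u_C_inf]) blast
  from someI_ex[OF this, folded v_def]
  show "(\<lambda>(s, x). v s x) \<in> borel_measurable (borel \<Otimes>\<^sub>M borel)"
    and "s > 0 \<Longrightarrow> AE x in lborel. u s x = v s x" and "s \<le> 0 \<Longrightarrow> v s x = 0" by blast+
qed

definition w :: "real \<Rightarrow> real ^ 'n \<Rightarrow> complex" where
  "w s x = f (v s x)"

lemma v_measurable2 [measurable]: "(\<lambda>z. v (fst z) (snd z)) \<in> borel_measurable (borel \<Otimes>\<^sub>M borel)"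
  using v_joint by (simp add: case_prod_beta)

lemma w_measurable2 [measurable]: "(\<lambda>z. w (fst z) (snd z)) \<in> borel_measurable (borel \<Otimes>\<^sub>M borel)"
  unfolding w_def by measurable

lemma v_measurable1 [measurable]: "v s \<in> borel_measurable borel"
  using measurable_compose[OF measurable_Pair1'[of s borel borel] v_measurable2] by simp

lemma w_measurable1 [measurable]: "w s \<in> borel_measurable borel"
  using measurable_compose[OF measurable_Pair1'[of s borel borel] w_measurable2] by simp

lemma w_neg: "s \<le> 0 \<Longrightarrow> w s x = 0"
  by (simp add: w_def v_neg f0)

lemma w_AE: "s > 0 \<Longrightarrow> AE x in lborel. f (u s x) = w s x"
  using v_AE[of s] by (auto simp: w_def elim!: eventually_mono)

text \<open>|f(v)| \<le> K |v|^(p-1) |v|, where |v|^(p-1) decays like (1 + s)^(-n(p-1)/2) = (1 +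
  s)^(-(\<sigma> + 1)): this is the origin of \<sigma>. One factor |v| remains, to be measured in
  L^1, in L^infinity or with weights.\<close>

lemma vw_bounds:
  obtains W where "W > 0"
    "\<And>s. s > 0 \<Longrightarrow> (\<integral>\<^sup>+x. ennreal (norm (v s x)) \<partial>lborel) \<le> ennreal W"
    "\<And>s. s > 0 \<Longrightarrow> AE x in lborel. norm (v s x) \<le> W"
    "\<And>s. s > 0 \<Longrightarrow> AE x in lborel. norm (w s x) \<le> W * (1 + s) powr (- (\<sigma> + 1)) * norm (v s x)"
    "\<And>s. s > 0 \<Longrightarrow> AE x in lborel. norm (w s x) \<le> W * (1 + s) powr (- (\<sigma> + 1 + real CARD('n) / 2))"
proof -
  let ?h = "real CARD('n) / 2"
  obtain V where V: "V > 0" "\<And>s. s > 0 \<Longrightarrow> Lq_norm 1 (u s) \<le> ennreal V"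
    "\<And>s. s > 0 \<Longrightarrow> Lq_norm \<infinity> (u s) \<le> ennreal (V * (1 + s) powr (- ?h))"
    using u_bounds by blast
  define W where "W = V + K * V powr (p - 1) + K * V powr (p - 1) * V"
  have W: "V \<le> W" "K * V powr (p - 1) \<le> W" "K * V powr (p - 1) * V \<le> W" "W > 0"
    using V K0 by (auto simp: W_def add_pos_nonneg)
  have vb: "AE x in lborel. norm (v s x) \<le> V * (1 + s) powr (- ?h)" if s: "s > 0" for s
    using Lq_norm_inf_AE[of "u s"] v_AE[OF s]
  proof eventually_elim
    case (elim x)
    then have "ennreal (norm (v s x)) \<le> ennreal (V * (1 + s) powr (- ?h))" using V(3)[OF s] by simp
    then show ?case using V by (simp add: ennreal_le_iff)
  qed
  have wb: "norm (w s x) \<le> K * V powr (p - 1) * (1 + s) powr (- (\<sigma> + 1)) * norm (v s x)"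
    if "norm (v s x) \<le> V * (1 + s) powr (- ?h)" "s > 0" for s x
  proof -
    have "norm (w s x) \<le> K * norm (v s x) powr (p - 1) * norm (v s x)" unfolding w_def by (rule f_norm)
    also have "\<dots> \<le> K * (V * (1 + s) powr (- ?h)) powr (p - 1) * norm (v s x)"
      using that K0 p1 by (intro mult_right_mono mult_left_mono powr_mono2) auto
    also have "(V * (1 + s) powr (- ?h)) powr (p - 1) = V powr (p - 1) * (1 + s) powr (- (\<sigma> + 1))"
      using V that by (simp add: powr_mult powr_powr \<sigma>_def)
    finally show ?thesis by (simp add: mult_ac)
  qed
  show ?thesis
  proof (rule that[OF W(4)])
    fix s :: real assume s: "s > 0"
    have "(\<integral>\<^sup>+x. ennreal (norm (v s x)) \<partial>lborel) = Lq_norm 1 (u s)"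
      unfolding Lq_norm_1 by (rule nn_integral_cong_AE) (use v_AE[OF s] in \<open>auto elim!: eventually_mono\<close>)
    also have "\<dots> \<le> ennreal W" using V(2)[OF s] W(1) by (meson ennreal_leI order_trans)
    finally show "(\<integral>\<^sup>+x. ennreal (norm (v s x)) \<partial>lborel) \<le> ennreal W" .
    have le1: "(1 + s) powr (- ?h) \<le> 1" using s powr_mono2'[of "- ?h" 1 "1 + s"] by simp
    show "AE x in lborel. norm (v s x) \<le> W"
      using vb[OF s]
    proof eventually_elim
      case (elim x)
      have "V * (1 + s) powr (- ?h) \<le> V * 1" using V le1 by (intro mult_left_mono) auto
      with elim W show ?case by linarith
    qed
    show "AE x in lborel. norm (w s x) \<le> W * (1 + s) powr (- (\<sigma> + 1)) * norm (v s x)"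
      using vb[OF s]
    proof eventually_elim
      case (elim x)
      have "K * V powr (p - 1) * (1 + s) powr (- (\<sigma> + 1)) * norm (v s x) \<le> W * (1 + s) powr (- (\<sigma> + 1)) * norm (v s x)"
        using W by (intro mult_right_mono) auto
      with wb[OF elim s] show ?case by linarith
    qed
    show "AE x in lborel. norm (w s x) \<le> W * (1 + s) powr (- (\<sigma> + 1 + ?h))"
      using vb[OF s]
    proof eventually_elim
      case (elim x)
      have "norm (w s x) \<le> K * V powr (p - 1) * (1 + s) powr (- (\<sigma> + 1)) * norm (v s x)"
        by (rule wb[OF elim s])
      also have "\<dots> \<le> K * V powr (p - 1) * (1 + s) powr (- (\<sigma> + 1)) * (V * (1 + s) powr (- ?h))"
        using elim K0 by (intro mult_left_mono) auto
      also have "\<dots> = K * V powr (p - 1) * V * ((1 + s) powr (- (\<sigma> + 1)) * (1 + s) powr (- ?h))"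
        by (simp add: mult_ac)
      also have "(1 + s) powr (- (\<sigma> + 1)) * (1 + s) powr (- ?h) = (1 + s) powr (- (\<sigma> + 1 + ?h))"
        unfolding powr_add[symmetric] by (rule arg_cong[where f = "\<lambda>a. (1 + s) powr a"]) simp
      also have "K * V powr (p - 1) * V * (1 + s) powr (- (\<sigma> + 1 + ?h)) \<le> W * (1 + s) powr (- (\<sigma> + 1 + ?h))"
        using W by (intro mult_right_mono) auto
      finally show ?case .
    qed
  qed
qed

end

section \<open>Transfer to Borel measure; radial moments of the initial value\<close>

lemma nn_integral_lebesgue_on:
  assumes "S \<in> sets borel"
  shows "(\<integral>\<^sup>+s. g s \<partial>lebesgue_on S) = (\<integral>\<^sup>+s. g s * indicator S s \<partial>lborel)"
  using assms by (subst nn_integral_restrict_space) (auto simp: nn_integral_completion)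

lemma integral_lebesgue_on:
  fixes g :: "'a::euclidean_space \<Rightarrow> complex"
  assumes "S \<in> sets borel" "g \<in> borel_measurable borel"
  shows "(LINT s|lebesgue_on S. g s) = (LINT s|lborel. indicator S s *\<^sub>R g s)"
  using assms by (subst integral_restrict_space) (auto intro!: integral_completion)

lemma integral_lebesgue_cong_AE:
  fixes g h :: "'a::euclidean_space \<Rightarrow> complex"
  assumes "AE x in lborel. g x = h x" "g \<in> borel_measurable lebesgue" "h \<in> borel_measurable borel"
  shows "(LINT x|lebesgue. g x) = (LINT x|lborel. h x)"
proof -
  have "(LINT x|lebesgue. g x) = (LINT x|lebesgue. h x)"
    using assms(3) by (intro integral_cong_AE assms(2) AE_completion[OF assms(1)] measurable_completion) simp
  also have "\<dots> = (LINT x|lborel. h x)" using assms(3) by (intro integral_completion) simp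
  finally show ?thesis .
qed

text \<open>The pure powers of the coordinates control the radial weight: if x_j is the coordinate
  largest in modulus, then |x| \<le> n |x_j|.\<close>

lemma L1_weighted_radial:
  fixes \<phi> :: "real ^ 'n::finite \<Rightarrow> complex"
  assumes "\<phi> \<in> L1_weighted k"
  shows "(\<integral>\<^sup>+x. ennreal ((1 + norm x) ^ k * norm (\<phi> x)) \<partial>lborel) < \<infinity>"
proof -
  define e :: "'n \<Rightarrow> 'n multiindex" where "e = (\<lambda>j i. if i = j then k else 0)"
  have e: "mi_abs (e j) = k" "mi_power x (e j) = (x $ j) ^ k" for j and x :: "real ^ 'n"
  proof -
    show "mi_abs (e j) = k" by (simp add: mi_abs_def e_def)
    have "mi_power x (e j) = (\<Prod>i\<in>UNIV. if i = j then (x $ i) ^ k else 1)"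
      unfolding mi_power_def e_def by (rule prod.cong) auto
    then show "mi_power x (e j) = (x $ j) ^ k" by simp
  qed
  define C where "C = 2 ^ k * real CARD('n) ^ k"
  have C1: "C \<ge> 2 ^ k" "C \<ge> 0" by (auto simp: C_def)
  have le: "(1 + norm x) ^ k \<le> C * (1 + (\<Sum>j\<in>UNIV. \<bar>x $ j\<bar> ^ k))" for x :: "real ^ 'n"
  proof -
    have "Max (range (\<lambda>i. \<bar>x $ i\<bar>)) \<in> range (\<lambda>i. \<bar>x $ i\<bar>)" by (rule Max_in) auto
    then obtain j where "Max (range (\<lambda>i. \<bar>x $ i\<bar>)) = \<bar>x $ j\<bar>" by (rule imageE)
    then have j: "\<bar>x $ i\<bar> \<le> \<bar>x $ j\<bar>" for i
      by (metis Max_ge finite finite_imageI rangeI)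
    have "norm x \<le> (\<Sum>i\<in>UNIV. \<bar>x $ i\<bar>)" by (rule norm_le_l1_cart)
    also have "\<dots> \<le> real CARD('n) * \<bar>x $ j\<bar>" using sum_bounded_above[of "UNIV :: 'n set" "\<lambda>i. \<bar>x $ i\<bar>" "\<bar>x $ j\<bar>"] j by simp
    finally have n: "norm x \<le> real CARD('n) * \<bar>x $ j\<bar>" .
    have "1 + norm x \<le> 2 * max 1 (real CARD('n) * \<bar>x $ j\<bar>)" using n by linarith
    then have "(1 + norm x) ^ k \<le> (2 * max 1 (real CARD('n) * \<bar>x $ j\<bar>)) ^ k" by (intro power_mono) auto
    also have "\<dots> = 2 ^ k * max 1 (real CARD('n) * \<bar>x $ j\<bar>) ^ k" by (simp add: power_mult_distrib)
    also have "max 1 (real CARD('n) * \<bar>x $ j\<bar>) ^ k \<le> 1 + (real CARD('n) * \<bar>x $ j\<bar>) ^ k"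
      by (auto simp: max_def)
    also have "1 + (real CARD('n) * \<bar>x $ j\<bar>) ^ k \<le> real CARD('n) ^ k * (1 + \<bar>x $ j\<bar> ^ k)"
      by (simp add: power_mult_distrib algebra_simps)
    also have "\<bar>x $ j\<bar> ^ k \<le> (\<Sum>j\<in>UNIV. \<bar>x $ j\<bar> ^ k)" by (rule member_le_sum) auto
    finally show ?thesis by (simp add: C_def mult_ac mult_left_mono)
  qed
  have meas: "\<phi> \<in> borel_measurable lebesgue" using assms by (simp add: L1_weighted_def Lq_def normed_part_def)
  have fin0: "(\<integral>\<^sup>+x. ennreal (norm (\<phi> x)) \<partial>lebesgue) < \<infinity>"
    using assms by (simp add: L1_weighted_def Lq_def normed_part_def Lq_norm_1 nn_integral_completion)
  have finj: "(\<integral>\<^sup>+x. ennreal (\<bar>x $ j\<bar> ^ k * norm (\<phi> x)) \<partial>lebesgue) < \<infinity>" for j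
  proof -
    have "(\<lambda>x. of_real (mi_power x (e j)) * \<phi> x) \<in> Lq 1"
      using assms e(1)[of j] by (auto simp: L1_weighted_def)
    then show ?thesis
      by (simp add: Lq_def normed_part_def Lq_norm_1 e(2) norm_mult norm_power nn_integral_completion)
  qed
  have mj: "(\<lambda>x. ennreal (\<bar>x $ j\<bar> ^ k * norm (\<phi> x))) \<in> borel_measurable lebesgue" for j
  proof -
    have "(\<lambda>x :: real ^ 'n. \<bar>x $ j\<bar> ^ k) \<in> borel_measurable lebesgue"
      by (rule measurable_completion) simp
    then show ?thesis using meas by (intro measurable_compose[OF _ measurable_ennreal] borel_measurable_times) auto
  qed
  have "(\<integral>\<^sup>+x. ennreal ((1 + norm x) ^ k * norm (\<phi> x)) \<partial>lebesgue)
      \<le> (\<integral>\<^sup>+x. ennreal C * (ennreal (norm (\<phi> x)) + (\<Sum>j\<in>UNIV. ennreal (\<bar>x $ j\<bar> ^ k * norm (\<phi> x)))) \<partial>lebesgue)"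
  proof (rule nn_integral_mono)
    fix x :: "real ^ 'n"
    have "(1 + norm x) ^ k * norm (\<phi> x) \<le> C * (1 + (\<Sum>j\<in>UNIV. \<bar>x $ j\<bar> ^ k)) * norm (\<phi> x)"
      using le by (intro mult_right_mono) auto
    also have "\<dots> = C * (norm (\<phi> x) + (\<Sum>j\<in>UNIV. \<bar>x $ j\<bar> ^ k * norm (\<phi> x)))"
      by (simp add: algebra_simps sum_distrib_left sum_distrib_right)
    finally show "ennreal ((1 + norm x) ^ k * norm (\<phi> x)) \<le> ennreal C * (ennreal (norm (\<phi> x)) + (\<Sum>j\<in>UNIV. ennreal (\<bar>x $ j\<bar> ^ k * norm (\<phi> x))))"
      using C1 by (simp add: sum_ennreal sum_nonneg ennreal_leI flip: ennreal_plus ennreal_mult)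
  qed
  also have "\<dots> = ennreal C * ((\<integral>\<^sup>+x. ennreal (norm (\<phi> x)) \<partial>lebesgue) + (\<Sum>j\<in>UNIV. \<integral>\<^sup>+x. ennreal (\<bar>x $ j\<bar> ^ k * norm (\<phi> x)) \<partial>lebesgue))"
  proof -
    have mn: "(\<lambda>x. ennreal (norm (\<phi> x))) \<in> borel_measurable lebesgue" using meas by simp
    have ms: "(\<lambda>x. \<Sum>j\<in>UNIV. ennreal (\<bar>x $ j\<bar> ^ k * norm (\<phi> x))) \<in> borel_measurable lebesgue"
      by (rule borel_measurable_sum) (rule mj)
    show ?thesis
      by (simp only: nn_integral_cmult[OF borel_measurable_add[OF mn ms]] nn_integral_add[OF mn ms] nn_integral_sum[OF mj])
  qed
  also have "\<dots> < \<infinity>"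
    using fin0 finj by (simp add: ennreal_mult_less_top)
  finally show ?thesis by (simp add: nn_integral_completion)
qed

context mild_solution
begin

definition u\<^sub>b :: "real ^ 'n \<Rightarrow> complex" where
  "u\<^sub>b = (SOME g. g \<in> borel_measurable borel \<and> (AE x in lborel. u\<^sub>0 x = g x))"

lemma u0_measurable: "u\<^sub>0 \<in> borel_measurable lebesgue"
  using initial by (simp add: Lq_def normed_part_def)

lemma ub_measurable [measurable]: "u\<^sub>b \<in> borel_measurable borel"
  and ub_AE: "AE x in lborel. u\<^sub>0 x = u\<^sub>b x"
proof -
  have "\<exists>g. g \<in> borel_measurable borel \<and> (AE x in lborel. u\<^sub>0 x = g x)"
    by (rule complex_ex_borel_measurable[OF u0_measurable]) blast
  from someI_ex[OF this, folded u\<^sub>b_def]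
  show "u\<^sub>b \<in> borel_measurable borel" "AE x in lborel. u\<^sub>0 x = u\<^sub>b x" by blast+
qed

lemma ub_weighted:
  obtains Z where "Z > 0" "(\<integral>\<^sup>+x. ennreal ((1 + norm x) ^ (m + 1) * norm (u\<^sub>b x)) \<partial>lborel) \<le> ennreal Z"
proof -
  have "(\<integral>\<^sup>+x. ennreal ((1 + norm x) ^ (m + 1) * norm (u\<^sub>b x)) \<partial>lborel)
      = (\<integral>\<^sup>+x. ennreal ((1 + norm x) ^ (m + 1) * norm (u\<^sub>0 x)) \<partial>lborel)"
    by (rule nn_integral_cong_AE) (use ub_AE in \<open>auto elim!: eventually_mono\<close>)
  also have "\<dots> < \<infinity>" using initial by (intro L1_weighted_radial) simp
  finally obtain z where z: "(\<integral>\<^sup>+x. ennreal ((1 + norm x) ^ (m + 1) * norm (u\<^sub>b x)) \<partial>lborel) = ennreal z" "z \<ge> 0"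
    by (cases "\<integral>\<^sup>+x. ennreal ((1 + norm x) ^ (m + 1) * norm (u\<^sub>b x)) \<partial>lborel") auto
  show ?thesis by (rule that[of "z + 1"]) (use z in \<open>auto simp: ennreal_leI\<close>)
qed

lemma fu_L1:
  assumes s: "s > 0"
  shows "(\<lambda>x. f (u s x)) \<in> borel_measurable lebesgue"
    "Lq_norm 1 (\<lambda>x. f (u s x)) = (\<integral>\<^sup>+x. ennreal (norm (w s x)) \<partial>lborel)"
  using measurable_compose[OF u_measurable[OF s] f_measurable] Lq_norm_1_cong[OF w_AE[OF s]]
  by (simp_all add: Lq_norm_1)

lemma w_L1:
  obtains W where "W > 0"
    "\<And>s. s > 0 \<Longrightarrow> (\<integral>\<^sup>+x. ennreal (norm (w s x)) \<partial>lborel) \<le> ennreal (W * (1 + s) powr (- (\<sigma> + 1)))"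
    "\<And>s. s > 0 \<Longrightarrow> AE x in lborel. norm (w s x) \<le> W * (1 + s) powr (- (\<sigma> + 1 + real CARD('n) / 2))"
proof -
  obtain W where W: "W > 0"
    "\<And>s. s > 0 \<Longrightarrow> (\<integral>\<^sup>+x. ennreal (norm (v s x)) \<partial>lborel) \<le> ennreal W"
    "\<And>s. s > 0 \<Longrightarrow> AE x in lborel. norm (v s x) \<le> W"
    "\<And>s. s > 0 \<Longrightarrow> AE x in lborel. norm (w s x) \<le> W * (1 + s) powr (- (\<sigma> + 1)) * norm (v s x)"
    "\<And>s. s > 0 \<Longrightarrow> AE x in lborel. norm (w s x) \<le> W * (1 + s) powr (- (\<sigma> + 1 + real CARD('n) / 2))"
    using vw_bounds by blast
  show ?thesis
  proof (rule that[of "W * W + W"])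
    show "W * W + W > 0" using W(1) by (simp add: add_pos_pos)
    fix s :: real assume s: "s > 0"
    have "(\<integral>\<^sup>+x. ennreal (norm (w s x)) \<partial>lborel) \<le> (\<integral>\<^sup>+x. ennreal (W * (1 + s) powr (- (\<sigma> + 1))) * ennreal (norm (v s x)) \<partial>lborel)"
      by (rule nn_integral_mono_AE) (use W(4)[OF s] W(1) in \<open>auto elim!: eventually_mono simp: ennreal_mult[symmetric] ennreal_leI\<close>)
    also have "\<dots> = ennreal (W * (1 + s) powr (- (\<sigma> + 1))) * (\<integral>\<^sup>+x. ennreal (norm (v s x)) \<partial>lborel)"
      by (rule nn_integral_cmult) simp
    also have "\<dots> \<le> ennreal (W * (1 + s) powr (- (\<sigma> + 1))) * ennreal W"
      by (intro mult_left_mono W(2) s) simp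
    also have "\<dots> = ennreal (W * W * (1 + s) powr (- (\<sigma> + 1)))"
      using W(1) by (simp add: ennreal_mult[symmetric] mult_ac)
    also have "\<dots> \<le> ennreal ((W * W + W) * (1 + s) powr (- (\<sigma> + 1)))"
      using W(1) by (intro ennreal_leI mult_right_mono) auto
    finally show "(\<integral>\<^sup>+x. ennreal (norm (w s x)) \<partial>lborel) \<le> ennreal ((W * W + W) * (1 + s) powr (- (\<sigma> + 1)))" .
    show "AE x in lborel. norm (w s x) \<le> (W * W + W) * (1 + s) powr (- (\<sigma> + 1 + real CARD('n) / 2))"
      using W(5)[OF s]
    proof eventually_elim
      case (elim x)
      have "W * (1 + s) powr (- (\<sigma> + 1 + real CARD('n) / 2)) \<le> (W * W + W) * (1 + s) powr (- (\<sigma> + 1 + real CARD('n) / 2))"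
        using W(1) by (intro mult_right_mono) auto
      with elim show ?case by linarith
    qed
  qed
qed

section \<open>The time integrals psi_k\<close>

text \<open>The difference splits into r^k (f(u r) - f(u s)), small because u is bounded and f is
  Lipschitz on bounded sets, and (r^k - s^k) f(u s), small because f(u s) lies in L^1.\<close>

lemma fu_continuous:
  assumes s: "s > 0"
  shows "((\<lambda>r. Lq_norm 1 (\<lambda>x. of_real (r ^ k) * f (u r x) - of_real (s ^ k) * f (u s x))) \<longlongrightarrow> 0) (at s within {0<..})"
proof -
  obtain A where A: "A > 0" "\<And>s. s > 0 \<Longrightarrow> Lq_norm \<infinity> (u s) \<le> ennreal A" using u_bounded by blast
  obtain W where W: "W > 0"
    "\<And>s. s > 0 \<Longrightarrow> (\<integral>\<^sup>+x. ennreal (norm (w s x)) \<partial>lborel) \<le> ennreal (W * (1 + s) powr (- (\<sigma> + 1)))"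
    using w_L1 by metis
  define c where "c = (s + 1) ^ k * (K * (2 * A powr (p - 1)))"
  define d where "d = W * (1 + s) powr (- (\<sigma> + 1))"
  have c: "c \<ge> 0" "d \<ge> 0" using A K0 s W by (auto simp: c_def d_def)
  have bA: "AE x in lborel. norm (u r x) \<le> A" if "r > 0" for r
    using Lq_norm_inf_AE[of "u r"]
  proof eventually_elim
    case (elim x)
    then have "ennreal (norm (u r x)) \<le> ennreal A" using A(2)[OF that] by (rule order_trans)
    then show ?case using A by (simp add: ennreal_le_iff)
  qed
  have bound: "Lq_norm 1 (\<lambda>x. of_real (r ^ k) * f (u r x) - of_real (s ^ k) * f (u s x))
      \<le> ennreal c * Lq_norm 1 (\<lambda>x. u r x - u s x) + ennreal (\<bar>r ^ k - s ^ k\<bar> * d)" if r: "r > 0" "r < s + 1" for r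
  proof -
    have "(\<integral>\<^sup>+x. ennreal (norm (of_real (r ^ k) * f (u r x) - of_real (s ^ k) * f (u s x))) \<partial>lebesgue)
       \<le> (\<integral>\<^sup>+x. ennreal c * ennreal (norm (u r x - u s x)) + ennreal \<bar>r ^ k - s ^ k\<bar> * ennreal (norm (f (u s x))) \<partial>lebesgue)"
    proof (rule nn_integral_mono_AE)
      show "AE x in lebesgue. ennreal (norm (of_real (r ^ k) * f (u r x) - of_real (s ^ k) * f (u s x)))
         \<le> ennreal c * ennreal (norm (u r x - u s x)) + ennreal \<bar>r ^ k - s ^ k\<bar> * ennreal (norm (f (u s x)))"
        using AE_completion[OF bA[OF r(1)]] AE_completion[OF bA[OF s]]
      proof eventually_elim
        case (elim x)
        have "of_real (r ^ k) * f (u r x) - of_real (s ^ k) * f (u s x)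
          = of_real (r ^ k) * (f (u r x) - f (u s x)) + of_real (r ^ k - s ^ k) * f (u s x)"
          by (simp add: algebra_simps)
        then have "norm (of_real (r ^ k) * f (u r x) - of_real (s ^ k) * f (u s x))
          \<le> norm (of_real (r ^ k) * (f (u r x) - f (u s x))) + norm (of_real (r ^ k - s ^ k) * f (u s x))"
          by (simp only: norm_triangle_ineq)
        also have "\<dots> = r ^ k * norm (f (u r x) - f (u s x)) + \<bar>r ^ k - s ^ k\<bar> * norm (f (u s x))"
          using r by (simp only: norm_mult norm_of_real) simp
        also have "r ^ k * norm (f (u r x) - f (u s x)) \<le> c * norm (u r x - u s x)"
        proof -
          have a: "norm (u r x) powr (p - 1) \<le> A powr (p - 1)" "norm (u s x) powr (p - 1) \<le> A powr (p - 1)"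
            using elim p1 by (auto intro!: powr_mono2)
          have "norm (f (u r x) - f (u s x)) \<le> K * (norm (u r x) powr (p - 1) + norm (u s x) powr (p - 1)) * norm (u r x - u s x)"
            by (rule f_diff)
          also have "\<dots> \<le> K * (2 * A powr (p - 1)) * norm (u r x - u s x)"
            using a K0 by (intro mult_right_mono mult_left_mono) auto
          finally have "r ^ k * norm (f (u r x) - f (u s x)) \<le> (s + 1) ^ k * (K * (2 * A powr (p - 1)) * norm (u r x - u s x))"
            using r by (intro mult_mono power_mono) auto
          then show ?thesis by (simp add: c_def mult.assoc)
        qed
        finally show ?case using c by (simp add: ennreal_leI flip: ennreal_plus ennreal_mult)
      qed
    qed
    also have "\<dots> = ennreal c * (\<integral>\<^sup>+x. ennreal (norm (u r x - u s x)) \<partial>lebesgue) + ennreal \<bar>r ^ k - s ^ k\<bar> * (\<integral>\<^sup>+x. ennreal (norm (f (u s x))) \<partial>lebesgue)"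
      using u_measurable[OF r(1)] u_measurable[OF s] fu_L1(1)[OF s]
      by (subst nn_integral_add) (auto simp: nn_integral_cmult)
    also have "\<dots> \<le> ennreal c * (\<integral>\<^sup>+x. ennreal (norm (u r x - u s x)) \<partial>lebesgue) + ennreal \<bar>r ^ k - s ^ k\<bar> * ennreal d"
      using W(2)[OF s] fu_L1(2)[OF s]
      by (intro add_left_mono mult_left_mono) (auto simp: Lq_norm_1 nn_integral_completion d_def)
    finally show ?thesis using c by (simp add: Lq_norm_1 nn_integral_completion ennreal_mult)
  qed
  have "((\<lambda>r. Lq_norm 1 (\<lambda>x. u r x - u s x)) \<longlongrightarrow> 0) (at s within {0..})"
    using u_C_1 s by (auto simp: C_Linf_def)
  then have l: "((\<lambda>r. Lq_norm 1 (\<lambda>x. u r x - u s x)) \<longlongrightarrow> 0) (at s within {0<..})"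
    by (rule tendsto_within_subset) auto
  have "((\<lambda>r. \<bar>r ^ k - s ^ k\<bar> * d) \<longlongrightarrow> \<bar>s ^ k - s ^ k\<bar> * d) (at s within {0<..})"
    by (intro tendsto_intros)
  then have l2: "((\<lambda>r. ennreal (\<bar>r ^ k - s ^ k\<bar> * d)) \<longlongrightarrow> ennreal 0) (at s within {0<..})"
    by (intro tendsto_ennrealI) simp
  have lim: "((\<lambda>r. ennreal c * Lq_norm 1 (\<lambda>x. u r x - u s x) + ennreal (\<bar>r ^ k - s ^ k\<bar> * d)) \<longlongrightarrow> ennreal c * 0 + ennreal 0) (at s within {0<..})"
    by (intro tendsto_add l2 ennreal_tendsto_cmult l) simp
  show ?thesis
  proof (rule tendsto_sandwich[OF _ _ tendsto_const])
    show "((\<lambda>r. ennreal c * Lq_norm 1 (\<lambda>x. u r x - u s x) + ennreal (\<bar>r ^ k - s ^ k\<bar> * d)) \<longlongrightarrow> 0) (at s within {0<..})"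
      using lim by simp
    have "eventually (\<lambda>r. r < s + 1) (at s within {0<..})"
      by (rule order_tendstoD(2)[OF tendsto_ident_at]) simp
    moreover have "eventually (\<lambda>r. r > 0) (at s within {0<..})"
      by (auto simp: eventually_at intro: exI[of _ 1])
    ultimately show "eventually (\<lambda>r. Lq_norm 1 (\<lambda>x. of_real (r ^ k) * f (u r x) - of_real (s ^ k) * f (u s x))
      \<le> ennreal c * Lq_norm 1 (\<lambda>x. u r x - u s x) + ennreal (\<bar>r ^ k - s ^ k\<bar> * d)) (at s within {0<..})"
      by eventually_elim (rule bound)
  qed simp
qed

text \<open>From 2k \<le> m < 2\<sigma> the L^1 norm of s^k f(u s) is at most W (1 + s)^(-a) with a
  = \<sigma> + 1 - k > 1: an integrable and decreasing majorant, as
  \<open>has_Bochner_integral_L1\<close> requires.\<close>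

lemma psi_AE:
  assumes k: "2 * k \<le> m"
  shows "AE x in lborel. psi f u k x = (LINT s|lborel. of_real (s ^ k) * w s x)"
    and "psi f u k \<in> borel_measurable lebesgue"
proof -
  obtain W where W: "W > 0"
    "\<And>s. s > 0 \<Longrightarrow> (\<integral>\<^sup>+x. ennreal (norm (w s x)) \<partial>lborel) \<le> ennreal (W * (1 + s) powr (- (\<sigma> + 1)))"
    using w_L1 by metis
  define a where "a = \<sigma> + 1 - real k"
  have a: "a > 1" using sigma_gt k by (simp add: a_def)
  define g where "g = (\<lambda>s. ennreal (W * (1 + s) powr (- a)))"
  define F where "F = (\<lambda>s x. of_real (s ^ k) * f (u s x))"
  define H where "H = (\<lambda>s x. of_real (s ^ k) * w s x)"
  have FH: "AE x in lborel. F s x = H s x" if "s > 0" for s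
    using w_AE[OF that] by eventually_elim (simp add: F_def H_def)
  have gb: "Lq_norm 1 (F s) \<le> g s" if s: "s > 0" for s
  proof -
    have "Lq_norm 1 (F s) = (\<integral>\<^sup>+x. ennreal (s ^ k) * ennreal (norm (w s x)) \<partial>lborel)"
      unfolding Lq_norm_1_cong[OF FH[OF s]] unfolding Lq_norm_1 H_def
      using s by (simp add: norm_mult norm_power ennreal_mult)
    also have "\<dots> = ennreal (s ^ k) * (\<integral>\<^sup>+x. ennreal (norm (w s x)) \<partial>lborel)"
      by (rule nn_integral_cmult) simp
    also have "\<dots> \<le> ennreal (s ^ k) * ennreal (W * (1 + s) powr (- (\<sigma> + 1)))"
      by (intro mult_left_mono W(2) s) simp
    also have "\<dots> \<le> g s"
    proof -
      have "s ^ k \<le> (1 + s) powr real k" using s by (simp add: powr_realpow power_mono)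
      then have "s ^ k * (W * (1 + s) powr (- (\<sigma> + 1))) \<le> (1 + s) powr real k * (W * (1 + s) powr (- (\<sigma> + 1)))"
        using W(1) by (intro mult_right_mono) auto
      also have "\<dots> = W * ((1 + s) powr real k * (1 + s) powr (- (\<sigma> + 1)))" by (simp add: mult_ac)
      also have "(1 + s) powr real k * (1 + s) powr (- (\<sigma> + 1)) = (1 + s) powr (- a)"
        unfolding powr_add[symmetric] a_def by (rule arg_cong[where f = "\<lambda>b. (1 + s) powr b"]) simp
      finally show ?thesis unfolding g_def using s W(1) by (simp add: ennreal_leI flip: ennreal_mult)
    qed
    finally show ?thesis .
  qed
  have cont: "((\<lambda>r. Lq_norm 1 (\<lambda>x. F r x - F s x)) \<longlongrightarrow> 0) (at s within {0<..})" if "s > 0" for s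
    using fu_continuous[OF that, of k] by (simp add: F_def)
  have gm: "g \<in> borel_measurable borel" unfolding g_def by measurable
  have gfin: "(\<integral>\<^sup>+s. g s \<partial>lebesgue_on {0<..}) < \<infinity>"
  proof -
    have "(\<integral>\<^sup>+s. g s \<partial>lebesgue_on {0<..}) \<le> (\<integral>\<^sup>+s. ennreal W * (ennreal ((1 + s) powr (- a)) * indicator {0..} s) \<partial>lborel)"
      unfolding nn_integral_lebesgue_on[of "{0<..}", OF borel_open[OF open_greaterThan]]
      using W(1) by (intro nn_integral_mono) (auto simp: g_def ennreal_mult indicator_def)
    also have "\<dots> = ennreal W * (\<integral>\<^sup>+s. ennreal ((1 + s) powr (- a)) * indicator {0..} s \<partial>lborel)"
      by (rule nn_integral_cmult) measurable
    also have "\<dots> < \<infinity>" unfolding nn_integral_one_plus_powr[OF a] by (simp add: ennreal_mult_less_top)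
    finally show ?thesis .
  qed
  have Hj: "(\<lambda>(s, x). H s x) \<in> borel_measurable (borel \<Otimes>\<^sub>M borel)"
    unfolding H_def case_prod_beta by measurable
  have FL: "F s \<in> Lq 1" if s: "s > 0" for s
  proof -
    have "F s \<in> borel_measurable lebesgue" unfolding F_def using fu_L1(1)[OF s] by simp
    moreover have "g s < \<infinity>" by (simp add: g_def)
    ultimately show ?thesis using gb[OF s] by (simp add: Lq_def normed_part_def)
  qed
  have gm': "g \<in> borel_measurable (lebesgue_on {0<..})"
    by (rule measurable_restrict_space1) (rule measurable_completion, simp add: gm)
  have mono: "g s \<le> g r" if "0 < r" "r \<le> s" for r s
    unfolding g_def using that W(1) a by (intro ennreal_leI mult_left_mono powr_mono2') auto
  have "psi f u k = Bochner_integral (Lq_norm 1) (lebesgue_on {0<..}) F"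
    by (simp add: psi_def F_def)
  moreover have "AE x in lborel. Bochner_integral (Lq_norm 1) (lebesgue_on {0<..}) F x = (LINT s|lebesgue_on {0<..}. H s x)"
    by (rule Bochner_integral_AE_eq(1)[where g = g]; (rule FL Hj FH cont gb mono gm' gfin | assumption)+)
  moreover have "Bochner_integral (Lq_norm 1) (lebesgue_on {0<..}) F \<in> borel_measurable lebesgue"
    by (rule Bochner_integral_AE_eq(2)[where g = g and H = H]; (rule FL Hj FH cont gb mono gm' gfin | assumption)+)
  moreover have "(LINT s|lebesgue_on {0<..}. H s x) = (LINT s|lborel. of_real (s ^ k) * w s x)" for x
  proof -
    have "(\<lambda>s. H s x) \<in> borel_measurable borel"
      using measurable_compose[OF measurable_Pair2'[of x borel borel] Hj] by simp
    then have "(LINT s|lebesgue_on {0<..}. H s x) = (LINT s|lborel. indicator {0<..} s *\<^sub>R H s x)"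
      by (intro integral_lebesgue_on) auto
    also have "\<dots> = (LINT s|lborel. of_real (s ^ k) * w s x)"
      by (rule Bochner_Integration.integral_cong[OF refl]) (auto simp: H_def indicator_def w_neg)
    finally show ?thesis .
  qed
  ultimately show "AE x in lborel. psi f u k x = (LINT s|lborel. of_real (s ^ k) * w s x)"
    and "psi f u k \<in> borel_measurable lebesgue" by simp_all
qed

end

text \<open>With \<beta> the primitive of the kernel, the supremum S of \<Phi> exp(-2\<beta>)
  satisfies S \<le> a + S/2, because the weighted kernel integrates to at most exp(2\<beta>)/2. The
  bound M makes S finite, without which this inequality would say nothing.\<close>

lemma gronwall_ennreal:
  fixes \<Phi> :: "real \<Rightarrow> ennreal"
  assumes \<sigma>: "\<sigma> > 0" and ab: "a \<ge> 0" "b \<ge> 0"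
    and M: "\<And>t. 0 < t \<Longrightarrow> t \<le> T \<Longrightarrow> \<Phi> t \<le> ennreal M"
    and ineq: "\<And>t. 0 < t \<Longrightarrow> t \<le> T \<Longrightarrow> \<Phi> t \<le> ennreal a +
      (\<integral>\<^sup>+s. ennreal (b * (1 + s) powr (- (\<sigma> + 1))) * \<Phi> s * indicator {0<..<t} s \<partial>lborel)"
    and t: "0 < t" "t \<le> T"
  shows "\<Phi> t \<le> ennreal (2 * a * exp (2 * b / \<sigma>))"
proof -
  \<comment> \<open>The primitive of b (1 + s)^(-(\<sigma> + 1)) that vanishes at 0; it stays below
    b/\<sigma>, hence the constant exp(2 b/\<sigma>).\<close>
  define \<beta> where "\<beta> = (\<lambda>t. b / \<sigma> * (1 - (1 + t) powr (- \<sigma>)))"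
  define S where "S = (SUP t\<in>{0<..T}. \<Phi> t * ennreal (exp (- (2 * \<beta> t))))"
  have \<beta>0: "0 \<le> \<beta> t" "\<beta> t \<le> b / \<sigma>" if "t > 0" for t
  proof -
    have "(1 + t) powr (- \<sigma>) \<le> 1" using that powr_mono2'[of "- \<sigma>" 1 "1 + t"] \<sigma> by simp
    then show "0 \<le> \<beta> t" using ab \<sigma> by (simp add: \<beta>_def)
    have "b / \<sigma> * (1 - (1 + t) powr (- \<sigma>)) \<le> b / \<sigma> * 1" using ab \<sigma> by (intro mult_left_mono) auto
    then show "\<beta> t \<le> b / \<sigma>" by (simp add: \<beta>_def)
  qed
  have inv: "ennreal (exp (- (2 * \<beta> t))) * ennreal (exp (2 * \<beta> t)) = 1" for t
    by (simp flip: ennreal_mult exp_add)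
  have le: "\<Phi> s \<le> S * ennreal (exp (2 * \<beta> s))" if "0 < s" "s \<le> T" for s
  proof -
    have "\<Phi> s * ennreal (exp (- (2 * \<beta> s))) \<le> S" unfolding S_def using that by (intro SUP_upper) auto
    then have "\<Phi> s * ennreal (exp (- (2 * \<beta> s))) * ennreal (exp (2 * \<beta> s)) \<le> S * ennreal (exp (2 * \<beta> s))"
      by (rule mult_right_mono) simp
    then show ?thesis by (simp add: mult.assoc inv)
  qed
  have SM: "S \<le> ennreal M" unfolding S_def
  proof (rule SUP_least)
    fix t assume t: "t \<in> {0<..T}"
    have "\<Phi> t * ennreal (exp (- (2 * \<beta> t))) \<le> ennreal M * 1"
      using M[of t] t \<beta>0[of t] by (intro mult_mono) auto
    then show "\<Phi> t * ennreal (exp (- (2 * \<beta> t))) \<le> ennreal M" by simp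
  qed
  have int: "(\<integral>\<^sup>+s. ennreal (b * (1 + s) powr (- (\<sigma> + 1))) * ennreal (exp (2 * \<beta> s)) * indicator {0<..<t} s \<partial>lborel)
      \<le> ennreal (exp (2 * \<beta> t) / 2)" if t: "t > 0" for t
  proof -
    have "(\<integral>\<^sup>+s. ennreal (b * (1 + s) powr (- (\<sigma> + 1))) * ennreal (exp (2 * \<beta> s)) * indicator {0<..<t} s \<partial>lborel)
       \<le> (\<integral>\<^sup>+s. ennreal (b * (1 + s) powr (- (\<sigma> + 1)) * exp (2 * \<beta> s)) * indicator {0..t} s \<partial>lborel)"
      using ab by (intro nn_integral_mono) (auto simp: indicator_def ennreal_mult)
    also have "\<dots> = ennreal (exp (2 * \<beta> t) / 2 - exp (2 * \<beta> 0) / 2)"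
    proof (rule nn_integral_FTC_Icc)
      show "(\<lambda>s. b * (1 + s) powr (- (\<sigma> + 1)) * exp (2 * \<beta> s)) \<in> borel_measurable borel"
        unfolding \<beta>_def by measurable
      fix s assume "s \<in> {0..t}"
      then have s: "0 \<le> s" "s \<le> t" by auto
      have "((\<lambda>s. (1 + s) powr (- \<sigma>)) has_real_derivative (- \<sigma>) * (1 + s) powr (- \<sigma> - 1)) (at s)"
        using s by (auto intro!: derivative_eq_intros)
      then have "(\<beta> has_real_derivative b / \<sigma> * (0 - (- \<sigma>) * (1 + s) powr (- \<sigma> - 1))) (at s)"
        unfolding \<beta>_def by (intro DERIV_cmult DERIV_diff DERIV_const)
      moreover have "b / \<sigma> * (0 - (- \<sigma>) * (1 + s) powr (- \<sigma> - 1)) = b * (1 + s) powr (- (\<sigma> + 1))"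
        using \<sigma> by simp
      ultimately have d: "(\<beta> has_real_derivative b * (1 + s) powr (- (\<sigma> + 1))) (at s)" by simp
      have "((\<lambda>s. exp (2 * \<beta> s) / 2) has_real_derivative exp (2 * \<beta> s) * (2 * (b * (1 + s) powr (- (\<sigma> + 1)))) / 2) (at s)"
        by (intro DERIV_cdivide DERIV_chain2[OF DERIV_exp] DERIV_cmult d)
      then show "((\<lambda>s. exp (2 * \<beta> s) / 2) has_real_derivative b * (1 + s) powr (- (\<sigma> + 1)) * exp (2 * \<beta> s)) (at s)"
        by (simp add: mult_ac)
      show "0 \<le> b * (1 + s) powr (- (\<sigma> + 1)) * exp (2 * \<beta> s)" using ab by simp
    qed (use t in simp)
    also have "\<dots> \<le> ennreal (exp (2 * \<beta> t) / 2)" by (intro ennreal_leI) simp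
    finally show ?thesis .
  qed
  obtain S' where S': "S = ennreal S'" "S' \<ge> 0" using SM by (cases S) (auto simp: top_unique)
  have hf: "ennreal (a + S' / 2) = ennreal a + S * ennreal (1 / 2)"
  proof -
    have "ennreal a + S * ennreal (1 / 2) = ennreal a + ennreal (S' * (1 / 2))"
      unfolding S'(1) by (subst ennreal_mult) (use S' in auto)
    also have "\<dots> = ennreal (a + S' * (1 / 2))" by (rule ennreal_plus[symmetric]) (use S' ab in auto)
    finally show ?thesis by simp
  qed
  have "S \<le> ennreal a + S * ennreal (1 / 2)" unfolding S_def
  proof (rule SUP_least, unfold S_def[symmetric])
    fix t assume t: "t \<in> {0<..T}"
    have "\<Phi> t \<le> ennreal a + (\<integral>\<^sup>+s. ennreal (b * (1 + s) powr (- (\<sigma> + 1))) * \<Phi> s * indicator {0<..<t} s \<partial>lborel)"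
      using t by (intro ineq) auto
    also have "\<dots> \<le> ennreal a + (\<integral>\<^sup>+s. S * (ennreal (b * (1 + s) powr (- (\<sigma> + 1))) * ennreal (exp (2 * \<beta> s)) * indicator {0<..<t} s) \<partial>lborel)"
    proof (intro add_left_mono nn_integral_mono)
      fix s
      show "ennreal (b * (1 + s) powr (- (\<sigma> + 1))) * \<Phi> s * indicator {0<..<t} s
        \<le> S * (ennreal (b * (1 + s) powr (- (\<sigma> + 1))) * ennreal (exp (2 * \<beta> s)) * indicator {0<..<t} s)"
      proof (cases "s \<in> {0<..<t}")
        case True
        then have "\<Phi> s \<le> S * ennreal (exp (2 * \<beta> s))" using t by (intro le) auto
        then have "ennreal (b * (1 + s) powr (- (\<sigma> + 1))) * \<Phi> s \<le> ennreal (b * (1 + s) powr (- (\<sigma> + 1))) * (S * ennreal (exp (2 * \<beta> s)))"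
          by (rule mult_left_mono) simp
        with True show ?thesis by (simp add: mult_ac)
      qed simp
    qed
    also have "\<dots> = ennreal a + S * (\<integral>\<^sup>+s. ennreal (b * (1 + s) powr (- (\<sigma> + 1))) * ennreal (exp (2 * \<beta> s)) * indicator {0<..<t} s \<partial>lborel)"
      unfolding \<beta>_def by (subst nn_integral_cmult) auto
    also have "\<dots> \<le> ennreal a + S * ennreal (exp (2 * \<beta> t) / 2)"
      using t by (intro add_left_mono mult_left_mono int) auto
    finally have "\<Phi> t * ennreal (exp (- (2 * \<beta> t))) \<le> (ennreal a + S * ennreal (exp (2 * \<beta> t) / 2)) * ennreal (exp (- (2 * \<beta> t)))"
      by (rule mult_right_mono) simp
    also have "\<dots> = ennreal ((a + S' * (exp (2 * \<beta> t) / 2)) * exp (- (2 * \<beta> t)))"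
      unfolding S' using S' ab by (simp flip: ennreal_mult ennreal_plus)
    also have "(a + S' * (exp (2 * \<beta> t) / 2)) * exp (- (2 * \<beta> t)) = a * exp (- (2 * \<beta> t)) + S' / 2"
      by (simp add: algebra_simps flip: exp_add)
    also have "ennreal (a * exp (- (2 * \<beta> t)) + S' / 2) \<le> ennreal (a * 1 + S' / 2)"
      using ab \<beta>0[of t] t by (intro ennreal_leI add_right_mono mult_left_mono) auto
    also have "\<dots> = ennreal a + S * ennreal (1 / 2)"
      using hf by simp
    finally show "\<Phi> t * ennreal (exp (- (2 * \<beta> t))) \<le> ennreal a + S * ennreal (1 / 2)" .
  qed
  then have "ennreal S' \<le> ennreal (a + S' / 2)" unfolding hf using S'(1) by simp
  from this S' ab have "S' \<le> a + S' / 2" by (subst (asm) ennreal_le_iff) auto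
  then have S2: "S' \<le> 2 * a" by simp
  have "\<Phi> t \<le> ennreal (S' * exp (2 * \<beta> t))" using le[OF t] S' by (simp add: ennreal_mult)
  also have "\<dots> \<le> ennreal (2 * a * exp (2 * b / \<sigma>))"
    using S2 ab \<beta>0[OF t(1)] S' by (intro ennreal_leI mult_mono) auto
  finally show ?thesis .
qed

lemma nn_integral_lborel_pair:
  fixes g :: "'a::euclidean_space \<times> 'b::euclidean_space \<Rightarrow> ennreal"
  assumes "g \<in> borel_measurable (borel \<Otimes>\<^sub>M borel)"
  shows "(\<integral>\<^sup>+z. g z \<partial>lborel) = (\<integral>\<^sup>+s. \<integral>\<^sup>+y. g (s, y) \<partial>lborel \<partial>lborel)"
  using lborel.nn_integral_fst[of g lborel] assms by (simp add: lborel_prod borel_prod)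

lemma nn_integral_lborel_swap:
  fixes g :: "'a::euclidean_space \<Rightarrow> 'b::euclidean_space \<Rightarrow> ennreal"
  assumes "(\<lambda>z. g (fst z) (snd z)) \<in> borel_measurable (borel \<Otimes>\<^sub>M borel)"
  shows "(\<integral>\<^sup>+x. \<integral>\<^sup>+y. g x y \<partial>lborel \<partial>lborel) = (\<integral>\<^sup>+y. \<integral>\<^sup>+x. g x y \<partial>lborel \<partial>lborel)"
proof -
  have "(\<lambda>(x, y). g x y) \<in> borel_measurable (lborel \<Otimes>\<^sub>M lborel)"
    using assms by (simp add: lborel_prod borel_prod case_prod_beta)
  from lborel_pair.Fubini'[OF this] show ?thesis by simp
qed

context mild_solution
begin

section \<open>The pointwise Duhamel formula\<close>

lemma w_compose [measurable]:
  assumes "g \<in> borel_measurable M" "h \<in> borel_measurable M"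
  shows "(\<lambda>z. w (g z) (h z)) \<in> borel_measurable M"
  using measurable_compose[OF measurable_Pair[OF assms] w_measurable2] by simp

lemma hk_compose [measurable]:
  assumes "g \<in> borel_measurable M" "h \<in> borel_measurable M"
  shows "(\<lambda>z. heat_kernel0 \<nu> (g z) (h z :: real ^ 'n)) \<in> borel_measurable M"
  by (rule heat_kernel0_compose[OF nu_nz assms])

lemma hk_bound:
  obtains C c where "C > 0" "c > 0"
    "\<And>\<tau> (z :: real ^ 'n). \<tau> > 0 \<Longrightarrow> norm (heat_kernel0 \<nu> \<tau> z) \<le> C * gauss c \<tau> z"
  using heat_kernel_expansion[OF Re_nu, where 'n = 'n] by (metis heat_kernel0_def)

text \<open>Holds at every x: w is bounded, the kernel has bounded mass in y, and the integrand
  vanishes unless 0 < s < t.\<close>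

lemma duhamel_integrable:
  assumes t: "t > 0"
  shows "integrable lborel (\<lambda>z. heat_kernel0 \<nu> (t - fst z) (x - snd z) * w (fst z) (snd z))"
proof (rule integrableI_bounded)
  show "(\<lambda>z. heat_kernel0 \<nu> (t - fst z) (x - snd z) * w (fst z) (snd z)) \<in> borel_measurable lborel"
    unfolding lborel_prod[symmetric] by measurable
  obtain C c where C: "C > 0" "c > 0"
    "\<And>\<tau> (z :: real ^ 'n). \<tau> > 0 \<Longrightarrow> norm (heat_kernel0 \<nu> \<tau> z) \<le> C * gauss c \<tau> z"
    using hk_bound by blast
  obtain W where W: "W > 0"
    "\<And>s. s > 0 \<Longrightarrow> AE x in lborel. norm (w s x) \<le> W * (1 + s) powr (- (\<sigma> + 1 + real CARD('n) / 2))"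
    using w_L1 by metis
  define B where "B = W * C * sqrt (pi / c) ^ CARD('n)"
  have inner: "(\<integral>\<^sup>+y. ennreal (norm (heat_kernel0 \<nu> (t - s) (x - y) * w s y)) \<partial>lborel) \<le> ennreal B * indicator {0..t} s" for s
  proof (cases "0 < s \<and> s < t")
    case True
    have "(\<integral>\<^sup>+y. ennreal (norm (heat_kernel0 \<nu> (t - s) (x - y) * w s y)) \<partial>lborel)
        \<le> (\<integral>\<^sup>+y. ennreal (W * C) * ennreal (gauss c (t - s) (y - x)) \<partial>lborel)"
    proof (rule nn_integral_mono_AE)
      show "AE y in lborel. ennreal (norm (heat_kernel0 \<nu> (t - s) (x - y) * w s y)) \<le> ennreal (W * C) * ennreal (gauss c (t - s) (y - x))"
        using W(2)[of s, OF conjunct1[OF True]]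
      proof eventually_elim
        case (elim y)
        have "(1 + s) powr (- (\<sigma> + 1 + real CARD('n) / 2)) \<le> 1"
          using True sigma_pos powr_mono2'[of "- (\<sigma> + 1 + real CARD('n) / 2)" 1 "1 + s"] by simp
        then have "W * (1 + s) powr (- (\<sigma> + 1 + real CARD('n) / 2)) \<le> W * 1"
          using W(1) by (intro mult_left_mono) auto
        then have wW: "norm (w s y) \<le> W" using elim by simp
        have g: "gauss c (t - s) (x - y) = gauss c (t - s) (y - x)"
          by (simp add: gauss_def norm_minus_commute)
        have "norm (heat_kernel0 \<nu> (t - s) (x - y) * w s y) \<le> (C * gauss c (t - s) (x - y)) * W"
          unfolding norm_mult using True C wW by (intro mult_mono) auto
        then show ?case using W(1) C by (simp add: g ennreal_leI mult_ac flip: ennreal_mult)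
      qed
    qed
    also have "\<dots> = ennreal (W * C) * (\<integral>\<^sup>+y. ennreal (gauss c (t - s) (y - x)) \<partial>lborel)"
      by (rule nn_integral_cmult) (simp add: gauss_def)
    also have "\<dots> = ennreal B"
      using True C W(1) by (subst nn_integral_gauss) (auto simp: B_def simp flip: ennreal_mult)
    finally show ?thesis using True by simp
  next
    case False
    then have z: "heat_kernel0 \<nu> (t - s) (x - y) * w s y = 0" for y
      by (cases "s \<le> 0") (auto simp: w_neg heat_kernel0_def)
    show ?thesis unfolding z by simp
  qed
  have "(\<integral>\<^sup>+z. ennreal (norm (heat_kernel0 \<nu> (t - fst z) (x - snd z) * w (fst z) (snd z))) \<partial>lborel)
      = (\<integral>\<^sup>+s. \<integral>\<^sup>+y. ennreal (norm (heat_kernel0 \<nu> (t - s) (x - y) * w s y)) \<partial>lborel \<partial>lborel)"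
    by (subst nn_integral_lborel_pair) auto
  also have "\<dots> \<le> (\<integral>\<^sup>+s. ennreal B * indicator {0..t} s \<partial>lborel)"
    by (rule nn_integral_mono[OF inner])
  also have "\<dots> < \<infinity>"
    using t by (subst nn_integral_cmult_indicator) (auto simp: ennreal_mult_less_top)
  finally show "(\<integral>\<^sup>+z. ennreal (norm (heat_kernel0 \<nu> (t - fst z) (x - snd z) * w (fst z) (snd z))) \<partial>lborel) < \<infinity>" .
qed

lemma heat_semigroup_borel:
  fixes x :: "real ^ 'n"
  assumes "AE x in lborel. \<phi> x = \<phi>' x" "\<phi> \<in> borel_measurable lebesgue" "\<phi>' \<in> borel_measurable borel" "r > 0"
  shows "heat_semigroup \<nu> r \<phi> x = (LINT y|lborel. heat_kernel0 \<nu> r (x - y) * \<phi>' y)"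
proof -
  have "heat_semigroup \<nu> r \<phi> x = (LINT y|lebesgue. heat_kernel0 \<nu> r (x - y) * \<phi> y)"
    using assms(4) by (simp add: heat_semigroup_def heat_kernel0_def)
  also have "\<dots> = (LINT y|lborel. heat_kernel0 \<nu> r (x - y) * \<phi>' y)"
  proof (rule integral_lebesgue_cong_AE)
    show "AE y in lborel. heat_kernel0 \<nu> r (x - y) * \<phi> y = heat_kernel0 \<nu> r (x - y) * \<phi>' y"
      using assms(1) by eventually_elim simp
    have hb: "(\<lambda>y. heat_kernel0 \<nu> r (x - y)) \<in> borel_measurable lborel"
      by (rule hk_compose[where g = "\<lambda>_. r" and h = "\<lambda>y. x - y"])
         (auto intro!: borel_measurable_const borel_measurable_diff)
    then have "(\<lambda>y. heat_kernel0 \<nu> r (x - y)) \<in> borel_measurable lebesgue" by (rule measurable_completion)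
    then show "(\<lambda>y. heat_kernel0 \<nu> r (x - y) * \<phi> y) \<in> borel_measurable lebesgue"
      using assms(2) by (rule borel_measurable_times)
    show "(\<lambda>y. heat_kernel0 \<nu> r (x - y) * \<phi>' y) \<in> borel_measurable borel"
      using hb assms(3) by simp
  qed
  finally show ?thesis .
qed

text \<open>The Bochner integral is taken in L^1 \<inter> L^infinity, whose norm dominates that of
  L^1, so it agrees almost everywhere with the iterated pointwise integral. The cutoffs in
  \<open>heat_kernel0\<close> and \<open>w\<close> let this integral run over all of
  space-time.\<close>

lemma duhamel:
  assumes t: "t > 0"
  shows "AE x in lborel. u t x = (LINT y|lborel. heat_kernel0 \<nu> t (x - y) * u\<^sub>b y) +
    (LINT z|lborel. heat_kernel0 \<nu> (t - fst z) (x - snd z) * w (fst z) (snd z))"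
proof -
  define M where "M = lebesgue_on {0<..<t}"
  define H where "H = (\<lambda>s x. LINT y|lborel. heat_kernel0 \<nu> (t - s) (x - y) * w s y)"
  obtain I where I: "has_Bochner_integral L1_Linf_norm M (\<lambda>s. heat_semigroup \<nu> (t - s) (\<lambda>x. f (u s x))) I"
    and ut: "AE x in lebesgue. u t x = heat_semigroup \<nu> t u\<^sub>0 x + I x"
    using solution t unfolding global_mild_solution_def M_def by blast
  have sp: "space M = {0<..<t}" by (simp add: M_def)
  have Hj: "(\<lambda>z. H (fst z) (snd z)) \<in> borel_measurable (borel \<Otimes>\<^sub>M borel)"
    unfolding H_def by (rule lborel.borel_measurable_lebesgue_integral) (simp add: case_prod_beta, measurable)
  obtain C c where C: "C > 0" "c > 0"
    "\<And>\<tau> (z :: real ^ 'n). \<tau> > 0 \<Longrightarrow> norm (heat_kernel0 \<nu> \<tau> z) \<le> C * gauss c \<tau> z"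
    using hk_bound by blast
  obtain W where W: "W > 0"
    "\<And>s. s > 0 \<Longrightarrow> (\<integral>\<^sup>+x. ennreal (norm (w s x)) \<partial>lborel) \<le> ennreal (W * (1 + s) powr (- (\<sigma> + 1)))"
    using w_L1 by metis
  define B where "B = C * sqrt (pi / c) ^ CARD('n)"
  have B0: "B > 0" using C by (simp add: B_def)
  \<comment> \<open>Young's inequality for convolutions: the bounded mass of the kernel times the
    L^1 norm of w.\<close>
  have inner: "(\<integral>\<^sup>+x. ennreal (norm (H s x)) \<partial>lborel) \<le> ennreal (B * W)" if s: "0 < s" "s < t" for s
  proof -
    have "(\<integral>\<^sup>+x. ennreal (norm (H s x)) \<partial>lborel)
        \<le> (\<integral>\<^sup>+x. \<integral>\<^sup>+y. ennreal (C * gauss c (t - s) (x - y)) * ennreal (norm (w s y)) \<partial>lborel \<partial>lborel)"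
    proof (rule nn_integral_mono)
      fix x
      have "ennreal (norm (H s x)) \<le> (\<integral>\<^sup>+y. ennreal (norm (heat_kernel0 \<nu> (t - s) (x - y) * w s y)) \<partial>lborel)"
      proof (cases "integrable lborel (\<lambda>y. heat_kernel0 \<nu> (t - s) (x - y) * w s y)")
        case True
        then show ?thesis unfolding H_def by (rule integral_norm_bound_ennreal)
      qed (simp add: H_def not_integrable_integral_eq)
      also have "\<dots> \<le> (\<integral>\<^sup>+y. ennreal (C * gauss c (t - s) (x - y)) * ennreal (norm (w s y)) \<partial>lborel)"
        using C s by (intro nn_integral_mono) (auto simp: norm_mult ennreal_mult[symmetric] intro!: ennreal_leI mult_right_mono)
      finally show "ennreal (norm (H s x)) \<le> (\<integral>\<^sup>+y. ennreal (C * gauss c (t - s) (x - y)) * ennreal (norm (w s y)) \<partial>lborel)" .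
    qed
    also have "\<dots> = (\<integral>\<^sup>+y. \<integral>\<^sup>+x. ennreal (C * gauss c (t - s) (x - y)) * ennreal (norm (w s y)) \<partial>lborel \<partial>lborel)"
      by (rule nn_integral_lborel_swap) (simp add: gauss_def)
    also have "\<dots> = (\<integral>\<^sup>+y. ennreal B * ennreal (norm (w s y)) \<partial>lborel)"
    proof (rule nn_integral_cong)
      fix y
      have "(\<integral>\<^sup>+x. ennreal (C * gauss c (t - s) (x - y)) * ennreal (norm (w s y)) \<partial>lborel)
         = (\<integral>\<^sup>+x. ennreal (C * gauss c (t - s) (x - y)) \<partial>lborel) * ennreal (norm (w s y))"
        by (rule nn_integral_multc) (simp add: gauss_def)
      also have "(\<integral>\<^sup>+x. ennreal (C * gauss c (t - s) (x - y)) \<partial>lborel) = ennreal C * (\<integral>\<^sup>+x. ennreal (gauss c (t - s) (x - y)) \<partial>lborel)"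
        using C by (subst nn_integral_cmult[symmetric]) (auto simp: gauss_def ennreal_mult)
      also have "\<dots> = ennreal B" using s C by (subst nn_integral_gauss) (auto simp: B_def ennreal_mult)
      finally show "(\<integral>\<^sup>+x. ennreal (C * gauss c (t - s) (x - y)) * ennreal (norm (w s y)) \<partial>lborel) = ennreal B * ennreal (norm (w s y))" .
    qed
    also have "\<dots> = ennreal B * (\<integral>\<^sup>+y. ennreal (norm (w s y)) \<partial>lborel)" by (rule nn_integral_cmult) simp
    also have "\<dots> \<le> ennreal B * ennreal (W * (1 + s) powr (- (\<sigma> + 1)))" by (intro mult_left_mono W(2) s) simp
    also have "\<dots> \<le> ennreal (B * W)"
    proof -
      have "(1 + s) powr (- (\<sigma> + 1)) \<le> 1" using s sigma_pos powr_mono2'[of "- (\<sigma> + 1)" 1 "1 + s"] by simp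
      then have "B * (W * (1 + s) powr (- (\<sigma> + 1))) \<le> B * (W * 1)"
        using B0 W(1) by (intro mult_left_mono) auto
      then show ?thesis using B0 W(1) by (simp add: ennreal_leI flip: ennreal_mult)
    qed
    finally show ?thesis .
  qed
  have "(\<integral>\<^sup>+s. \<integral>\<^sup>+x. ennreal (norm (H s x)) \<partial>lborel \<partial>M) \<le> (\<integral>\<^sup>+s. ennreal (B * W) \<partial>M)"
    by (rule nn_integral_mono) (use inner sp in auto)
  also have "\<dots> < \<infinity>"
  proof -
    have "emeasure M (space M) = emeasure lebesgue {0<..<t}"
      unfolding sp unfolding M_def by (rule emeasure_restrict_space) auto
    then show ?thesis using t by (simp add: ennreal_mult_less_top)
  qed
  finally have fin: "(\<integral>\<^sup>+s. \<integral>\<^sup>+x. ennreal (norm (H s x)) \<partial>lborel \<partial>M) < \<infinity>" .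
  have "AE x in lborel. I x = (LINT s|M. H s x)"
  proof (rule has_Bochner_integral_AE_eq[OF _ _ fin _ _ I])
    show "sigma_finite_measure M" unfolding M_def by (rule sigma_finite_lebesgue_on) simp
    show "(\<lambda>(s, x). H s x) \<in> borel_measurable (M \<Otimes>\<^sub>M lborel)"
      unfolding M_def using Hj by (intro measurable_lebesgue_on_pair) (simp add: case_prod_beta)
    show "Lq_norm 1 \<phi> \<le> L1_Linf_norm \<phi>" for \<phi> :: "real ^ 'n \<Rightarrow> complex"
      by (simp add: L1_Linf_norm_def)
    show "AE s in M. AE x in lborel. heat_semigroup \<nu> (t - s) (\<lambda>x. f (u s x)) x = H s x"
    proof (rule AE_I2)
      fix s assume "s \<in> space M"
      then have s: "0 < s" "s < t" by (auto simp: sp)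
      have "heat_semigroup \<nu> (t - s) (\<lambda>x. f (u s x)) x = H s x" for x
        unfolding H_def using s by (intro heat_semigroup_borel w_AE fu_L1) auto
      then show "AE x in lborel. heat_semigroup \<nu> (t - s) (\<lambda>x. f (u s x)) x = H s x" by simp
    qed
  qed
  moreover have "(LINT s|M. H s x) = (LINT z|lborel. heat_kernel0 \<nu> (t - fst z) (x - snd z) * w (fst z) (snd z))" for x
  proof -
    have "(\<lambda>s. H s x) \<in> borel_measurable borel"
      using measurable_compose[OF measurable_Pair2'[of x borel borel] Hj] by simp
    then have "(LINT s|M. H s x) = (LINT s|lborel. indicator {0<..<t} s *\<^sub>R H s x)"
      unfolding M_def by (intro integral_lebesgue_on) auto
    also have "\<dots> = (LINT s|lborel. H s x)"
    proof (rule Bochner_Integration.integral_cong[OF refl])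
      fix s
      show "indicator {0<..<t} s *\<^sub>R H s x = H s x"
      proof (cases "0 < s \<and> s < t")
        case False
        then have z: "heat_kernel0 \<nu> (t - s) (x - y) * w s y = 0" for y
          by (cases "s \<le> 0") (auto simp: w_neg heat_kernel0_def)
        have "H s x = 0" unfolding H_def z by simp
        then show ?thesis by simp
      qed simp
    qed
    also have "\<dots> = (LINT z|(lborel \<Otimes>\<^sub>M lborel). heat_kernel0 \<nu> (t - fst z) (x - snd z) * w (fst z) (snd z))"
      unfolding H_def using lborel_pair.integral_fst'[of "\<lambda>z. heat_kernel0 \<nu> (t - fst z) (x - snd z) * w (fst z) (snd z)"]
        duhamel_integrable[OF t, of x] by (simp add: lborel_prod)
    finally show ?thesis by (simp add: lborel_prod)
  qed
  moreover have "heat_semigroup \<nu> t u\<^sub>0 x = (LINT y|lborel. heat_kernel0 \<nu> t (x - y) * u\<^sub>b y)" for x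
    by (rule heat_semigroup_borel[OF ub_AE u0_measurable ub_measurable t])
  ultimately show ?thesis
    using ut unfolding AE_completion_iff by (auto elim!: eventually_elim2)
qed

end

section \<open>Weighted bounds\<close>

text \<open>If f is not integrable, its integral is 0 by convention, so the bound is
  unconditional.\<close>

lemma norm_integral_le_nn_integral:
  fixes f :: "'a \<Rightarrow> complex"
  shows "ennreal (norm (LINT z|M. f z)) \<le> (\<integral>\<^sup>+z. ennreal (norm (f z)) \<partial>M)"
proof (cases "integrable M f")
  case True
  then show ?thesis by (rule integral_norm_bound_ennreal)
qed (simp add: not_integrable_integral_eq)

lemma gauss_measurable [measurable]: "gauss c \<tau> \<in> borel_measurable borel"
  unfolding gauss_def by measurable

context mild_solution
begin

text \<open>
  Truncating the weight at \<open>R\<close> makes the quantity in Gronwall's lemma finite a priori.  Its length scale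
  $\sqrt{1+T}$ is frozen at the final time, so that the weight is submultiplicative up to a factor which the heat
  kernel integrates to a constant.
\<close>

lemma truncated_weight:
  obtains Z where "Z > 0"
    "\<And>T R. T > 0 \<Longrightarrow> R \<ge> 1 \<Longrightarrow>
      (\<integral>\<^sup>+x. ennreal (min (1 + norm x / sqrt (1 + T)) R ^ (m + 1) * norm (v T x)) \<partial>lborel) \<le> ennreal Z"
proof -
  obtain C c where C: "C > 0" "c > 0"
    "\<And>\<tau> (z :: real ^ 'n). \<tau> > 0 \<Longrightarrow> norm (heat_kernel0 \<nu> \<tau> z) \<le> C * gauss c \<tau> z"
    using hk_bound by blast
  obtain \<kappa> where \<kappa>: "\<kappa> > 0"
    "\<And>\<tau> L (y :: real ^ 'n). 0 < \<tau> \<Longrightarrow> 0 < L \<Longrightarrow> \<tau> \<le> L\<^sup>2 \<Longrightarrow>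
      (\<integral>\<^sup>+x. ennreal (gauss c \<tau> (x - y) * (1 + norm (x - y) / L) ^ (m + 1)) \<partial>lborel) \<le> ennreal \<kappa>"
    using nn_integral_gauss_weighted[OF C(2), of "m + 1"] by blast
  obtain Z0 where Z0: "Z0 > 0" "(\<integral>\<^sup>+x. ennreal ((1 + norm x) ^ (m + 1) * norm (u\<^sub>b x)) \<partial>lborel) \<le> ennreal Z0"
    using ub_weighted by blast
  obtain W where W: "W > 0"
    "\<And>s. s > 0 \<Longrightarrow> (\<integral>\<^sup>+x. ennreal (norm (v s x)) \<partial>lborel) \<le> ennreal W"
    "\<And>s. s > 0 \<Longrightarrow> AE x in lborel. norm (w s x) \<le> W * (1 + s) powr (- (\<sigma> + 1)) * norm (v s x)"
    by (rule vw_bounds) blast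
  define a where "a = C * \<kappa> * Z0"
  define b where "b = C * \<kappa> * W"
  have ab: "a > 0" "b > 0" using C \<kappa> Z0 W by (auto simp: a_def b_def)
  show ?thesis
  proof (rule that[of "2 * a * exp (2 * b / \<sigma>)"])
    show "2 * a * exp (2 * b / \<sigma>) > 0" using ab by simp
    fix T R :: real assume T: "T > 0" and R: "R \<ge> 1"
    define L where "L = sqrt (1 + T)"
    have L: "L \<ge> 1" "L\<^sup>2 = 1 + T" using T by (auto simp: L_def)
    define \<omega> where "\<omega> = (\<lambda>x :: real ^ 'n. min (1 + norm x / L) R ^ (m + 1))"
    have [measurable]: "\<omega> \<in> borel_measurable borel" unfolding \<omega>_def by measurable
    have base: "0 \<le> min (1 + norm x / L) R" for x :: "real ^ 'n" using L R by (auto simp: min_def)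
    have \<omega>0: "0 \<le> \<omega> x" for x unfolding \<omega>_def by (rule zero_le_power[OF base])
    have \<omega>R: "\<omega> x \<le> R ^ (m + 1)" for x unfolding \<omega>_def using base[of x] by (intro power_mono) auto
    have \<omega>1: "\<omega> x \<le> (1 + norm x) ^ (m + 1)" for x
    proof -
      have "norm x / L \<le> norm x / 1" using L by (intro divide_left_mono) auto
      then have "min (1 + norm x / L) R \<le> 1 + norm x" by simp
      then show ?thesis unfolding \<omega>_def using base[of x] by (intro power_mono) auto
    qed
    \<comment> \<open>1 + a + q \<le> (1 + a)(1 + q) for a, q \<ge> 0, and the truncation at R
      survives because R \<le> R (1 + q).\<close>
    have sub: "\<omega> x \<le> \<omega> y * (1 + norm (x - y) / L) ^ (m + 1)" for x y
    proof -
      define q where "q = norm (x - y) / L"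
      have q: "q \<ge> 0" using L by (simp add: q_def)
      have "norm x \<le> norm y + norm (x - y)" by (metis norm_triangle_sub)
      then have "norm x / L \<le> (norm y + norm (x - y)) / L" using L by (intro divide_right_mono) auto
      then have "1 + norm x / L \<le> 1 + norm y / L + q" by (simp add: add_divide_distrib q_def)
      also have "\<dots> \<le> (1 + norm y / L) * (1 + q)"
      proof -
        have "1 + r + q \<le> (1 + r) * (1 + q)" if "r \<ge> 0" for r
          using mult_nonneg_nonneg[OF that q] by (simp add: algebra_simps)
        then show ?thesis using L by simp
      qed
      finally have 1: "1 + norm x / L \<le> (1 + norm y / L) * (1 + q)" .
      have 2: "R \<le> R * (1 + q)" using q R by simp
      have "min (1 + norm x / L) R \<le> min (1 + norm y / L) R * (1 + q)"
        using 1 2 by (auto simp: min_def)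
      then have "\<omega> x \<le> (min (1 + norm y / L) R * (1 + q)) ^ (m + 1)"
        unfolding \<omega>_def using base[of x] by (intro power_mono) auto
      then show ?thesis unfolding \<omega>_def power_mult_distrib q_def .
    qed
    \<comment> \<open>\<tau> \<le> T < L^2, so the constant \<kappa> is uniform in \<tau>, T and
      R.\<close>
    have ker: "(\<integral>\<^sup>+x. ennreal (\<omega> x * norm (heat_kernel0 \<nu> \<tau> (x - y))) \<partial>lborel) \<le> ennreal (C * \<kappa> * \<omega> y)"
      if \<tau>: "0 < \<tau>" "\<tau> \<le> T" for \<tau> y
    proof -
      have "(\<integral>\<^sup>+x. ennreal (\<omega> x * norm (heat_kernel0 \<nu> \<tau> (x - y))) \<partial>lborel)
        \<le> (\<integral>\<^sup>+x. ennreal (C * \<omega> y) * ennreal (gauss c \<tau> (x - y) * (1 + norm (x - y) / L) ^ (m + 1)) \<partial>lborel)"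
      proof (rule nn_integral_mono)
        fix x :: "real ^ 'n"
        have "\<omega> x * norm (heat_kernel0 \<nu> \<tau> (x - y)) \<le> (\<omega> y * (1 + norm (x - y) / L) ^ (m + 1)) * (C * gauss c \<tau> (x - y))"
          using sub[of x y] C(3)[OF \<tau>(1), of "x - y"] \<omega>0[of x] \<omega>0[of y] L by (intro mult_mono) auto
        then show "ennreal (\<omega> x * norm (heat_kernel0 \<nu> \<tau> (x - y)))
          \<le> ennreal (C * \<omega> y) * ennreal (gauss c \<tau> (x - y) * (1 + norm (x - y) / L) ^ (m + 1))"
          using C \<omega>0[of y] L by (simp add: ennreal_leI mult_ac flip: ennreal_mult)
      qed
      also have "\<dots> = ennreal (C * \<omega> y) * (\<integral>\<^sup>+x. ennreal (gauss c \<tau> (x - y) * (1 + norm (x - y) / L) ^ (m + 1)) \<partial>lborel)"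
        by (rule nn_integral_cmult) measurable
      also have "\<dots> \<le> ennreal (C * \<omega> y) * ennreal \<kappa>"
        using \<tau> L by (intro mult_left_mono \<kappa>(2)) auto
      also have "\<dots> = ennreal (C * \<kappa> * \<omega> y)"
        using C \<kappa>(1) \<omega>0[of y] by (simp add: mult_ac flip: ennreal_mult)
      finally show ?thesis .
    qed
    define \<Phi> where "\<Phi> = (\<lambda>t. \<integral>\<^sup>+x. ennreal (\<omega> x * norm (v t x)) \<partial>lborel)"
    have "\<Phi> T \<le> ennreal (2 * a * exp (2 * b / \<sigma>))"
    \<comment> \<open>R enters the a priori bound M but neither a nor b, so it is absent from the
      conclusion.\<close>
    proof (rule gronwall_ennreal[OF sigma_pos, where T = T and M = "R ^ (m + 1) * W"])
      fix t assume t: "0 < t" "t \<le> T"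
      have "\<Phi> t \<le> (\<integral>\<^sup>+x. ennreal (R ^ (m + 1)) * ennreal (norm (v t x)) \<partial>lborel)"
        unfolding \<Phi>_def using \<omega>R \<omega>0 R
        by (intro nn_integral_mono) (auto simp: ennreal_leI mult_right_mono simp flip: ennreal_mult)
      also have "\<dots> = ennreal (R ^ (m + 1)) * (\<integral>\<^sup>+x. ennreal (norm (v t x)) \<partial>lborel)"
        by (rule nn_integral_cmult) measurable
      also have "\<dots> \<le> ennreal (R ^ (m + 1)) * ennreal W" by (intro mult_left_mono W(2) t) simp
      finally show "\<Phi> t \<le> ennreal (R ^ (m + 1) * W)" using R W(1) by (simp add: ennreal_mult)
    next
      fix t assume t: "0 < t" "t \<le> T"
      let ?A = "\<lambda>x y. ennreal (\<omega> x * norm (heat_kernel0 \<nu> t (x - y))) * ennreal (norm (u\<^sub>b y))"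
      let ?B = "\<lambda>x z. ennreal (\<omega> x * norm (heat_kernel0 \<nu> (t - fst z) (x - snd z))) * ennreal (norm (w (fst z) (snd z)))"
      have "\<Phi> t \<le> (\<integral>\<^sup>+x. (\<integral>\<^sup>+y. ?A x y \<partial>lborel) + (\<integral>\<^sup>+z. ?B x z \<partial>(lborel \<Otimes>\<^sub>M lborel)) \<partial>lborel)"
        unfolding \<Phi>_def
      proof (rule nn_integral_mono_AE)
        show "AE x in lborel. ennreal (\<omega> x * norm (v t x)) \<le> (\<integral>\<^sup>+y. ?A x y \<partial>lborel) + (\<integral>\<^sup>+z. ?B x z \<partial>(lborel \<Otimes>\<^sub>M lborel))"
          using duhamel[OF t(1)] v_AE[OF t(1)]
        proof eventually_elim
          case (elim x)
          have "norm (v t x) \<le> norm (LINT y|lborel. heat_kernel0 \<nu> t (x - y) * u\<^sub>b y)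
             + norm (LINT z|lborel. heat_kernel0 \<nu> (t - fst z) (x - snd z) * w (fst z) (snd z))"
            using elim by (simp add: norm_triangle_ineq)
          then have "ennreal (norm (v t x)) \<le> ennreal (norm (LINT y|lborel. heat_kernel0 \<nu> t (x - y) * u\<^sub>b y))
             + ennreal (norm (LINT z|lborel. heat_kernel0 \<nu> (t - fst z) (x - snd z) * w (fst z) (snd z)))"
            by (simp add: ennreal_leI flip: ennreal_plus)
          also have "\<dots> \<le> (\<integral>\<^sup>+y. ennreal (norm (heat_kernel0 \<nu> t (x - y) * u\<^sub>b y)) \<partial>lborel)
             + (\<integral>\<^sup>+z. ennreal (norm (heat_kernel0 \<nu> (t - fst z) (x - snd z) * w (fst z) (snd z))) \<partial>lborel)"
            by (intro add_mono norm_integral_le_nn_integral)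
          finally have "ennreal (\<omega> x) * ennreal (norm (v t x)) \<le> ennreal (\<omega> x) * ((\<integral>\<^sup>+y. ennreal (norm (heat_kernel0 \<nu> t (x - y) * u\<^sub>b y)) \<partial>lborel)
             + (\<integral>\<^sup>+z. ennreal (norm (heat_kernel0 \<nu> (t - fst z) (x - snd z) * w (fst z) (snd z))) \<partial>(lborel \<Otimes>\<^sub>M lborel)))"
            unfolding lborel_prod by (rule mult_left_mono) simp
          also have "\<dots> = (\<integral>\<^sup>+y. ?A x y \<partial>lborel) + (\<integral>\<^sup>+z. ?B x z \<partial>(lborel \<Otimes>\<^sub>M lborel))"
            unfolding distrib_left
            by (subst (1 2) nn_integral_cmult[symmetric]) (measurable, simp add: norm_mult ennreal_mult \<omega>0 mult.assoc)
          finally show ?case by (simp add: ennreal_mult \<omega>0)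
        qed
      qed
      also have "\<dots> = (\<integral>\<^sup>+x. \<integral>\<^sup>+y. ?A x y \<partial>lborel \<partial>lborel) + (\<integral>\<^sup>+x. \<integral>\<^sup>+z. ?B x z \<partial>(lborel \<Otimes>\<^sub>M lborel) \<partial>lborel)"
        by (rule nn_integral_add) measurable
      also have "(\<integral>\<^sup>+x. \<integral>\<^sup>+y. ?A x y \<partial>lborel \<partial>lborel) \<le> ennreal a"
      proof -
        have "(\<integral>\<^sup>+x. \<integral>\<^sup>+y. ?A x y \<partial>lborel \<partial>lborel) = (\<integral>\<^sup>+y. \<integral>\<^sup>+x. ?A x y \<partial>lborel \<partial>lborel)"
          by (rule nn_integral_lborel_swap) measurable
        also have "\<dots> \<le> (\<integral>\<^sup>+y. ennreal (C * \<kappa>) * ennreal ((1 + norm y) ^ (m + 1) * norm (u\<^sub>b y)) \<partial>lborel)"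
        proof (rule nn_integral_mono)
          fix y :: "real ^ 'n"
          have "(\<integral>\<^sup>+x. ?A x y \<partial>lborel) = (\<integral>\<^sup>+x. ennreal (\<omega> x * norm (heat_kernel0 \<nu> t (x - y))) \<partial>lborel) * ennreal (norm (u\<^sub>b y))"
            by (rule nn_integral_multc) measurable
          also have "\<dots> \<le> ennreal (C * \<kappa> * \<omega> y) * ennreal (norm (u\<^sub>b y))"
            by (intro mult_right_mono ker t) simp
          also have "\<dots> \<le> ennreal (C * \<kappa> * (1 + norm y) ^ (m + 1)) * ennreal (norm (u\<^sub>b y))"
            using C \<kappa>(1) \<omega>1[of y] by (intro mult_right_mono ennreal_leI mult_left_mono) auto
          also have "\<dots> = ennreal (C * \<kappa>) * ennreal ((1 + norm y) ^ (m + 1) * norm (u\<^sub>b y))"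
            using C \<kappa>(1) by (simp add: mult.assoc flip: ennreal_mult)
          finally show "(\<integral>\<^sup>+x. ?A x y \<partial>lborel) \<le> ennreal (C * \<kappa>) * ennreal ((1 + norm y) ^ (m + 1) * norm (u\<^sub>b y))" .
        qed
        also have "\<dots> = ennreal (C * \<kappa>) * (\<integral>\<^sup>+y. ennreal ((1 + norm y) ^ (m + 1) * norm (u\<^sub>b y)) \<partial>lborel)"
          by (rule nn_integral_cmult) measurable
        also have "\<dots> \<le> ennreal (C * \<kappa>) * ennreal Z0" by (intro mult_left_mono Z0) simp
        also have "\<dots> = ennreal a" using C \<kappa>(1) Z0(1) by (simp add: a_def flip: ennreal_mult)
        finally show ?thesis .
      qed
      also have "(\<integral>\<^sup>+x. \<integral>\<^sup>+z. ?B x z \<partial>(lborel \<Otimes>\<^sub>M lborel) \<partial>lborel)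
        \<le> (\<integral>\<^sup>+s. ennreal (b * (1 + s) powr (- (\<sigma> + 1))) * \<Phi> s * indicator {0<..<t} s \<partial>lborel)"
      proof -
        have "(\<integral>\<^sup>+x. \<integral>\<^sup>+z. ?B x z \<partial>(lborel \<Otimes>\<^sub>M lborel) \<partial>lborel) = (\<integral>\<^sup>+z. \<integral>\<^sup>+x. ?B x z \<partial>lborel \<partial>(lborel \<Otimes>\<^sub>M lborel))"
          unfolding lborel_prod by (rule nn_integral_lborel_swap) (unfold borel_prod[symmetric], measurable)
        also have "\<dots> = (\<integral>\<^sup>+s. \<integral>\<^sup>+y. \<integral>\<^sup>+x. ?B x (s, y) \<partial>lborel \<partial>lborel \<partial>lborel)"
        proof -
          have "(\<lambda>q. ennreal (\<omega> (snd q) * norm (heat_kernel0 \<nu> (t - fst (fst q)) (snd q - snd (fst q))))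
              * ennreal (norm (w (fst (fst q)) (snd (fst q))))) \<in> borel_measurable ((lborel \<Otimes>\<^sub>M lborel) \<Otimes>\<^sub>M lborel)"
            by measurable
          then have "(\<lambda>z. \<integral>\<^sup>+x. ?B x z \<partial>lborel) \<in> borel_measurable (lborel \<Otimes>\<^sub>M lborel)"
            by (intro lborel.borel_measurable_nn_integral) (simp add: case_prod_beta)
          from lborel.nn_integral_fst[OF this] show ?thesis by simp
        qed
        also have "\<dots> \<le> (\<integral>\<^sup>+s. ennreal (b * (1 + s) powr (- (\<sigma> + 1))) * \<Phi> s * indicator {0<..<t} s \<partial>lborel)"
        proof (rule nn_integral_mono)
          fix s :: real
          show "(\<integral>\<^sup>+y. \<integral>\<^sup>+x. ?B x (s, y) \<partial>lborel \<partial>lborel) \<le> ennreal (b * (1 + s) powr (- (\<sigma> + 1))) * \<Phi> s * indicator {0<..<t} s"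
          proof (cases "0 < s \<and> s < t")
            case False
            then have z: "?B x (s, y) = 0" for x y
              by (cases "s \<le> 0") (auto simp: w_neg heat_kernel0_def)
            show ?thesis unfolding z by simp
          next
            case True
            have "(\<integral>\<^sup>+y. \<integral>\<^sup>+x. ?B x (s, y) \<partial>lborel \<partial>lborel)
              \<le> (\<integral>\<^sup>+y. ennreal (b * (1 + s) powr (- (\<sigma> + 1))) * ennreal (\<omega> y * norm (v s y)) \<partial>lborel)"
            proof (rule nn_integral_mono_AE)
              show "AE y in lborel. (\<integral>\<^sup>+x. ?B x (s, y) \<partial>lborel) \<le> ennreal (b * (1 + s) powr (- (\<sigma> + 1))) * ennreal (\<omega> y * norm (v s y))"
                using W(3)[of s, OF conjunct1[OF True]]
              proof eventually_elim
                case (elim y)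
                have "(\<integral>\<^sup>+x. ?B x (s, y) \<partial>lborel) = (\<integral>\<^sup>+x. ennreal (\<omega> x * norm (heat_kernel0 \<nu> (t - s) (x - y))) \<partial>lborel) * ennreal (norm (w s y))"
                  unfolding fst_conv snd_conv by (rule nn_integral_multc) measurable
                also have "\<dots> \<le> ennreal (C * \<kappa> * \<omega> y) * ennreal (W * (1 + s) powr (- (\<sigma> + 1)) * norm (v s y))"
                  using True t elim by (intro mult_mono ker ennreal_leI) auto
                also have "\<dots> = ennreal (b * (1 + s) powr (- (\<sigma> + 1))) * ennreal (\<omega> y * norm (v s y))"
                  using C \<kappa>(1) \<omega>0[of y] W(1) by (simp add: b_def mult_ac flip: ennreal_mult)
                finally show ?case .
              qed
            qed
            also have "\<dots> = ennreal (b * (1 + s) powr (- (\<sigma> + 1))) * \<Phi> s"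
              unfolding \<Phi>_def by (rule nn_integral_cmult) measurable
            finally show ?thesis using True by simp
          qed
        qed
        finally show ?thesis .
      qed
      finally show "\<Phi> t \<le> ennreal a + (\<integral>\<^sup>+s. ennreal (b * (1 + s) powr (- (\<sigma> + 1))) * \<Phi> s * indicator {0<..<t} s \<partial>lborel)"
        by (simp add: add_mono)
    qed (use ab T in auto)
    then show "(\<integral>\<^sup>+x. ennreal (min (1 + norm x / sqrt (1 + T)) R ^ (m + 1) * norm (v T x)) \<partial>lborel) \<le> ennreal (2 * a * exp (2 * b / \<sigma>))"
      by (simp add: \<Phi>_def \<omega>_def L_def)
  qed
qed

lemma v_weighted:
  obtains Z where "Z > 0"
    "\<And>t. t > 0 \<Longrightarrow> (\<integral>\<^sup>+x. ennreal ((1 + norm x / sqrt (1 + t)) ^ (m + 1) * norm (v t x)) \<partial>lborel) \<le> ennreal Z"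
proof -
  obtain Z where Z: "Z > 0" "\<And>T R. T > 0 \<Longrightarrow> R \<ge> 1 \<Longrightarrow>
      (\<integral>\<^sup>+x. ennreal (min (1 + norm x / sqrt (1 + T)) R ^ (m + 1) * norm (v T x)) \<partial>lborel) \<le> ennreal Z"
    using truncated_weight by blast
  show ?thesis
  proof (rule that[OF Z(1)])
    fix t :: real assume t: "t > 0"
    define F where "F = (\<lambda>i::nat. \<lambda>x. ennreal (min (1 + norm x / sqrt (1 + t)) (real i + 1) ^ (m + 1) * norm (v t x)))"
    have base: "0 \<le> 1 + norm x / sqrt (1 + t)" for x :: "real ^ 'n" using t by simp
    have "(\<integral>\<^sup>+x. ennreal ((1 + norm x / sqrt (1 + t)) ^ (m + 1) * norm (v t x)) \<partial>lborel) \<le> (\<integral>\<^sup>+x. (SUP i. F i x) \<partial>lborel)"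
    proof (rule nn_integral_mono)
      fix x :: "real ^ 'n"
      obtain i :: nat where "1 + norm x / sqrt (1 + t) < real i" using reals_Archimedean2 by blast
      then have "F i x = ennreal ((1 + norm x / sqrt (1 + t)) ^ (m + 1) * norm (v t x))"
        by (simp add: F_def min_absorb1)
      then show "ennreal ((1 + norm x / sqrt (1 + t)) ^ (m + 1) * norm (v t x)) \<le> (SUP i. F i x)"
        by (metis SUP_upper UNIV_I)
    qed
    also have "\<dots> = (SUP i. \<integral>\<^sup>+x. F i x \<partial>lborel)"
    proof (rule nn_integral_monotone_convergence_SUP)
      show "incseq F"
        using base unfolding F_def incseq_def le_fun_def
        by (intro allI impI ennreal_leI mult_right_mono power_mono min.mono) auto
      show "F i \<in> borel_measurable lborel" for i unfolding F_def by measurable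
    qed
    also have "\<dots> \<le> ennreal Z" unfolding F_def by (intro SUP_least Z(2) t) simp
    finally show "(\<integral>\<^sup>+x. ennreal ((1 + norm x / sqrt (1 + t)) ^ (m + 1) * norm (v t x)) \<partial>lborel) \<le> ennreal Z" .
  qed
qed

text \<open>|y| + sqrt s \<le> sqrt(1 + s) (1 + |y| / sqrt(1 + s)): every power of the parabolic
  length costs (1 + s)^(1/2), against the decay (1 + s)^(-(\<sigma> + 1)) gained from the
  nonlinearity.\<close>

lemma w_weighted:
  obtains Z where "Z > 0"
    "\<And>s j. s > 0 \<Longrightarrow> j \<le> m + 1 \<Longrightarrow> (\<integral>\<^sup>+y. ennreal ((norm y + sqrt s) ^ j * norm (w s y)) \<partial>lborel)
       \<le> ennreal (Z * (1 + s) powr (real j / 2 - (\<sigma> + 1)))"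
proof -
  obtain Z where Z: "Z > 0"
    "\<And>t. t > 0 \<Longrightarrow> (\<integral>\<^sup>+x. ennreal ((1 + norm x / sqrt (1 + t)) ^ (m + 1) * norm (v t x)) \<partial>lborel) \<le> ennreal Z"
    using v_weighted by blast
  obtain W where W: "W > 0"
    "\<And>s. s > 0 \<Longrightarrow> AE x in lborel. norm (w s x) \<le> W * (1 + s) powr (- (\<sigma> + 1)) * norm (v s x)"
    by (rule vw_bounds) blast
  show ?thesis
  proof (rule that[of "W * Z"])
    show "W * Z > 0" using W Z by simp
    fix s :: real and j assume s: "s > 0" and j: "j \<le> m + 1"
    define B where "B = W * (1 + s) powr (real j / 2 - (\<sigma> + 1))"
    have pj: "sqrt (1 + s) ^ j = (1 + s) powr (real j / 2)"
      using s powr_powr[of "1 + s" "1 / 2" "real j"] powr_realpow[of "(1 + s) powr (1 / 2)" j]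
      by (simp add: powr_half_sqrt)
    have "(\<integral>\<^sup>+y. ennreal ((norm y + sqrt s) ^ j * norm (w s y)) \<partial>lborel)
       \<le> (\<integral>\<^sup>+y. ennreal B * ennreal ((1 + norm y / sqrt (1 + s)) ^ (m + 1) * norm (v s y)) \<partial>lborel)"
    proof (rule nn_integral_mono_AE)
      show "AE y in lborel. ennreal ((norm y + sqrt s) ^ j * norm (w s y))
         \<le> ennreal B * ennreal ((1 + norm y / sqrt (1 + s)) ^ (m + 1) * norm (v s y))"
        using W(2)[OF s]
      proof eventually_elim
        case (elim y)
        have "norm y + sqrt s \<le> sqrt (1 + s) * (1 + norm y / sqrt (1 + s))"
          using s by (simp add: distrib_left)
        then have "(norm y + sqrt s) ^ j \<le> (sqrt (1 + s) * (1 + norm y / sqrt (1 + s))) ^ j"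
          using s by (intro power_mono) auto
        also have "\<dots> = (1 + s) powr (real j / 2) * (1 + norm y / sqrt (1 + s)) ^ j"
          by (simp add: power_mult_distrib pj)
        also have "\<dots> \<le> (1 + s) powr (real j / 2) * (1 + norm y / sqrt (1 + s)) ^ (m + 1)"
          using s j by (intro mult_left_mono power_increasing) auto
        finally have "(norm y + sqrt s) ^ j * norm (w s y) \<le> ((1 + s) powr (real j / 2) * (1 + norm y / sqrt (1 + s)) ^ (m + 1))
          * (W * (1 + s) powr (- (\<sigma> + 1)) * norm (v s y))"
          using elim s by (intro mult_mono) auto
        also have "\<dots> = W * ((1 + s) powr (real j / 2) * (1 + s) powr (- (\<sigma> + 1))) * ((1 + norm y / sqrt (1 + s)) ^ (m + 1) * norm (v s y))"
          by (simp add: mult_ac)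
        also have "(1 + s) powr (real j / 2) * (1 + s) powr (- (\<sigma> + 1)) = (1 + s) powr (real j / 2 - (\<sigma> + 1))"
          unfolding powr_add[symmetric] by (rule arg_cong[where f = "\<lambda>b. (1 + s) powr b"]) simp
        finally show ?case using W(1) s by (simp add: B_def ennreal_leI flip: ennreal_mult)
      qed
    qed
    also have "\<dots> = ennreal B * (\<integral>\<^sup>+y. ennreal ((1 + norm y / sqrt (1 + s)) ^ (m + 1) * norm (v s y)) \<partial>lborel)"
      by (rule nn_integral_cmult) measurable
    also have "\<dots> \<le> ennreal B * ennreal Z" by (intro mult_left_mono Z(2) s) simp
    also have "\<dots> = ennreal (W * Z * (1 + s) powr (real j / 2 - (\<sigma> + 1)))"
      using W(1) Z(1) by (simp add: B_def mult_ac flip: ennreal_mult)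
    finally show "(\<integral>\<^sup>+y. ennreal ((norm y + sqrt s) ^ j * norm (w s y)) \<partial>lborel)
       \<le> ennreal (W * Z * (1 + s) powr (real j / 2 - (\<sigma> + 1)))" .
  qed
qed

end

section \<open>The profile as an integral against the Taylor polynomial\<close>

lemma abs_mi_power_le: "\<bar>mi_power y \<beta>\<bar> \<le> norm (y :: real ^ 'n::finite) ^ mi_abs \<beta>"
proof -
  have "\<bar>mi_power y \<beta>\<bar> = (\<Prod>j\<in>UNIV. \<bar>y $ j\<bar> ^ \<beta> j)"
    by (simp add: mi_power_def abs_prod power_abs)
  also have "\<dots> \<le> (\<Prod>j\<in>UNIV. norm y ^ \<beta> j)"
    by (intro prod_mono conjI power_mono component_le_norm_cart) auto
  also have "\<dots> = norm y ^ mi_abs \<beta>" by (simp add: mi_abs_def power_sum)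
  finally show ?thesis .
qed

lemma mi_fact_nz [simp]: "mi_fact \<beta> \<noteq> 0"
  by (simp add: mi_fact_def)

lemma mi_power_measurable [measurable]: "(\<lambda>y :: real ^ 'n::finite. mi_power y \<beta>) \<in> borel_measurable borel"
  unfolding mi_power_def by measurable

text \<open>The factor \<beta>! compensates that 1/\<beta>! occurs both in \<open>moment\<close> and
  in \<open>profile_coeff\<close>.\<close>

lemma Lambda_profile_coeff:
  "(- \<nu>) ^ mi_abs \<gamma> / of_nat (mi_fact \<gamma>) * Lambda_profile \<nu> (mi_double \<gamma>) N t \<phi> x
   = (\<Sum>k=0..N. \<Sum>\<beta> | mi_abs \<beta> = k. profile_coeff \<nu> t x \<gamma> \<beta> * (of_nat (mi_fact \<beta>) * moment \<beta> \<phi>))"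
  unfolding Lambda_profile_def sum_distrib_left
  by (intro sum.cong refl) (auto simp: profile_coeff_def)

lemma mi_abs_eq_0: "mi_abs \<gamma> = 0 \<longleftrightarrow> \<gamma> = (\<lambda>_. 0)"
  by (auto simp: mi_abs_def fun_eq_iff)

context mild_solution
begin

text \<open>s^k |y^\<beta>| is at most the power l = 2k + |\<beta>| of |y| + sqrt s. As l \<le> m <
  2\<sigma>, the weighted bound is integrable in time: the lower bound on p is what makes the
  moments in the profile finite.\<close>

lemma moment_w_integrable:
  assumes j: "2 * k + mi_abs \<beta> \<le> m"
  shows "integrable lborel (\<lambda>z. of_real (fst z ^ k) * of_real (mi_power (snd z) \<beta>) * w (fst z) (snd z))"
proof (rule integrableI_bounded)
  show "(\<lambda>z. of_real (fst z ^ k) * of_real (mi_power (snd z) \<beta>) * w (fst z) (snd z)) \<in> borel_measurable lborel"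
    unfolding lborel_prod[symmetric] by measurable
  obtain Z where Z: "Z > 0"
    "\<And>s j. s > 0 \<Longrightarrow> j \<le> m + 1 \<Longrightarrow> (\<integral>\<^sup>+y. ennreal ((norm y + sqrt s) ^ j * norm (w s y)) \<partial>lborel)
       \<le> ennreal (Z * (1 + s) powr (real j / 2 - (\<sigma> + 1)))"
    using w_weighted by blast
  define l where "l = 2 * k + mi_abs \<beta>"
  define a where "a = \<sigma> + 1 - real l / 2"
  have a: "a > 1" using sigma_gt j by (simp add: a_def l_def)
  have inner: "(\<integral>\<^sup>+y. ennreal (norm (of_real (s ^ k) * of_real (mi_power y \<beta>) * w s y)) \<partial>lborel)
      \<le> ennreal Z * (ennreal ((1 + s) powr (- a)) * indicator {0..} s)" for s
  proof (cases "s > 0")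
    case True
    have "(\<integral>\<^sup>+y. ennreal (norm (of_real (s ^ k) * of_real (mi_power y \<beta>) * w s y)) \<partial>lborel)
        \<le> (\<integral>\<^sup>+y. ennreal ((norm y + sqrt s) ^ l * norm (w s y)) \<partial>lborel)"
    proof (intro nn_integral_mono ennreal_leI)
      fix y :: "real ^ 'n"
      have "s ^ k = sqrt s ^ (2 * k)" using True by (simp add: power_mult)
      also have "\<dots> \<le> (norm y + sqrt s) ^ (2 * k)" using True by (intro power_mono) auto
      finally have 1: "s ^ k \<le> (norm y + sqrt s) ^ (2 * k)" .
      have "\<bar>mi_power y \<beta>\<bar> \<le> norm y ^ mi_abs \<beta>" by (rule abs_mi_power_le)
      also have "\<dots> \<le> (norm y + sqrt s) ^ mi_abs \<beta>" using True by (intro power_mono) auto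
      finally have 2: "\<bar>mi_power y \<beta>\<bar> \<le> (norm y + sqrt s) ^ mi_abs \<beta>" .
      have "norm (of_real (s ^ k) * of_real (mi_power y \<beta>) * w s y) = s ^ k * \<bar>mi_power y \<beta>\<bar> * norm (w s y)"
        using True by (simp only: norm_mult norm_of_real) simp
      also have "\<dots> \<le> (norm y + sqrt s) ^ (2 * k) * (norm y + sqrt s) ^ mi_abs \<beta> * norm (w s y)"
        using 1 2 True by (intro mult_right_mono mult_mono) auto
      finally show "norm (of_real (s ^ k) * of_real (mi_power y \<beta>) * w s y) \<le> (norm y + sqrt s) ^ l * norm (w s y)"
        by (simp add: l_def power_add)
    qed
    also have "\<dots> \<le> ennreal (Z * (1 + s) powr (real l / 2 - (\<sigma> + 1)))"
      using j by (intro Z(2) True) (simp add: l_def)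
    also have "real l / 2 - (\<sigma> + 1) = - a" by (simp add: a_def)
    finally show ?thesis using True Z(1) by (simp add: ennreal_mult)
  qed (simp add: w_neg)
  have "(\<integral>\<^sup>+z. ennreal (norm (of_real (fst z ^ k) * of_real (mi_power (snd z) \<beta>) * w (fst z) (snd z))) \<partial>lborel)
      = (\<integral>\<^sup>+s. \<integral>\<^sup>+y. ennreal (norm (of_real (s ^ k) * of_real (mi_power y \<beta>) * w s y)) \<partial>lborel \<partial>lborel)"
  proof -
    have "(\<lambda>z. ennreal (norm (of_real (fst z ^ k) * of_real (mi_power (snd z) \<beta>) * w (fst z) (snd z)))) \<in> borel_measurable (borel \<Otimes>\<^sub>M borel)"
      by measurable
    from nn_integral_lborel_pair[OF this] show ?thesis by simp
  qed
  also have "\<dots> \<le> (\<integral>\<^sup>+s. ennreal Z * (ennreal ((1 + s) powr (- a)) * indicator {0..} s) \<partial>lborel)"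
    by (rule nn_integral_mono[OF inner])
  also have "\<dots> = ennreal Z * (\<integral>\<^sup>+s. ennreal ((1 + s) powr (- a)) * indicator {0..} s \<partial>lborel)"
    by (rule nn_integral_cmult) measurable
  also have "\<dots> < \<infinity>" unfolding nn_integral_one_plus_powr[OF a] by (simp add: ennreal_mult_less_top)
  finally show "(\<integral>\<^sup>+z. ennreal (norm (of_real (fst z ^ k) * of_real (mi_power (snd z) \<beta>) * w (fst z) (snd z))) \<partial>lborel) < \<infinity>" .
qed

text \<open>Fubini, justified by \<open>moment_w_integrable\<close>, exchanges the moment in y with
  the time integral that defines psi_k.\<close>

lemma moment_psi:
  assumes j: "2 * k + mi_abs \<beta> \<le> m"
  shows "of_nat (mi_fact \<beta>) * moment \<beta> (psi f u k)
    = (LINT z|lborel. of_real (fst z ^ k) * of_real (mi_power (snd z) \<beta>) * w (fst z) (snd z))"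
proof -
  have k: "2 * k \<le> m" using j by simp
  have J: "(\<lambda>y. LINT s|lborel. of_real (s ^ k) * w s y) \<in> borel_measurable borel"
    by (rule lborel.borel_measurable_lebesgue_integral) (simp add: case_prod_beta, measurable)
  have mpb: "(\<lambda>y :: real ^ 'n. complex_of_real (mi_power y \<beta>)) \<in> borel_measurable borel" by measurable
  have mp: "(\<lambda>y :: real ^ 'n. complex_of_real (mi_power y \<beta>)) \<in> borel_measurable lebesgue"
    by (rule measurable_completion) (simp add: mpb)
  have "of_nat (mi_fact \<beta>) * moment \<beta> (psi f u k) = (LINT y|lebesgue. of_real (mi_power y \<beta>) * psi f u k y)"
    by (simp add: moment_def)
  also have "\<dots> = (LINT y|lborel. of_real (mi_power y \<beta>) * (LINT s|lborel. of_real (s ^ k) * w s y))"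
  proof (rule integral_lebesgue_cong_AE)
    show "AE y in lborel. of_real (mi_power y \<beta>) * psi f u k y = of_real (mi_power y \<beta>) * (LINT s|lborel. of_real (s ^ k) * w s y)"
      using psi_AE(1)[OF k] by eventually_elim simp
    show "(\<lambda>y. of_real (mi_power y \<beta>) * psi f u k y) \<in> borel_measurable lebesgue"
      by (rule borel_measurable_times[OF mp psi_AE(2)[OF k]])
    show "(\<lambda>y. of_real (mi_power y \<beta>) * (LINT s|lborel. of_real (s ^ k) * w s y)) \<in> borel_measurable borel"
      by (rule borel_measurable_times[OF mpb J])
  qed
  also have "\<dots> = (LINT y|lborel. (LINT s|lborel. of_real (s ^ k) * of_real (mi_power y \<beta>) * w s y))"
    by (subst integral_mult_right_zero[symmetric]) (simp add: mult_ac)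
  also have "\<dots> = (LINT z|(lborel \<Otimes>\<^sub>M lborel). (\<lambda>(s, y). of_real (s ^ k) * of_real (mi_power y \<beta>) * w s y) z)"
    using moment_w_integrable[OF j] by (intro lborel_pair.integral_snd) (simp add: lborel_prod case_prod_beta')
  finally show ?thesis by (simp add: lborel_prod case_prod_beta')
qed

lemma moment_u_integrable:
  assumes "mi_abs \<beta> \<le> m"
  shows "integrable lborel (\<lambda>y. of_real (mi_power y \<beta>) * u\<^sub>b y)"
proof (rule integrableI_bounded)
  show "(\<lambda>y. of_real (mi_power y \<beta>) * u\<^sub>b y) \<in> borel_measurable lborel" by measurable
  obtain Z where Z: "(\<integral>\<^sup>+x. ennreal ((1 + norm x) ^ (m + 1) * norm (u\<^sub>b x)) \<partial>lborel) \<le> ennreal Z"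
    by (rule ub_weighted) blast
  have "(\<integral>\<^sup>+y. ennreal (norm (of_real (mi_power y \<beta>) * u\<^sub>b y)) \<partial>lborel) \<le> (\<integral>\<^sup>+x. ennreal ((1 + norm x) ^ (m + 1) * norm (u\<^sub>b x)) \<partial>lborel)"
  proof (intro nn_integral_mono ennreal_leI)
    fix y :: "real ^ 'n"
    have "\<bar>mi_power y \<beta>\<bar> \<le> norm y ^ mi_abs \<beta>" by (rule abs_mi_power_le)
    also have "\<dots> \<le> (1 + norm y) ^ mi_abs \<beta>" by (intro power_mono) auto
    also have "\<dots> \<le> (1 + norm y) ^ (m + 1)" using assms by (intro power_increasing) auto
    finally show "norm (of_real (mi_power y \<beta>) * u\<^sub>b y) \<le> (1 + norm y) ^ (m + 1) * norm (u\<^sub>b y)"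
      by (simp add: norm_mult mult_right_mono)
  qed
  also note Z
  finally show "(\<integral>\<^sup>+y. ennreal (norm (of_real (mi_power y \<beta>) * u\<^sub>b y)) \<partial>lborel) < \<infinity>"
    by (rule order.strict_trans1) simp
qed

lemma moment_u0:
  shows "of_nat (mi_fact \<beta>) * moment \<beta> u\<^sub>0 = (LINT y|lborel. of_real (mi_power y \<beta>) * u\<^sub>b y)"
proof -
  have mpb: "(\<lambda>y :: real ^ 'n. complex_of_real (mi_power y \<beta>)) \<in> borel_measurable borel" by measurable
  have mp: "(\<lambda>y :: real ^ 'n. complex_of_real (mi_power y \<beta>)) \<in> borel_measurable lebesgue"
    by (rule measurable_completion) (simp add: mpb)
  have "of_nat (mi_fact \<beta>) * moment \<beta> u\<^sub>0 = (LINT y|lebesgue. of_real (mi_power y \<beta>) * u\<^sub>0 y)"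
    by (simp add: moment_def)
  also have "\<dots> = (LINT y|lborel. of_real (mi_power y \<beta>) * u\<^sub>b y)"
  proof (rule integral_lebesgue_cong_AE)
    show "AE y in lborel. of_real (mi_power y \<beta>) * u\<^sub>0 y = of_real (mi_power y \<beta>) * u\<^sub>b y"
      using ub_AE by eventually_elim simp
    show "(\<lambda>y. of_real (mi_power y \<beta>) * u\<^sub>0 y) \<in> borel_measurable lebesgue"
      by (rule borel_measurable_times[OF mp u0_measurable])
    show "(\<lambda>y. of_real (mi_power y \<beta>) * u\<^sub>b y) \<in> borel_measurable borel" by measurable
  qed
  finally show ?thesis .
qed

text \<open>The Taylor polynomial is a finite sum of products of functions of x with monomials in y
  and s; integrated term by term, each monomial gives a moment of some psi_k.\<close>

lemma profile_w_sum:
  assumes t: "t > 0"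
  shows "integrable lborel (\<lambda>z. profile_kernel \<nu> m t x (snd z) (fst z) * w (fst z) (snd z))"
    and "(LINT z|lborel. profile_kernel \<nu> m t x (snd z) (fst z) * w (fst z) (snd z))
     = (\<Sum>\<gamma> | 2 * mi_abs \<gamma> \<le> m. (- \<nu>) ^ mi_abs \<gamma> / of_nat (mi_fact \<gamma>) *
        Lambda_profile \<nu> (mi_double \<gamma>) (m - 2 * mi_abs \<gamma>) t (psi f u (mi_abs \<gamma>)) x)"
proof -
  define G where "G = (\<lambda>\<gamma> \<beta> z. profile_coeff \<nu> t x \<gamma> \<beta> * (of_real (fst z ^ mi_abs \<gamma>) * of_real (mi_power (snd z) \<beta>) * w (fst z) (snd z)))"
  have e: "(\<lambda>z. profile_kernel \<nu> m t x (snd z) (fst z) * w (fst z) (snd z)) =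
    (\<lambda>z. \<Sum>\<gamma> | 2 * mi_abs \<gamma> \<le> m. \<Sum>k=0..m - 2 * mi_abs \<gamma>. \<Sum>\<beta> | mi_abs \<beta> = k. G \<gamma> \<beta> z)"
    unfolding profile_kernel_eq[OF nu_nz t] sum_distrib_right G_def by (simp only: mult.assoc)
  have int: "integrable lborel (G \<gamma> \<beta>)" if "2 * mi_abs \<gamma> \<le> m" "k \<in> {0..m - 2 * mi_abs \<gamma>}" "mi_abs \<beta> = k" for \<gamma> \<beta> k
    unfolding G_def using that by (intro integrable_mult_right moment_w_integrable) auto
  show "integrable lborel (\<lambda>z. profile_kernel \<nu> m t x (snd z) (fst z) * w (fst z) (snd z))"
    unfolding e by (intro Bochner_Integration.integrable_sum) (auto intro: int)
  have "(LINT z|lborel. (\<Sum>\<gamma> | 2 * mi_abs \<gamma> \<le> m. \<Sum>k=0..m - 2 * mi_abs \<gamma>. \<Sum>\<beta> | mi_abs \<beta> = k. G \<gamma> \<beta> z))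
    = (\<Sum>\<gamma> | 2 * mi_abs \<gamma> \<le> m. \<Sum>k=0..m - 2 * mi_abs \<gamma>. \<Sum>\<beta> | mi_abs \<beta> = k. (LINT z|lborel. G \<gamma> \<beta> z))"
    by (subst Bochner_Integration.integral_sum, (auto intro!: Bochner_Integration.integrable_sum intro: int)[1],
        intro sum.cong refl, subst Bochner_Integration.integral_sum, (auto intro!: Bochner_Integration.integrable_sum intro: int)[1],
        intro sum.cong refl, subst Bochner_Integration.integral_sum, (auto intro: int)[1], rule refl)
  also have "\<dots> = (\<Sum>\<gamma> | 2 * mi_abs \<gamma> \<le> m. \<Sum>k=0..m - 2 * mi_abs \<gamma>. \<Sum>\<beta> | mi_abs \<beta> = k.
      profile_coeff \<nu> t x \<gamma> \<beta> * (of_nat (mi_fact \<beta>) * moment \<beta> (psi f u (mi_abs \<gamma>))))"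
  proof (intro sum.cong refl)
    fix \<gamma> \<beta> :: "'n multiindex" and k assume *: "\<gamma> \<in> {\<gamma>. 2 * mi_abs \<gamma> \<le> m}" "k \<in> {0..m - 2 * mi_abs \<gamma>}" "\<beta> \<in> {\<beta>. mi_abs \<beta> = k}"
    then have "2 * mi_abs \<gamma> + mi_abs \<beta> \<le> m" by auto
    from moment_psi[OF this]
    show "(LINT z|lborel. G \<gamma> \<beta> z) = profile_coeff \<nu> t x \<gamma> \<beta> * (of_nat (mi_fact \<beta>) * moment \<beta> (psi f u (mi_abs \<gamma>)))"
      unfolding G_def integral_mult_right_zero by simp
  qed
  finally show "(LINT z|lborel. profile_kernel \<nu> m t x (snd z) (fst z) * w (fst z) (snd z))
     = (\<Sum>\<gamma> | 2 * mi_abs \<gamma> \<le> m. (- \<nu>) ^ mi_abs \<gamma> / of_nat (mi_fact \<gamma>) *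
        Lambda_profile \<nu> (mi_double \<gamma>) (m - 2 * mi_abs \<gamma>) t (psi f u (mi_abs \<gamma>)) x)"
    unfolding e Lambda_profile_coeff .
qed

text \<open>At s = 0 every term with \<gamma> \<noteq> 0 carries a factor 0^|\<gamma>| = 0, so that
  only the spatial moments of the initial value are left.\<close>

lemma profile_u_sum:
  assumes t: "t > 0"
  shows "integrable lborel (\<lambda>y. profile_kernel \<nu> m t x y 0 * u\<^sub>b y)"
    and "(LINT y|lborel. profile_kernel \<nu> m t x y 0 * u\<^sub>b y) = Lambda_profile \<nu> (\<lambda>_. 0) m t u\<^sub>0 x"
proof -
  let ?o = "\<lambda>_ :: 'n. 0 :: nat"
  define G where "G = (\<lambda>\<beta> y. profile_coeff \<nu> t x ?o \<beta> * (of_real (mi_power y \<beta>) * u\<^sub>b y))"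
  have o: "mi_abs ?o = 0" "mi_double ?o = ?o" "mi_fact ?o = 1" by (auto simp: mi_abs_def mi_double_def mi_fact_def)
  have P0: "profile_kernel \<nu> m t x y 0 = (\<Sum>k=0..m. \<Sum>\<beta> | mi_abs \<beta> = k. profile_coeff \<nu> t x ?o \<beta> * of_real (mi_power y \<beta>))" for y
  proof -
    have "profile_kernel \<nu> m t x y 0 = (\<Sum>\<gamma>\<in>{?o}. \<Sum>k=0..m - 2 * mi_abs \<gamma>. \<Sum>\<beta> | mi_abs \<beta> = k.
      profile_coeff \<nu> t x \<gamma> \<beta> * (of_real (0 ^ mi_abs \<gamma>) * of_real (mi_power y \<beta>)))"
      unfolding profile_kernel_eq[OF nu_nz t]
    proof (rule sum.mono_neutral_right[OF finite_mi_abs_le])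
      show "{?o} \<subseteq> {\<gamma>. 2 * mi_abs \<gamma> \<le> m}" by (simp add: o)
      show "\<forall>\<gamma>\<in>{\<gamma>. 2 * mi_abs \<gamma> \<le> m} - {?o}. (\<Sum>k=0..m - 2 * mi_abs \<gamma>. \<Sum>\<beta> | mi_abs \<beta> = k.
        profile_coeff \<nu> t x \<gamma> \<beta> * (of_real (0 ^ mi_abs \<gamma>) * of_real (mi_power y \<beta>))) = 0"
      proof
        fix \<gamma> assume "\<gamma> \<in> {\<gamma>. 2 * mi_abs \<gamma> \<le> m} - {?o}"
        then have "mi_abs \<gamma> \<noteq> 0" using mi_abs_eq_0[of \<gamma>] by auto
        then have "(0::real) ^ mi_abs \<gamma> = 0" by simp
        then show "(\<Sum>k=0..m - 2 * mi_abs \<gamma>. \<Sum>\<beta> | mi_abs \<beta> = k.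
          profile_coeff \<nu> t x \<gamma> \<beta> * (of_real (0 ^ mi_abs \<gamma>) * of_real (mi_power y \<beta>))) = 0"
            by (simp only: of_real_0 mult_zero_left mult_zero_right sum.neutral_const)
      qed
    qed
    then show ?thesis by (simp add: o)
  qed
  have e: "(\<lambda>y. profile_kernel \<nu> m t x y 0 * u\<^sub>b y) = (\<lambda>y. \<Sum>k=0..m. \<Sum>\<beta> | mi_abs \<beta> = k. G \<beta> y)"
    unfolding P0 sum_distrib_right G_def by (simp only: mult.assoc)
  have int: "integrable lborel (G \<beta>)" if "k \<in> {0..m}" "mi_abs \<beta> = k" for \<beta> k
    unfolding G_def using that by (intro integrable_mult_right moment_u_integrable) auto
  show "integrable lborel (\<lambda>y. profile_kernel \<nu> m t x y 0 * u\<^sub>b y)"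
    unfolding e by (intro Bochner_Integration.integrable_sum) (auto intro: int)
  have "(LINT y|lborel. (\<Sum>k=0..m. \<Sum>\<beta> | mi_abs \<beta> = k. G \<beta> y)) = (\<Sum>k=0..m. \<Sum>\<beta> | mi_abs \<beta> = k. (LINT y|lborel. G \<beta> y))"
    by (subst Bochner_Integration.integral_sum, (auto intro!: Bochner_Integration.integrable_sum intro: int)[1],
        intro sum.cong refl, subst Bochner_Integration.integral_sum, (auto intro: int)[1], rule refl)
  also have "\<dots> = (\<Sum>k=0..m. \<Sum>\<beta> | mi_abs \<beta> = k. profile_coeff \<nu> t x ?o \<beta> * (of_nat (mi_fact \<beta>) * moment \<beta> u\<^sub>0))"
    unfolding G_def integral_mult_right_zero moment_u0 ..
  also have "\<dots> = (- \<nu>) ^ mi_abs ?o / of_nat (mi_fact ?o) * Lambda_profile \<nu> (mi_double ?o) m t u\<^sub>0 x"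
    unfolding Lambda_profile_coeff ..
  finally show "(LINT y|lborel. profile_kernel \<nu> m t x y 0 * u\<^sub>b y) = Lambda_profile \<nu> (\<lambda>_. 0) m t u\<^sub>0 x"
    unfolding e o by simp
qed

lemma heat_u_integrable:
  assumes t: "t > 0"
  shows "integrable lborel (\<lambda>y. heat_kernel0 \<nu> t (x - y) * u\<^sub>b y)"
proof (rule integrableI_bounded)
  show "(\<lambda>y. heat_kernel0 \<nu> t (x - y) * u\<^sub>b y) \<in> borel_measurable lborel" by measurable
  obtain C c where C: "C > 0" "c > 0"
    "\<And>\<tau> (z :: real ^ 'n). \<tau> > 0 \<Longrightarrow> norm (heat_kernel0 \<nu> \<tau> z) \<le> C * gauss c \<tau> z"
    using hk_bound by blast
  obtain Z where Z: "(\<integral>\<^sup>+x. ennreal ((1 + norm x) ^ (m + 1) * norm (u\<^sub>b x)) \<partial>lborel) \<le> ennreal Z"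
    by (rule ub_weighted) blast
  define B where "B = C * t powr (- (real CARD('n) / 2))"
  have hB: "norm (heat_kernel0 \<nu> t z) \<le> B" for z :: "real ^ 'n"
  proof -
    have "exp (- (c * (norm z)\<^sup>2 / t)) \<le> 1" using C t by simp
    then have "gauss c t z \<le> t powr (- (real CARD('n) / 2)) * 1"
      unfolding gauss_def by (intro mult_left_mono) auto
    then have "C * gauss c t z \<le> B" using C by (simp add: B_def)
    with C(3)[OF t, of z] show ?thesis by linarith
  qed
  have B0: "B \<ge> 0" using C by (simp add: B_def)
  have "(\<integral>\<^sup>+y. ennreal (norm (heat_kernel0 \<nu> t (x - y) * u\<^sub>b y)) \<partial>lborel)
      \<le> (\<integral>\<^sup>+y. ennreal B * ennreal ((1 + norm y) ^ (m + 1) * norm (u\<^sub>b y)) \<partial>lborel)"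
  proof (rule nn_integral_mono)
    fix y :: "real ^ 'n"
    have "1 * norm (u\<^sub>b y) \<le> (1 + norm y) ^ (m + 1) * norm (u\<^sub>b y)" by (intro mult_right_mono one_le_power) auto
    then have "norm (heat_kernel0 \<nu> t (x - y) * u\<^sub>b y) \<le> B * ((1 + norm y) ^ (m + 1) * norm (u\<^sub>b y))"
      unfolding norm_mult using hB B0 by (intro mult_mono) auto
    then show "ennreal (norm (heat_kernel0 \<nu> t (x - y) * u\<^sub>b y)) \<le> ennreal B * ennreal ((1 + norm y) ^ (m + 1) * norm (u\<^sub>b y))"
      using B0 by (simp add: ennreal_leI flip: ennreal_mult)
  qed
  also have "\<dots> = ennreal B * (\<integral>\<^sup>+y. ennreal ((1 + norm y) ^ (m + 1) * norm (u\<^sub>b y)) \<partial>lborel)"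
    by (rule nn_integral_cmult) measurable
  also have "\<dots> \<le> ennreal B * ennreal Z" by (intro mult_left_mono Z) simp
  also have "\<dots> < \<infinity>" by (simp add: ennreal_mult_less_top)
  finally show "(\<integral>\<^sup>+y. ennreal (norm (heat_kernel0 \<nu> t (x - y) * u\<^sub>b y)) \<partial>lborel) < \<infinity>" .
qed

text \<open>A majorant of the remainder defined at every x. The second integral runs over all times:
  for s \<ge> t the heat kernel is cut off and only the Taylor polynomial remains, which accounts
  for the tails of the integrals psi_k.\<close>

definition error :: "real \<Rightarrow> real ^ 'n \<Rightarrow> ennreal" where
  "error t x = (\<integral>\<^sup>+y. ennreal (norm (heat_kernel0 \<nu> t (x - y) - profile_kernel \<nu> m t x y 0)) * ennreal (norm (u\<^sub>b y)) \<partial>lborel) +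
     (\<integral>\<^sup>+z. ennreal (norm (heat_kernel0 \<nu> (t - fst z) (x - snd z) - profile_kernel \<nu> m t x (snd z) (fst z)))
       * ennreal (norm (w (fst z) (snd z))) \<partial>lborel)"

lemma error_AE:
  assumes t: "t > 0"
  shows "AE x in lborel. ennreal (norm (u t x - asymptotic_profile \<nu> f u\<^sub>0 u m t x)) \<le> error t x"
  using duhamel[OF t]
proof eventually_elim
  case (elim x)
  have "u t x - asymptotic_profile \<nu> f u\<^sub>0 u m t x =
    ((LINT y|lborel. heat_kernel0 \<nu> t (x - y) * u\<^sub>b y) - (LINT y|lborel. profile_kernel \<nu> m t x y 0 * u\<^sub>b y)) +
    ((LINT z|lborel. heat_kernel0 \<nu> (t - fst z) (x - snd z) * w (fst z) (snd z)) -
     (LINT z|lborel. profile_kernel \<nu> m t x (snd z) (fst z) * w (fst z) (snd z)))"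
    unfolding elim asymptotic_profile_def profile_u_sum(2)[OF t] profile_w_sum(2)[OF t] by simp
  also have "\<dots> = (LINT y|lborel. heat_kernel0 \<nu> t (x - y) * u\<^sub>b y - profile_kernel \<nu> m t x y 0 * u\<^sub>b y) +
    (LINT z|lborel. heat_kernel0 \<nu> (t - fst z) (x - snd z) * w (fst z) (snd z) - profile_kernel \<nu> m t x (snd z) (fst z) * w (fst z) (snd z))"
    using heat_u_integrable[OF t, of x] profile_u_sum(1)[OF t, of x] duhamel_integrable[OF t, of x] profile_w_sum(1)[OF t, of x]
    by (simp only: Bochner_Integration.integral_diff)
  finally have *: "u t x - asymptotic_profile \<nu> f u\<^sub>0 u m t x =
     (LINT y|lborel. heat_kernel0 \<nu> t (x - y) * u\<^sub>b y - profile_kernel \<nu> m t x y 0 * u\<^sub>b y) +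
    (LINT z|lborel. heat_kernel0 \<nu> (t - fst z) (x - snd z) * w (fst z) (snd z) - profile_kernel \<nu> m t x (snd z) (fst z) * w (fst z) (snd z))" .
  have "ennreal (norm (u t x - asymptotic_profile \<nu> f u\<^sub>0 u m t x)) \<le>
     ennreal (norm (LINT y|lborel. heat_kernel0 \<nu> t (x - y) * u\<^sub>b y - profile_kernel \<nu> m t x y 0 * u\<^sub>b y)) +
    ennreal (norm (LINT z|lborel. heat_kernel0 \<nu> (t - fst z) (x - snd z) * w (fst z) (snd z) - profile_kernel \<nu> m t x (snd z) (fst z) * w (fst z) (snd z)))"
    unfolding * by (simp add: ennreal_leI norm_triangle_ineq flip: ennreal_plus)
  also have "\<dots> \<le> error t x"
    unfolding error_def
    by (intro add_mono order.trans[OF norm_integral_le_nn_integral])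
       (simp_all add: norm_mult ennreal_mult flip: left_diff_distrib)
  finally show ?case .
qed

end

section \<open>The error estimate\<close>

lemma nn_integral_swap_sigma_finite:
  fixes k :: "'a::euclidean_space \<Rightarrow> 'b::euclidean_space \<times> 'c::euclidean_space \<Rightarrow> ennreal"
  assumes \<mu>: "sigma_finite_measure \<mu>" "sets \<mu> = sets borel"
    and k: "(\<lambda>q. k (fst q) (snd q)) \<in> borel_measurable (borel \<Otimes>\<^sub>M (borel \<Otimes>\<^sub>M borel))"
  shows "(\<integral>\<^sup>+x. \<integral>\<^sup>+z. k x z \<partial>(lborel \<Otimes>\<^sub>M lborel) \<partial>\<mu>) = (\<integral>\<^sup>+z. \<integral>\<^sup>+x. k x z \<partial>\<mu> \<partial>(lborel \<Otimes>\<^sub>M lborel))"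
proof -
  interpret \<mu>: sigma_finite_measure \<mu> by fact
  interpret pair_sigma_finite \<mu> "lborel :: ('b \<times> 'c) measure" ..
  have "sets (\<mu> \<Otimes>\<^sub>M (lborel :: ('b \<times> 'c) measure)) = sets borel"
    using sets_pair_measure_cong[OF \<mu>(2), of "lborel :: ('b \<times> 'c) measure" borel] unfolding borel_prod by simp
  then have "(\<lambda>(x, z). k x z) \<in> borel_measurable (\<mu> \<Otimes>\<^sub>M lborel)"
    using k[unfolded borel_prod] by (simp add: case_prod_beta' cong: measurable_cong_sets)
  from Fubini'[OF this] show ?thesis by (simp add: lborel_prod)
qed

lemma nn_integral_swap_sigma_finite1:
  fixes k :: "'a::euclidean_space \<Rightarrow> 'b::euclidean_space \<Rightarrow> ennreal"
  assumes \<mu>: "sigma_finite_measure \<mu>" "sets \<mu> = sets borel"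
    and k: "(\<lambda>q. k (fst q) (snd q)) \<in> borel_measurable (borel \<Otimes>\<^sub>M borel)"
  shows "(\<integral>\<^sup>+x. \<integral>\<^sup>+z. k x z \<partial>lborel \<partial>\<mu>) = (\<integral>\<^sup>+z. \<integral>\<^sup>+x. k x z \<partial>\<mu> \<partial>lborel)"
proof -
  interpret \<mu>: sigma_finite_measure \<mu> by fact
  interpret pair_sigma_finite \<mu> "lborel :: 'b measure" ..
  have "sets (\<mu> \<Otimes>\<^sub>M (lborel :: 'b measure)) = sets (borel \<Otimes>\<^sub>M borel)"
    using \<mu>(2) by (intro sets_pair_measure_cong) auto
  then have "(\<lambda>(x, z). k x z) \<in> borel_measurable (\<mu> \<Otimes>\<^sub>M lborel)"
    using k by (simp add: case_prod_beta' cong: measurable_cong_sets)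
  from Fubini'[OF this] show ?thesis by simp
qed

lemma nn_integral_cmult_gauss_le:
  assumes [measurable_cong]: "sets \<mu> = sets borel"
    and G: "\<And>y. (\<integral>\<^sup>+x. ennreal (gauss c t (x - y :: real ^ 'n::finite)) \<partial>\<mu>) \<le> ennreal G" "G \<ge> 0"
  shows "(\<integral>\<^sup>+x. h * ennreal (gauss c t x + gauss c t (x - y)) \<partial>\<mu>) \<le> h * ennreal (2 * G)"
    and "(\<integral>\<^sup>+x. h * ennreal (gauss c t x) \<partial>\<mu>) \<le> h * ennreal G"
proof -
  have "(\<integral>\<^sup>+x. h * ennreal (gauss c t x + gauss c t (x - y)) \<partial>\<mu>)
      = h * ((\<integral>\<^sup>+x. ennreal (gauss c t (x - 0)) \<partial>\<mu>) + (\<integral>\<^sup>+x. ennreal (gauss c t (x - y)) \<partial>\<mu>))"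
    by (simp add: nn_integral_cmult nn_integral_add)
  also have "\<dots> \<le> h * (ennreal G + ennreal G)" by (intro mult_left_mono add_mono G) simp
  finally show "(\<integral>\<^sup>+x. h * ennreal (gauss c t x + gauss c t (x - y)) \<partial>\<mu>) \<le> h * ennreal (2 * G)"
    using G(2) by (simp flip: ennreal_plus)
  have "(\<integral>\<^sup>+x. h * ennreal (gauss c t x) \<partial>\<mu>) = h * (\<integral>\<^sup>+x. ennreal (gauss c t (x - 0)) \<partial>\<mu>)"
    by (simp add: nn_integral_cmult)
  also have "\<dots> \<le> h * ennreal G" by (intro mult_left_mono G) simp
  finally show "(\<integral>\<^sup>+x. h * ennreal (gauss c t x) \<partial>\<mu>) \<le> h * ennreal G" .
qed

context mild_solution
begin

text \<open>For s > t/2 the quotient \<rho> of |y| + sqrt s by sqrt t is at least 1/2, so 1 + \<rho>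
  \<le> 3\<rho>, and the polynomial obeys the same bound as a remainder of degree m, whence the
  factor 3^m. The heat kernel keeps its own time t - s there.\<close>

lemma hk_profile_bounds:
  obtains C c where "C > 0" "c > 0"
    "\<And>\<tau> (z :: real ^ 'n). \<tau> > 0 \<Longrightarrow> norm (heat_kernel0 \<nu> \<tau> z) \<le> C * gauss c \<tau> z"
    "\<And>t (x :: real ^ 'n) y s j. t > 0 \<Longrightarrow> 0 \<le> s \<Longrightarrow> s \<le> t / 2 \<Longrightarrow> j \<in> {m, m + 1} \<Longrightarrow>
      norm (heat_kernel0 \<nu> (t - s) (x - y) - profile_kernel \<nu> m t x y s)
        \<le> C * ((norm y + sqrt s) / sqrt t) ^ j * (gauss c t x + gauss c t (x - y))"
    "\<And>t (x :: real ^ 'n) y s. t > 0 \<Longrightarrow> t / 2 < s \<Longrightarrow>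
      norm (heat_kernel0 \<nu> (t - s) (x - y) - profile_kernel \<nu> m t x y s)
        \<le> C * ((norm y + sqrt s) / sqrt t) ^ m * gauss c t x + (if s < t then C * gauss c (t - s) (x - y) else 0)"
proof -
  obtain B c where B: "B > 0" "c > 0"
    and b1: "\<And>\<tau> (z :: real ^ 'n). \<tau> > 0 \<Longrightarrow> norm (heat_kernel (of_real \<tau> * \<nu>) z) \<le> B * gauss c \<tau> z"
    and b2: "\<And>t (x :: real ^ 'n) y s. t > 0 \<Longrightarrow> 0 \<le> s \<Longrightarrow>
      norm (profile_kernel \<nu> m t x y s) \<le> B * (1 + (norm y + sqrt s) / sqrt t) ^ m * gauss c t x"
    and b3: "\<And>t (x :: real ^ 'n) y s j. t > 0 \<Longrightarrow> 0 \<le> s \<Longrightarrow> s \<le> t / 2 \<Longrightarrow> j \<in> {m, m + 1} \<Longrightarrow>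
      norm (heat_kernel (of_real (t - s) * \<nu>) (x - y) - profile_kernel \<nu> m t x y s)
        \<le> B * ((norm y + sqrt s) / sqrt t) ^ j * (gauss c t x + gauss c t (x - y))"
    by (rule heat_kernel_expansion[OF Re_nu, where m = m]) blast
  define C where "C = B * 3 ^ m"
  have BC: "B \<le> C" unfolding C_def using B by simp
  show ?thesis
  proof (rule that[of C c])
    show "C > 0" using B BC by linarith
    show "c > 0" by fact
    show "norm (heat_kernel0 \<nu> \<tau> z) \<le> C * gauss c \<tau> z" if "\<tau> > 0" for \<tau> and z :: "real ^ 'n"
      using b1[OF that, of z] that mult_right_mono[OF BC gauss_nonneg[of c \<tau> z]] by (simp add: heat_kernel0_def)
    fix t s :: real and x y :: "real ^ 'n" assume t: "t > 0"
    {
      fix j assume s: "0 \<le> s" "s \<le> t / 2" and j: "j \<in> {m, m + 1}"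
      have "norm (heat_kernel0 \<nu> (t - s) (x - y) - profile_kernel \<nu> m t x y s)
        \<le> B * (((norm y + sqrt s) / sqrt t) ^ j * (gauss c t x + gauss c t (x - y)))"
        using b3[OF t s j, of x y] s t by (simp add: heat_kernel0_def mult.assoc)
      also have "\<dots> \<le> C * (((norm y + sqrt s) / sqrt t) ^ j * (gauss c t x + gauss c t (x - y)))"
        using BC s t by (intro mult_right_mono) auto
      finally show "norm (heat_kernel0 \<nu> (t - s) (x - y) - profile_kernel \<nu> m t x y s)
        \<le> C * ((norm y + sqrt s) / sqrt t) ^ j * (gauss c t x + gauss c t (x - y))" by (simp add: mult.assoc)
    }
    assume s: "t / 2 < s"
    define \<rho> where "\<rho> = (norm y + sqrt s) / sqrt t"
    have "sqrt s \<ge> sqrt t / 2"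
    proof (rule real_le_rsqrt)
      show "(sqrt t / 2)\<^sup>2 \<le> s" using s t by (simp add: power_divide)
    qed
    then have "1 / 2 \<le> \<rho>" using t by (simp add: \<rho>_def field_simps add_increasing2)
    then have "(1 + \<rho>) ^ m \<le> (3 * \<rho>) ^ m" by (intro power_mono) auto
    then have "B * (1 + \<rho>) ^ m * gauss c t x \<le> B * (3 * \<rho>) ^ m * gauss c t x"
      using B by (intro mult_right_mono mult_left_mono) auto
    then have P: "norm (profile_kernel \<nu> m t x y s) \<le> C * \<rho> ^ m * gauss c t x"
      using b2[OF t, of s x y] s t by (simp add: C_def \<rho>_def[symmetric] power_mult_distrib mult.assoc)
    have H: "norm (heat_kernel0 \<nu> (t - s) (x - y)) \<le> (if s < t then C * gauss c (t - s) (x - y) else 0)"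
      using b1[of "t - s" "x - y"] mult_right_mono[OF BC gauss_nonneg[of c "t - s" "x - y"]]
      by (auto simp: heat_kernel0_def)
    show "norm (heat_kernel0 \<nu> (t - s) (x - y) - profile_kernel \<nu> m t x y s)
        \<le> C * ((norm y + sqrt s) / sqrt t) ^ m * gauss c t x + (if s < t then C * gauss c (t - s) (x - y) else 0)"
      using norm_triangle_ineq4[of "heat_kernel0 \<nu> (t - s) (x - y)" "profile_kernel \<nu> m t x y s"] P H
      unfolding \<rho>_def by linarith
  qed
qed

text \<open>The weighted bound integrated over a set S of times; it serves the slabs (0, t/2], (t/2,
  \<infinity>) and (t/2, t).\<close>

lemma w_slab:
  assumes Z: "Z > 0"
    "\<And>s j. s > 0 \<Longrightarrow> j \<le> m + 1 \<Longrightarrow> (\<integral>\<^sup>+y. ennreal ((norm y + sqrt s) ^ j * norm (w s y)) \<partial>lborel)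
       \<le> ennreal (Z * (1 + s) powr (real j / 2 - (\<sigma> + 1)))"
    and S: "S \<in> sets borel" "S \<subseteq> {0<..}" and j: "j \<le> m + 1" and a: "a \<ge> 0"
    and I: "(\<integral>\<^sup>+s. ennreal ((1 + s) powr (real j / 2 - (\<sigma> + 1))) * indicator S s \<partial>lborel) \<le> ennreal I" "I \<ge> 0"
  shows "(\<integral>\<^sup>+z. ennreal (a * (norm (snd z) + sqrt (fst z)) ^ j) * ennreal (norm (w (fst z) (snd z))) * indicator S (fst z) \<partial>(lborel \<Otimes>\<^sub>M lborel))
    \<le> ennreal (a * Z * I)"
proof -
  note S(1)[measurable]
  have "(\<lambda>z. ennreal (a * (norm (snd z) + sqrt (fst z)) ^ j) * ennreal (norm (w (fst z) (snd z))) * indicator S (fst z)) \<in> borel_measurable (lborel \<Otimes>\<^sub>M lborel)"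
    by measurable
  from lborel.nn_integral_fst[OF this]
  have "(\<integral>\<^sup>+z. ennreal (a * (norm (snd z) + sqrt (fst z)) ^ j) * ennreal (norm (w (fst z) (snd z))) * indicator S (fst z) \<partial>(lborel \<Otimes>\<^sub>M lborel))
    = (\<integral>\<^sup>+s. \<integral>\<^sup>+y. ennreal (a * (norm y + sqrt s) ^ j) * ennreal (norm (w s y)) * indicator S s \<partial>lborel \<partial>lborel)"
    by simp
  also have "\<dots> \<le> (\<integral>\<^sup>+s. ennreal (a * Z) * (ennreal ((1 + s) powr (real j / 2 - (\<sigma> + 1))) * indicator S s) \<partial>lborel)"
  proof (rule nn_integral_mono)
    fix s :: real
    show "(\<integral>\<^sup>+y. ennreal (a * (norm y + sqrt s) ^ j) * ennreal (norm (w s y)) * indicator S s \<partial>lborel)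
      \<le> ennreal (a * Z) * (ennreal ((1 + s) powr (real j / 2 - (\<sigma> + 1))) * indicator S s)"
    proof (cases "s \<in> S")
      case True
      then have s: "s > 0" using S by auto
      have "(\<integral>\<^sup>+y. ennreal (a * (norm y + sqrt s) ^ j) * ennreal (norm (w s y)) * indicator S s \<partial>lborel)
         = (\<integral>\<^sup>+y. ennreal a * ennreal ((norm y + sqrt s) ^ j * norm (w s y)) \<partial>lborel)"
        using True a s by (intro nn_integral_cong) (simp add: mult.assoc flip: ennreal_mult)
      also have "\<dots> = ennreal a * (\<integral>\<^sup>+y. ennreal ((norm y + sqrt s) ^ j * norm (w s y)) \<partial>lborel)"
        by (rule nn_integral_cmult) measurable
      also have "\<dots> \<le> ennreal a * ennreal (Z * (1 + s) powr (real j / 2 - (\<sigma> + 1)))"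
        by (intro mult_left_mono Z(2) s j) simp
      also have "\<dots> = ennreal (a * Z) * (ennreal ((1 + s) powr (real j / 2 - (\<sigma> + 1))) * indicator S s)"
        using True a Z(1) by (simp add: mult.assoc flip: ennreal_mult)
      finally show ?thesis .
    qed simp
  qed
  also have "\<dots> = ennreal (a * Z) * (\<integral>\<^sup>+s. ennreal ((1 + s) powr (real j / 2 - (\<sigma> + 1))) * indicator S s \<partial>lborel)"
    by (rule nn_integral_cmult) measurable
  also have "\<dots> \<le> ennreal (a * Z) * ennreal I" by (intro mult_left_mono I) simp
  also have "\<dots> = ennreal (a * Z * I)" using a Z(1) I(2) by (simp flip: ennreal_mult)
  finally show ?thesis .
qed

text \<open>
  The measure \<open>\<mu>\<close> will be Lebesgue measure for the $L^1$ bound and a Dirac measure for the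
  $L^\infty$ bound.
\<close>

lemma error_integral:
  assumes \<mu>: "sigma_finite_measure \<mu>" and sets_mu [measurable_cong]: "sets \<mu> = sets borel"
    and t: "t > 0" and C: "C > 0" "c > 0"
    and near: "\<And>(x :: real ^ 'n) y s j. 0 \<le> s \<Longrightarrow> s \<le> t / 2 \<Longrightarrow> j \<in> {m, m + 1} \<Longrightarrow>
      norm (heat_kernel0 \<nu> (t - s) (x - y) - profile_kernel \<nu> m t x y s)
        \<le> C * ((norm y + sqrt s) / sqrt t) ^ j * (gauss c t x + gauss c t (x - y))"
    and far: "\<And>(x :: real ^ 'n) y s. t / 2 < s \<Longrightarrow>
      norm (heat_kernel0 \<nu> (t - s) (x - y) - profile_kernel \<nu> m t x y s)
        \<le> C * ((norm y + sqrt s) / sqrt t) ^ m * gauss c t x + (if s < t then C * gauss c (t - s) (x - y) else 0)"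
    and Z0: "Z0 > 0" "(\<integral>\<^sup>+x. ennreal ((1 + norm x) ^ (m + 1) * norm (u\<^sub>b x)) \<partial>lborel) \<le> ennreal Z0"
    and Z: "Z > 0"
    "\<And>s j. s > 0 \<Longrightarrow> j \<le> m + 1 \<Longrightarrow> (\<integral>\<^sup>+y. ennreal ((norm y + sqrt s) ^ j * norm (w s y)) \<partial>lborel)
       \<le> ennreal (Z * (1 + s) powr (real j / 2 - (\<sigma> + 1)))"
    and G: "\<And>y. (\<integral>\<^sup>+x. ennreal (gauss c t (x - y)) \<partial>\<mu>) \<le> ennreal G" "G \<ge> 0"
    and I: "(\<integral>\<^sup>+s. ennreal ((1 + s) powr (real (m + 1) / 2 - (\<sigma> + 1))) * indicator {0<..t / 2} s \<partial>lborel) \<le> ennreal I" "I \<ge> 0"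
    and J: "(\<integral>\<^sup>+s. ennreal ((1 + s) powr (real m / 2 - (\<sigma> + 1))) * indicator {t / 2<..} s \<partial>lborel) \<le> ennreal J" "J \<ge> 0"
    and M: "(\<integral>\<^sup>+x. \<integral>\<^sup>+z. ennreal (C * gauss c (t - fst z) (x - snd z)) * ennreal (norm (w (fst z) (snd z)))
       * indicator {t / 2<..<t} (fst z) \<partial>(lborel \<Otimes>\<^sub>M lborel) \<partial>\<mu>) \<le> ennreal M" "M \<ge> 0"
    and j: "j \<in> {m, m + 1}"
  shows "\<exists>E\<in>borel_measurable borel. (\<forall>x. error t x \<le> E x) \<and> (\<integral>\<^sup>+x. E x \<partial>\<mu>) \<le> ennreal (C * (1 / sqrt t) ^ j * Z0 * (2 * G)
      + C * (1 / sqrt t) ^ (m + 1) * Z * I * (2 * G) + C * (1 / sqrt t) ^ m * Z * J * G + M)"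
proof -
  let ?T = "1 / sqrt t"
  \<comment> \<open>The sources of the four parts: the initial value; times up to t/2, with degree m
    + 1; later times, with degree m, for the polynomial; and the heat kernel for t/2 < s < t, kept
    apart since its Gaussian has time t - s.\<close>
  define h0 where "h0 = (\<lambda>y :: real ^ 'n. ennreal (C * ?T ^ j) * ennreal (norm y ^ j * norm (u\<^sub>b y)))"
  define h1 where "h1 = (\<lambda>z :: real \<times> (real ^ 'n). ennreal (C * ?T ^ (m + 1) * (norm (snd z) + sqrt (fst z)) ^ (m + 1))
     * ennreal (norm (w (fst z) (snd z))) * indicator {0<..t / 2} (fst z))"
  define h2 where "h2 = (\<lambda>z :: real \<times> (real ^ 'n). ennreal (C * ?T ^ m * (norm (snd z) + sqrt (fst z)) ^ m)
     * ennreal (norm (w (fst z) (snd z))) * indicator {t / 2<..} (fst z))"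
  define h3 where "h3 = (\<lambda>x (z :: real \<times> (real ^ 'n)). ennreal (C * gauss c (t - fst z) (x - snd z)) * ennreal (norm (w (fst z) (snd z)))
       * indicator {t / 2<..<t} (fst z))"
  have hm [measurable]: "h0 \<in> borel_measurable borel" "h1 \<in> borel_measurable (borel \<Otimes>\<^sub>M borel)" "h2 \<in> borel_measurable (borel \<Otimes>\<^sub>M borel)"
    unfolding h0_def h1_def h2_def by measurable
  have h3m [measurable]: "(\<lambda>q. h3 (fst q) (snd q)) \<in> borel_measurable (borel \<Otimes>\<^sub>M (borel \<Otimes>\<^sub>M borel))"
    unfolding h3_def gauss_def by measurable
  have gm [measurable]: "(\<lambda>q. gauss c t (f q - g q)) \<in> borel_measurable N"
    if "f \<in> borel_measurable N" "g \<in> borel_measurable N" for f g :: "'z \<Rightarrow> real ^ 'n" and N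
    using that unfolding gauss_def by measurable
  define A where "A = (\<lambda>x :: real ^ 'n. \<integral>\<^sup>+y. h0 y * ennreal (gauss c t x + gauss c t (x - y)) \<partial>lborel)"
  define B1 where "B1 = (\<lambda>x :: real ^ 'n. \<integral>\<^sup>+z. h1 z * ennreal (gauss c t x + gauss c t (x - snd z)) \<partial>(lborel \<Otimes>\<^sub>M lborel))"
  define B2 where "B2 = (\<lambda>x :: real ^ 'n. \<integral>\<^sup>+z. h2 z * ennreal (gauss c t x) \<partial>(lborel \<Otimes>\<^sub>M lborel))"
  define B3 where "B3 = (\<lambda>x :: real ^ 'n. \<integral>\<^sup>+z. h3 x z \<partial>(lborel \<Otimes>\<^sub>M lborel))"
  have le1: "ennreal (norm (heat_kernel0 \<nu> t (x - y) - profile_kernel \<nu> m t x y 0)) * ennreal (norm (u\<^sub>b y))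
      \<le> h0 y * ennreal (gauss c t x + gauss c t (x - y))" for x y
  proof -
    have "norm (heat_kernel0 \<nu> t (x - y) - profile_kernel \<nu> m t x y 0) \<le> C * (norm y / sqrt t) ^ j * (gauss c t x + gauss c t (x - y))"
      using near[of 0 j x y] t j by simp
    then have "norm (heat_kernel0 \<nu> t (x - y) - profile_kernel \<nu> m t x y 0) * norm (u\<^sub>b y)
        \<le> C * (norm y / sqrt t) ^ j * (gauss c t x + gauss c t (x - y)) * norm (u\<^sub>b y)"
      by (rule mult_right_mono) simp
    also have "\<dots> = (C * ?T ^ j) * (norm y ^ j * norm (u\<^sub>b y)) * (gauss c t x + gauss c t (x - y))"
      by (simp add: power_divide)
    finally show ?thesis
      using C t unfolding h0_def by (simp add: ennreal_leI del: ennreal_plus flip: ennreal_mult)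
  qed
  have le2: "ennreal (norm (heat_kernel0 \<nu> (t - s) (x - y) - profile_kernel \<nu> m t x y s)) * ennreal (norm (w s y))
      \<le> h1 (s, y) * ennreal (gauss c t x + gauss c t (x - y)) + h2 (s, y) * ennreal (gauss c t x) + h3 x (s, y)" for x y s
  proof -
    consider "s \<le> 0" | "0 < s" "s \<le> t / 2" | "t / 2 < s" by linarith
    then show ?thesis
    proof cases
      case 1
      then show ?thesis by (simp add: w_neg)
    next
      case 2
      have "norm (heat_kernel0 \<nu> (t - s) (x - y) - profile_kernel \<nu> m t x y s) * norm (w s y)
          \<le> C * ((norm y + sqrt s) / sqrt t) ^ (m + 1) * (gauss c t x + gauss c t (x - y)) * norm (w s y)"
        using near[of s "m + 1" x y] 2 by (intro mult_right_mono) auto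
      also have "\<dots> = (C * ?T ^ (m + 1) * (norm y + sqrt s) ^ (m + 1)) * norm (w s y) * (gauss c t x + gauss c t (x - y))"
        by (simp add: power_divide)
      finally have "ennreal (norm (heat_kernel0 \<nu> (t - s) (x - y) - profile_kernel \<nu> m t x y s)) * ennreal (norm (w s y))
        \<le> h1 (s, y) * ennreal (gauss c t x + gauss c t (x - y))"
        using C t 2 unfolding h1_def by (simp add: ennreal_leI del: ennreal_plus flip: ennreal_mult)
      then show ?thesis by (simp add: add_increasing2)
    next
      case 3
      then have s: "s > 0" using t by linarith
      define g where "g = (if s < t then C * gauss c (t - s) (x - y) else 0)"
      have g0: "g \<ge> 0" using C by (simp add: g_def)
      have "norm (heat_kernel0 \<nu> (t - s) (x - y) - profile_kernel \<nu> m t x y s) * norm (w s y)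
          \<le> (C * ((norm y + sqrt s) / sqrt t) ^ m * gauss c t x + g) * norm (w s y)"
        using far[OF 3, of x y] by (intro mult_right_mono) (auto simp: g_def)
      also have "\<dots> = (C * ?T ^ m * (norm y + sqrt s) ^ m) * norm (w s y) * gauss c t x + g * norm (w s y)"
        by (simp add: power_divide algebra_simps)
      finally have "ennreal (norm (heat_kernel0 \<nu> (t - s) (x - y) - profile_kernel \<nu> m t x y s) * norm (w s y))
        \<le> ennreal ((C * ?T ^ m * (norm y + sqrt s) ^ m) * norm (w s y) * gauss c t x + g * norm (w s y))"
        by (rule ennreal_leI)
      also have "\<dots> = ennreal ((C * ?T ^ m * (norm y + sqrt s) ^ m) * norm (w s y) * gauss c t x) + ennreal (g * norm (w s y))"
        using C t s g0 by (intro ennreal_plus) auto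
      also have "ennreal ((C * ?T ^ m * (norm y + sqrt s) ^ m) * norm (w s y) * gauss c t x) = h2 (s, y) * ennreal (gauss c t x)"
        using C t s 3 unfolding h2_def by (simp flip: ennreal_mult)
      also have "ennreal (g * norm (w s y)) = h3 x (s, y)"
        using C 3 unfolding h3_def g_def by (simp add: ennreal_mult)
      finally show ?thesis using 3 by (simp add: ennreal_mult h1_def)
    qed
  qed
  have err: "error t x \<le> A x + (B1 x + B2 x + B3 x)" for x
  proof -
    have "(\<integral>\<^sup>+z. ennreal (norm (heat_kernel0 \<nu> (t - fst z) (x - snd z) - profile_kernel \<nu> m t x (snd z) (fst z))) * ennreal (norm (w (fst z) (snd z))) \<partial>lborel)
       \<le> (\<integral>\<^sup>+z. h1 z * ennreal (gauss c t x + gauss c t (x - snd z)) + h2 z * ennreal (gauss c t x) + h3 x z \<partial>(lborel \<Otimes>\<^sub>M lborel))"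
      unfolding lborel_prod
    proof (rule nn_integral_mono)
      fix z :: "real \<times> (real ^ 'n)"
      show "ennreal (norm (heat_kernel0 \<nu> (t - fst z) (x - snd z) - profile_kernel \<nu> m t x (snd z) (fst z))) * ennreal (norm (w (fst z) (snd z)))
        \<le> h1 z * ennreal (gauss c t x + gauss c t (x - snd z)) + h2 z * ennreal (gauss c t x) + h3 x z"
        using le2[of "fst z" x "snd z"] by simp
    qed
    also have "\<dots> = B1 x + B2 x + B3 x"
    proof -
      have h3x: "h3 x \<in> borel_measurable (borel \<Otimes>\<^sub>M borel)"
        unfolding h3_def gauss_def by measurable
      show ?thesis unfolding B1_def B2_def B3_def using h3x by (simp add: nn_integral_add)
    qed
    finally show ?thesis
      unfolding error_def A_def by (intro add_mono nn_integral_mono le1)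
  qed
  \<comment> \<open>Tonelli puts the integral over \<mu> inside, where only the mass G of a Gaussian
    of time t enters.\<close>
  have mA: "(\<integral>\<^sup>+x. A x \<partial>\<mu>) \<le> ennreal (C * ?T ^ j * Z0 * (2 * G))"
  proof -
    have "(\<integral>\<^sup>+x. A x \<partial>\<mu>) = (\<integral>\<^sup>+y. \<integral>\<^sup>+x. h0 y * ennreal (gauss c t x + gauss c t (x - y)) \<partial>\<mu> \<partial>lborel)"
      unfolding A_def by (rule nn_integral_swap_sigma_finite1[OF \<mu> sets_mu]) measurable
    also have "\<dots> \<le> (\<integral>\<^sup>+y. h0 y * ennreal (2 * G) \<partial>lborel)"
      by (intro nn_integral_mono nn_integral_cmult_gauss_le(1)[OF sets_mu G])
    also have "\<dots> = (\<integral>\<^sup>+y. h0 y \<partial>lborel) * ennreal (2 * G)" by (rule nn_integral_multc) simp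
    also have "(\<integral>\<^sup>+y. h0 y \<partial>lborel) = ennreal (C * ?T ^ j) * (\<integral>\<^sup>+y. ennreal (norm y ^ j * norm (u\<^sub>b y)) \<partial>lborel)"
      unfolding h0_def by (rule nn_integral_cmult) measurable
    also have "(\<integral>\<^sup>+y. ennreal (norm y ^ j * norm (u\<^sub>b y)) \<partial>lborel) \<le> ennreal Z0"
    proof (rule order.trans[OF nn_integral_mono Z0(2)], rule ennreal_leI, rule mult_right_mono)
      fix y :: "real ^ 'n"
      have "norm y ^ j \<le> (1 + norm y) ^ j" by (intro power_mono) auto
      also have "\<dots> \<le> (1 + norm y) ^ (m + 1)" using j by (intro power_increasing) auto
      finally show "norm y ^ j \<le> (1 + norm y) ^ (m + 1)" .
    qed simp
    finally have "(\<integral>\<^sup>+x. A x \<partial>\<mu>) \<le> ennreal (C * ?T ^ j) * ennreal Z0 * ennreal (2 * G)"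
      by (simp add: mult_left_mono mult_right_mono)
    also have "\<dots> = ennreal (C * ?T ^ j * Z0 * (2 * G))" using C t Z0 G by (simp flip: ennreal_mult)
    finally show ?thesis .
  qed
  have mB1: "(\<integral>\<^sup>+x. B1 x \<partial>\<mu>) \<le> ennreal (C * ?T ^ (m + 1) * Z * I * (2 * G))"
  proof -
    have "(\<integral>\<^sup>+x. B1 x \<partial>\<mu>) = (\<integral>\<^sup>+z. \<integral>\<^sup>+x. h1 z * ennreal (gauss c t x + gauss c t (x - snd z)) \<partial>\<mu> \<partial>(lborel \<Otimes>\<^sub>M lborel))"
      unfolding B1_def by (rule nn_integral_swap_sigma_finite[OF \<mu> sets_mu]) measurable
    also have "\<dots> \<le> (\<integral>\<^sup>+z. h1 z * ennreal (2 * G) \<partial>(lborel \<Otimes>\<^sub>M lborel))"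
      by (intro nn_integral_mono nn_integral_cmult_gauss_le(1)[OF sets_mu G])
    also have "\<dots> = (\<integral>\<^sup>+z. h1 z \<partial>(lborel \<Otimes>\<^sub>M lborel)) * ennreal (2 * G)" by (rule nn_integral_multc) simp
    also have "\<dots> \<le> ennreal (C * ?T ^ (m + 1) * Z * I) * ennreal (2 * G)"
      unfolding h1_def using C t by (intro mult_right_mono w_slab[OF Z _ _ _ _ I]) auto
    also have "\<dots> = ennreal (C * ?T ^ (m + 1) * Z * I * (2 * G))" using C t Z(1) I G by (simp flip: ennreal_mult)
    finally show ?thesis .
  qed
  have mB2: "(\<integral>\<^sup>+x. B2 x \<partial>\<mu>) \<le> ennreal (C * ?T ^ m * Z * J * G)"
  proof -
    have "(\<integral>\<^sup>+x. B2 x \<partial>\<mu>) = (\<integral>\<^sup>+z. \<integral>\<^sup>+x. h2 z * ennreal (gauss c t x) \<partial>\<mu> \<partial>(lborel \<Otimes>\<^sub>M lborel))"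
      unfolding B2_def by (rule nn_integral_swap_sigma_finite[OF \<mu> sets_mu]) measurable
    also have "\<dots> \<le> (\<integral>\<^sup>+z. h2 z * ennreal G \<partial>(lborel \<Otimes>\<^sub>M lborel))"
      by (intro nn_integral_mono nn_integral_cmult_gauss_le(2)[OF sets_mu G])
    also have "\<dots> = (\<integral>\<^sup>+z. h2 z \<partial>(lborel \<Otimes>\<^sub>M lborel)) * ennreal G" by (rule nn_integral_multc) simp
    also have "\<dots> \<le> ennreal (C * ?T ^ m * Z * J) * ennreal G"
      unfolding h2_def using C t by (intro mult_right_mono w_slab[OF Z _ _ _ _ J]) auto
    also have "\<dots> = ennreal (C * ?T ^ m * Z * J * G)" using C t Z(1) J G by (simp flip: ennreal_mult)
    finally show ?thesis .
  qed
  have meas: "A \<in> borel_measurable \<mu>" "B1 \<in> borel_measurable \<mu>" "B2 \<in> borel_measurable \<mu>" "B3 \<in> borel_measurable \<mu>"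
  proof -
    have "A \<in> borel_measurable borel" unfolding A_def
      by (rule lborel.borel_measurable_nn_integral) (simp add: case_prod_beta', measurable)
    moreover have "B1 \<in> borel_measurable borel" unfolding B1_def
      by (rule sigma_finite_measure.borel_measurable_nn_integral[OF lborel_pair.sigma_finite_measure_axioms])
         (simp add: case_prod_beta', measurable)
    moreover have "B2 \<in> borel_measurable borel" unfolding B2_def
      by (rule sigma_finite_measure.borel_measurable_nn_integral[OF lborel_pair.sigma_finite_measure_axioms])
         (simp add: case_prod_beta', measurable)
    moreover have "B3 \<in> borel_measurable borel" unfolding B3_def
      by (rule sigma_finite_measure.borel_measurable_nn_integral[OF lborel_pair.sigma_finite_measure_axioms])
         (simp add: case_prod_beta', measurable)
    ultimately show "A \<in> borel_measurable \<mu>" "B1 \<in> borel_measurable \<mu>" "B2 \<in> borel_measurable \<mu>" "B3 \<in> borel_measurable \<mu>"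
      by measurable
  qed
  have "(\<integral>\<^sup>+x. A x + (B1 x + B2 x + B3 x) \<partial>\<mu>) = (\<integral>\<^sup>+x. A x \<partial>\<mu>) + ((\<integral>\<^sup>+x. B1 x \<partial>\<mu>) + (\<integral>\<^sup>+x. B2 x \<partial>\<mu>) + (\<integral>\<^sup>+x. B3 x \<partial>\<mu>))"
    using meas by (simp add: nn_integral_add)
  also have "\<dots> \<le> ennreal (C * ?T ^ j * Z0 * (2 * G)) + (ennreal (C * ?T ^ (m + 1) * Z * I * (2 * G)) + ennreal (C * ?T ^ m * Z * J * G) + ennreal M)"
    using mA mB1 mB2 M(1) unfolding B3_def h3_def by (intro add_mono) auto
  also have "\<dots> = ennreal (C * ?T ^ j * Z0 * (2 * G)
      + C * ?T ^ (m + 1) * Z * I * (2 * G) + C * ?T ^ m * Z * J * G + M)"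
    using C t Z0(1) Z(1) G(2) I(2) J(2) M(2) by (simp add: add.assoc flip: ennreal_plus)
  finally have bound: "(\<integral>\<^sup>+x. A x + (B1 x + B2 x + B3 x) \<partial>\<mu>) \<le> ennreal (C * ?T ^ j * Z0 * (2 * G)
      + C * ?T ^ (m + 1) * Z * I * (2 * G) + C * ?T ^ m * Z * J * G + M)" .
  have "(\<lambda>x. A x + (B1 x + B2 x + B3 x)) \<in> borel_measurable \<mu>"
    using meas by simp
  then have "(\<lambda>x. A x + (B1 x + B2 x + B3 x)) \<in> borel_measurable borel"
    using sets_mu by (simp cong: measurable_cong_sets)
  then show ?thesis using err bound by (intro bexI[of _ "\<lambda>x. A x + (B1 x + B2 x + B3 x)"]) auto
qed

end

section \<open>Time integrals and the three rates\<close>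

lemma nn_integral_one_plus_powr_tail:
  assumes d: "d > 0" and r: "r \<ge> (0::real)"
  shows "(\<integral>\<^sup>+s. ennreal ((1 + s) powr (- (d + 1))) * indicator {r<..} s \<partial>lborel) \<le> ennreal ((1 + r) powr (- d) / d)"
proof -
  have "(\<integral>\<^sup>+s. ennreal ((1 + s) powr (- (d + 1))) * indicator {r<..} s \<partial>lborel)
      \<le> (\<integral>\<^sup>+s. ennreal ((1 + s) powr (- (d + 1))) * indicator {r..} s \<partial>lborel)"
    by (intro nn_integral_mono) (auto simp: indicator_def)
  also have "\<dots> = ennreal (0 - (- ((1 + r) powr (- d) / d)))"
  proof (rule nn_integral_FTC_atLeast)
    fix s :: real assume "r \<le> s"
    then have "((\<lambda>s. (1 + s) powr (- d)) has_real_derivative (- d) * (1 + s) powr (- d - 1)) (at s)"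
      using r by (auto intro!: derivative_eq_intros)
    then have "((\<lambda>s. - ((1 + s) powr (- d) / d)) has_real_derivative - ((- d) * (1 + s) powr (- d - 1) / d)) (at s)"
      by (intro DERIV_minus DERIV_cdivide)
    moreover have "- ((- d) * (1 + s) powr (- d - 1) / d) = (1 + s) powr (- (d + 1))"
      using d by simp
    ultimately show "((\<lambda>s. - ((1 + s) powr (- d) / d)) has_real_derivative (1 + s) powr (- (d + 1))) (at s)"
      by simp
  next
    have l: "((\<lambda>s. (1 + s) powr (- d)) \<longlongrightarrow> 0) at_top"
      using d by (intro tendsto_neg_powr filterlim_tendsto_add_at_top[OF tendsto_const filterlim_ident]) auto
    show "((\<lambda>s. - ((1 + s) powr (- d) / d)) \<longlongrightarrow> 0) at_top"
      using tendsto_minus[OF tendsto_divide[OF l tendsto_const[of d]]] d by simp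
  qed auto
  finally show ?thesis by simp
qed

text \<open>The fractions x/(1 + x) and 1/(1 + x) add up to 1, and neither exceeds its power of
  exponent e \<le> 1.\<close>

lemma one_plus_powr_le:
  assumes "0 \<le> x" "0 < e" "e \<le> (1::real)"
  shows "(1 + x) powr e \<le> 1 + x powr e"
proof -
  define q where "q = x / (1 + x)"
  define r where "r = 1 / (1 + x)"
  have q: "0 \<le> q" "q \<le> 1" "0 \<le> r" "r \<le> 1" "q + r = 1" using assms by (auto simp: q_def r_def field_simps)
  have "q powr 1 \<le> q powr e" by (rule powr_mono') (use q assms in auto)
  moreover have "r powr 1 \<le> r powr e" by (rule powr_mono') (use q assms in auto)
  ultimately have "1 \<le> q powr e + r powr e" using q by simp
  also have "\<dots> = (x powr e + 1) / (1 + x) powr e"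
    using assms by (simp add: q_def r_def powr_divide add_divide_distrib)
  finally show ?thesis using assms by (simp add: le_divide_eq)
qed

text \<open>Used with e = 1/2 - (\<sigma> - m/2), whose sign decides between the three rates. For e
  > 0 the bound is r^e/e and not (1 + r)^e/e: it has to be homogeneous to give a pure power of t for
  small t as well.\<close>

lemma near_integral:
  assumes e: "e \<le> 1" and r: "r \<ge> (0::real)"
  defines "I \<equiv> (if e > 0 then r powr e / e else if e = 0 then ln (1 + r) else 1 / (- e))"
  shows "(\<integral>\<^sup>+s. ennreal ((1 + s) powr (e - 1)) * indicator {0<..r} s \<partial>lborel) \<le> ennreal I" and "I \<ge> 0"
proof -
  show "I \<ge> 0" using r by (auto simp: I_def)
  have "(\<integral>\<^sup>+s. ennreal ((1 + s) powr (e - 1)) * indicator {0<..r} s \<partial>lborel)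
     \<le> (\<integral>\<^sup>+s. ennreal ((1 + s) powr (e - 1)) * indicator {0..r} s \<partial>lborel)"
    by (intro nn_integral_mono) (auto simp: indicator_def)
  also have "\<dots> \<le> ennreal I"
  proof -
    consider "e > 0" | "e = 0" | "e < 0" by linarith
    then show ?thesis
    proof cases
      case 1
      have "(\<integral>\<^sup>+s. ennreal ((1 + s) powr (e - 1)) * indicator {0..r} s \<partial>lborel)
          = ennreal ((1 + r) powr e / e - (1 + 0) powr e / e)"
      proof (rule nn_integral_FTC_Icc)
        fix s assume "s \<in> {0..r}"
        then have "((\<lambda>s. (1 + s) powr e) has_real_derivative e * (1 + s) powr (e - 1)) (at s)"
          by (auto intro!: derivative_eq_intros)
        then have "((\<lambda>s. (1 + s) powr e / e) has_real_derivative e * (1 + s) powr (e - 1) / e) (at s)"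
          by (rule DERIV_cdivide)
        then show "((\<lambda>s. (1 + s) powr e / e) has_real_derivative (1 + s) powr (e - 1)) (at s)"
          using 1 by simp
      qed (use r in auto)
      also have "\<dots> \<le> ennreal (r powr e / e)"
      proof (rule ennreal_leI)
        have "((1 + r) powr e - 1) / e \<le> r powr e / e"
          using one_plus_powr_le[OF r 1 e] 1 by (intro divide_right_mono) auto
        then show "(1 + r) powr e / e - (1 + 0) powr e / e \<le> r powr e / e" by (simp add: diff_divide_distrib)
      qed
      finally show ?thesis using 1 by (simp add: I_def)
    next
      case 2
      have "(\<integral>\<^sup>+s. ennreal ((1 + s) powr (e - 1)) * indicator {0..r} s \<partial>lborel) = ennreal (ln (1 + r) - ln (1 + 0))"
      proof (rule nn_integral_FTC_Icc)
        fix s assume "s \<in> {0..r}"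
        then have "((\<lambda>s. ln (1 + s)) has_real_derivative 1 / (1 + s)) (at s)"
          by (auto intro!: derivative_eq_intros)
        then show "((\<lambda>s. ln (1 + s)) has_real_derivative (1 + s) powr (e - 1)) (at s)"
          using 2 \<open>s \<in> {0..r}\<close> by (simp add: powr_minus inverse_eq_divide)
      qed (use r in auto)
      then show ?thesis using 2 by (simp add: I_def)
    next
      case 3
      have "(\<integral>\<^sup>+s. ennreal ((1 + s) powr (e - 1)) * indicator {0..r} s \<partial>lborel)
         \<le> (\<integral>\<^sup>+s. ennreal ((1 + s) powr (- (1 - e))) * indicator {0..} s \<partial>lborel)"
        by (intro nn_integral_mono) (auto simp: indicator_def)
      also have "\<dots> = ennreal (1 / (1 - e - 1))" by (rule nn_integral_one_plus_powr) (use 3 in simp)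
      finally show ?thesis using 3 by (simp add: I_def)
    qed
  qed
  finally show "(\<integral>\<^sup>+s. ennreal ((1 + s) powr (e - 1)) * indicator {0<..r} s \<partial>lborel) \<le> ennreal I" .
qed

text \<open>The three summands stem from the initial value, from times up to t/2, and from later
  times. For d < 1/2 the second is a multiple of t^(-d), and the first is below t^(-d) on either
  side of t = 1. For d = 1/2 constants are absorbed by ln(2 + t) \<ge> ln 2.\<close>

lemma rate_bound:
  fixes d :: real
  assumes d: "d > 0"
  defines "I \<equiv> \<lambda>t. (if 1 / 2 - d > 0 then (t / 2) powr (1 / 2 - d) / (1 / 2 - d)
     else if 1 / 2 - d = 0 then ln (1 + t / 2) else 1 / (- (1 / 2 - d)))"
  obtains B where "B > 0" "\<And>t. t > 0 \<Longrightarrow> min 1 (t powr (- (1 / 2))) + t powr (- (1 / 2)) * I t + (1 + t / 2) powr (- d)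
     \<le> B * (if d < 1 / 2 then t powr (- d) else if d = 1 / 2 then t powr (- (1 / 2)) * ln (2 + t) else t powr (- (1 / 2)))"
proof -
  have half: "(t / 2) powr (- b) = 2 powr b * t powr (- b)" if "t > 0" for t b :: real
    using that by (simp add: powr_divide powr_minus field_simps)
  have tail: "(1 + t / 2) powr (- b) \<le> 2 powr b * t powr (- b)" if "t > 0" "b > 0" for t b :: real
  proof -
    have "(1 + t / 2) powr (- b) \<le> (t / 2) powr (- b)" using that by (intro powr_mono2') auto
    then show ?thesis using half[OF that(1)] by simp
  qed
  consider "d < 1 / 2" | "d = 1 / 2" | "d > 1 / 2" by linarith
  then show ?thesis
  proof cases
    case 1
    define e where "e = 1 / 2 - d"
    have e: "e > 0" using 1 by (simp add: e_def)
    show ?thesis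
    proof (rule that[of "1 + 2 powr (- e) / e + 2 powr d"])
      show "1 + 2 powr (- e) / e + 2 powr d > 0" using e by (intro add_pos_pos) auto
      fix t :: real assume t: "t > 0"
      have a: "min 1 (t powr (- (1 / 2))) \<le> t powr (- d)"
      proof (cases "t \<le> 1")
        case True
        then have "t powr 0 \<le> t powr (- d)" using t d by (intro powr_mono') auto
        then show ?thesis using t by simp
      next
        case False
        then have "t powr (- (1 / 2)) \<le> t powr (- d)" using 1 by (intro powr_mono) auto
        then show ?thesis by simp
      qed
      have "t powr (- (1 / 2)) * I t = 2 powr (- e) / e * (t powr (- (1 / 2)) * t powr e)"
        using e half[OF t, of "- e"] by (simp add: I_def e_def[symmetric])
      also have "t powr (- (1 / 2)) * t powr e = t powr (- d)"
        unfolding powr_add[symmetric] e_def by (rule arg_cong[where f = "\<lambda>b. t powr b"]) simp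
      finally have b: "t powr (- (1 / 2)) * I t = 2 powr (- e) / e * t powr (- d)" .
      show "min 1 (t powr (- (1 / 2))) + t powr (- (1 / 2)) * I t + (1 + t / 2) powr (- d)
     \<le> (1 + 2 powr (- e) / e + 2 powr d) * (if d < 1 / 2 then t powr (- d) else if d = 1 / 2 then t powr (- (1 / 2)) * ln (2 + t) else t powr (- (1 / 2)))"
        using a b tail[OF t d] 1 by (simp add: algebra_simps)
    qed
  next
    case 2
    show ?thesis
    proof (rule that[of "1 / ln 2 + 1 + 2 powr (1 / 2) / ln 2"])
      show "1 / ln 2 + 1 + 2 powr (1 / 2) / ln 2 > (0::real)" by (intro add_pos_pos) auto
      fix t :: real assume t: "t > 0"
      define q where "q = t powr (- (1 / 2))"
      have q: "q > 0" using t by (simp add: q_def)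
      have l: "ln 2 \<le> ln (2 + t)" "ln (1 + t / 2) \<le> ln (2 + t)" "ln 2 > (0::real)" using t by auto
      have k: "q \<le> 1 / ln 2 * (q * ln (2 + t))"
        using q l by (simp add: field_simps)
      have a: "min 1 q \<le> 1 / ln 2 * (q * ln (2 + t))" using k by linarith
      have b: "q * I t \<le> q * ln (2 + t)" using q l 2 by (simp add: I_def)
      have "(1 + t / 2) powr (- d) \<le> 2 powr (1 / 2) * q" using tail[OF t, of "1 / 2"] unfolding 2 q_def by simp
      also have "\<dots> \<le> 2 powr (1 / 2) * (1 / ln 2 * (q * ln (2 + t)))" using k by (intro mult_left_mono) auto
      finally have c: "(1 + t / 2) powr (- d) \<le> 2 powr (1 / 2) / ln 2 * (q * ln (2 + t))" by simp
      have "min 1 q + q * I t + (1 + t / 2) powr (- d) \<le> (1 / ln 2 + 1 + 2 powr (1 / 2) / ln 2) * (q * ln (2 + t))"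
        unfolding distrib_right using a b c by linarith
      then show "min 1 (t powr (- (1 / 2))) + t powr (- (1 / 2)) * I t + (1 + t / 2) powr (- d)
     \<le> (1 / ln 2 + 1 + 2 powr (1 / 2) / ln 2) * (if d < 1 / 2 then t powr (- d) else if d = 1 / 2 then t powr (- (1 / 2)) * ln (2 + t) else t powr (- (1 / 2)))"
        unfolding 2 q_def by simp
    qed
  next
    case 3
    show ?thesis
    proof (rule that[of "1 + 1 / (d - 1 / 2) + 2 powr (1 / 2)"])
      show "1 + 1 / (d - 1 / 2) + 2 powr (1 / 2) > 0" using 3 by (intro add_pos_pos) auto
      fix t :: real assume t: "t > 0"
      define q where "q = t powr (- (1 / 2))"
      have "(1 + t / 2) powr (- d) \<le> (1 + t / 2) powr (- (1 / 2))" using t 3 by (intro powr_mono) auto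
      also have "\<dots> \<le> 2 powr (1 / 2) * q" unfolding q_def by (rule tail[OF t]) simp
      finally have c: "(1 + t / 2) powr (- d) \<le> 2 powr (1 / 2) * q" .
      have b: "q * I t = 1 / (d - 1 / 2) * q" using 3 by (simp add: I_def)
      have "min 1 q + q * I t + (1 + t / 2) powr (- d) \<le> (1 + 1 / (d - 1 / 2) + 2 powr (1 / 2)) * q"
        unfolding distrib_right b using c by linarith
      then show "min 1 (t powr (- (1 / 2))) + t powr (- (1 / 2)) * I t + (1 + t / 2) powr (- d)
     \<le> (1 + 1 / (d - 1 / 2) + 2 powr (1 / 2)) * (if d < 1 / 2 then t powr (- d) else if d = 1 / 2 then t powr (- (1 / 2)) * ln (2 + t) else t powr (- (1 / 2)))"
        using 3 by (simp add: q_def)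
    qed
  qed
qed

lemma asymptotic_profile_measurable:
  assumes "\<nu> \<noteq> 0"
  shows "asymptotic_profile \<nu> f u\<^sub>0 u m t \<in> borel_measurable (borel :: (real ^ 'n::finite) measure)"
proof -
  have "continuous_on UNIV (heat_kernel \<nu> :: real ^ 'n \<Rightarrow> complex)"
    unfolding heat_kernel_def using assms by (intro continuous_intros) auto
  then have [measurable]: "(heat_kernel \<nu> :: real ^ 'n \<Rightarrow> complex) \<in> borel_measurable borel"
    by (rule borel_measurable_continuous_onI)
  have [measurable]: "(hermite \<nu> \<alpha> :: real ^ 'n \<Rightarrow> complex) \<in> borel_measurable borel" for \<alpha>
    unfolding hermite_def by measurable
  show ?thesis
    unfolding asymptotic_profile_def Lambda_profile_def dilation_def by measurable
qed

section \<open>The heat kernel between t/2 and t\<close>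

context mild_solution
begin

text \<open>For s > t/2 the factors (1 + s)^(-b) and (1 + s)^(-m/2) are bounded by their analogues
  at t/2, which leaves the integrand of J.\<close>

lemma middle_weight:
  assumes t: "t > 0" and S: "S \<subseteq> {t / 2<..}"
    and J: "(\<integral>\<^sup>+s. ennreal ((1 + s) powr (real m / 2 - (\<sigma> + 1))) * indicator {t / 2<..} s \<partial>lborel) \<le> ennreal J"
    and b: "b \<ge> 0"
  shows "(\<integral>\<^sup>+s. ennreal ((1 + s) powr (- (\<sigma> + 1 + b))) * indicator S s \<partial>lborel)
     \<le> ennreal ((t / 2) powr (- b) * (t / 2) powr (- (real m / 2)) * J)"
proof -
  let ?a = "(t / 2) powr (- b) * (t / 2) powr (- (real m / 2))"
  have "(\<integral>\<^sup>+s. ennreal ((1 + s) powr (- (\<sigma> + 1 + b))) * indicator S s \<partial>lborel)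
     \<le> (\<integral>\<^sup>+s. ennreal ?a * (ennreal ((1 + s) powr (real m / 2 - (\<sigma> + 1))) * indicator {t / 2<..} s) \<partial>lborel)"
  proof (rule nn_integral_mono)
    fix s :: real
    show "ennreal ((1 + s) powr (- (\<sigma> + 1 + b))) * indicator S s
      \<le> ennreal ?a * (ennreal ((1 + s) powr (real m / 2 - (\<sigma> + 1))) * indicator {t / 2<..} s)"
    proof (cases "s \<in> S")
      case True
      then have s: "s > t / 2" using S by auto
      have "(1 + s) powr (- (\<sigma> + 1 + b)) = (1 + s) powr (- b) * (1 + s) powr (- (real m / 2)) * (1 + s) powr (real m / 2 - (\<sigma> + 1))"
        unfolding powr_add[symmetric] by (rule arg_cong[where f = "\<lambda>b. (1 + s) powr b"]) simp
      also have "\<dots> \<le> ?a * (1 + s) powr (real m / 2 - (\<sigma> + 1))"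
        using s t b by (intro mult_right_mono mult_mono powr_mono2') auto
      finally show ?thesis using True s by (simp add: ennreal_leI flip: ennreal_mult)
    qed simp
  qed
  also have "\<dots> = ennreal ?a * (\<integral>\<^sup>+s. ennreal ((1 + s) powr (real m / 2 - (\<sigma> + 1))) * indicator {t / 2<..} s \<partial>lborel)"
    by (rule nn_integral_cmult) measurable
  also have "\<dots> \<le> ennreal ?a * ennreal J" by (intro mult_left_mono J) simp
  finally show ?thesis by (simp add: ennreal_mult')
qed

text \<open>The kernel is integrated in x first and has the same mass for every t - s, so no
  singularity arises at s = t.\<close>

lemma middle_L1:
  assumes t: "t > 0" and C: "C > 0" "c > 0"
    and Z: "Z > 0"
    "\<And>s j. s > 0 \<Longrightarrow> j \<le> m + 1 \<Longrightarrow> (\<integral>\<^sup>+y. ennreal ((norm y + sqrt s) ^ j * norm (w s y)) \<partial>lborel)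
       \<le> ennreal (Z * (1 + s) powr (real j / 2 - (\<sigma> + 1)))"
    and J: "(\<integral>\<^sup>+s. ennreal ((1 + s) powr (real m / 2 - (\<sigma> + 1))) * indicator {t / 2<..} s \<partial>lborel) \<le> ennreal J" "J \<ge> 0"
  shows "(\<integral>\<^sup>+x. \<integral>\<^sup>+z. ennreal (C * gauss c (t - fst z) (x - snd z :: real ^ 'n)) * ennreal (norm (w (fst z) (snd z)))
       * indicator {t / 2<..<t} (fst z) \<partial>(lborel \<Otimes>\<^sub>M lborel) \<partial>lborel)
      \<le> ennreal (C * sqrt (pi / c) ^ CARD('n) * Z * ((t / 2) powr (- (real m / 2)) * J))"
proof -
  let ?k = "sqrt (pi / c) ^ CARD('n)"
  have "(\<integral>\<^sup>+x. \<integral>\<^sup>+z. ennreal (C * gauss c (t - fst z) (x - snd z :: real ^ 'n)) * ennreal (norm (w (fst z) (snd z)))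
       * indicator {t / 2<..<t} (fst z) \<partial>(lborel \<Otimes>\<^sub>M lborel) \<partial>lborel)
    = (\<integral>\<^sup>+z. \<integral>\<^sup>+x. ennreal (C * gauss c (t - fst z) (x - snd z :: real ^ 'n)) * ennreal (norm (w (fst z) (snd z)))
       * indicator {t / 2<..<t} (fst z) \<partial>lborel \<partial>(lborel \<Otimes>\<^sub>M lborel))"
    by (rule nn_integral_swap_sigma_finite) (auto simp: gauss_def intro: sigma_finite_lborel)
  also have "\<dots> \<le> (\<integral>\<^sup>+z. ennreal (C * ?k * (norm (snd z) + sqrt (fst z)) ^ 0) * ennreal (norm (w (fst z) (snd z)))
       * indicator {t / 2<..<t} (fst z) \<partial>(lborel \<Otimes>\<^sub>M lborel))"
  proof (rule nn_integral_mono)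
    fix z :: "real \<times> (real ^ 'n)"
    show "(\<integral>\<^sup>+x. ennreal (C * gauss c (t - fst z) (x - snd z)) * ennreal (norm (w (fst z) (snd z))) * indicator {t / 2<..<t} (fst z) \<partial>lborel)
      \<le> ennreal (C * ?k * (norm (snd z) + sqrt (fst z)) ^ 0) * ennreal (norm (w (fst z) (snd z))) * indicator {t / 2<..<t} (fst z)"
    proof (cases "fst z \<in> {t / 2<..<t}")
      case True
      have "(\<integral>\<^sup>+x. ennreal (C * gauss c (t - fst z) (x - snd z)) * ennreal (norm (w (fst z) (snd z))) \<partial>lborel)
        = (\<integral>\<^sup>+x. ennreal C * ennreal (gauss c (t - fst z) (x - snd z)) \<partial>lborel) * ennreal (norm (w (fst z) (snd z)))"
        using C by (subst nn_integral_multc[symmetric]) (auto simp: ennreal_mult)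
      also have "(\<integral>\<^sup>+x. ennreal C * ennreal (gauss c (t - fst z) (x - snd z)) \<partial>lborel) = ennreal (C * ?k)"
        using C True by (subst nn_integral_cmult) (auto simp: nn_integral_gauss ennreal_mult)
      finally show ?thesis using True by simp
    qed simp
  qed
  also have "\<dots> \<le> ennreal (C * ?k * Z * ((t / 2) powr (- (real m / 2)) * J))"
  proof (rule w_slab[OF Z])
    show "(\<integral>\<^sup>+s. ennreal ((1 + s) powr (real 0 / 2 - (\<sigma> + 1))) * indicator {t / 2<..<t} s \<partial>lborel) \<le> ennreal ((t / 2) powr (- (real m / 2)) * J)"
    proof -
      have "{t / 2<..<t} \<subseteq> {t / 2<..}" by auto
      from middle_weight[OF t this J(1), of 0] t show ?thesis by simp
    qed
  qed (use t C J in auto)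
  finally show ?thesis .
qed

text \<open>At a fixed point the kernel is integrated in y, against the pointwise bound of w. The
  factor t^(-n/2) comes from the decay of w and not from the kernel, whose maximum (t - s)^(-n/2) is
  not integrable up to s = t for n \<ge> 2.\<close>

lemma middle_Linf:
  fixes x\<^sub>0 :: "real ^ 'n"
  assumes t: "t > 0" and C: "C > 0" "c > 0"
    and W: "W > 0" "\<And>s. s > 0 \<Longrightarrow> AE x in lborel. norm (w s x) \<le> W * (1 + s) powr (- (\<sigma> + 1 + real CARD('n) / 2))"
    and J: "(\<integral>\<^sup>+s. ennreal ((1 + s) powr (real m / 2 - (\<sigma> + 1))) * indicator {t / 2<..} s \<partial>lborel) \<le> ennreal J" "J \<ge> 0"
  shows "(\<integral>\<^sup>+x. \<integral>\<^sup>+z. ennreal (C * gauss c (t - fst z) (x - snd z)) * ennreal (norm (w (fst z) (snd z)))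
       * indicator {t / 2<..<t} (fst z) \<partial>(lborel \<Otimes>\<^sub>M lborel) \<partial>return borel x\<^sub>0)
      \<le> ennreal (C * sqrt (pi / c) ^ CARD('n) * W * ((t / 2) powr (- (real CARD('n) / 2)) * (t / 2) powr (- (real m / 2)) * J))"
proof -
  let ?k = "sqrt (pi / c) ^ CARD('n)"
  interpret R: prob_space "return borel x\<^sub>0" by (rule prob_space_return) simp
  have "(\<integral>\<^sup>+x. \<integral>\<^sup>+z. ennreal (C * gauss c (t - fst z) (x - snd z)) * ennreal (norm (w (fst z) (snd z)))
       * indicator {t / 2<..<t} (fst z) \<partial>(lborel \<Otimes>\<^sub>M lborel) \<partial>return borel x\<^sub>0)
    = (\<integral>\<^sup>+z. \<integral>\<^sup>+x. ennreal (C * gauss c (t - fst z) (x - snd z)) * ennreal (norm (w (fst z) (snd z)))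
       * indicator {t / 2<..<t} (fst z) \<partial>return borel x\<^sub>0 \<partial>(lborel \<Otimes>\<^sub>M lborel))"
    by (rule nn_integral_swap_sigma_finite) (auto simp: gauss_def R.sigma_finite_measure_axioms)
  also have "\<dots> = (\<integral>\<^sup>+z. ennreal (C * gauss c (t - fst z) (x\<^sub>0 - snd z)) * ennreal (norm (w (fst z) (snd z)))
       * indicator {t / 2<..<t} (fst z) \<partial>(lborel \<Otimes>\<^sub>M lborel))"
    by (intro nn_integral_cong) (simp add: nn_integral_return gauss_def)
  also have "\<dots> = (\<integral>\<^sup>+s. \<integral>\<^sup>+y. ennreal (C * gauss c (t - s) (x\<^sub>0 - y)) * ennreal (norm (w s y))
       * indicator {t / 2<..<t} s \<partial>lborel \<partial>lborel)"
  proof -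
    have "(\<lambda>z. ennreal (C * gauss c (t - fst z) (x\<^sub>0 - snd z)) * ennreal (norm (w (fst z) (snd z)))
       * indicator {t / 2<..<t} (fst z)) \<in> borel_measurable (lborel \<Otimes>\<^sub>M lborel)"
      unfolding gauss_def by measurable
    from lborel.nn_integral_fst[OF this] show ?thesis by simp
  qed
  also have "\<dots> \<le> (\<integral>\<^sup>+s. ennreal (C * ?k * W) * (ennreal ((1 + s) powr (- (\<sigma> + 1 + real CARD('n) / 2))) * indicator {t / 2<..<t} s) \<partial>lborel)"
  proof (rule nn_integral_mono)
    fix s :: real
    show "(\<integral>\<^sup>+y. ennreal (C * gauss c (t - s) (x\<^sub>0 - y)) * ennreal (norm (w s y)) * indicator {t / 2<..<t} s \<partial>lborel)
      \<le> ennreal (C * ?k * W) * (ennreal ((1 + s) powr (- (\<sigma> + 1 + real CARD('n) / 2))) * indicator {t / 2<..<t} s)"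
    proof (cases "s \<in> {t / 2<..<t}")
      case True
      define q where "q = W * (1 + s) powr (- (\<sigma> + 1 + real CARD('n) / 2))"
      have s: "s > 0" using True t by auto
      have "(\<integral>\<^sup>+y. ennreal (C * gauss c (t - s) (x\<^sub>0 - y)) * ennreal (norm (w s y)) \<partial>lborel)
         \<le> (\<integral>\<^sup>+y. ennreal (C * q) * ennreal (gauss c (t - s) (y - x\<^sub>0)) \<partial>lborel)"
      proof (rule nn_integral_mono_AE)
        show "AE y in lborel. ennreal (C * gauss c (t - s) (x\<^sub>0 - y)) * ennreal (norm (w s y)) \<le> ennreal (C * q) * ennreal (gauss c (t - s) (y - x\<^sub>0))"
          using W(2)[OF s]
        proof eventually_elim
          case (elim y)
          have g: "gauss c (t - s) (x\<^sub>0 - y) = gauss c (t - s) (y - x\<^sub>0)"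
            by (simp add: gauss_def norm_minus_commute)
          have "(C * gauss c (t - s) (y - x\<^sub>0)) * norm (w s y) \<le> (C * gauss c (t - s) (y - x\<^sub>0)) * q"
            using elim C by (intro mult_left_mono) (auto simp: q_def)
          moreover have "q \<ge> 0" using W(1) by (simp add: q_def)
          ultimately show ?case using C by (simp add: g ennreal_leI mult_ac flip: ennreal_mult)
        qed
      qed
      also have "\<dots> = ennreal (C * q) * (\<integral>\<^sup>+y. ennreal (gauss c (t - s) (y - x\<^sub>0)) \<partial>lborel)"
        by (rule nn_integral_cmult) measurable
      also have "\<dots> = ennreal (C * q) * ennreal ?k" using C True by (subst nn_integral_gauss) auto
      also have "\<dots> = ennreal (C * ?k * W) * ennreal ((1 + s) powr (- (\<sigma> + 1 + real CARD('n) / 2)))"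
        using C W(1) by (simp add: q_def mult_ac flip: ennreal_mult)
      finally show ?thesis using True by simp
    qed simp
  qed
  also have "\<dots> = ennreal (C * ?k * W) * (\<integral>\<^sup>+s. ennreal ((1 + s) powr (- (\<sigma> + 1 + real CARD('n) / 2))) * indicator {t / 2<..<t} s \<partial>lborel)"
    by (rule nn_integral_cmult) measurable
  also have "\<dots> \<le> ennreal (C * ?k * W) * ennreal ((t / 2) powr (- (real CARD('n) / 2)) * (t / 2) powr (- (real m / 2)) * J)"
    by (intro mult_left_mono middle_weight t J) auto
  also have "\<dots> = ennreal (C * ?k * W * ((t / 2) powr (- (real CARD('n) / 2)) * (t / 2) powr (- (real m / 2)) * J))"
    using C W(1) J(2) by (simp flip: ennreal_mult)
  finally show ?thesis .
qed

end

text \<open>Each contribution is a constant times H P times one of r, q I and V, so the sum of the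
  constants serves for all of them.\<close>

lemma collect_bounds:
  fixes C g Z0 Z M0 d P H r q I V :: real
  assumes "C \<ge> 0" "g \<ge> 0" "Z0 \<ge> 0" "Z \<ge> 0" "M0 \<ge> 0" "d > 0" "P \<ge> 0" "H \<ge> 0" "r \<ge> 0" "q \<ge> 0" "I \<ge> 0" "V \<ge> 0"
  shows "C * (P * r) * Z0 * (2 * (g * H)) + C * (P * q) * Z * I * (2 * (g * H)) + C * P * Z * (V / d) * (g * H)
      + M0 * (H * P * (V / d)) \<le> (2 * C * g * Z0 + 2 * C * g * Z + C * Z * g / d + M0 / d) * (H * P * (r + q * I + V))"
proof -
  define a1 a2 a3 where "a1 = 2 * C * g * Z0" "a2 = 2 * C * g * Z" "a3 = C * Z * g / d + M0 / d"
  note a = this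
  have nn: "a1 \<ge> 0" "a2 \<ge> 0" "a3 \<ge> 0" using assms by (simp_all add: a)
  have "C * (P * r) * Z0 * (2 * (g * H)) + C * (P * q) * Z * I * (2 * (g * H)) + C * P * Z * (V / d) * (g * H)
      + M0 * (H * P * (V / d)) = H * P * (a1 * r + a2 * (q * I) + a3 * V)"
    by (simp add: a algebra_simps)
  also have "\<dots> \<le> H * P * ((a1 + a2 + a3) * r + (a1 + a2 + a3) * (q * I) + (a1 + a2 + a3) * V)"
    using assms nn by (intro mult_left_mono add_mono mult_right_mono) auto
  also have "\<dots> = (2 * C * g * Z0 + 2 * C * g * Z + C * Z * g / d + M0 / d) * (H * P * (r + q * I + V))"
    by (simp add: a distrib_left distrib_right mult_ac)
  finally show ?thesis .
qed

lemma inverse_sqrt_power: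
  assumes "t > 0"
  shows "(1 / sqrt t) ^ j = t powr (- (real j / 2))"
proof -
  have "(1 / sqrt t) = t powr (- (1 / 2))" using assms by (simp add: powr_minus powr_half_sqrt inverse_eq_divide)
  then show ?thesis using assms by (simp add: powr_powr flip: powr_realpow)
qed

section \<open>From the error integral to the bound in L^q\<close>

context mild_solution
begin

text \<open>The claimed rate with its cases sorted by \<sigma> - m/2 instead of p.\<close>

definition rate :: "real \<Rightarrow> real" where
  "rate t = (if \<sigma> - real m / 2 < 1 / 2 then t powr (- (\<sigma> - real m / 2))
     else if \<sigma> - real m / 2 = 1 / 2 then t powr (- (1 / 2)) * ln (2 + t) else t powr (- (1 / 2)))"

lemma rate_pos: "t > 0 \<Longrightarrow> rate t > 0"
  by (auto simp: rate_def)

text \<open>The exponent b distinguishes the two uses: b = 0 for Lebesgue measure, b = n/2 for a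
  Dirac measure, with t^(-b) the size of a Gaussian of time t integrated against \<mu>. The bound on
  the heat kernel between t/2 and t is left as a hypothesis, since it is proved differently in the
  two cases.\<close>

lemma error_integral_rate:
  assumes C: "C > 0" "c > 0"
    and near: "\<And>t (x :: real ^ 'n) y s j. t > 0 \<Longrightarrow> 0 \<le> s \<Longrightarrow> s \<le> t / 2 \<Longrightarrow> j \<in> {m, m + 1} \<Longrightarrow>
      norm (heat_kernel0 \<nu> (t - s) (x - y) - profile_kernel \<nu> m t x y s)
        \<le> C * ((norm y + sqrt s) / sqrt t) ^ j * (gauss c t x + gauss c t (x - y))"
    and far: "\<And>t (x :: real ^ 'n) y s. t > 0 \<Longrightarrow> t / 2 < s \<Longrightarrow>
      norm (heat_kernel0 \<nu> (t - s) (x - y) - profile_kernel \<nu> m t x y s)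
        \<le> C * ((norm y + sqrt s) / sqrt t) ^ m * gauss c t x + (if s < t then C * gauss c (t - s) (x - y) else 0)"
    and Z0: "Z0 > 0" "(\<integral>\<^sup>+x. ennreal ((1 + norm x) ^ (m + 1) * norm (u\<^sub>b x)) \<partial>lborel) \<le> ennreal Z0"
    and Z: "Z > 0"
    "\<And>s j. s > 0 \<Longrightarrow> j \<le> m + 1 \<Longrightarrow> (\<integral>\<^sup>+y. ennreal ((norm y + sqrt s) ^ j * norm (w s y)) \<partial>lborel)
       \<le> ennreal (Z * (1 + s) powr (real j / 2 - (\<sigma> + 1)))"
    and g: "g > 0" and M0: "M0 \<ge> 0"
  obtains B where "B > 0"
    "\<And>t (\<mu> :: (real ^ 'n) measure). t > 0 \<Longrightarrow> sigma_finite_measure \<mu> \<Longrightarrow> sets \<mu> = sets borel \<Longrightarrow>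
      (\<And>y. (\<integral>\<^sup>+x. ennreal (gauss c t (x - y)) \<partial>\<mu>) \<le> ennreal (g * t powr (- b))) \<Longrightarrow>
      (\<And>J. (\<integral>\<^sup>+s. ennreal ((1 + s) powr (real m / 2 - (\<sigma> + 1))) * indicator {t / 2<..} s \<partial>lborel) \<le> ennreal J \<Longrightarrow> J \<ge> 0 \<Longrightarrow>
        (\<integral>\<^sup>+x. \<integral>\<^sup>+z. ennreal (C * gauss c (t - fst z) (x - snd z)) * ennreal (norm (w (fst z) (snd z)))
       * indicator {t / 2<..<t} (fst z) \<partial>(lborel \<Otimes>\<^sub>M lborel) \<partial>\<mu>)
        \<le> ennreal (M0 * ((t / 2) powr (- b) * (t / 2) powr (- (real m / 2)) * J))) \<Longrightarrow>
      \<exists>E\<in>borel_measurable borel. (\<forall>x. error t x \<le> E x) \<and>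
        (\<integral>\<^sup>+x. E x \<partial>\<mu>) \<le> ennreal (B * (t powr (- b) * t powr (- (real m / 2)) * rate t))"
proof -
  define d where "d = \<sigma> - real m / 2"
  have d: "d > 0" using sigma_gt by (simp add: d_def)
  define I where "I = (\<lambda>t. if 1 / 2 - d > 0 then (t / 2) powr (1 / 2 - d) / (1 / 2 - d)
     else if 1 / 2 - d = 0 then ln (1 + t / 2) else 1 / (- (1 / 2 - d)))"
  have rate: "rate t = (if d < 1 / 2 then t powr (- d) else if d = 1 / 2 then t powr (- (1 / 2)) * ln (2 + t) else t powr (- (1 / 2)))" for t
    by (simp only: rate_def d_def)
  obtain B0 where B0: "B0 > 0"
    "\<And>t. t > 0 \<Longrightarrow> min 1 (t powr (- (1 / 2))) + t powr (- (1 / 2)) * I t + (1 + t / 2) powr (- d) \<le> B0 * rate t"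
    unfolding I_def rate by (rule rate_bound[OF d]) blast
  \<comment> \<open>The powers of 2 come from passing from powers of t/2 to powers of t.\<close>
  define M1 where "M1 = M0 * (2 powr b * 2 powr (real m / 2))"
  define D where "D = 2 * C * g * Z0 + 2 * C * g * Z + C * Z * g / d + M1 / d"
  have M1: "M1 \<ge> 0" using M0 by (simp add: M1_def)
  have "2 * C * g * Z0 > 0" "2 * C * g * Z > 0" "C * Z * g / d > 0" "M1 / d \<ge> 0" using C g Z(1) Z0(1) d M1 by simp_all
  then have D: "D > 0" unfolding D_def by linarith
  show ?thesis
  proof (rule that[of "D * B0"])
    show "D * B0 > 0" using D B0 by simp
    fix t :: real and \<mu> :: "(real ^ 'n) measure"
    assume t: "t > 0" and mu: "sigma_finite_measure \<mu>" "sets \<mu> = sets borel"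
      and G: "\<And>y. (\<integral>\<^sup>+x. ennreal (gauss c t (x - y)) \<partial>\<mu>) \<le> ennreal (g * t powr (- b))"
      and mid: "\<And>J. (\<integral>\<^sup>+s. ennreal ((1 + s) powr (real m / 2 - (\<sigma> + 1))) * indicator {t / 2<..} s \<partial>lborel) \<le> ennreal J \<Longrightarrow> J \<ge> 0 \<Longrightarrow>
        (\<integral>\<^sup>+x. \<integral>\<^sup>+z. ennreal (C * gauss c (t - fst z) (x - snd z)) * ennreal (norm (w (fst z) (snd z)))
       * indicator {t / 2<..<t} (fst z) \<partial>(lborel \<Otimes>\<^sub>M lborel) \<partial>\<mu>)
        \<le> ennreal (M0 * ((t / 2) powr (- b) * (t / 2) powr (- (real m / 2)) * J))"
    define q where "q = t powr (- (1 / 2))"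
    define P where "P = t powr (- (real m / 2))"
    define H where "H = t powr (- b)"
    define V where "V = (1 + t / 2) powr (- d)"
    \<comment> \<open>For the initial value the degree depends on the size of t, which yields the
      factor min(1, t^(-1/2)). With m + 1 throughout, the bound for small t would exceed the rate
      t^(-d) in the case d < 1/2.\<close>
    define j where "j = (if t \<ge> 1 then m + 1 else m)"
    have j: "j \<in> {m, m + 1}" by (simp add: j_def)
    have half: "(t / 2) powr (- a) = 2 powr a * t powr (- a)" for a
      using t by (simp add: powr_divide powr_minus field_simps)
    have Pm: "(1 / sqrt t) ^ m = P" using inverse_sqrt_power[OF t] by (simp add: P_def)
    have Pm1: "(1 / sqrt t) ^ (m + 1) = P * q"
      unfolding inverse_sqrt_power[OF t] P_def q_def powr_add[symmetric]
      by (rule arg_cong[where f = "\<lambda>b. t powr b"]) (simp add: add_divide_distrib)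
    have Pj: "(1 / sqrt t) ^ j = P * min 1 q"
    proof (cases "t \<ge> 1")
      case True
      then have "t powr (- (1 / 2)) \<le> t powr 0" by (intro powr_mono) auto
      then have "q \<le> 1" using t by (simp add: q_def)
      then show ?thesis using True Pm1 by (simp add: j_def min_def)
    next
      case False
      then have "t powr 0 \<le> t powr (- (1 / 2))" using t by (intro powr_mono') auto
      then have "1 \<le> q" using t by (simp add: q_def)
      then show ?thesis using False Pm by (simp add: j_def min_def)
    qed
    have It: "(\<integral>\<^sup>+s. ennreal ((1 + s) powr (real (m + 1) / 2 - (\<sigma> + 1))) * indicator {0<..t / 2} s \<partial>lborel) \<le> ennreal (I t)"
      and I0: "I t \<ge> 0"
    proof -
      have e: "real (m + 1) / 2 - (\<sigma> + 1) = (1 / 2 - d) - 1" by (simp add: d_def add_divide_distrib)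
      have r: "1 / 2 - d \<le> 1" "t / 2 \<ge> 0" using d t by auto
      show "(\<integral>\<^sup>+s. ennreal ((1 + s) powr (real (m + 1) / 2 - (\<sigma> + 1))) * indicator {0<..t / 2} s \<partial>lborel) \<le> ennreal (I t)"
        unfolding e I_def by (rule near_integral(1)[OF r])
      show "I t \<ge> 0" unfolding I_def by (rule near_integral(2)[OF r])
    qed
    have Jt: "(\<integral>\<^sup>+s. ennreal ((1 + s) powr (real m / 2 - (\<sigma> + 1))) * indicator {t / 2<..} s \<partial>lborel) \<le> ennreal (V / d)"
    proof -
      have e: "real m / 2 - (\<sigma> + 1) = - (d + 1)" by (simp add: d_def)
      show ?thesis unfolding e V_def by (rule nn_integral_one_plus_powr_tail[OF d]) (use t in simp)
    qed
    have J0: "V / d \<ge> 0" using d by (simp add: V_def)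
    have M: "M0 * ((t / 2) powr (- b) * (t / 2) powr (- (real m / 2)) * (V / d)) = M1 * (H * P * (V / d))"
      unfolding half by (simp add: M1_def H_def P_def)
    have "\<exists>E\<in>borel_measurable borel. (\<forall>x. error t x \<le> E x) \<and> (\<integral>\<^sup>+x. E x \<partial>\<mu>) \<le> ennreal (C * (1 / sqrt t) ^ j * Z0 * (2 * (g * H))
      + C * (1 / sqrt t) ^ (m + 1) * Z * I t * (2 * (g * H)) + C * (1 / sqrt t) ^ m * Z * (V / d) * (g * H) + M1 * (H * P * (V / d)))"
    proof (rule error_integral[OF mu t C near[OF t] far[OF t] Z0 Z _ _ It I0 Jt J0 _ _ j])
      show "(\<integral>\<^sup>+x. ennreal (gauss c t (x - y)) \<partial>\<mu>) \<le> ennreal (g * H)" for y using G by (simp add: H_def)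
      show "(\<integral>\<^sup>+x. \<integral>\<^sup>+z. ennreal (C * gauss c (t - fst z) (x - snd z)) * ennreal (norm (w (fst z) (snd z)))
       * indicator {t / 2<..<t} (fst z) \<partial>(lborel \<Otimes>\<^sub>M lborel) \<partial>\<mu>) \<le> ennreal (M1 * (H * P * (V / d)))"
        using mid[OF Jt J0] unfolding M .
    qed (use g M1 d in \<open>auto simp: H_def P_def V_def\<close>)
    then obtain E where E: "E \<in> borel_measurable borel" "\<And>x. error t x \<le> E x"
      and Eint: "(\<integral>\<^sup>+x. E x \<partial>\<mu>) \<le> ennreal (C * (P * min 1 q) * Z0 * (2 * (g * H))
      + C * (P * q) * Z * I t * (2 * (g * H)) + C * P * Z * (V / d) * (g * H) + M1 * (H * P * (V / d)))"
      unfolding Pj Pm1 Pm by blast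
    have "C * (P * min 1 q) * Z0 * (2 * (g * H)) + C * (P * q) * Z * I t * (2 * (g * H)) + C * P * Z * (V / d) * (g * H) + M1 * (H * P * (V / d))
       \<le> D * (H * P * (min 1 q + q * I t + V))"
      unfolding D_def
      by (rule collect_bounds) (use C g Z0 Z M1 d I0 in \<open>auto simp: P_def q_def H_def V_def\<close>)
    also have "\<dots> \<le> D * (H * P * (B0 * rate t))"
      using B0(2)[OF t] D by (intro mult_left_mono) (auto simp: P_def q_def H_def V_def)
    also have "\<dots> = D * B0 * (t powr (- b) * t powr (- (real m / 2)) * rate t)" by (simp add: H_def P_def)
    finally have "(\<integral>\<^sup>+x. E x \<partial>\<mu>) \<le> ennreal (D * B0 * (t powr (- b) * t powr (- (real m / 2)) * rate t))"
      using Eint by (meson ennreal_leI order_trans)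
    with E show "\<exists>E\<in>borel_measurable borel. (\<forall>x. error t x \<le> E x) \<and>
        (\<integral>\<^sup>+x. E x \<partial>\<mu>) \<le> ennreal (D * B0 * (t powr (- b) * t powr (- (real m / 2)) * rate t))" by blast
  qed
qed

text \<open>Lebesgue measure gives the bound in L^1. Against the Dirac measure at x the integral of
  a majorant of \<open>error\<close> is its value at x, with a constant that does not depend on
  x.\<close>

lemma profile_error_bounds:
  obtains B where "B > 0"
    "\<And>t. t > 0 \<Longrightarrow> (\<integral>\<^sup>+x. ennreal (norm (u t x - asymptotic_profile \<nu> f u\<^sub>0 u m t x)) \<partial>lborel)
       \<le> ennreal (B * (t powr (- (real m / 2)) * rate t))"
    "\<And>t. t > 0 \<Longrightarrow> AE x in lborel. norm (u t x - asymptotic_profile \<nu> f u\<^sub>0 u m t x)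
       \<le> B * (t powr (- (real CARD('n) / 2)) * t powr (- (real m / 2)) * rate t)"
proof -
  obtain C c where C: "C > 0" "c > 0"
    and near: "\<And>t (x :: real ^ 'n) y s j. t > 0 \<Longrightarrow> 0 \<le> s \<Longrightarrow> s \<le> t / 2 \<Longrightarrow> j \<in> {m, m + 1} \<Longrightarrow>
      norm (heat_kernel0 \<nu> (t - s) (x - y) - profile_kernel \<nu> m t x y s)
        \<le> C * ((norm y + sqrt s) / sqrt t) ^ j * (gauss c t x + gauss c t (x - y))"
    and far: "\<And>t (x :: real ^ 'n) y s. t > 0 \<Longrightarrow> t / 2 < s \<Longrightarrow>
      norm (heat_kernel0 \<nu> (t - s) (x - y) - profile_kernel \<nu> m t x y s)
        \<le> C * ((norm y + sqrt s) / sqrt t) ^ m * gauss c t x + (if s < t then C * gauss c (t - s) (x - y) else 0)"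
    by (rule hk_profile_bounds) blast
  obtain Z0 where Z0: "Z0 > 0" "(\<integral>\<^sup>+x. ennreal ((1 + norm x) ^ (m + 1) * norm (u\<^sub>b x)) \<partial>lborel) \<le> ennreal Z0"
    by (rule ub_weighted) blast
  obtain Z where Z: "Z > 0"
    "\<And>s j. s > 0 \<Longrightarrow> j \<le> m + 1 \<Longrightarrow> (\<integral>\<^sup>+y. ennreal ((norm y + sqrt s) ^ j * norm (w s y)) \<partial>lborel)
       \<le> ennreal (Z * (1 + s) powr (real j / 2 - (\<sigma> + 1)))"
    by (rule w_weighted) blast
  obtain W where W: "W > 0"
    "\<And>s. s > 0 \<Longrightarrow> AE x in lborel. norm (w s x) \<le> W * (1 + s) powr (- (\<sigma> + 1 + real CARD('n) / 2))"
    by (rule w_L1) blast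
  define k where "k = sqrt (pi / c) ^ CARD('n)"
  have k: "k > 0" using C by (simp add: k_def)
  have cont: "C * k * Z \<ge> 0" "C * k * W \<ge> 0" using C k Z(1) W(1) by simp_all
  obtain B1 where B1: "B1 > 0" "\<And>t (\<mu> :: (real ^ 'n) measure). t > 0 \<Longrightarrow> sigma_finite_measure \<mu> \<Longrightarrow> sets \<mu> = sets borel \<Longrightarrow>
      (\<And>y. (\<integral>\<^sup>+x. ennreal (gauss c t (x - y)) \<partial>\<mu>) \<le> ennreal (k * t powr (- 0))) \<Longrightarrow>
      (\<And>J. (\<integral>\<^sup>+s. ennreal ((1 + s) powr (real m / 2 - (\<sigma> + 1))) * indicator {t / 2<..} s \<partial>lborel) \<le> ennreal J \<Longrightarrow> J \<ge> 0 \<Longrightarrow>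
        (\<integral>\<^sup>+x. \<integral>\<^sup>+z. ennreal (C * gauss c (t - fst z) (x - snd z)) * ennreal (norm (w (fst z) (snd z)))
       * indicator {t / 2<..<t} (fst z) \<partial>(lborel \<Otimes>\<^sub>M lborel) \<partial>\<mu>)
        \<le> ennreal (C * k * Z * ((t / 2) powr (- 0) * (t / 2) powr (- (real m / 2)) * J))) \<Longrightarrow>
      \<exists>E\<in>borel_measurable borel. (\<forall>x. error t x \<le> E x) \<and>
        (\<integral>\<^sup>+x. E x \<partial>\<mu>) \<le> ennreal (B1 * (t powr (- 0) * t powr (- (real m / 2)) * rate t))"
    by (rule error_integral_rate[OF C near far Z0 Z k cont(1), where b = 0]) blast+
  obtain B2 where B2: "B2 > 0" "\<And>t (\<mu> :: (real ^ 'n) measure). t > 0 \<Longrightarrow> sigma_finite_measure \<mu> \<Longrightarrow> sets \<mu> = sets borel \<Longrightarrow>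
      (\<And>y. (\<integral>\<^sup>+x. ennreal (gauss c t (x - y)) \<partial>\<mu>) \<le> ennreal (1 * t powr (- (real CARD('n) / 2)))) \<Longrightarrow>
      (\<And>J. (\<integral>\<^sup>+s. ennreal ((1 + s) powr (real m / 2 - (\<sigma> + 1))) * indicator {t / 2<..} s \<partial>lborel) \<le> ennreal J \<Longrightarrow> J \<ge> 0 \<Longrightarrow>
        (\<integral>\<^sup>+x. \<integral>\<^sup>+z. ennreal (C * gauss c (t - fst z) (x - snd z)) * ennreal (norm (w (fst z) (snd z)))
       * indicator {t / 2<..<t} (fst z) \<partial>(lborel \<Otimes>\<^sub>M lborel) \<partial>\<mu>)
        \<le> ennreal (C * k * W * ((t / 2) powr (- (real CARD('n) / 2)) * (t / 2) powr (- (real m / 2)) * J))) \<Longrightarrow>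
      \<exists>E\<in>borel_measurable borel. (\<forall>x. error t x \<le> E x) \<and>
        (\<integral>\<^sup>+x. E x \<partial>\<mu>) \<le> ennreal (B2 * (t powr (- (real CARD('n) / 2)) * t powr (- (real m / 2)) * rate t))"
    by (rule error_integral_rate[OF C near far Z0 Z zero_less_one cont(2), where b = "real CARD('n) / 2"]) blast+
  show ?thesis
  proof (rule that[of "B1 + B2"])
    show "B1 + B2 > 0" using B1 B2 by simp
    fix t :: real assume t: "t > 0"
    have p: "t powr (- (real m / 2)) * rate t \<ge> 0" "t powr (- (real CARD('n) / 2)) * t powr (- (real m / 2)) * rate t \<ge> 0"
      using rate_pos[OF t] by simp_all
    have "\<exists>E\<in>borel_measurable borel. (\<forall>x. error t x \<le> E x) \<and>
        (\<integral>\<^sup>+x. E x \<partial>lborel) \<le> ennreal (B1 * (t powr (- 0) * t powr (- (real m / 2)) * rate t))"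
    proof (rule B1(2)[OF t sigma_finite_lborel sets_lborel])
      show "(\<integral>\<^sup>+x. ennreal (gauss c t (x - y :: real ^ 'n)) \<partial>lborel) \<le> ennreal (k * t powr (- 0))" for y
        using nn_integral_gauss[OF C(2) t, of y] t by (simp add: k_def)
      fix J assume J: "(\<integral>\<^sup>+s. ennreal ((1 + s) powr (real m / 2 - (\<sigma> + 1))) * indicator {t / 2<..} s \<partial>lborel) \<le> ennreal J" "J \<ge> 0"
      show "(\<integral>\<^sup>+x. \<integral>\<^sup>+z. ennreal (C * gauss c (t - fst z) (x - snd z)) * ennreal (norm (w (fst z) (snd z)))
       * indicator {t / 2<..<t} (fst z) \<partial>(lborel \<Otimes>\<^sub>M lborel) \<partial>lborel)
        \<le> ennreal (C * k * Z * ((t / 2) powr (- 0) * (t / 2) powr (- (real m / 2)) * J))"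
        using middle_L1[OF t C Z J] t by (simp add: k_def)
    qed
    then obtain E where E: "\<And>x. error t x \<le> E x" "(\<integral>\<^sup>+x. E x \<partial>lborel) \<le> ennreal (B1 * (t powr (- 0) * t powr (- (real m / 2)) * rate t))"
      by blast
    have "(\<integral>\<^sup>+x. ennreal (norm (u t x - asymptotic_profile \<nu> f u\<^sub>0 u m t x)) \<partial>lborel) \<le> (\<integral>\<^sup>+x. E x \<partial>lborel)"
      by (rule nn_integral_mono_AE) (use error_AE[OF t] E(1) in \<open>auto elim!: eventually_mono intro: order_trans\<close>)
    also have "\<dots> \<le> ennreal (B1 * (t powr (- (real m / 2)) * rate t))" using E(2) t by simp
    also have "\<dots> \<le> ennreal ((B1 + B2) * (t powr (- (real m / 2)) * rate t))"
      by (intro ennreal_leI mult_right_mono p) (use B2 in simp)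
    finally show "(\<integral>\<^sup>+x. ennreal (norm (u t x - asymptotic_profile \<nu> f u\<^sub>0 u m t x)) \<partial>lborel)
       \<le> ennreal ((B1 + B2) * (t powr (- (real m / 2)) * rate t))" .
    have pt: "error t x \<le> ennreal (B2 * (t powr (- (real CARD('n) / 2)) * t powr (- (real m / 2)) * rate t))" for x
    proof -
      interpret R: prob_space "return borel x" by (rule prob_space_return) simp
      have "\<exists>E\<in>borel_measurable borel. (\<forall>x. error t x \<le> E x) \<and>
        (\<integral>\<^sup>+y. E y \<partial>return borel x) \<le> ennreal (B2 * (t powr (- (real CARD('n) / 2)) * t powr (- (real m / 2)) * rate t))"
      proof (rule B2(2)[OF t R.sigma_finite_measure_axioms sets_return])
        show "(\<integral>\<^sup>+x. ennreal (gauss c t (x - y)) \<partial>return borel x) \<le> ennreal (1 * t powr (- (real CARD('n) / 2)))" for y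
        proof -
          have "gauss c t (x - y) \<le> t powr (- (real CARD('n) / 2)) * 1"
            unfolding gauss_def using C t by (intro mult_left_mono) auto
          then show ?thesis by (subst nn_integral_return) (auto simp: gauss_def intro: ennreal_leI)
        qed
        fix J assume J: "(\<integral>\<^sup>+s. ennreal ((1 + s) powr (real m / 2 - (\<sigma> + 1))) * indicator {t / 2<..} s \<partial>lborel) \<le> ennreal J" "J \<ge> 0"
        show "(\<integral>\<^sup>+x. \<integral>\<^sup>+z. ennreal (C * gauss c (t - fst z) (x - snd z)) * ennreal (norm (w (fst z) (snd z)))
           * indicator {t / 2<..<t} (fst z) \<partial>(lborel \<Otimes>\<^sub>M lborel) \<partial>return borel x)
          \<le> ennreal (C * k * W * ((t / 2) powr (- (real CARD('n) / 2)) * (t / 2) powr (- (real m / 2)) * J))"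
          unfolding k_def by (rule middle_Linf[OF t C W J])
      qed
      then obtain E where E: "E \<in> borel_measurable borel" "error t x \<le> E x"
        "(\<integral>\<^sup>+y. E y \<partial>return borel x) \<le> ennreal (B2 * (t powr (- (real CARD('n) / 2)) * t powr (- (real m / 2)) * rate t))"
        by blast
      have "(\<integral>\<^sup>+y. E y \<partial>return borel x) = E x" using E(1) by (intro nn_integral_return) auto
      with E(2,3) show ?thesis by simp
    qed
    have "B2 * (t powr (- (real CARD('n) / 2)) * t powr (- (real m / 2)) * rate t)
       \<le> (B1 + B2) * (t powr (- (real CARD('n) / 2)) * t powr (- (real m / 2)) * rate t)"
      by (intro mult_right_mono p) (use B1 in simp)
    moreover have "0 \<le> B2 * (t powr (- (real CARD('n) / 2)) * t powr (- (real m / 2)) * rate t)"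
      using B2 p by (intro mult_nonneg_nonneg[of B2]) auto
    ultimately show "AE x in lborel. norm (u t x - asymptotic_profile \<nu> f u\<^sub>0 u m t x)
       \<le> (B1 + B2) * (t powr (- (real CARD('n) / 2)) * t powr (- (real m / 2)) * rate t)"
      using error_AE[OF t] pt
      by (auto elim!: eventually_mono simp: ennreal_le_iff dest!: order_trans[OF _ pt])
  qed
qed

text \<open>Interpolation with \<theta> = 1/q. The pointwise bound is H = t^(-n/2) times the L^1
  bound a, and a^\<theta> (H a)^(1-\<theta>) = H^(1-\<theta>) a, whose powers of t are cancelled by
  the weight in front.\<close>

lemma profile_Lq_bound:
  obtains B where "B > 0"
    "\<And>t q. t > 0 \<Longrightarrow> 1 \<le> q \<Longrightarrow> ennreal (t powr (real CARD('n) / 2 * (1 - enn2real (1 / q)) + real m / 2)) *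
         Lq_norm q (\<lambda>x. u t x - asymptotic_profile \<nu> f u\<^sub>0 u m t x) \<le> ennreal (B * rate t)"
proof -
  obtain B where B: "B > 0"
    "\<And>t. t > 0 \<Longrightarrow> (\<integral>\<^sup>+x. ennreal (norm (u t x - asymptotic_profile \<nu> f u\<^sub>0 u m t x)) \<partial>lborel)
       \<le> ennreal (B * (t powr (- (real m / 2)) * rate t))"
    "\<And>t. t > 0 \<Longrightarrow> AE x in lborel. norm (u t x - asymptotic_profile \<nu> f u\<^sub>0 u m t x)
       \<le> B * (t powr (- (real CARD('n) / 2)) * t powr (- (real m / 2)) * rate t)"
    by (rule profile_error_bounds) blast
  show ?thesis
  proof (rule that[OF B(1)])
    fix t :: real and q :: ennreal assume t: "t > 0" and q: "1 \<le> q"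
    define \<theta> where "\<theta> = enn2real (1 / q)"
    define a where "a = B * (t powr (- (real m / 2)) * rate t)"
    define H where "H = t powr (- (real CARD('n) / 2))"
    have a: "a > 0" using B(1) t rate_pos[OF t] by (simp add: a_def)
    have H: "H > 0" using t by (simp add: H_def)
    have Ha: "B * (t powr (- (real CARD('n) / 2)) * t powr (- (real m / 2)) * rate t) = H * a"
      by (simp add: H_def a_def)
    have meas: "(\<lambda>x. u t x - asymptotic_profile \<nu> f u\<^sub>0 u m t x) \<in> borel_measurable lebesgue"
      using u_measurable[OF t] asymptotic_profile_measurable[OF nu_nz, of f u\<^sub>0 u m t]
      by (intro borel_measurable_diff) (auto intro: measurable_completion)
    have "Lq_norm q (\<lambda>x. u t x - asymptotic_profile \<nu> f u\<^sub>0 u m t x) \<le> ennreal (a powr \<theta> * (H * a) powr (1 - \<theta>))"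
      unfolding \<theta>_def
      by (rule Lq_norm_interpolation[OF meas _ a _ _ q])
        (use B(2,3)[OF t] a H in \<open>auto simp: Ha simp flip: a_def\<close>)
    also have "a powr \<theta> * (H * a) powr (1 - \<theta>) = H powr (1 - \<theta>) * a"
    proof -
      have "a powr \<theta> * a powr (1 - \<theta>) = a" using a by (simp flip: powr_add)
      then show ?thesis using a H by (simp add: powr_mult)
    qed
    also have "H powr (1 - \<theta>) = t powr (- (real CARD('n) / 2 * (1 - \<theta>)))"
      by (simp add: H_def powr_powr)
    finally have l: "Lq_norm q (\<lambda>x. u t x - asymptotic_profile \<nu> f u\<^sub>0 u m t x)
      \<le> ennreal (t powr (- (real CARD('n) / 2 * (1 - \<theta>))) * a)" .
    have e: "t powr (real CARD('n) / 2 * (1 - \<theta>) + real m / 2) * (t powr (- (real CARD('n) / 2 * (1 - \<theta>))) * a) = B * rate t"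
    proof -
      have "t powr (real CARD('n) / 2 * (1 - \<theta>) + real m / 2) * (t powr (- (real CARD('n) / 2 * (1 - \<theta>))) * t powr (- (real m / 2))) = 1"
        unfolding powr_add[symmetric] using t by simp
      then show ?thesis unfolding a_def by (simp only: mult_ac mult_1_right)
    qed
    have "ennreal (t powr (real CARD('n) / 2 * (1 - \<theta>) + real m / 2)) * Lq_norm q (\<lambda>x. u t x - asymptotic_profile \<nu> f u\<^sub>0 u m t x)
      \<le> ennreal (t powr (real CARD('n) / 2 * (1 - \<theta>) + real m / 2)) * ennreal (t powr (- (real CARD('n) / 2 * (1 - \<theta>))) * a)"
      by (intro mult_left_mono l) simp
    also have "\<dots> = ennreal (B * rate t)" by (simp only: ennreal_mult'[OF powr_ge_zero, symmetric] e)
    finally show "ennreal (t powr (real CARD('n) / 2 * (1 - enn2real (1 / q)) + real m / 2)) *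
         Lq_norm q (\<lambda>x. u t x - asymptotic_profile \<nu> f u\<^sub>0 u m t x) \<le> ennreal (B * rate t)" by (simp only: \<theta>_def)
  qed
qed

text \<open>By the definition of \<sigma>, the threshold 1 + (m + 3)/n for p is the threshold 1/2
  for \<sigma> - m/2.\<close>

lemma rate_cases:
  "B * rate t = (if p < 1 + (real m + 3) / real CARD('n) then B * t powr (- (\<sigma> - real m / 2))
            else if p = 1 + (real m + 3) / real CARD('n) then B * t powr (- (1 / 2)) * ln (2 + t)
            else B * t powr (- (1 / 2)))"
proof -
  have "p < 1 + (real m + 3) / real CARD('n) \<longleftrightarrow> \<sigma> - real m / 2 < 1 / 2"
    and "p = 1 + (real m + 3) / real CARD('n) \<longleftrightarrow> \<sigma> - real m / 2 = 1 / 2"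
    by (auto simp: \<sigma>_def field_simps)
  then show ?thesis by (simp add: rate_def)
qed

end

theorem theorem1p4:
  fixes \<nu> :: complex and p K :: real and f :: "complex \<Rightarrow> complex" and m :: nat
    and u\<^sub>0 :: "real ^ 'n::finite \<Rightarrow> complex"
    and u :: "real \<Rightarrow> real ^ 'n \<Rightarrow> complex"
  assumes "Re \<nu> > 0"
    and "p > 1"
    and "f 0 = 0"
    and "K > 0"
    and "\<And>\<xi> \<eta>. norm (f \<xi> - f \<eta>) \<le> K * (norm \<xi> powr (p - 1) + norm \<eta> powr (p - 1)) * norm (\<xi> - \<eta>)"
    and "p > 1 + (real m + 2) / real CARD('n)"
    and "u\<^sub>0 \<in> L1_weighted (m + 1) \<inter> Lq \<infinity>"
    and "global_mild_solution \<nu> f u\<^sub>0 u"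
    and "(SUP q\<in>{1::ennreal..}. SUP t\<in>{0<..}.
           ennreal (t powr (real CARD('n) / 2 * (1 - enn2real (1 / q)))) * Lq_norm q (u t)) < \<infinity>"
  shows "let n = real CARD('n); \<sigma> = n / 2 * (p - 1) - 1 in
    \<sigma> > real m / 2 \<and>
    (\<forall>q::ennreal. 1 \<le> q \<longrightarrow> (\<exists>C>0. \<forall>t>0.
       ennreal (t powr (n / 2 * (1 - enn2real (1 / q)) + real m / 2)) *
         Lq_norm q (\<lambda>x. u t x - asymptotic_profile \<nu> f u\<^sub>0 u m t x)
       \<le> ennreal
           (if p < 1 + (real m + 3) / n then C * t powr (- (\<sigma> - real m / 2))
            else if p = 1 + (real m + 3) / n then C * t powr (- (1 / 2)) * ln (2 + t)
            else C * t powr (- (1 / 2)))))"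
proof -
  interpret mild_solution \<nu> p K f m u\<^sub>0 u by unfold_locales (fact assms)+
  obtain B where B: "B > 0"
    "\<And>t q. t > 0 \<Longrightarrow> 1 \<le> q \<Longrightarrow> ennreal (t powr (real CARD('n) / 2 * (1 - enn2real (1 / q)) + real m / 2)) *
         Lq_norm q (\<lambda>x. u t x - asymptotic_profile \<nu> f u\<^sub>0 u m t x) \<le> ennreal (B * rate t)"
    by (rule profile_Lq_bound) blast
  show ?thesis
    unfolding Let_def \<sigma>_def[symmetric] using sigma_gt B(1) B(2)[unfolded rate_cases] by blast
qed

end
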